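(* Let $\overline{\rho}\in BV(\mathbb{R})\cap L^1(\mathbb{R})\cap L^\infty(\mathbb{R})$ be non-negative with compact support and $\|\overline{\rho}\|_{L^1(\mathbb{R})}=1$, and let $\overline{R}:=\|\overline{\rho}\|_{L^\infty(\mathbb{R})}$. Let $v\in C^1([0,\overline{R}])$ be strictly decreasing on $[0,\overline{R}]$, set $\phi(\rho):=\rho v'(\rho)$, and assume that there exists a constant $K\ge 0$ such that $$0\le \frac{\phi(\rho)-\phi(\sigma)}{v(\rho)-v(\sigma)}\le K\qquad\text{for all }\rho,\sigma\in[0,\overline{R}]\text{ with }\rho\ne\sigma.$$ Let $f(\rho):=\rho v(\rho)$ and let $\rho^n$ be the follow-the-leader approximated density with $n+1$ particles associated with $\overline{\rho}$ and $v$. Then $\{\rho^n\}_{n\in\mathbb{N}}$ converges, up to a subsequence, almost everywhere and in $L^1_{loc}$ on $\mathbb{R}\times[0,+\infty)$ to the unique extended entropy solution of the Cauchy problem $$\rho_t+f(\rho)_x=0\ \text{ in }\mathbb{R}\times(0,+\infty),\qquad \rho(x,0)=\overline{\rho}(x),\ x\in\mathbb{R}.$$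
   Context: Follow-the-leader scheme. Let $[\overline{x}_{\min},\overline{x}_{\max}]$ be the convex hull of $\mathrm{supp}(\overline{\rho})$, $\ell_n:=1/n$, $v_{\max}:=v(0)$. Set $\overline{x}_0:=\overline{x}_{\min}$, $\overline{x}_n:=\overline{x}_{\max}$ and recursively $\overline{x}_i:=\sup\{x\in\mathbb{R}:\int_{\overline{x}_{i-1}}^x\overline{\rho}(y)\,dy<\ell_n\}$ for $i\in\{1,\dots,n-1\}$, so that each interval $[\overline{x}_{i},\overline{x}_{i+1}]$ carries mass $1/n$. The particles $x_0(t),\dots,x_n(t)$ (depending on $n$) solve $$\dot{x}_i(t)=v(R_i(t)),\ i\in\{0,\dots,n-1\},\qquad \dot{x}_n(t)=v_{\max},\qquad x_i(0)=\overline{x}_i,\ i\in\{0,\dots,n\},$$ where $R_i(t):=\frac{\ell_n}{x_{i+1}(t)-x_i(t)}$. It is known (discrete maximum principle) that the particles never collide, $0<R_i(t)\le\overline{R}$, and the solution exists for all $t\ge0$. The approximated density is $$\rho^n(x,t):=\sum_{i=0}^{n-1}R_i(t)\mathbf{1}_{[x_i(t),x_{i+1}(t))}(x).$$ Extended entropy solution. A function $\rho\in L^\infty([0,+\infty);L^1\cap L^\infty(\mathbb{R}))$, with values in $[0,\overline{R}]$ almost everywhere, is an extended entropy solution if: (1) $\rho_t+f(\rho)_x=0$ in the sense of distributions on $\mathbb{R}\times(0,+\infty)$; (2) $\rho(\cdot,t)\to\overline{\rho}$ strongly in $L^1(\mathbb{R})$ as $t\searrow 0$ (for a suitable representative of $\rho$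 in time); (3) there exists a constant $C\ge 1$ such that $f'(\rho)_x\le C/t$ in the sense of distributions, i.e. $\int_0^{+\infty}\int_{\mathbb{R}} f'(\rho)\varphi_x\,dx\,dt\ge -\int_0^{+\infty}\int_{\mathbb{R}}\frac{C}{t}\varphi\,dx\,dt$ for all non-negative $\varphi\in C_c^\infty(\mathbb{R}\times(0,+\infty))$. *)

theory Defs
  imports "HOL-Analysis.Analysis" "HOL-Probability.Essential_Supremum"
begin

text \<open>
  Elements of Lebesgue spaces are represented by functions that are measurable with respect
  to the complete measure \<^const>\<open>lebesgue\<close>. Completeness matters here: two
  representatives that agree almost everywhere have the same measurability and the same
  integrals, also after composition with \<open>v\<close>, whose values outside the interval
  \<open>[0, R]\<close> are arbitrary.
\<close>

subsection \<open>Function spaces\<close>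

definition Linf_norm :: "(real \<Rightarrow> real) \<Rightarrow> ereal" where
  "Linf_norm g = esssup lebesgue (\<lambda>x. ereal \<bar>g x\<bar>)"

definition Linf :: "(real \<Rightarrow> real) \<Rightarrow> bool" where
  "Linf g \<longleftrightarrow> g \<in> borel_measurable lebesgue \<and> Linf_norm g < \<infinity>"

definition ess_support :: "(real \<Rightarrow> real) \<Rightarrow> real set" where
  "ess_support g = - \<Union>{U. open U \<and> (AE x in lebesgue. x \<in> U \<longrightarrow> g x = 0)}"

primrec Ck :: "nat \<Rightarrow> ('a::euclidean_space \<Rightarrow> real) \<Rightarrow> bool" where
  "Ck 0 g \<longleftrightarrow> continuous_on UNIV g"
| "Ck (Suc k) g \<longleftrightarrow> (\<forall>x. g differentiable (at x)) \<and>
     (\<forall>u. Ck k (\<lambda>x. frechet_derivative g (at x) u))"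

definition compact_support_in :: "'a::euclidean_space set \<Rightarrow> ('a \<Rightarrow> real) \<Rightarrow> bool" where
  "compact_support_in U g \<longleftrightarrow>
     compact (closure {x. g x \<noteq> 0}) \<and> closure {x. g x \<noteq> 0} \<subseteq> U"

definition BV :: "(real \<Rightarrow> real) \<Rightarrow> bool" where
  "BV g \<longleftrightarrow> integrable lebesgue g \<and>
     (\<exists>M. \<forall>\<phi>. Ck 1 \<phi> \<and> compact_support_in UNIV \<phi> \<and> (\<forall>x. \<bar>\<phi> x\<bar> \<le> 1) \<longrightarrow>
        (LINT x|lebesgue. g x * deriv \<phi> x) \<le> M)"

text \<open>Derivative relative to a set, hence one-sided at the endpoints of a closed interval.\<close>

abbreviation deriv_within :: "(real \<Rightarrow> real) \<Rightarrow> real set \<Rightarrow> real \<Rightarrow> real" where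
  "deriv_within g S x \<equiv> vector_derivative g (at x within S)"

definition C1_on :: "real set \<Rightarrow> (real \<Rightarrow> real) \<Rightarrow> bool" where
  "C1_on S g \<longleftrightarrow> (\<forall>x\<in>S. g differentiable (at x within S)) \<and>
     continuous_on S (deriv_within g S)"

text \<open>Smooth compactly supported functions on the open half plane, extended by zero; a point
  is the pair of its space and its time coordinate.\<close>

definition test_function :: "(real \<times> real \<Rightarrow> real) \<Rightarrow> bool" where
  "test_function \<phi> \<longleftrightarrow> (\<forall>k. Ck k \<phi>) \<and> compact_support_in (UNIV \<times> {0<..}) \<phi>"

definition dx :: "(real \<times> real \<Rightarrow> real) \<Rightarrow> real \<Rightarrow> real \<Rightarrow> real" where
  "dx \<phi> x t = deriv (\<lambda>y. \<phi> (y, t)) x"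

definition dt :: "(real \<times> real \<Rightarrow> real) \<Rightarrow> real \<Rightarrow> real \<Rightarrow> real" where
  "dt \<phi> x t = deriv (\<lambda>s. \<phi> (x, s)) t"

text \<open>Convergence in \<open>L\<^sup>1\<^sub>l\<^sub>o\<^sub>c(S)\<close>; integrability is
  required explicitly because the integral of a non-integrable function is \<open>0\<close>.\<close>

definition L1loc_converges ::
  "(real \<times> real) set \<Rightarrow> (nat \<Rightarrow> real \<Rightarrow> real \<Rightarrow> real) \<Rightarrow> (real \<Rightarrow> real \<Rightarrow> real) \<Rightarrow> bool" where
  "L1loc_converges S F g \<longleftrightarrow>
     (\<forall>K. compact K \<and> K \<subseteq> S \<longrightarrow>
        set_integrable lebesgue K (\<lambda>(x, t). g x t) \<and>
        (\<forall>k. set_integrable lebesgue K (\<lambda>(x, t). F k x t)) \<and>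
        (\<lambda>k. LINT (x, t):K|lebesgue. \<bar>F k x t - g x t\<bar>) \<longlonglongrightarrow> 0)"

subsection \<open>Follow-the-leader scheme\<close>

definition Rbar :: "(real \<Rightarrow> real) \<Rightarrow> real" where
  "Rbar \<rho>0 = real_of_ereal (Linf_norm \<rho>0)"

definition x_min :: "(real \<Rightarrow> real) \<Rightarrow> real" where
  "x_min \<rho>0 = Inf (convex hull (ess_support \<rho>0))"

definition x_max :: "(real \<Rightarrow> real) \<Rightarrow> real" where
  "x_max \<rho>0 = Sup (convex hull (ess_support \<rho>0))"

primrec initial_position :: "(real \<Rightarrow> real) \<Rightarrow> nat \<Rightarrow> nat \<Rightarrow> real" where
  "initial_position \<rho>0 n 0 = x_min \<rho>0"
| "initial_position \<rho>0 n (Suc i) =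
     (if Suc i = n then x_max \<rho>0
      else Sup {x. (LINT y=ereal (initial_position \<rho>0 n i)..ereal x|lebesgue. \<rho>0 y) < 1 / real n})"

definition discrete_density :: "nat \<Rightarrow> (nat \<Rightarrow> real \<Rightarrow> real) \<Rightarrow> nat \<Rightarrow> real \<Rightarrow> real" where
  "discrete_density n x i t = (1 / real n) / (x (Suc i) t - x i t)"

text \<open>The second clause says that the trajectory stays in the domain of the right-hand side:
  consecutive particles do not coincide, and \<open>v\<close> is given on \<open>[0, R]\<close> only.\<close>

definition ftl_solution ::
  "(real \<Rightarrow> real) \<Rightarrow> (real \<Rightarrow> real) \<Rightarrow> nat \<Rightarrow> (nat \<Rightarrow> real \<Rightarrow> real) \<Rightarrow> bool" where
  "ftl_solution v \<rho>0 n x \<longleftrightarrow>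
     (\<forall>i\<le>n. x i 0 = initial_position \<rho>0 n i) \<and>
     (\<forall>t\<ge>0. \<forall>i<n. x i t < x (Suc i) t \<and> discrete_density n x i t \<in> {0..Rbar \<rho>0}) \<and>
     (\<forall>t\<ge>0. \<forall>i<n. (x i has_real_derivative v (discrete_density n x i t)) (at t within {0..})) \<and>
     (\<forall>t\<ge>0. (x n has_real_derivative v 0) (at t within {0..}))"

definition ftl_density :: "nat \<Rightarrow> (nat \<Rightarrow> real \<Rightarrow> real) \<Rightarrow> real \<Rightarrow> real \<Rightarrow> real" where
  "ftl_density n x y t =
     (\<Sum>i<n. discrete_density n x i t * indicator {x i t..<x (Suc i) t} y)"

subsection \<open>Extended entropy solutions\<close>

definition flux :: "(real \<Rightarrow> real) \<Rightarrow> real \<Rightarrow> real" where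
  "flux v r = r * v r"

definition Linf_time_L1_Linf :: "(real \<Rightarrow> real \<Rightarrow> real) \<Rightarrow> bool" where
  "Linf_time_L1_Linf \<rho> \<longleftrightarrow>
     (\<lambda>(x, t). \<rho> x t) \<in> borel_measurable (lebesgue_on (UNIV \<times> {0..})) \<and>
     (\<exists>M. AE t in lebesgue_on {0..}.
        integrable lebesgue (\<lambda>x. \<rho> x t) \<and> (LINT x|lebesgue. \<bar>\<rho> x t\<bar>) \<le> M \<and>
        (AE x in lebesgue. \<bar>\<rho> x t\<bar> \<le> M))"

definition weak_solution :: "(real \<Rightarrow> real) \<Rightarrow> (real \<Rightarrow> real \<Rightarrow> real) \<Rightarrow> bool" where
  "weak_solution f \<rho> \<longleftrightarrow>
     (\<forall>\<phi>. test_function \<phi> \<longrightarrow>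
        (LINT (x, t):UNIV \<times> {0<..}|lebesgue. \<rho> x t * dt \<phi> x t + f (\<rho> x t) * dx \<phi> x t) = 0)"

text \<open>Here \<open>\<sigma>\<close> is the representative of \<open>\<rho>\<close> in time.\<close>

definition attains_initial_datum :: "(real \<Rightarrow> real) \<Rightarrow> (real \<Rightarrow> real \<Rightarrow> real) \<Rightarrow> bool" where
  "attains_initial_datum \<rho>0 \<rho> \<longleftrightarrow>
     (\<exists>\<sigma>. (AE t in lebesgue_on {0..}. AE x in lebesgue. \<sigma> x t = \<rho> x t) \<and>
        (\<forall>t>0. integrable lebesgue (\<lambda>x. \<sigma> x t)) \<and>
        ((\<lambda>t. LINT x|lebesgue. \<bar>\<sigma> x t - \<rho>0 x\<bar>) \<longlongrightarrow> 0) (at_right 0))"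

definition one_sided_estimate :: "(real \<Rightarrow> real) \<Rightarrow> (real \<Rightarrow> real \<Rightarrow> real) \<Rightarrow> bool" where
  "one_sided_estimate f' \<rho> \<longleftrightarrow>
     (\<exists>C\<ge>1. \<forall>\<phi>. test_function \<phi> \<and> (\<forall>p. 0 \<le> \<phi> p) \<longrightarrow>
        (LINT (x, t):UNIV \<times> {0<..}|lebesgue. f' (\<rho> x t) * dx \<phi> x t)
          \<ge> - (LINT (x, t):UNIV \<times> {0<..}|lebesgue. C / t * \<phi> (x, t)))"

definition extended_entropy_solution ::
  "(real \<Rightarrow> real) \<Rightarrow> (real \<Rightarrow> real) \<Rightarrow> (real \<Rightarrow> real \<Rightarrow> real) \<Rightarrow> bool" where
  "extended_entropy_solution v \<rho>0 \<rho> \<longleftrightarrow>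
     Linf_time_L1_Linf \<rho> \<and>
     (AE (x, t) in lebesgue_on (UNIV \<times> {0..}). \<rho> x t \<in> {0..Rbar \<rho>0}) \<and>
     weak_solution (flux v) \<rho> \<and>
     attains_initial_datum \<rho>0 \<rho> \<and>
     one_sided_estimate (deriv_within (flux v) {0..Rbar \<rho>0}) \<rho>"

end

theory Submission
  imports Defs "HOL-Computational_Algebra.Polynomial" "HOL-Complex_Analysis.Great_Picard"
begin

text \<open>
  Uniqueness. The potential \<open>U\<close> of a solution, \<open>U\<^sub>x = \<rho>\<close> and \<open>U\<^sub>t = - f(\<rho>)\<close>, is Lipschitz. As \<open>f'\<close> is
  decreasing, the bound on \<open>f'(\<rho>)\<^sub>x\<close> forbids downward jumps of \<open>\<rho>\<close>, so that \<open>\<rho>\<close> is squeezed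
  between the backward and the forward difference quotients of \<open>U\<close>. At a maximum of
  \<open>U\<^sub>1 - U\<^sub>2 - \<kappa> sqrt (1 + x\<^sup>2) - \<lambda> t\<close>, with \<open>U\<^sub>2\<close> mollified, these quotients force \<open>\<rho>\<^sub>1\<close> to be close
  to the mollified \<open>\<rho>\<^sub>2\<close>, and Jensen's inequality for the concave flux contradicts
  \<open>U\<^sub>t = - f(\<rho>)\<close> when \<open>\<lambda>\<close> dominates \<open>\<kappa>\<close>. Hence the potentials agree, and so do the densities.

  Existence. The maximum principle for \<open>(v(R\<^sub>i\<^sub>+\<^sub>1) - v(R\<^sub>i)) / (x\<^sub>i\<^sub>+\<^sub>1 - x\<^sub>i)\<close> bounds these quotients by
  \<open>1/t\<close>, which makes \<open>v(\<rho>\<^sup>n)\<close> one-sided Lipschitz up to a vanishing error. The cumulative masses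
  are equi-Lipschitz in space and almost so in time, hence converge along a subsequence; the
  one-sided bound then squeezes \<open>v(\<rho>\<^sup>n)\<close> between difference quotients of the limit, for each
  \<open>t > 0\<close> and all but countably many \<open>x\<close>. The estimate
  \<open>f'(r) - f'(s) \<le> (1 + K) max 0 (v(r) - v(s))\<close> carries the bound over to \<open>f'(\<rho>)\<close>. The initial
  datum is attained strongly because the limit in \<open>t \<rightarrow> 0\<close> is weak in space and
  \<open>\<integral> (\<rho>\<^sup>n)\<^sup>2\<close> does not increase in time.
\<close>

subsection \<open>Smooth functions of one variable\<close>

text \<open>Uniqueness is a comparison principle for the Hamilton-Jacobi equation
  \<open>U_t + f(U_x) = 0\<close>. Concavity gives \<open>w_t + f(w_x) \<ge> 0\<close> for a
  mollified potential \<open>w\<close>: it is a classical supersolution at every fixed width, so no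
  mollification error appears. The other potential is merely Lipschitz, but its kinks are convex,
  and a smooth function cannot touch a convex kink from above. Near a touching point the density is
  therefore almost constant, which gives pointwise information on a function known only almost
  everywhere.

  In the existence part, bounds per particle say little about arbitrary points: a gap may be long,
  and a point may lie far from both ends of its gap. This is the source of the vanishing error.
  Compactness is taken from primitives, where bounded density and finite speed suffice. A function
  with increments bounded from one side is monotone up to a linear term; this is what upgrades
  convergence of primitives to pointwise convergence.\<close>

primrec smooth_upto :: "nat \<Rightarrow> (real \<Rightarrow> real) \<Rightarrow> bool" where
  "smooth_upto 0 g \<longleftrightarrow> continuous_on UNIV g"
| "smooth_upto (Suc k) g \<longleftrightarrow>
     (\<exists>g'. (\<forall>x. (g has_real_derivative g' x) (at x)) \<and> smooth_upto k g')"

definition smooth :: "(real \<Rightarrow> real) \<Rightarrow> bool" where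
  "smooth g \<longleftrightarrow> (\<forall>k. smooth_upto k g)"

lemma smooth_upto_SucD: "smooth_upto (Suc k) g \<Longrightarrow> smooth_upto k g"
proof (induction k arbitrary: g)
  case 0
  then obtain g' where "\<And>x. (g has_real_derivative g' x) (at x)" by auto
  then show ?case
    using DERIV_isCont by (auto simp: continuous_on_eq_continuous_at)
next
  case (Suc k)
  then obtain g' where "\<forall>x. (g has_real_derivative g' x) (at x)" "smooth_upto (Suc k) g'"
    by auto
  with Suc.IH[of g'] show ?case by auto
qed

lemma smooth_upto_DERIV:
  assumes "smooth_upto (Suc k) g" "\<And>x. (g has_real_derivative g' x) (at x)"
  shows "smooth_upto k g'"
proof -
  obtain h where h: "\<And>x. (g has_real_derivative h x) (at x)" "smooth_upto k h"
    using assms(1) by auto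
  have "h = g'" using h(1) assms(2) DERIV_unique by blast
  with h show ?thesis by simp
qed

lemma smooth_DERIV: "smooth g \<Longrightarrow> (\<And>x. (g has_real_derivative g' x) (at x)) \<Longrightarrow> smooth g'"
  unfolding smooth_def using smooth_upto_DERIV by blast

lemma smooth_antideriv: "smooth g' \<Longrightarrow> (\<And>x. (g has_real_derivative g' x) (at x)) \<Longrightarrow> smooth g"
  unfolding smooth_def using smooth_upto_SucD by (metis smooth_upto.simps(2))

lemma smooth_imp_continuous: "smooth g \<Longrightarrow> continuous_on UNIV g"
  unfolding smooth_def by (metis smooth_upto.simps(1))

lemma smooth_imp_DERIV: "smooth g \<Longrightarrow> (g has_real_derivative deriv g x) (at x)"
  unfolding smooth_def by (metis smooth_upto.simps(2) DERIV_imp_deriv)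

lemma smooth_upto_const: "smooth_upto k (\<lambda>_. c)"
proof (induction k arbitrary: c)
  case (Suc k)
  show ?case by (auto intro!: exI[of _ "\<lambda>_. 0"] Suc)
qed auto

lemma smooth_upto_add: "smooth_upto k g \<Longrightarrow> smooth_upto k h \<Longrightarrow> smooth_upto k (\<lambda>x. g x + h x)"
proof (induction k arbitrary: g h)
  case (Suc k)
  then obtain g' h' where "\<forall>x. (g has_real_derivative g' x) (at x)" "smooth_upto k g'"
    "\<forall>x. (h has_real_derivative h' x) (at x)" "smooth_upto k h'"
    by auto
  with Suc.IH[of g' h'] show ?case
    by (auto intro!: exI[of _ "\<lambda>x. g' x + h' x"] derivative_intros)
qed (auto intro: continuous_intros)

lemma smooth_upto_mult: "smooth_upto k g \<Longrightarrow> smooth_upto k h \<Longrightarrow> smooth_upto k (\<lambda>x. g x * h x)"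
proof (induction k arbitrary: g h)
  case (Suc k)
  then obtain g' h' where *: "\<forall>x. (g has_real_derivative g' x) (at x)" "smooth_upto k g'"
    "\<forall>x. (h has_real_derivative h' x) (at x)" "smooth_upto k h'"
    by auto
  have "smooth_upto k (\<lambda>x. g' x * h x + h' x * g x)"
    using Suc * smooth_upto_SucD by (intro smooth_upto_add Suc.IH) blast+
  with * show ?case
    by (auto intro!: exI[of _ "\<lambda>x. g' x * h x + h' x * g x"] DERIV_mult)
qed (auto intro: continuous_intros)

lemma smooth_upto_affine: "smooth_upto k g \<Longrightarrow> smooth_upto k (\<lambda>x. g (a * x + c))"
proof (induction k arbitrary: g)
  case 0
  then show ?case
    by (auto intro!: continuous_on_compose2[of UNIV g] continuous_intros)
next
  case (Suc k)
  then obtain g' where *: "\<And>x. (g has_real_derivative g' x) (at x)" "smooth_upto k g'"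
    by auto
  have "smooth_upto k (\<lambda>x. g' (a * x + c) * a)"
    by (rule smooth_upto_mult[OF Suc.IH[OF *(2)] smooth_upto_const])
  moreover have "((\<lambda>x. g (a * x + c)) has_real_derivative g' (a * x + c) * a) (at x)" for x
    by (rule DERIV_chain2[OF *(1)]) (auto intro!: derivative_eq_intros)
  ultimately show ?case
    unfolding smooth_upto.simps by (intro exI[of _ "\<lambda>x. g' (a * x + c) * a"] conjI allI)
qed

lemma smooth_const: "smooth (\<lambda>_. c)"
  and smooth_add: "smooth g \<Longrightarrow> smooth h \<Longrightarrow> smooth (\<lambda>x. g x + h x)"
  and smooth_mult: "smooth g \<Longrightarrow> smooth h \<Longrightarrow> smooth (\<lambda>x. g x * h x)"
  and smooth_affine: "smooth g \<Longrightarrow> smooth (\<lambda>x. g (a * x + c))"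
  by (auto simp: smooth_def smooth_upto_const smooth_upto_add smooth_upto_mult smooth_upto_affine)

lemma smooth_cmult: "smooth g \<Longrightarrow> smooth (\<lambda>x. c * g x)"
  by (intro smooth_mult smooth_const)

lemma smooth_diff: "smooth g \<Longrightarrow> smooth h \<Longrightarrow> smooth (\<lambda>x. g x - h x)"
  using smooth_add[of g "\<lambda>x. (-1) * h x"] smooth_cmult[of h "-1"] by simp

lemma smooth_shift: "smooth g \<Longrightarrow> smooth (\<lambda>x. g (x - c))"
  using smooth_affine[of g 1 "-c"] by simp

subsection \<open>A smooth step\<close>

text \<open>The polynomial parameter makes the family \<open>p(1/x) exp(- 1/x)\<close> closed under
  differentiation, so one induction gives the smoothness of all members at once.\<close>

definition flat :: "real poly \<Rightarrow> real \<Rightarrow> real" where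
  "flat p x = (if x > 0 then poly p (1 / x) * exp (- (1 / x)) else 0)"

lemma poly_times_exp_minus_tendsto_0:
  "((\<lambda>y::real. poly p y * exp (- y)) \<longlongrightarrow> 0) at_top"
proof -
  have "((\<lambda>y::real. \<Sum>i\<le>degree p. coeff p i * (y ^ i / exp y)) \<longlongrightarrow> (\<Sum>i\<le>degree p. coeff p i * 0)) at_top"
    by (intro tendsto_intros tendsto_power_div_exp_0)
  then show ?thesis
    by (simp add: poly_altdef exp_minus field_simps sum_divide_distrib)
qed

lemma flat_tendsto_0: "(flat p \<longlongrightarrow> 0) (at_right 0)"
proof -
  have "((\<lambda>x::real. poly p (1 / x) * exp (- (1 / x))) \<longlongrightarrow> 0) (at_right 0)"
    using filterlim_compose[OF poly_times_exp_minus_tendsto_0 filterlim_inverse_at_top_right]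
    by (simp add: inverse_eq_divide)
  then show ?thesis
    by (rule Lim_transform_eventually) (auto simp: flat_def eventually_at_filter)
qed

lemma flat_DERIV: "(flat p has_real_derivative flat ([:0,0,1:] * (p - pderiv p)) x) (at x)"
proof -
  consider "x < 0" | "x = 0" | "x > 0" by linarith
  then show ?thesis
  proof cases
    case 1
    have "((\<lambda>_. 0::real) has_real_derivative 0) (at x)" by simp
    then have "(flat p has_real_derivative 0) (at x)"
      by (rule has_field_derivative_transform_within_open[where S="{..<0}"]) (use 1 in \<open>auto simp: flat_def\<close>)
    then show ?thesis using 1 by (simp add: flat_def)
  next
    case 3
    have "((\<lambda>x. poly p (1 / x) * exp (- (1 / x))) has_real_derivative
        poly p (1 / x) * (exp (- (1 / x)) * (1 / x^2)) + (poly (pderiv p) (1 / x) * (- 1 / x^2)) * exp (- (1 / x))) (at x)"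
      using 3 by (auto intro!: derivative_eq_intros DERIV_chain2[OF poly_DERIV] simp: power2_eq_square field_simps)
    then have "(flat p has_real_derivative
        poly p (1 / x) * (exp (- (1 / x)) * (1 / x^2)) + (poly (pderiv p) (1 / x) * (- 1 / x^2)) * exp (- (1 / x))) (at x)"
      by (rule has_field_derivative_transform_within_open[where S="{0<..}"]) (use 3 in \<open>auto simp: flat_def\<close>)
    then show ?thesis
      using 3 by (simp add: flat_def power2_eq_square field_simps)
  next
    case 2
    \<comment> \<open>Dividing by \<open>h\<close> multiplies the polynomial in \<open>1 / h\<close>
      by its variable, so the difference quotient at \<open>0\<close> is again a flat function and
      tends to \<open>0\<close>.\<close>
    have "((\<lambda>h. flat p h / h) \<longlongrightarrow> 0) (at_right 0)"
      by (rule Lim_transform_eventually[OF flat_tendsto_0[of "pCons 0 p"]])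
        (auto simp: flat_def eventually_at_filter)
    moreover have "((\<lambda>h. flat p h / h) \<longlongrightarrow> 0) (at_left 0)"
      by (rule Lim_transform_eventually[OF tendsto_const]) (auto simp: flat_def eventually_at_filter)
    ultimately have "((\<lambda>h. flat p h / h) \<longlongrightarrow> 0) (at 0)"
      by (simp add: filterlim_at_split)
    then show ?thesis
      using 2 by (simp add: flat_def has_field_derivative_iff)
  qed
qed

lemma smooth_flat: "smooth (flat p)"
proof -
  have "smooth_upto k (flat p)" for k
  proof (induction k arbitrary: p)
    case 0
    then show ?case
      by (auto intro!: continuous_at_imp_continuous_on DERIV_isCont[OF flat_DERIV])
  next
    case (Suc k)
    then show ?case using flat_DERIV by auto
  qed
  then show ?thesis by (simp add: smooth_def)
qed

definition is_step :: "(real \<Rightarrow> real) \<Rightarrow> bool" where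
  "is_step S \<longleftrightarrow> smooth S \<and> (\<forall>x\<le>0. S x = 0) \<and> (\<forall>x\<ge>1. S x = 1) \<and> mono S"

lemma is_step_exists: "\<exists>S. is_step S"
proof -
  \<comment> \<open>A bump, positive exactly on the open unit interval; its normalised primitive is
    the step.\<close>
  define e where "e x = flat 1 x * flat 1 (1 - x)" for x
  have sm: "smooth e"
    unfolding e_def using smooth_mult[OF smooth_flat smooth_affine[OF smooth_flat, where a="-1" and c=1], of 1 1]
    by simp
  then have "isCont e x" for x
    using smooth_imp_continuous continuous_on_eq_continuous_at by blast
  then obtain F where F: "\<And>x. (F has_real_derivative e x) (at x)"
    using einterval_antiderivative[of "-\<infinity>" "\<infinity>" e] by (auto simp: has_real_derivative_iff_has_vector_derivative)
  have e0: "e x = 0" if "x \<le> 0 \<or> x \<ge> 1" for x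
    using that by (auto simp: e_def flat_def)
  have epos: "e x \<ge> 0" for x by (auto simp: e_def flat_def)
  have mono: "F x \<le> F y" if "x \<le> y" for x y
    using that F epos by (intro DERIV_nonneg_imp_nondecreasing[of x y F]) auto
  have neg: "F x = F 0" if "x \<le> 0" for x
  proof (cases "x = 0")
    case False
    with that show ?thesis
      using F e0 by (intro DERIV_isconst2[of x 0 F 0, THEN sym])
        (auto intro!: continuous_at_imp_continuous_on DERIV_isCont[OF F] ; metis F e0 less_imp_le)+
  qed simp
  have pos: "F x = F 1" if "x \<ge> 1" for x
  proof (cases "x = 1")
    case False
    with that show ?thesis
      using F e0 by (intro DERIV_isconst2[of 1 x F x])
        (auto intro!: continuous_at_imp_continuous_on DERIV_isCont[OF F] ; metis F e0 less_imp_le)+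
  qed simp
  have lt: "F 0 < F 1"
    by (rule DERIV_pos_imp_increasing_open[of 0 1 F])
      (auto intro!: continuous_at_imp_continuous_on DERIV_isCont[OF F] exI[of _ "e _"] F simp: e_def flat_def)
  define S where "S x = (F x - F 0) / (F 1 - F 0)" for x
  have "smooth (\<lambda>x. (1 / (F 1 - F 0)) * (F x - F 0))"
    by (intro smooth_mult smooth_diff smooth_const smooth_antideriv[OF sm F])
  then have "smooth S" by (simp add: S_def[abs_def])
  moreover have "mono S" using mono lt by (auto simp: S_def mono_def divide_right_mono)
  moreover have "S x = 0" if "x \<le> 0" for x using neg[OF that] by (simp add: S_def)
  moreover have "S x = 1" if "x \<ge> 1" for x
    unfolding S_def pos[OF that] using lt by simp
  ultimately have "is_step S" by (simp add: is_step_def)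
  then show ?thesis by blast
qed

section \<open>Steps of width \<epsilon> and their kernels\<close>

definition unit_step :: "real \<Rightarrow> real" where "unit_step = (SOME S. is_step S)"

lemma is_step_unit_step: "is_step unit_step"
  unfolding unit_step_def using is_step_exists by (rule someI_ex)

definition step :: "real \<Rightarrow> real \<Rightarrow> real" where "step \<epsilon> x = unit_step (x / \<epsilon>)"

text \<open>The kernel lives on \<open>[0, \<epsilon>]\<close> instead of being symmetric. Averages
  at time \<open>t\<close> then involve later times only, so they stay inside the half plane of
  positive times for every \<open>t > 0\<close> and every \<open>\<epsilon>\<close>.\<close>

definition kern :: "real \<Rightarrow> real \<Rightarrow> real" where "kern \<epsilon> = deriv (step \<epsilon>)"

lemma smooth_step: "smooth (step \<epsilon>)"
  using smooth_affine[of unit_step "1/\<epsilon>" 0] is_step_unit_step by (simp add: step_def[abs_def] is_step_def)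

lemma DERIV_step: "(step \<epsilon> has_real_derivative kern \<epsilon> x) (at x)"
  unfolding kern_def by (rule smooth_imp_DERIV[OF smooth_step])

lemma smooth_kern: "smooth (kern \<epsilon>)"
  by (rule smooth_DERIV[OF smooth_step DERIV_step])

lemma continuous_step: "continuous_on A (step \<epsilon>)" and continuous_kern: "continuous_on A (kern \<epsilon>)"
  using smooth_imp_continuous smooth_step smooth_kern continuous_on_subset by blast+

lemma step_measurable [measurable]: "step \<epsilon> \<in> borel_measurable borel"
  and kern_measurable [measurable]: "kern \<epsilon> \<in> borel_measurable borel"
  by (auto intro!: borel_measurable_continuous_onI continuous_step continuous_kern)

context fixes \<epsilon> :: real assumes eps: "\<epsilon> > 0"
begin

lemma step_0: "x \<le> 0 \<Longrightarrow> step \<epsilon> x = 0" and step_1: "x \<ge> \<epsilon> \<Longrightarrow> step \<epsilon> x = 1"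
  using is_step_unit_step eps by (auto simp: step_def is_step_def divide_le_0_iff)

lemma step_mono: "x \<le> y \<Longrightarrow> step \<epsilon> x \<le> step \<epsilon> y"
  using is_step_unit_step eps by (auto simp: step_def is_step_def mono_def divide_right_mono)

lemma step_ge_0: "0 \<le> step \<epsilon> x" and step_le_1: "step \<epsilon> x \<le> 1"
  using step_mono[of "min 0 x" x] step_mono[of x "max \<epsilon> x"] step_0[of "min 0 x"] step_1[of "max \<epsilon> x"] by auto

lemma kern_nonneg: "0 \<le> kern \<epsilon> x"
proof (rule ccontr)
  assume "\<not> 0 \<le> kern \<epsilon> x"
  then obtain d where "d > 0" "\<And>h. 0 < h \<Longrightarrow> h < d \<Longrightarrow> step \<epsilon> (x + h) < step \<epsilon> x"
    using DERIV_neg_dec_right[OF DERIV_step[of \<epsilon> x]] by auto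
  from this(2)[of "d/2"] step_mono[of x "x+d/2"] \<open>d > 0\<close> show False by auto
qed

lemma kern_0: assumes "x \<le> 0 \<or> \<epsilon> \<le> x" shows "kern \<epsilon> x = 0"
proof -
  have 1: "kern \<epsilon> x = 0" if "x < 0" for x
  proof -
    have "((\<lambda>_. 0::real) has_real_derivative 0) (at x)" by simp
    then have "(step \<epsilon> has_real_derivative 0) (at x)"
      by (rule has_field_derivative_transform_within_open[where S="{..<0}"]) (use that in \<open>auto simp: step_0\<close>)
    then show ?thesis using DERIV_step DERIV_unique by blast
  qed
  have 2: "kern \<epsilon> x = 0" if "x > \<epsilon>" for x
  proof -
    have "((\<lambda>_. 1::real) has_real_derivative 0) (at x)" by simp
    then have "(step \<epsilon> has_real_derivative 0) (at x)"
      by (rule has_field_derivative_transform_within_open[where S="{\<epsilon><..}"]) (use that in \<open>auto simp: step_1\<close>)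
    then show ?thesis using DERIV_step DERIV_unique by blast
  qed
  have c: "isCont (kern \<epsilon>) x" for x
    using continuous_kern[of UNIV] by (simp add: continuous_on_eq_continuous_at)
  \<comment> \<open>At the two endpoints the value follows by continuity from the outer
    side.\<close>
  have "kern \<epsilon> 0 = 0"
  proof (rule tendsto_unique)
    show "(kern \<epsilon> \<longlongrightarrow> kern \<epsilon> 0) (at_left 0)" using c[of 0] by (simp add: isCont_def filterlim_at_split)
    show "(kern \<epsilon> \<longlongrightarrow> 0) (at_left 0)"
      by (rule Lim_transform_eventually[OF tendsto_const]) (auto simp: 1 eventually_at_filter)
  qed auto
  moreover have "kern \<epsilon> \<epsilon> = 0"
  proof (rule tendsto_unique)
    show "(kern \<epsilon> \<longlongrightarrow> kern \<epsilon> \<epsilon>) (at_right \<epsilon>)" using c[of \<epsilon>] by (simp add: isCont_def filterlim_at_split)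
    show "(kern \<epsilon> \<longlongrightarrow> 0) (at_right \<epsilon>)"
      by (rule Lim_transform_eventually[OF tendsto_const]) (auto simp: 2 eventually_at_filter)
  qed auto
  ultimately show ?thesis using 1[of x] 2[of x] assms by (cases "x = 0 \<or> x = \<epsilon>") auto
qed

lemma kern_Lipschitz: "\<exists>c\<ge>0. \<forall>x y. \<bar>kern \<epsilon> x - kern \<epsilon> y\<bar> \<le> c * \<bar>x - y\<bar>"
proof -
  define k' where "k' = deriv (kern \<epsilon>)"
  have D: "(kern \<epsilon> has_real_derivative k' x) (at x)" for x
    unfolding k'_def by (rule smooth_imp_DERIV[OF smooth_kern])
  have "continuous_on {0..\<epsilon>} k'"
    using smooth_imp_continuous[OF smooth_DERIV[OF smooth_kern D]] continuous_on_subset by blast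
  then have "bounded (k' ` {0..\<epsilon>})"
    by (intro compact_imp_bounded compact_continuous_image) auto
  then obtain c where c: "\<And>x. x \<in> {0..\<epsilon>} \<Longrightarrow> \<bar>k' x\<bar> \<le> c"
    unfolding bounded_iff by (metis image_eqI real_norm_def)
  have "\<bar>k' 0\<bar> \<le> c" using eps by (intro c) auto
  then have c0: "c \<ge> 0" by linarith
  have "\<bar>k' x\<bar> \<le> c" for x
  proof (cases "x \<in> {0..\<epsilon>}")
    case False
    have "((\<lambda>_. 0::real) has_real_derivative 0) (at x)" by simp
    then have "(kern \<epsilon> has_real_derivative 0) (at x)"
      by (rule has_field_derivative_transform_within_open[where S="{..<0} \<union> {\<epsilon><..}"])
        (use False in \<open>auto simp: kern_0\<close>)
    then have "k' x = 0" using D DERIV_unique by blast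
    then show ?thesis using c0 by simp
  qed (use c in auto)
  then have "\<bar>kern \<epsilon> x - kern \<epsilon> y\<bar> \<le> c * \<bar>x - y\<bar>" for x y
    using field_differentiable_bound[of UNIV "kern \<epsilon>" k' c x y] D by auto
  then show ?thesis using c0 by blast
qed

text \<open>The mean value inequality is applied to
  \<open>step \<epsilon> z - z * kern \<epsilon> y\<close>, whose derivative is small near
  \<open>y\<close> because the kernel is Lipschitz. The quadratic remainder becomes that of the
  Taylor expansions of the mollified potential.\<close>

lemma step_Taylor: 
  assumes c: "\<And>x y. \<bar>kern \<epsilon> x - kern \<epsilon> y\<bar> \<le> c * \<bar>x - y\<bar>"
  shows "\<bar>step \<epsilon> y - step \<epsilon> (y - r) - r * kern \<epsilon> y\<bar> \<le> c * r\<^sup>2"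
proof -
  define g where "g z = step \<epsilon> z - z * kern \<epsilon> y" for z
  have D: "(g has_real_derivative kern \<epsilon> z - kern \<epsilon> y) (at z)" for z
    unfolding g_def by (auto intro!: derivative_eq_intros DERIV_step)
  have c0: "c \<ge> 0" using c[of 0 1] by auto
  have "\<bar>g y - g (y - r)\<bar> \<le> (c * \<bar>r\<bar>) * \<bar>y - (y - r)\<bar>"
  proof -
    have "norm (kern \<epsilon> z - kern \<epsilon> y) \<le> c * \<bar>r\<bar>" if "z \<in> cball y \<bar>r\<bar>" for z
    proof -
      have "\<bar>kern \<epsilon> z - kern \<epsilon> y\<bar> \<le> c * \<bar>z - y\<bar>" by (rule c)
      also have "\<dots> \<le> c * \<bar>r\<bar>" using that c0 by (intro mult_left_mono) (auto simp: dist_real_def)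
      finally show ?thesis by simp
    qed
    then show ?thesis
      using field_differentiable_bound[of "cball y \<bar>r\<bar>" g "\<lambda>z. kern \<epsilon> z - kern \<epsilon> y" "c * \<bar>r\<bar>" "y-r" y] 
        has_field_derivative_at_within[OF D]
      by (auto simp: dist_real_def)
  qed
  also have "\<dots> = c * r\<^sup>2" by (simp add: power2_eq_square)
  finally show ?thesis by (simp add: g_def algebra_simps)
qed

lemma kern_has_integral: "has_bochner_integral lborel (kern \<epsilon>) 1"
proof -
  have "has_bochner_integral lborel (\<lambda>x. indicator {0..\<epsilon>} x *\<^sub>R kern \<epsilon> x) (step \<epsilon> \<epsilon> - step \<epsilon> 0)"
    using eps has_field_derivative_at_within[OF DERIV_step]
    by (intro has_bochner_integral_FTC_Icc continuous_kern)
       (auto simp: has_real_derivative_iff_has_vector_derivative[symmetric])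
  moreover have "(\<lambda>x. indicator {0..\<epsilon>} x *\<^sub>R kern \<epsilon> x) = kern \<epsilon>"
  proof
    fix x
    show "indicator {0..\<epsilon>} x *\<^sub>R kern \<epsilon> x = kern \<epsilon> x"
      using kern_0[of x] by (cases "x \<in> {0..\<epsilon>}") auto
  qed
  ultimately show ?thesis by (simp add: step_0 step_1)
qed

text \<open>The integrand is a smoothed indicator of \<open>[a, b]\<close>. Its two transition
  layers are translates of each other and cancel, so estimates with these weights carry no error in
  \<open>\<epsilon>\<close>.\<close>

lemma step_diff_has_integral:
  assumes "a \<le> b"
  shows "has_bochner_integral lborel (\<lambda>x. step \<epsilon> (x - a) - step \<epsilon> (x - b)) (b - a)"
proof -
  have "isCont (step \<epsilon>) x" for x
    using continuous_step[of UNIV] by (simp add: continuous_on_eq_continuous_at)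
  then obtain Z where Z: "\<And>x. (Z has_real_derivative step \<epsilon> x) (at x)"
    using einterval_antiderivative[of "-\<infinity>" "\<infinity>" "step \<epsilon>"] by (auto simp: has_real_derivative_iff_has_vector_derivative)
  \<comment> \<open>\<open>Z\<close> is constant left of \<open>0\<close> and \<open>Z x - x\<close>
    is constant right of \<open>\<epsilon>\<close>; these two facts evaluate the boundary
    terms.\<close>
  have neg: "Z (a - b) = Z 0"
  proof (cases "a = b")
    case False
    then show ?thesis
      using assms 
      by (intro DERIV_isconst2[of "a-b" 0 Z 0, THEN sym])
        (auto intro!: continuous_at_imp_continuous_on DERIV_isCont[OF Z] ; metis Z step_0 less_imp_le)+
  qed simp
  have pos: "Z (b + \<epsilon> - a) - (b + \<epsilon> - a) = Z \<epsilon> - \<epsilon>"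
  proof (cases "a = b")
    case False
    have D: "((\<lambda>x. Z x - x) has_real_derivative 0) (at x)" if "x > \<epsilon>" for x
      using Z[of x] that by (auto intro!: derivative_eq_intros simp: step_1)
    show ?thesis
      using assms False D
      by (intro DERIV_isconst2[of "\<epsilon>" "b+\<epsilon>-a" "\<lambda>x. Z x - x" "b+\<epsilon>-a"])
        (auto intro!: continuous_at_imp_continuous_on continuous_intros DERIV_isCont[OF Z])
  qed simp
  have D: "((\<lambda>x. Z (x - a) - Z (x - b)) has_real_derivative step \<epsilon> (x - a) - step \<epsilon> (x - b)) (at x)" for x
    by (intro DERIV_diff DERIV_chain2[OF Z, where s="UNIV" and Db=1, simplified]) (auto intro!: derivative_eq_intros)
  have "has_bochner_integral lborel (\<lambda>x. indicator {a..b+\<epsilon>} x *\<^sub>R (step \<epsilon> (x - a) - step \<epsilon> (x - b)))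
     ((Z (b + \<epsilon> - a) - Z (b + \<epsilon> - b)) - (Z (a - a) - Z (a - b)))"
    using eps assms has_field_derivative_at_within[OF D]
    by (intro has_bochner_integral_FTC_Icc)
       (auto simp: has_real_derivative_iff_has_vector_derivative[symmetric]
         intro!: continuous_intros continuous_on_compose2[OF continuous_step])
  moreover have "(\<lambda>x. indicator {a..b+\<epsilon>} x *\<^sub>R (step \<epsilon> (x - a) - step \<epsilon> (x - b))) = (\<lambda>x. step \<epsilon> (x - a) - step \<epsilon> (x - b))"
  proof
    fix x
    show "indicator {a..b+\<epsilon>} x *\<^sub>R (step \<epsilon> (x - a) - step \<epsilon> (x - b)) = step \<epsilon> (x - a) - step \<epsilon> (x - b)"
      using assms eps step_0[of "x-a"] step_0[of "x-b"] step_1[of "x-a"] step_1[of "x-b"]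
      by (cases "x < a"; cases "x > b + \<epsilon>") (auto simp: indicator_def)
  qed
  moreover have "(Z (b + \<epsilon> - a) - Z (b + \<epsilon> - b)) - (Z (a - a) - Z (a - b)) = b - a"
    using neg pos by simp
  ultimately show ?thesis by (simp only:)
qed

end

subsection \<open>Tensor products as test functions\<close>

lemma Ck_add: "Ck k g \<Longrightarrow> Ck k h \<Longrightarrow> Ck k (\<lambda>x. g x + h x)"
proof (induction k arbitrary: g h)
  case (Suc k)
  have "((\<lambda>x. g x + h x) has_derivative (\<lambda>u. frechet_derivative g (at x) u + frechet_derivative h (at x) u)) (at x)" for x
    using Suc.prems by (intro has_derivative_add) (simp_all add: frechet_derivative_works)
  then have "frechet_derivative (\<lambda>x. g x + h x) (at x) = (\<lambda>u. frechet_derivative g (at x) u + frechet_derivative h (at x) u)" for x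
    using frechet_derivative_at by (metis (no_types, lifting))
  with Suc show ?case by (auto intro: differentiable_add)
qed (auto intro: continuous_intros)

lemma Ck_cmult: "Ck k g \<Longrightarrow> Ck k (\<lambda>x. c * g x)"
proof (induction k arbitrary: g)
  case (Suc k)
  have D: "((\<lambda>x. c * g x) has_derivative (\<lambda>u. c * frechet_derivative g (at x) u)) (at x)" for x
    using Suc.prems by (intro has_derivative_mult_right) (simp add: frechet_derivative_works)
  have "frechet_derivative (\<lambda>x. c * g x) (at x) = (\<lambda>u. c * frechet_derivative g (at x) u)" for x
    using frechet_derivative_at[OF D] by simp
  moreover have "(\<lambda>x. c * g x) differentiable (at x)" for x
    using D unfolding differentiable_def by blast
  ultimately show ?case using Suc by simp
qed (auto intro: continuous_intros)

text \<open>A directional derivative of a product \<open>g(x) h(t)\<close> is a sum of two such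
  products, which closes the induction over \<open>k\<close>. Products are all that uniqueness tests
  with: steps and kernels in each variable.\<close>

lemma Ck_tensor:
  "smooth_upto k g \<Longrightarrow> smooth_upto k h \<Longrightarrow> Ck k (\<lambda>p::real \<times> real. g (fst p) * h (snd p))"
proof (induction k arbitrary: g h)
  case 0
  then show ?case by (auto intro!: continuous_intros continuous_on_compose2[of UNIV g] continuous_on_compose2[of UNIV h])
next
  case (Suc k)
  then obtain g' h' where *: "\<And>x. (g has_real_derivative g' x) (at x)" "smooth_upto k g'"
    "\<And>x. (h has_real_derivative h' x) (at x)" "smooth_upto k h'"
    by auto
  have D: "((\<lambda>p::real \<times> real. g (fst p) * h (snd p)) has_derivative
      (\<lambda>u. fst u * (g' (fst p) * h (snd p)) + snd u * (g (fst p) * h' (snd p)))) (at p)" for p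
  proof -
    have "((\<lambda>p::real \<times> real. g (fst p)) has_derivative (\<lambda>u. g' (fst p) * fst u)) (at p)"
      by (rule has_derivative_compose[of fst fst p UNIV g "(*) (g' (fst p))"])
        (use *(1)[of "fst p"] in \<open>auto simp: has_field_derivative_def intro!: derivative_eq_intros\<close>)
    moreover have "((\<lambda>p::real \<times> real. h (snd p)) has_derivative (\<lambda>u. h' (snd p) * snd u)) (at p)"
      by (rule has_derivative_compose[of snd snd p UNIV h "(*) (h' (snd p))"])
        (use *(3)[of "snd p"] in \<open>auto simp: has_field_derivative_def intro!: derivative_eq_intros\<close>)
    ultimately show ?thesis
      by (rule has_derivative_eq_rhs[OF has_derivative_mult]) (auto simp: fun_eq_iff)
  qed
  have "smooth_upto k g" "smooth_upto k h" using Suc.prems smooth_upto_SucD by blast+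
  then have "Ck k (\<lambda>p. fst u * (g' (fst p) * h (snd p)) + snd u * (g (fst p) * h' (snd p)))" for u
    by (intro Ck_add Ck_cmult Suc.IH *)
  moreover have "frechet_derivative (\<lambda>p. g (fst p) * h (snd p)) (at p) = 
      (\<lambda>u. fst u * (g' (fst p) * h (snd p)) + snd u * (g (fst p) * h' (snd p)))" for p
    using frechet_derivative_at[OF D] by simp
  moreover have "(\<lambda>p. g (fst p) * h (snd p)) differentiable (at p)" for p :: "real \<times> real"
    using D unfolding differentiable_def by blast
  ultimately show ?case by simp
qed

lemma test_function_tensor:
  assumes "smooth g" "smooth h" "\<And>x. x \<notin> {a..b} \<Longrightarrow> g x = 0" "\<And>t. t \<notin> {c..d} \<Longrightarrow> h t = 0" "c > 0"
  shows "test_function (\<lambda>p::real \<times> real. g (fst p) * h (snd p))"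
proof -
  have "{p. g (fst p) * h (snd p) \<noteq> 0} \<subseteq> {a..b} \<times> {c..d}"
    using assms(3,4) by force
  then have cl: "closure {p. g (fst p) * h (snd p) \<noteq> 0} \<subseteq> {a..b} \<times> {c..d}"
    by (intro closure_minimal closed_Times) auto
  moreover have "compact ({a..b} \<times> {c..d})" by (intro compact_Times) auto
  ultimately have "compact (closure {p. g (fst p) * h (snd p) \<noteq> 0})"
    using compact_Int_closed[of "{a..b} \<times> {c..d}" "closure {p. g (fst p) * h (snd p) \<noteq> 0}"]
    by (simp add: Int_absorb1)
  moreover have "{a..b} \<times> {c..d} \<subseteq> UNIV \<times> {0<..}" using assms(5) by auto
  ultimately show ?thesis
    using cl assms(1,2) by (auto simp: test_function_def compact_support_in_def smooth_def intro!: Ck_tensor)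
qed

lemma dx_tensor: "(\<And>x. (g has_real_derivative g' x) (at x)) \<Longrightarrow> dx (\<lambda>p. g (fst p) * h (snd p)) x t = g' x * h t"
  and dt_tensor: "(\<And>x. (h has_real_derivative h' x) (at x)) \<Longrightarrow> dt (\<lambda>p. g (fst p) * h (snd p)) x t = g x * h' t"
  by (auto simp: dx_def dt_def intro!: DERIV_imp_deriv derivative_eq_intros)

subsection \<open>Mollification\<close>

lemma fst_borel [measurable]: "fst \<in> borel_measurable (borel :: (real \<times> real) measure)"
  and snd_borel [measurable]: "snd \<in> borel_measurable (borel :: (real \<times> real) measure)"
  by (auto intro!: borel_measurable_continuous_onI continuous_intros)

lemma integral_shift:
  fixes f :: "'a::euclidean_space \<Rightarrow> real"
  assumes [measurable]: "f \<in> borel_measurable borel"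
  shows "(LINT x|lborel. f (c + x)) = (LINT x|lborel. f x)"
proof -
  have "(LINT x|lborel. f (c + x)) = (LINT x|distr lborel borel ((+) c). f x)"
    by (subst integral_distr) auto
  then show ?thesis by (simp add: lborel_distr_plus)
qed

lemma AE_shift:
  fixes c :: "'a::euclidean_space"
  assumes "AE x in lborel. P x"
  shows "AE x in lborel. P (c + x)"
proof -
  have "AE x in distr lborel borel ((+) c). P x" unfolding lborel_distr_plus by (rule assms)
  then show ?thesis by (rule AE_distrD[rotated]) auto
qed

lemma integrable_bounded_mult:
  fixes h k :: "'a \<Rightarrow> real"
  assumes "integrable N k" "h \<in> borel_measurable N" "\<And>x. \<bar>h x\<bar> \<le> M"
  shows "integrable N (\<lambda>x. h x * k x)"
proof (rule Bochner_Integration.integrable_bound[where f="\<lambda>x. M * k x"])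
  show "AE x in N. norm (h x * k x) \<le> norm (M * k x)"
  proof (rule AE_I2)
    fix x
    have "\<bar>h x\<bar> \<le> \<bar>M\<bar>" using assms(3)[of x] by linarith
    then show "norm (h x * k x) \<le> norm (M * k x)" by (simp add: abs_mult mult_right_mono)
  qed
qed (use assms in \<open>auto intro!: borel_measurable_times borel_measurable_integrable\<close>)

lemma integral_bounded_mult:
  fixes h k :: "'a \<Rightarrow> real"
  assumes "integrable N k" "h \<in> borel_measurable N" "\<And>x. \<bar>h x\<bar> \<le> M"
  shows "\<bar>LINT x|N. h x * k x\<bar> \<le> M * (LINT x|N. \<bar>k x\<bar>)"
proof -
  have "\<bar>LINT x|N. h x * k x\<bar> \<le> (LINT x|N. \<bar>h x * k x\<bar>)" by (rule integral_abs_bound)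
  also have "\<dots> \<le> (LINT x|N. M * \<bar>k x\<bar>)"
    using assms by (intro integral_mono integrable_abs integrable_bounded_mult[OF assms] integrable_mult_right)
      (auto simp: abs_mult mult_right_mono)
  finally show ?thesis by simp
qed

lemma tensor_has_integral:
  fixes a b :: "real \<Rightarrow> real"
  assumes "has_bochner_integral lborel a A" "has_bochner_integral lborel b B"
  shows "has_bochner_integral lborel (\<lambda>p::real \<times> real. a (fst p) * b (snd p)) (A * B)"
proof -
  have a: "integrable lborel a" "(LINT x|lborel. a x) = A" and b: "integrable lborel b" "(LINT x|lborel. b x) = B"
    using assms by (auto simp: has_bochner_integral_iff)
  have [measurable]: "a \<in> borel_measurable borel" "b \<in> borel_measurable borel"
    using a(1) b(1) borel_measurable_integrable by fastforce+
  have int: "integrable (lborel \<Otimes>\<^sub>M lborel) (\<lambda>(x, y). a x * b y)"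
  proof (rule lborel_pair.Fubini_integrable)
    show "(\<lambda>(x, y). a x * b y) \<in> borel_measurable (lborel \<Otimes>\<^sub>M lborel)" by measurable
    show "integrable lborel (\<lambda>x. LINT y|lborel. norm (case (x, y) of (x, y) \<Rightarrow> a x * b y))"
      using a b by (simp add: abs_mult)
    show "AE x in lborel. integrable lborel (\<lambda>y. case (x, y) of (x, y) \<Rightarrow> a x * b y)"
      using b by simp
  qed
  moreover have "(LINT p|(lborel \<Otimes>\<^sub>M lborel). (case p of (x, y) \<Rightarrow> a x * b y)) = A * B"
    using lborel_pair.integral_fst[OF int] a b by simp
  ultimately show ?thesis
    by (simp add: has_bochner_integral_iff lborel_prod case_prod_unfold)
qed

text \<open>Du Bois-Reymond for inequalities. The indicator of the set where \<open>h > 0\<close> is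
  an almost everywhere limit of continuous functions; clamped to \<open>[0, 1]\<close> and cut off
  they become admissible tests, and dominated convergence shows that the positive part of
  \<open>h\<close> has integral \<open>0\<close> against every cut-off.\<close>

lemma AE_nonpos_of_continuous_tests:
  fixes h :: "'a::euclidean_space \<Rightarrow> real"
  assumes [measurable]: "h \<in> borel_measurable borel" and bnd: "\<And>p. \<bar>h p\<bar> \<le> M"
    and test: "\<And>\<psi> r. continuous_on UNIV \<psi> \<Longrightarrow> (\<And>p. 0 \<le> \<psi> p) \<Longrightarrow> (\<And>p. norm p > r \<Longrightarrow> \<psi> p = 0) \<Longrightarrow>
        (LINT p|lborel. h p * \<psi> p) \<le> 0"
  shows "AE p in lborel. h p \<le> 0"
proof -
  define A where "A = {p. h p > 0}"
  have [measurable]: "A \<in> sets borel" unfolding A_def by measurable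
  have "(indicator A :: 'a \<Rightarrow> real) \<in> borel_measurable lebesgue"
    by (intro measurable_completion) auto
  then have "(indicator A :: 'a \<Rightarrow> real) measurable_on UNIV"
    by (rule lebesgue_measurable_imp_measurable_on) simp
  then obtain N g where N: "negligible N" and g: "\<And>n. continuous_on UNIV (g n)"
    "\<And>x. x \<notin> N \<Longrightarrow> (\<lambda>n. g n x) \<longlonglongrightarrow> (indicator A x :: real)"
    unfolding measurable_on_def by auto
  have aeN: "AE x in lborel. x \<notin> N"
    using N unfolding negligible_iff_null_sets using AE_not_in AE_completion_iff by blast
  have M0: "M \<ge> 0" using bnd[of undefined] by linarith
  \<comment> \<open>A continuous cut-off, equal to \<open>1\<close> on the ball of radius
    \<open>m\<close> and to \<open>0\<close> outside radius \<open>m + 1\<close>; it gives the tests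
    compact support and an integrable majorant.\<close>
  define c where "c m p = max 0 (min 1 (real m + 1 - norm p))" for m and p :: 'a
  define \<psi> where "\<psi> m n p = max 0 (min 1 (g n p)) * c m p" for m n p
  have c01: "0 \<le> c m p" "c m p \<le> 1" "norm p > real m + 1 \<Longrightarrow> c m p = 0" for m p
    by (auto simp: c_def)
  have cont: "continuous_on UNIV (\<psi> m n)" for m n
    unfolding \<psi>_def c_def by (intro continuous_intros g)
  have [measurable]: "\<psi> m n \<in> borel_measurable borel" "c m \<in> borel_measurable borel" for m n
    using cont by (auto intro!: borel_measurable_continuous_onI continuous_intros simp: c_def)
  have ball: "integrable lborel (\<lambda>p::'a. M * indicator (cball 0 (real m + 1)) p)" for m
    by (intro integrable_mult_right integrable_real_indicator) (auto simp: emeasure_lborel_cball_finite[simplified])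
  have \<psi>01: "0 \<le> \<psi> m n p" "\<psi> m n p \<le> indicator (cball 0 (real m + 1)) p" for m n p
    using c01[of m p] by (auto simp: \<psi>_def indicator_def intro: mult_le_one)
  have c_ind: "c m p \<le> indicator (cball 0 (real m + 1)) p" for m p
    using c01[of m p] by (auto simp: indicator_def)
  have int: "integrable lborel (\<lambda>p. h p * (indicator A p * c m p))" for m
    using c01 c_ind bnd M0
    by (intro Bochner_Integration.integrable_bound[OF ball[of m]] AE_I2)
      (auto simp: abs_mult indicator_def intro!: mult_mono split: if_splits intro: order_trans[OF mult_mono[OF bnd c01(2)[of m]]])
  have "(LINT p|lborel. h p * (indicator A p * c m p)) \<le> 0" for m
  proof (rule LIMSEQ_le_const2)
    show "(\<lambda>n. LINT p|lborel. h p * \<psi> m n p) \<longlonglongrightarrow> (LINT p|lborel. h p * (indicator A p * c m p))"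
    proof (rule integral_dominated_convergence[OF _ _ ball[of m]])
      show "AE x in lborel. (\<lambda>n. h x * \<psi> m n x) \<longlonglongrightarrow> h x * (indicator A x * c m x)"
        using aeN
      proof eventually_elim
        case (elim x)
        have "(\<lambda>n. h x * (max 0 (min 1 (g n x)) * c m x)) \<longlonglongrightarrow> h x * (max 0 (min 1 (indicator A x)) * c m x)"
          by (intro tendsto_intros g(2) elim)
        then show ?case by (simp add: \<psi>_def indicator_def split: if_splits)
      qed
      show "AE x in lborel. norm (h x * \<psi> m n x) \<le> M * indicator (cball 0 (real m + 1)) x" for n
        using \<psi>01 bnd M0 by (intro AE_I2) (auto simp: abs_mult intro!: mult_mono)
    qed measurable
    show "\<exists>N. \<forall>n\<ge>N. (LINT p|lborel. h p * \<psi> m n p) \<le> 0"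
    proof -
      have "(LINT p|lborel. h p * \<psi> m n p) \<le> 0" for n
        by (rule test[OF cont, where r="real m + 1"]) (use \<psi>01 c01(3) in \<open>auto simp: \<psi>_def\<close>)
      then show ?thesis by blast
    qed
  qed
  moreover have nn: "0 \<le> h p * (indicator A p * c m p)" for m p
    using c01 by (auto simp: A_def indicator_def)
  ultimately have "(LINT p|lborel. h p * (indicator A p * c m p)) = 0" for m
    by (intro antisym Bochner_Integration.integral_nonneg) auto
  then have "AE p in lborel. h p * (indicator A p * c m p) = 0" for m
    using integral_nonneg_eq_0_iff_AE[OF int[of m] AE_I2[OF nn]] by simp
  then have "AE p in lborel. \<forall>m. h p * (indicator A p * c m p) = 0"
    unfolding AE_all_countable by blast
  then show ?thesis
  proof eventually_elim
    case (elim p)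
    obtain m where "norm p < real m" using reals_Archimedean2 by blast
    then have "c m p = 1" by (simp add: c_def)
    then show ?case using elim[rule_format, of m] by (auto simp: A_def indicator_def split: if_splits)
  qed
qed

text \<open>\<open>h\<close> is only measurable; by translation invariance the shift is moved onto
  \<open>\<psi>\<close>, which is uniformly continuous with compact support.\<close>

lemma integral_shift_continuous:
  fixes h \<psi> :: "'a::euclidean_space \<Rightarrow> real"
  assumes [measurable]: "h \<in> borel_measurable borel" and bnd: "\<And>p. \<bar>h p\<bar> \<le> M"
    and \<psi>: "continuous_on UNIV \<psi>" "\<And>p. norm p > r \<Longrightarrow> \<psi> p = 0" and "e > 0"
  shows "\<exists>d>0. \<forall>z. norm z < d \<longrightarrow> \<bar>(LINT p|lborel. h (z + p) * \<psi> p) - (LINT p|lborel. h p * \<psi> p)\<bar> \<le> e"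
proof -
  have M0: "M \<ge> 0" using bnd[of undefined] by linarith
  have [measurable]: "\<psi> \<in> borel_measurable borel" using \<psi> by (auto intro!: borel_measurable_continuous_onI)
  \<comment> \<open>The summand \<open>1\<close> keeps \<open>C\<close> positive, so that dividing
    by it is harmless.\<close>
  define C where "C = M * measure lborel (cball (0::'a) (r+1)) + 1"
  have C: "C > 0" using M0 by (auto simp: C_def intro!: add_nonneg_pos mult_nonneg_nonneg)
  have "uniformly_continuous_on (cball 0 (r+2)) \<psi>"
    by (intro compact_uniformly_continuous continuous_on_subset[OF \<psi>(1)]) auto
  then obtain d0 where d0: "d0 > 0" "\<And>x y. x \<in> cball 0 (r+2) \<Longrightarrow> y \<in> cball 0 (r+2) \<Longrightarrow> dist y x < d0 \<Longrightarrow> \<bar>\<psi> y - \<psi> x\<bar> < e / C"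
    unfolding uniformly_continuous_on_def dist_real_def using \<open>e > 0\<close> C by (metis divide_pos_pos)
  define d where "d = min 1 d0"
  have d: "d > 0" using d0 by (simp add: d_def)
  have u: "\<bar>\<psi> (p - z) - \<psi> p\<bar> \<le> (e / C) * indicator (cball 0 (r+1)) p" if z: "norm z < d" for p z
  proof (cases "norm p \<le> r + 1")
    case True
    have "norm (p - z) \<le> norm p + norm z" by (rule norm_triangle_ineq4)
    then have "norm (p - z) \<le> r + 2" using True z by (simp add: d_def)
    then show ?thesis using d0(2)[of p "p - z"] True z by (auto simp: d_def dist_norm norm_minus_commute)
  next
    case False
    have "norm p \<le> norm (p - z) + norm z" using norm_triangle_sub[of p z] norm_triangle_ineq[of "p-z" z] by simp
    then have "norm (p - z) > r" using False z by (simp add: d_def)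
    then show ?thesis using False \<psi>(2) by (simp add: indicator_def)
  qed
  have ball: "integrable lborel (\<lambda>p::'a. indicator (cball 0 s) p :: real)" for s
    by (intro integrable_real_indicator) (auto simp: emeasure_lborel_cball_finite[simplified])
  obtain B where B: "\<And>p. \<bar>\<psi> p\<bar> \<le> B"
  proof -
    have "bounded (\<psi> ` cball 0 r)"
      by (intro compact_imp_bounded compact_continuous_image continuous_on_subset[OF \<psi>(1)]) auto
    then obtain B where "\<And>p. p \<in> cball 0 r \<Longrightarrow> \<bar>\<psi> p\<bar> \<le> B"
      unfolding bounded_iff by (metis image_eqI real_norm_def)
    then have "\<bar>\<psi> p\<bar> \<le> max B 0" for p
      using \<psi>(2)[of p] by (cases "norm p \<le> r") (auto simp: max_def, fastforce)
    then show ?thesis using that by blast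
  qed
  have int\<psi>: "integrable lborel \<psi>"
  proof -
    have "integrable lborel (\<lambda>p. \<psi> p * indicator (cball 0 r) p)"
      using B by (intro integrable_bounded_mult[OF ball]) auto
    moreover have "(\<lambda>p. \<psi> p * indicator (cball 0 r) p) = \<psi>"
      using \<psi>(2) by (auto simp: indicator_def fun_eq_iff not_le)
    ultimately show ?thesis by simp
  qed
  have "\<bar>(LINT p|lborel. h (z + p) * \<psi> p) - (LINT p|lborel. h p * \<psi> p)\<bar> \<le> e" if z: "norm z < d" for z
  proof -
    have sh: "(LINT p|lborel. h (z + p) * \<psi> p) = (LINT p|lborel. h p * \<psi> (p - z))"
      using integral_shift[of "\<lambda>p. h p * \<psi> (p - z)" z] by simp
    have ishift: "integrable lborel (\<lambda>p. \<psi> (p - z))"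
    proof -
      have "integrable (distr lborel borel ((+) (-z))) \<psi>" using int\<psi> by (simp add: lborel_distr_plus)
      then show ?thesis by (subst (asm) integrable_distr_eq) auto
    qed
    have "(LINT p|lborel. h p * \<psi> (p - z)) - (LINT p|lborel. h p * \<psi> p) = (LINT p|lborel. h p * (\<psi> (p - z) - \<psi> p))"
      using Bochner_Integration.integral_diff[OF integrable_bounded_mult[OF ishift assms(1)[folded measurable_lborel2] bnd]
          integrable_bounded_mult[OF int\<psi> assms(1)[folded measurable_lborel2] bnd]]
      by (simp add: right_diff_distrib)
    also have "\<bar>\<dots>\<bar> \<le> M * (LINT p|lborel. \<bar>\<psi> (p - z) - \<psi> p\<bar>)"
      by (intro integral_bounded_mult bnd) (auto intro!: int\<psi> ishift)
    also have "\<dots> \<le> M * (LINT p|lborel. (e / C) * indicator (cball 0 (r+1)) (p::'a))"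
    proof -
      have "(LINT p|lborel. \<bar>\<psi> (p - z) - \<psi> p\<bar>) \<le> (LINT p|lborel. (e / C) * indicator (cball 0 (r+1)) (p::'a))"
        by (rule Bochner_Integration.integral_mono)
          (use u[OF z] in \<open>auto intro!: int\<psi> ishift integrable_mult_right ball\<close>)
      then show ?thesis by (rule mult_left_mono[OF _ M0])
    qed
    also have "\<dots> = (e / C) * (C - 1)" by (simp add: C_def)
    also have "\<dots> \<le> e" using \<open>e > 0\<close> C by (simp add: field_simps)
    finally show ?thesis using sh by simp
  qed
  then show ?thesis using d by blast
qed

definition kern2 :: "real \<Rightarrow> real \<times> real \<Rightarrow> real" where
  "kern2 \<epsilon> z = kern \<epsilon> (fst z) * kern \<epsilon> (snd z)"

text \<open>A weighted average of \<open>h\<close> over the square of side \<open>\<epsilon>\<close>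
  with lower left corner \<open>p\<close>, because the kernel is evaluated at
  \<open>q - p\<close>.\<close>

definition mol :: "real \<Rightarrow> (real \<times> real \<Rightarrow> real) \<Rightarrow> real \<times> real \<Rightarrow> real" where
  "mol \<epsilon> h p = (LINT q|lborel. h q * kern2 \<epsilon> (q - p))"

lemma kern2_measurable [measurable]: "kern2 \<epsilon> \<in> borel_measurable borel"
  unfolding kern2_def[abs_def] by measurable

lemma kern2_nonneg: "\<epsilon> > 0 \<Longrightarrow> 0 \<le> kern2 \<epsilon> z"
  by (simp add: kern2_def kern_nonneg)

lemma kern2_has_integral: "\<epsilon> > 0 \<Longrightarrow> has_bochner_integral lborel (kern2 \<epsilon>) 1"
  unfolding kern2_def[abs_def] using tensor_has_integral[OF kern_has_integral kern_has_integral] by simp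

lemma kern2_0: "\<epsilon> > 0 \<Longrightarrow> norm z \<ge> 2 * \<epsilon> \<or> snd z \<le> 0 \<or> fst z \<le> 0 \<Longrightarrow> kern2 \<epsilon> z = 0"
  using kern_0[of \<epsilon> "fst z"] kern_0[of \<epsilon> "snd z"] norm_Pair_le[of "fst z" "snd z"]
  by (auto simp: kern2_def, linarith)

lemma mol_alt:
  assumes [measurable]: "h \<in> borel_measurable borel"
  shows "mol \<epsilon> h p = (LINT z|lborel. h (p + z) * kern2 \<epsilon> z)"
  unfolding mol_def using integral_shift[of "\<lambda>q. h q * kern2 \<epsilon> (q - p)" p] by simp

text \<open>By Fubini the integral of the mollification is the \<open>kern2\<close>-average over
  \<open>z\<close> of the integrals of \<open>h (z + p) * \<psi> p\<close>, and these are continuous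
  in \<open>z\<close> at \<open>0\<close>. This takes the place of pointwise convergence of
  mollifications.\<close>

lemma mol_integral_tendsto:
  fixes h \<psi> :: "real \<times> real \<Rightarrow> real"
  assumes [measurable]: "h \<in> borel_measurable borel" and bnd: "\<And>p. \<bar>h p\<bar> \<le> M"
    and \<psi>: "continuous_on UNIV \<psi>" "\<And>p. norm p > r \<Longrightarrow> \<psi> p = 0"
    and \<epsilon>: "\<And>k. \<epsilon> k > 0" "\<epsilon> \<longlonglongrightarrow> 0"
  shows "(\<lambda>k::nat. LINT p|lborel. mol (\<epsilon> k) h p * \<psi> p) \<longlonglongrightarrow> (LINT p|lborel. h p * \<psi> p)"
proof (rule LIMSEQ_I)
  fix e :: real assume "e > 0"
  have [measurable]: "\<psi> \<in> borel_measurable borel" using \<psi> by (auto intro!: borel_measurable_continuous_onI)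
  obtain d where d: "d > 0" "\<And>z. norm z < d \<Longrightarrow> \<bar>(LINT p|lborel. h (z + p) * \<psi> p) - (LINT p|lborel. h p * \<psi> p)\<bar> \<le> e / 2"
    using integral_shift_continuous[OF assms(1) bnd \<psi>(1) \<psi>(2) half_gt_zero[OF \<open>e > 0\<close>]] by blast
  have int\<psi>: "integrable lborel \<psi>"
  proof -
    have "integrable lborel (\<lambda>p. indicator (cball 0 r) p *\<^sub>R \<psi> p)"
      by (rule borel_integrable_compact) (auto intro: continuous_on_subset[OF \<psi>(1)])
    moreover have "(\<lambda>p. indicator (cball 0 r) p *\<^sub>R \<psi> p) = \<psi>"
      using \<psi>(2) by (auto simp: indicator_def fun_eq_iff not_le)
    ultimately show ?thesis by simp
  qed
  have key: "\<bar>(LINT p|lborel. mol t h p * \<psi> p) - (LINT p|lborel. h p * \<psi> p)\<bar> \<le> e / 2" if t: "0 < t" "2 * t < d" for t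
  proof -
    define I where "I z = (LINT p|lborel. h (z + p) * \<psi> p)" for z
    have k2: "integrable lborel (kern2 t)" "(LINT z|lborel. kern2 t z) = 1"
      using kern2_has_integral[OF t(1)] by (auto simp: has_bochner_integral_iff)
    have int: "integrable (lborel \<Otimes>\<^sub>M lborel) (\<lambda>(z, p). h (p + z) * (kern2 t z * \<psi> p))"
    proof -
      have "integrable (lborel \<Otimes>\<^sub>M lborel) (\<lambda>zp. kern2 t (fst zp) * \<psi> (snd zp))"
      proof (rule lborel_pair.Fubini_integrable)
        show "integrable lborel (\<lambda>z. LINT p|lborel. norm (kern2 t (fst (z, p)) * \<psi> (snd (z, p))))"
          using k2(1) by (simp add: abs_mult)
        show "AE z in lborel. integrable lborel (\<lambda>p. kern2 t (fst (z, p)) * \<psi> (snd (z, p)))"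
          using int\<psi> by simp
      qed measurable
      then have "integrable (lborel \<Otimes>\<^sub>M lborel) (\<lambda>zp. h (snd zp + fst zp) * (kern2 t (fst zp) * \<psi> (snd zp)))"
        by (rule integrable_bounded_mult[OF _ _ bnd]) measurable
      then show ?thesis by (simp add: case_prod_unfold)
    qed
    have Ik: "(LINT p|lborel. h (p + z) * (kern2 t z * \<psi> p)) = I z * kern2 t z" for z
    proof -
      have "(LINT p|lborel. h (p + z) * (kern2 t z * \<psi> p)) = (LINT p|lborel. kern2 t z * (h (z + p) * \<psi> p))"
        by (rule Bochner_Integration.integral_cong) (auto simp: mult_ac add.commute)
      then show ?thesis by (simp add: I_def)
    qed
    have "(LINT p|lborel. mol t h p * \<psi> p) = (LINT p|lborel. LINT z|lborel. h (p + z) * (kern2 t z * \<psi> p))"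
      by (simp add: mol_alt mult.assoc[symmetric])
    also have "\<dots> = (LINT z|lborel. LINT p|lborel. h (p + z) * (kern2 t z * \<psi> p))"
      by (rule lborel_pair.Fubini_integral[OF int])
    also have "\<dots> = (LINT z|lborel. I z * kern2 t z)" by (simp only: Ik)
    finally have 1: "(LINT p|lborel. mol t h p * \<psi> p) = (LINT z|lborel. I z * kern2 t z)" .
    have iI: "integrable lborel (\<lambda>z. I z * kern2 t z)"
    proof -
      have "integrable lborel (\<lambda>z. LINT p|lborel. h (p + z) * (kern2 t z * \<psi> p))"
        by (rule lborel_pair.integrable_fst[OF int])
      then show ?thesis by (simp only: Ik)
    qed
    have "(LINT z|lborel. I z * kern2 t z) - (LINT p|lborel. h p * \<psi> p) = (LINT z|lborel. I z * kern2 t z - I 0 * kern2 t z)"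
      using iI k2 by (subst Bochner_Integration.integral_diff) (auto simp: I_def)
    also have "\<bar>\<dots>\<bar> \<le> (LINT z|lborel. \<bar>I z * kern2 t z - I 0 * kern2 t z\<bar>)" by (rule integral_abs_bound)
    also have "\<dots> \<le> (LINT z|lborel. (e / 2) * kern2 t z)"
    proof (rule integral_mono)
      fix z
      show "\<bar>I z * kern2 t z - I 0 * kern2 t z\<bar> \<le> e / 2 * kern2 t z"
      proof (cases "norm z < d")
        case True
        have "\<bar>I z * kern2 t z - I 0 * kern2 t z\<bar> = \<bar>I z - I 0\<bar> * kern2 t z"
          using kern2_nonneg[OF t(1), of z] by (simp add: left_diff_distrib[symmetric] abs_mult)
        moreover have "\<bar>I z - I 0\<bar> \<le> e / 2" using d(2)[OF True] by (simp add: I_def)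
        ultimately show ?thesis using mult_right_mono[OF _ kern2_nonneg[OF t(1), of z]] by metis
      next
        case False
        then show ?thesis using kern2_0[OF t(1), of z] t by simp
      qed
    qed (use iI k2 in auto)
    also have "\<dots> = e / 2" using k2 by simp
    finally show ?thesis using 1 by simp
  qed
  obtain k0 where "\<And>k. k \<ge> k0 \<Longrightarrow> \<bar>\<epsilon> k\<bar> < d / 2"
    using LIMSEQ_D[OF \<epsilon>(2), of "d/2"] d(1) by auto
  then have "2 * \<epsilon> k < d" if "k \<ge> k0" for k using that \<epsilon>(1)[of k] by fastforce
  then have "\<bar>(LINT p|lborel. mol (\<epsilon> k) h p * \<psi> p) - (LINT p|lborel. h p * \<psi> p)\<bar> < e" if "k \<ge> k0" for k
    using key[OF \<epsilon>(1)[of k]] that \<open>e > 0\<close> by fastforce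
  then show "\<exists>k0. \<forall>k\<ge>k0. norm ((LINT p|lborel. mol (\<epsilon> k) h p * \<psi> p) - (LINT p|lborel. h p * \<psi> p)) < e"
    by auto
qed

lemma mol_measurable [measurable]:
  assumes [measurable]: "h \<in> borel_measurable borel"
  shows "mol \<epsilon> h \<in> borel_measurable borel"
proof -
  have "(\<lambda>p. LINT q|lborel. h q * kern2 \<epsilon> (q - p)) \<in> borel_measurable borel" by measurable
  then show ?thesis unfolding mol_def[abs_def] .
qed

lemma mol_bound:
  assumes [measurable]: "h \<in> borel_measurable borel" and bnd: "\<And>p. \<bar>h p\<bar> \<le> M" and "\<epsilon> > 0"
  shows "\<bar>mol \<epsilon> h p\<bar> \<le> M"
proof -
  have k2: "integrable lborel (kern2 \<epsilon>)" "(LINT z|lborel. kern2 \<epsilon> z) = 1"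
    using kern2_has_integral[OF \<open>\<epsilon> > 0\<close>] by (auto simp: has_bochner_integral_iff)
  have "\<bar>LINT z|lborel. h (p + z) * kern2 \<epsilon> z\<bar> \<le> M * (LINT z|lborel. \<bar>kern2 \<epsilon> z\<bar>)"
    by (rule integral_bounded_mult[OF k2(1) _ bnd]) measurable
  then show ?thesis using k2 kern2_nonneg[OF \<open>\<epsilon> > 0\<close>] by (simp add: mol_alt)
qed

text \<open>Converts a bound known at every point for all mollifications into an almost everywhere
  bound for \<open>h\<close>. Both sides are tested with continuous functions, so no Lebesgue points
  are involved; the bounds may vary with the width as long as they converge.\<close>

lemma AE_le_of_mol_le:
  fixes h D :: "real \<times> real \<Rightarrow> real"
  assumes [measurable]: "h \<in> borel_measurable borel" "D \<in> borel_measurable borel" "\<And>k. D' k \<in> borel_measurable borel"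
    and bnd: "\<And>p. \<bar>h p\<bar> \<le> M" "\<And>p. snd p > \<theta> \<Longrightarrow> \<bar>D p\<bar> \<le> M" "\<And>k p. snd p > \<theta> \<Longrightarrow> \<bar>D' k p\<bar> \<le> M"
    and \<epsilon>: "\<And>k. \<epsilon> k > 0" "\<epsilon> \<longlonglongrightarrow> 0"
    and le: "\<And>k p. snd p > \<theta> \<Longrightarrow> mol (\<epsilon> k) h p \<le> D' k p"
    and lim: "\<And>p. snd p > \<theta> \<Longrightarrow> (\<lambda>k::nat. D' k p) \<longlonglongrightarrow> D p"
  shows "AE p in lborel. snd p > \<theta> \<longrightarrow> h p \<le> D p"
proof -
  \<comment> \<open>Positive exactly for times above \<open>\<theta>\<close>; multiplying by
    \<open>c\<close> removes the region where nothing is known about \<open>D\<close>.\<close>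
  define c where "c p = max 0 (min 1 (snd p - \<theta>))" for p :: "real \<times> real"
  have c01: "0 \<le> c p" "c p \<le> 1" "snd p \<le> \<theta> \<Longrightarrow> c p = 0" "snd p > \<theta> \<Longrightarrow> c p > 0" for p
    by (auto simp: c_def)
  have cc: "continuous_on UNIV c" unfolding c_def by (intro continuous_intros)
  then have [measurable]: "c \<in> borel_measurable borel" by (rule borel_measurable_continuous_onI)
  have M0: "M \<ge> 0" using bnd(1)[of undefined] by linarith
  have Dc: "\<bar>D p * c p\<bar> \<le> M" "\<bar>D' k p * c p\<bar> \<le> M" "\<bar>h p * c p\<bar> \<le> M" for p k
    using c01[of p] bnd(1)[of p] bnd(2)[where p=p] bnd(3)[where p=p and k=k] M0 mult_mono[of "\<bar>D p\<bar>" M "c p" 1]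
      mult_mono[of "\<bar>D' k p\<bar>" M "c p" 1] mult_mono[of "\<bar>h p\<bar>" M "c p" 1]
    by (cases "snd p > \<theta>"; auto simp: abs_mult)+
  have "AE p in lborel. (h p - D p) * c p \<le> 0"
  proof (rule AE_nonpos_of_continuous_tests)
    show "\<bar>(h p - D p) * c p\<bar> \<le> 2 * M" for p
      using Dc(1)[of p] Dc(3)[of p] by (simp add: left_diff_distrib)
    fix \<psi> :: "real \<times> real \<Rightarrow> real" and r
    assume \<psi>: "continuous_on UNIV \<psi>" "\<And>p. 0 \<le> \<psi> p" "\<And>p. norm p > r \<Longrightarrow> \<psi> p = 0"
    have [measurable]: "\<psi> \<in> borel_measurable borel" using \<psi> by (auto intro!: borel_measurable_continuous_onI)
    have int\<psi>: "integrable lborel \<psi>"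
    proof -
      have "integrable lborel (\<lambda>p. indicator (cball 0 r) p *\<^sub>R \<psi> p)"
        by (rule borel_integrable_compact) (auto intro: continuous_on_subset[OF \<psi>(1)])
      moreover have "(\<lambda>p. indicator (cball 0 r) p *\<^sub>R \<psi> p) = \<psi>"
        using \<psi>(3) by (auto simp: indicator_def fun_eq_iff not_le)
      ultimately show ?thesis by simp
    qed
    have i1: "integrable lborel (\<lambda>p. (D p * c p) * \<psi> p)" "integrable lborel (\<lambda>p. (D' k p * c p) * \<psi> p)"
       "integrable lborel (\<lambda>p. (h p * c p) * \<psi> p)" for k
      by (rule integrable_bounded_mult[OF int\<psi> _ Dc(1)] integrable_bounded_mult[OF int\<psi> _ Dc(2)]
        integrable_bounded_mult[OF int\<psi> _ Dc(3)], measurable)+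
    have ic: "integrable lborel (\<lambda>p. c p * \<psi> p)"
      using c01 by (intro integrable_bounded_mult[OF int\<psi>, of _ 1]) auto
    have im: "integrable lborel (\<lambda>p. mol (\<epsilon> k) h p * (c p * \<psi> p))" for k
      by (intro integrable_bounded_mult[OF ic _ mol_bound[OF assms(1) bnd(1) \<epsilon>(1)]]) measurable
    have "(LINT p|lborel. h p * (c p * \<psi> p)) \<le> (LINT p|lborel. (D p * c p) * \<psi> p)"
    proof (rule LIMSEQ_le)
      show "(\<lambda>k. LINT p|lborel. mol (\<epsilon> k) h p * (c p * \<psi> p)) \<longlonglongrightarrow> (LINT p|lborel. h p * (c p * \<psi> p))"
        using \<psi> by (intro mol_integral_tendsto[OF assms(1) bnd(1) _ _ \<epsilon>, of _ r] continuous_intros cc) auto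
      show "(\<lambda>k. LINT p|lborel. (D' k p * c p) * \<psi> p) \<longlonglongrightarrow> (LINT p|lborel. (D p * c p) * \<psi> p)"
      proof (rule integral_dominated_convergence[where w="\<lambda>p. M * \<psi> p"])
        show "AE x in lborel. (\<lambda>k. D' k x * c x * \<psi> x) \<longlonglongrightarrow> D x * c x * \<psi> x"
        proof (rule AE_I2)
          fix x show "(\<lambda>k. D' k x * c x * \<psi> x) \<longlonglongrightarrow> D x * c x * \<psi> x"
            using lim[of x] c01(3)[of x] by (cases "snd x > \<theta>") (auto intro!: tendsto_intros)
        qed
        show "AE x in lborel. norm (D' k x * c x * \<psi> x) \<le> M * \<psi> x" for k
          using Dc(2)[of k] \<psi>(2) by (intro AE_I2) (auto simp: abs_mult[of "_ * _" "\<psi> _"] intro!: mult_right_mono)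
      qed (use int\<psi> in auto)
      have "(LINT p|lborel. mol (\<epsilon> k) h p * (c p * \<psi> p)) \<le> (LINT p|lborel. (D' k p * c p) * \<psi> p)" for k
      proof (rule integral_mono[OF im i1(2)])
        fix p show "mol (\<epsilon> k) h p * (c p * \<psi> p) \<le> (D' k p * c p) * \<psi> p"
          using le[where p=p and k=k] c01[of p] \<psi>(2)[of p] by (cases "snd p > \<theta>") (auto simp: mult.assoc intro!: mult_right_mono)
      qed
      then show "\<exists>N. \<forall>k\<ge>N. (LINT p|lborel. mol (\<epsilon> k) h p * (c p * \<psi> p)) \<le> (LINT p|lborel. (D' k p * c p) * \<psi> p)" by blast
    qed
    moreover have "(LINT p|lborel. (h p - D p) * c p * \<psi> p) = (LINT p|lborel. (h p * c p) * \<psi> p) - (LINT p|lborel. (D p * c p) * \<psi> p)"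
      using Bochner_Integration.integral_diff[OF i1(3) i1(1)] by (simp add: left_diff_distrib)
    ultimately show "(LINT p|lborel. (h p - D p) * c p * \<psi> p) \<le> 0" by (simp add: mult.assoc)
  qed measurable
  then show ?thesis
  proof eventually_elim
    case (elim p) then show ?case using c01(4)[of p] by (auto simp: mult_le_0_iff)
  qed
qed

subsection \<open>Potentials of entropy solutions\<close>

lemma AE_nonneg_mult_integral_mono:
  fixes h h' k :: "'a \<Rightarrow> real"
  assumes "integrable N (\<lambda>x. h x * k x)" "integrable N (\<lambda>x. h' x * k x)"
    and "\<And>x. 0 \<le> k x" "AE x in N. k x \<noteq> 0 \<longrightarrow> h x \<le> h' x"
  shows "(LINT x|N. h x * k x) \<le> (LINT x|N. h' x * k x)"
proof (rule integral_mono_AE[OF assms(1,2)])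
  show "AE x in N. h x * k x \<le> h' x * k x"
    using assms(4)
  proof eventually_elim
    case (elim x)
    then show ?case using assms(3)[of x] by (cases "k x = 0") (auto intro: mult_right_mono)
  qed
qed

lemma step_diff_has_integral':
  assumes "\<epsilon> > 0"
  shows "has_bochner_integral lborel (\<lambda>x. step \<epsilon> (x - a) - step \<epsilon> (x - b)) (b - a)"
proof (cases "a \<le> b")
  case False
  then have "has_bochner_integral lborel (\<lambda>x. - (step \<epsilon> (x - b) - step \<epsilon> (x - a))) (- (a - b))"
    by (intro has_bochner_integral_minus step_diff_has_integral assms) auto
  then show ?thesis by simp
qed (rule step_diff_has_integral[OF assms])

lemma DERIV_step_diff:
  "((\<lambda>x. step \<epsilon> (x - a) - step \<epsilon> (x - c)) has_real_derivative kern \<epsilon> (x - a) - kern \<epsilon> (x - c)) (at x)"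
  by (intro DERIV_diff DERIV_chain2[OF DERIV_step, where s="UNIV" and Db=1, simplified]) (auto intro!: derivative_eq_intros)

lemma kern_shift_has_integral:
  assumes "\<epsilon> > 0"
  shows "has_bochner_integral lborel (\<lambda>x. kern \<epsilon> (x - a)) 1"
proof -
  have k: "integrable lborel (kern \<epsilon>)" "(LINT x|lborel. kern \<epsilon> x) = 1"
    using kern_has_integral[OF assms] by (auto simp: has_bochner_integral_iff)
  have "integrable (distr lborel borel ((+) (-a))) (kern \<epsilon>)" using k(1) by (simp only: lborel_distr_plus)
  then have "integrable lborel (\<lambda>x. kern \<epsilon> (x - a))" by (subst (asm) integrable_distr_eq) auto
  moreover have "(LINT x|lborel. kern \<epsilon> (x - a)) = 1"
    using integral_shift[of "\<lambda>x. kern \<epsilon> (x - a)" a] k(2) by simp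
  ultimately show ?thesis by (simp add: has_bochner_integral_iff)
qed

text \<open>\<open>b\<close> stands for \<open>f'\<close>. Concavity is stated as the tangent
  inequality, the form used for Jensen's inequality and for the Lipschitz bound, so that the
  endpoints \<open>0\<close> and \<open>R\<close>, where derivatives are one-sided, are treated like
  all other points.\<close>

locale flux_fun =
  fixes f b :: "real \<Rightarrow> real" and R B :: real
  assumes R_pos: "R > 0"
    and tangent: "\<And>r s. r \<in> {0..R} \<Longrightarrow> s \<in> {0..R} \<Longrightarrow> f r \<le> f s + b s * (r - s)"
    and b_cont: "continuous_on {0..R} b"
    and b_anti: "\<And>r s. r \<in> {0..R} \<Longrightarrow> s \<in> {0..R} \<Longrightarrow> r < s \<Longrightarrow> b s < b r"
    and b_bound: "\<And>r. r \<in> {0..R} \<Longrightarrow> \<bar>b r\<bar> \<le> B"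
begin

lemma B_nonneg: "0 \<le> B"
  using b_bound[of 0] R_pos by force

lemma f_Lipschitz:
  assumes "r \<in> {0..R}" "s \<in> {0..R}"
  shows "\<bar>f r - f s\<bar> \<le> B * \<bar>r - s\<bar>"
proof -
  have *: "f r - f s \<le> B * \<bar>r - s\<bar>" if "r \<in> {0..R}" "s \<in> {0..R}" for r s
  proof -
    have "f r - f s \<le> b s * (r - s)" using tangent[OF that] by simp
    also have "\<dots> \<le> \<bar>b s\<bar> * \<bar>r - s\<bar>" by (metis abs_ge_self abs_mult)
    also have "\<dots> \<le> B * \<bar>r - s\<bar>" using b_bound[OF that(2)] by (rule mult_right_mono) simp
    finally show ?thesis .
  qed
  show ?thesis using *[OF assms] *[OF assms(2,1)] by (auto simp: abs_minus_commute)
qed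

lemma f_cont: "continuous_on {0..R} f"
  unfolding continuous_on_iff
proof (intro ballI allI impI)
  fix x e :: real assume x: "x \<in> {0..R}" and "0 < e"
  show "\<exists>d>0. \<forall>x'\<in>{0..R}. dist x' x < d \<longrightarrow> dist (f x') (f x) < e"
  proof (intro exI[of _ "e / (B + 1)"] conjI ballI impI)
    fix x' assume x': "x' \<in> {0..R}" "dist x' x < e / (B + 1)"
    have "B * \<bar>x' - x\<bar> \<le> (B + 1) * \<bar>x' - x\<bar>" by (intro mult_right_mono) auto
    also have "\<dots> < e" using x'(2) B_nonneg by (simp add: dist_real_def field_simps)
    finally show "dist (f x') (f x) < e" using f_Lipschitz[OF x'(1) x] by (simp add: dist_real_def)
  qed (use \<open>0 < e\<close> B_nonneg in auto)
qed

definition fb :: real where "fb = \<bar>f 0\<bar> + B * R"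

lemma f_bound: "r \<in> {0..R} \<Longrightarrow> \<bar>f r\<bar> \<le> fb"
  using f_Lipschitz[of r 0] mult_left_mono[of r R B] B_nonneg R_pos by (auto simp: fb_def)

lemma fb_nonneg: "0 \<le> fb" using B_nonneg R_pos by (simp add: fb_def)

text \<open>An inverse modulus of continuity. On the compact set of pairs with
  \<open>s \<le> r - e\<close> the continuous positive function \<open>b s - b r\<close> is bounded
  away from \<open>0\<close>; half of its minimum serves as \<open>d\<close>. A one-sided bound on
  \<open>b(\<rho>)\<close> thus becomes one on \<open>\<rho>\<close> itself.\<close>

lemma b_modulus:
  assumes "e > 0"
  shows "\<exists>d>0. \<forall>r\<in>{0..R}. \<forall>s\<in>{0..R}. b s \<le> b r + d \<longrightarrow> r - e \<le> s"
proof -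
  define T where "T = {p \<in> {0..R} \<times> {0..R}. snd p \<le> fst p - e}"
  have "closed {p::real\<times>real. snd p \<le> fst p - e}"
    by (intro closed_Collect_le continuous_intros)
  then have "compact ({0..R} \<times> {0..R} \<inter> {p::real\<times>real. snd p \<le> fst p - e})"
    by (intro compact_Int_closed compact_Times) auto
  then have T: "compact T" by (simp add: T_def Int_def)
  show ?thesis
  proof (cases "T = {}")
    case True
    then show ?thesis
      by (intro exI[of _ 1]) (auto simp: T_def set_eq_iff, meson linear)
  next
    case False
    have c: "continuous_on T (\<lambda>p. b (snd p) - b (fst p))"
      by (intro continuous_intros continuous_on_compose2[OF b_cont]) (auto simp: T_def)
    obtain p0 where p0: "p0 \<in> T" "\<And>p. p \<in> T \<Longrightarrow> b (snd p0) - b (fst p0) \<le> b (snd p) - b (fst p)"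
      using continuous_attains_inf[OF T False c] by auto
    define m where "m = b (snd p0) - b (fst p0)"
    have m: "m > 0" using p0(1) b_anti[of "snd p0" "fst p0"] \<open>e > 0\<close> by (auto simp: m_def T_def)
    have "r - e \<le> s" if "r \<in> {0..R}" "s \<in> {0..R}" "b s \<le> b r + m / 2" for r s
    proof (rule ccontr)
      assume "\<not> r - e \<le> s"
      then have "(r, s) \<in> T" using that by (auto simp: T_def)
      from p0(2)[OF this] have "m \<le> b s - b r" by (simp add: m_def)
      with that(3) have "m \<le> m / 2" by linarith
      with m show False by simp
    qed
    then show ?thesis using m by (intro exI[of _ "m / 2"]) auto
  qed
qed

text \<open>\<open>k\<close> may be arbitrary off \<open>{0..R}\<close>. Composing it with the clamp
  to this interval makes it continuous on the line without changing it on the values of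
  \<open>g\<close>.\<close>

lemma comp_measurable:
  assumes c: "continuous_on {0..R} k" and [measurable]: "g \<in> borel_measurable N" and r: "\<And>p. g p \<in> {0..R}"
  shows "(\<lambda>p. k (g p)) \<in> borel_measurable N"
proof -
  have "continuous_on UNIV (\<lambda>r. k (max 0 (min R r)))"
    using R_pos by (intro continuous_on_compose2[OF c] continuous_intros) auto
  then have [measurable]: "(\<lambda>r. k (max 0 (min R r))) \<in> borel_measurable borel" by (rule borel_measurable_continuous_onI)
  have "(\<lambda>p. (\<lambda>r. k (max 0 (min R r))) (g p)) \<in> borel_measurable N" by measurable
  moreover have "max 0 (min R (g p)) = g p" for p using r[of p] by auto
  ultimately show ?thesis by simp
qed

end

text \<open>What uniqueness uses of a solution, for a Borel representative with values in
  \<open>{0..R}\<close> everywhere. The distributional conditions are restricted to product test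
  functions, and the initial condition is stated for almost every small time, since \<open>g\<close>
  has no preferred representative in time.\<close>

locale entropy_core = flux_fun +
  fixes g :: "real \<times> real \<Rightarrow> real" and r0 :: "real \<Rightarrow> real" and C :: real
  assumes g_meas [measurable]: "g \<in> borel_measurable borel"
    and g_range: "\<And>p. g p \<in> {0..R}"
    and weak: "\<And>\<alpha> \<beta> \<alpha>' \<beta>' xlo xhi tlo thi. smooth \<alpha> \<Longrightarrow> smooth \<beta> \<Longrightarrow>
       (\<And>x. (\<alpha> has_real_derivative \<alpha>' x) (at x)) \<Longrightarrow> (\<And>t. (\<beta> has_real_derivative \<beta>' t) (at t)) \<Longrightarrow>
       (\<And>x. x \<notin> {xlo..xhi} \<Longrightarrow> \<alpha> x = 0) \<Longrightarrow> (\<And>t. t \<notin> {tlo..thi} \<Longrightarrow> \<beta> t = 0) \<Longrightarrow> tlo > 0 \<Longrightarrow>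
       (LINT p|lborel. g p * (\<alpha> (fst p) * \<beta>' (snd p)) + f (g p) * (\<alpha>' (fst p) * \<beta> (snd p))) = 0"
    and one_sided: "\<And>\<alpha> \<beta> \<alpha>' xlo xhi tlo thi. smooth \<alpha> \<Longrightarrow> smooth \<beta> \<Longrightarrow>
       (\<And>x. (\<alpha> has_real_derivative \<alpha>' x) (at x)) \<Longrightarrow> (\<And>x. \<alpha> x \<ge> 0) \<Longrightarrow> (\<And>t. \<beta> t \<ge> 0) \<Longrightarrow>
       (\<And>x. x \<notin> {xlo..xhi} \<Longrightarrow> \<alpha> x = 0) \<Longrightarrow> (\<And>t. t \<notin> {tlo..thi} \<Longrightarrow> \<beta> t = 0) \<Longrightarrow> tlo > 0 \<Longrightarrow>
       (LINT p|lborel. b (g p) * (\<alpha>' (fst p) * \<beta> (snd p))) \<ge> - (LINT p|lborel. C / snd p * (\<alpha> (fst p) * \<beta> (snd p)))"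
    and C_nonneg: "C \<ge> 0"
    and r0_int: "integrable lborel r0" and r0_range: "\<And>x. r0 x \<in> {0..R}"
    and init: "\<And>e. e > 0 \<Longrightarrow> \<exists>d>0. AE s in lborel. 0 < s \<and> s < d \<longrightarrow>
       integrable lborel (\<lambda>x. g (x, s)) \<and> (LINT x|lborel. \<bar>g (x, s) - r0 x\<bar>) \<le> e"
begin

lemma fg_meas [measurable]: "(\<lambda>p. f (g p)) \<in> borel_measurable borel"
  and bg_meas [measurable]: "(\<lambda>p. b (g p)) \<in> borel_measurable borel"
  by (rule comp_measurable[OF f_cont g_meas g_range] comp_measurable[OF b_cont g_meas g_range])+

lemma g_abs: "\<bar>g p\<bar> \<le> R" and fg_abs: "\<bar>f (g p)\<bar> \<le> fb" and bg_abs: "\<bar>b (g p)\<bar> \<le> B"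
  using g_range[of p] f_bound b_bound by auto

text \<open>Mollified versions of the mass in \<open>[x, y]\<close> at time \<open>t\<close>, of the flux through \<open>x\<close> during
  \<open>[s, t]\<close>, and of the potential.\<close>

definition spx :: "real \<Rightarrow> real \<Rightarrow> real \<Rightarrow> real \<Rightarrow> real" where
  "spx \<epsilon> x y t = (LINT q|lborel. g q * ((step \<epsilon> (fst q - x) - step \<epsilon> (fst q - y)) * kern \<epsilon> (snd q - t)))"

definition tpx :: "real \<Rightarrow> real \<Rightarrow> real \<Rightarrow> real \<Rightarrow> real" where
  "tpx \<epsilon> x s t = (LINT q|lborel. f (g q) * (kern \<epsilon> (fst q - x) * (step \<epsilon> (snd q - s) - step \<epsilon> (snd q - t))))"

definition pot :: "real \<Rightarrow> real \<Rightarrow> real \<Rightarrow> real" where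
  "pot \<epsilon> x t = spx \<epsilon> 0 x t - tpx \<epsilon> 0 0 t"

lemma pot_measurable [measurable]: "(\<lambda>p. pot \<epsilon> (fst p + a) (snd p)) \<in> borel_measurable borel"
  unfolding pot_def spx_def tpx_def by measurable

context fixes \<epsilon> :: real assumes eps: "\<epsilon> > 0"
begin

lemma sk_int: "has_bochner_integral lborel (\<lambda>q::real\<times>real. (step \<epsilon> (fst q - x) - step \<epsilon> (fst q - y)) * kern \<epsilon> (snd q - t)) (y - x)"
  and ks_int: "has_bochner_integral lborel (\<lambda>q::real\<times>real. kern \<epsilon> (fst q - x) * (step \<epsilon> (snd q - s) - step \<epsilon> (snd q - t))) (t - s)"
  and kk_int: "has_bochner_integral lborel (\<lambda>q::real\<times>real. kern \<epsilon> (fst q - x) * kern \<epsilon> (snd q - t)) 1"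
  using tensor_has_integral[OF step_diff_has_integral'[OF eps, of x y] kern_shift_has_integral[OF eps, of t]]
    tensor_has_integral[OF kern_shift_has_integral[OF eps, of x] step_diff_has_integral'[OF eps, of s t]]
    tensor_has_integral[OF kern_shift_has_integral[OF eps, of x] kern_shift_has_integral[OF eps, of t]]
  by simp_all

lemmas sk_integrable = has_bochner_integral_iff[THEN iffD1, OF sk_int, THEN conjunct1]
lemmas ks_integrable = has_bochner_integral_iff[THEN iffD1, OF ks_int, THEN conjunct1]
lemmas kk_integrable = has_bochner_integral_iff[THEN iffD1, OF kk_int, THEN conjunct1]
lemmas sk_integral = has_bochner_integral_iff[THEN iffD1, OF sk_int, THEN conjunct2]
lemmas ks_integral = has_bochner_integral_iff[THEN iffD1, OF ks_int, THEN conjunct2]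
lemmas kk_integral = has_bochner_integral_iff[THEN iffD1, OF kk_int, THEN conjunct2]

lemma gsk_integrable: "integrable lborel (\<lambda>q. g q * ((step \<epsilon> (fst q - x) - step \<epsilon> (fst q - y)) * kern \<epsilon> (snd q - t)))"
  and fks_integrable: "integrable lborel (\<lambda>q. f (g q) * (kern \<epsilon> (fst q - x) * (step \<epsilon> (snd q - s) - step \<epsilon> (snd q - t))))"
  and gkk_integrable: "integrable lborel (\<lambda>q. g q * (kern \<epsilon> (fst q - x) * kern \<epsilon> (snd q - t)))"
  and fkk_integrable: "integrable lborel (\<lambda>q. f (g q) * (kern \<epsilon> (fst q - x) * kern \<epsilon> (snd q - t)))"
  and bkk_integrable: "integrable lborel (\<lambda>q. b (g q) * (kern \<epsilon> (fst q - x) * kern \<epsilon> (snd q - t)))"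
  by (rule integrable_bounded_mult[OF sk_integrable _ g_abs] integrable_bounded_mult[OF ks_integrable _ fg_abs]
    integrable_bounded_mult[OF kk_integrable _ g_abs] integrable_bounded_mult[OF kk_integrable _ fg_abs]
    integrable_bounded_mult[OF kk_integrable _ bg_abs], measurable)+

lemma spx_add: "spx \<epsilon> x y t + spx \<epsilon> y z t = spx \<epsilon> x z t"
  unfolding spx_def
  by (subst Bochner_Integration.integral_add[OF gsk_integrable gsk_integrable, symmetric])
    (auto intro!: Bochner_Integration.integral_cong simp: algebra_simps)

lemma tpx_add: "tpx \<epsilon> x r s + tpx \<epsilon> x s t = tpx \<epsilon> x r t"
  unfolding tpx_def
  by (subst Bochner_Integration.integral_add[OF fks_integrable fks_integrable, symmetric])
    (auto intro!: Bochner_Integration.integral_cong simp: algebra_simps)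

lemma pot_diff_x: "pot \<epsilon> y t - pot \<epsilon> x t = spx \<epsilon> x y t"
  using spx_add[of 0 x t y] by (simp add: pot_def)

text \<open>Conservation of mass, tested with the smoothed indicator of the rectangle
  \<open>[a, c] \<times> [s, t]\<close>. Its derivatives are products of steps and kernels, so the
  weak formulation becomes an exact balance between masses at two times and fluxes at two
  places.\<close>

lemma pot_diff_t:
  assumes "0 < s" "s \<le> t"
  shows "pot \<epsilon> x t - pot \<epsilon> x s = - tpx \<epsilon> x s t"
proof -
  have main: "spx \<epsilon> a c t - spx \<epsilon> a c s = tpx \<epsilon> a s t - tpx \<epsilon> c s t" if "a \<le> c" for a c
  proof -
    have "(LINT p|lborel. g p * ((step \<epsilon> (fst p - a) - step \<epsilon> (fst p - c)) * (kern \<epsilon> (snd p - s) - kern \<epsilon> (snd p - t))) +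
       f (g p) * ((kern \<epsilon> (fst p - a) - kern \<epsilon> (fst p - c)) * (step \<epsilon> (snd p - s) - step \<epsilon> (snd p - t)))) = 0"
    proof (rule weak[where xlo = a and xhi = "c + \<epsilon>" and tlo = s and thi = "t + \<epsilon>"])
      show "step \<epsilon> (x - a) - step \<epsilon> (x - c) = 0" if "x \<notin> {a..c + \<epsilon>}" for x
        using that \<open>a \<le> c\<close> eps step_0[OF eps, of "x-a"] step_0[OF eps, of "x-c"] step_1[OF eps, of "x-a"] step_1[OF eps, of "x-c"]
        by (cases "x < a") auto
      show "step \<epsilon> (x - s) - step \<epsilon> (x - t) = 0" if "x \<notin> {s..t + \<epsilon>}" for x
        using that assms eps step_0[OF eps, of "x-s"] step_0[OF eps, of "x-t"] step_1[OF eps, of "x-s"] step_1[OF eps, of "x-t"]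
        by (cases "x < s") auto
    qed (auto intro!: smooth_diff smooth_shift smooth_step assms DERIV_step_diff)
    also have "(\<lambda>p. g p * ((step \<epsilon> (fst p - a) - step \<epsilon> (fst p - c)) * (kern \<epsilon> (snd p - s) - kern \<epsilon> (snd p - t))) +
       f (g p) * ((kern \<epsilon> (fst p - a) - kern \<epsilon> (fst p - c)) * (step \<epsilon> (snd p - s) - step \<epsilon> (snd p - t)))) =
       (\<lambda>p. (g p * ((step \<epsilon> (fst p - a) - step \<epsilon> (fst p - c)) * kern \<epsilon> (snd p - s))
         - g p * ((step \<epsilon> (fst p - a) - step \<epsilon> (fst p - c)) * kern \<epsilon> (snd p - t)))
         + (f (g p) * (kern \<epsilon> (fst p - a) * (step \<epsilon> (snd p - s) - step \<epsilon> (snd p - t)))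
         - f (g p) * (kern \<epsilon> (fst p - c) * (step \<epsilon> (snd p - s) - step \<epsilon> (snd p - t)))))"
      by (auto simp: algebra_simps)
    also have "(LINT p|lborel. \<dots> p) = (spx \<epsilon> a c s - spx \<epsilon> a c t) + (tpx \<epsilon> a s t - tpx \<epsilon> c s t)"
      unfolding spx_def tpx_def
      by (simp add: Bochner_Integration.integral_add Bochner_Integration.integral_diff gsk_integrable fks_integrable)
    finally show ?thesis by simp
  qed
  \<comment> \<open>\<open>main\<close> needs ordered endpoints; for negative \<open>x\<close> the
    roles of \<open>0\<close> and \<open>x\<close> are exchanged.\<close>
  have neg: "spx \<epsilon> c a t = - spx \<epsilon> a c t" for a c t
    using spx_add[of a c t a] by (simp add: spx_def)
  have "spx \<epsilon> 0 x t - spx \<epsilon> 0 x s = tpx \<epsilon> 0 s t - tpx \<epsilon> x s t"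
    using main[of 0 x] main[of x 0] neg[of 0 x t] neg[of 0 x s] by (cases "0 \<le> x") auto
  then show ?thesis using tpx_add[of 0 0 s t] by (simp add: pot_def)
qed

lemma sk_nonneg: "x \<le> y \<Longrightarrow> 0 \<le> (step \<epsilon> (fst q - x) - step \<epsilon> (fst q - y)) * kern \<epsilon> (snd q - t)"
  and ks_nonneg: "s \<le> t \<Longrightarrow> 0 \<le> kern \<epsilon> (fst q - x) * (step \<epsilon> (snd q - s) - step \<epsilon> (snd q - t))"
  by (auto intro!: mult_nonneg_nonneg kern_nonneg[OF eps] step_mono[OF eps])

lemma spx_bounds:
  assumes "x \<le> y" shows "0 \<le> spx \<epsilon> x y t" "spx \<epsilon> x y t \<le> R * (y - x)"
proof -
  show "0 \<le> spx \<epsilon> x y t" unfolding spx_def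
    using g_range by (intro Bochner_Integration.integral_nonneg mult_nonneg_nonneg[OF _ sk_nonneg[OF assms]]) auto
  have "spx \<epsilon> x y t \<le> (LINT q|lborel. R * ((step \<epsilon> (fst q - x) - step \<epsilon> (fst q - y)) * kern \<epsilon> (snd q - t)))"
    unfolding spx_def using sk_nonneg[OF assms] g_range
    by (intro AE_nonneg_mult_integral_mono gsk_integrable integrable_mult_right sk_integrable) auto
  then show "spx \<epsilon> x y t \<le> R * (y - x)" using sk_integral by simp
qed

text \<open>The kernels look right and forward, so only values of \<open>f (g q)\<close> in a box of
  width \<open>\<epsilon>\<close> to the right of \<open>x\<close>, lasting until
  \<open>\<epsilon>\<close> after \<open>t\<close>, enter the flux.\<close>

lemma tpx_lower:
  assumes "s \<le> t" "AE q in lborel. fst q \<in> {x..x + \<epsilon>} \<and> snd q \<in> {s..t + \<epsilon>} \<longrightarrow> m \<le> f (g q)"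
  shows "m * (t - s) \<le> tpx \<epsilon> x s t"
proof -
  have "(LINT q|lborel. m * (kern \<epsilon> (fst q - x) * (step \<epsilon> (snd q - s) - step \<epsilon> (snd q - t)))) \<le> tpx \<epsilon> x s t"
    unfolding tpx_def
  proof (intro AE_nonneg_mult_integral_mono fks_integrable integrable_mult_right ks_integrable ks_nonneg assms(1))
    show "AE q in lborel. kern \<epsilon> (fst q - x) * (step \<epsilon> (snd q - s) - step \<epsilon> (snd q - t)) \<noteq> 0 \<longrightarrow> m \<le> f (g q)"
      using assms(2)
    proof eventually_elim
      case (elim q)
      show ?case
      proof
        assume "kern \<epsilon> (fst q - x) * (step \<epsilon> (snd q - s) - step \<epsilon> (snd q - t)) \<noteq> 0"
        then have "kern \<epsilon> (fst q - x) \<noteq> 0" "step \<epsilon> (snd q - s) \<noteq> step \<epsilon> (snd q - t)" by auto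
        then have "fst q \<in> {x..x + \<epsilon>}" "snd q \<in> {s..t + \<epsilon>}"
          using kern_0[OF eps, of "fst q - x"] assms(1) step_0[OF eps, of "snd q-s"] step_0[OF eps, of "snd q-t"]
            step_1[OF eps, of "snd q-s"] step_1[OF eps, of "snd q-t"] by (force, smt (verit) atLeastAtMost_iff)
        with elim show "m \<le> f (g q)" by blast
      qed
    qed
  qed
  then show ?thesis using ks_integral by simp
qed

lemma tpx_abs: assumes "s \<le> t" shows "\<bar>tpx \<epsilon> x s t\<bar> \<le> fb * (t - s)"
proof -
  have "\<bar>tpx \<epsilon> x s t\<bar> \<le> fb * (LINT q|lborel. \<bar>kern \<epsilon> (fst q - x) * (step \<epsilon> (snd q - s) - step \<epsilon> (snd q - t))\<bar>)"
    unfolding tpx_def by (rule integral_bounded_mult[OF ks_integrable _ fg_abs]) measurable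
  then show ?thesis using ks_nonneg[OF assms] ks_integral by simp
qed

lemma pot_Lipschitz_x: "\<bar>pot \<epsilon> x t - pot \<epsilon> y t\<bar> \<le> R * \<bar>x - y\<bar>"
  using pot_diff_x[of x t y] pot_diff_x[of y t x] spx_bounds[of x y t] spx_bounds[of y x t] by (cases "x \<le> y") auto

lemma pot_Lipschitz:
  assumes "0 < s" "0 < t"
  shows "\<bar>pot \<epsilon> x t - pot \<epsilon> y s\<bar> \<le> R * \<bar>x - y\<bar> + fb * \<bar>t - s\<bar>"
proof -
  have "\<bar>pot \<epsilon> y t - pot \<epsilon> y s\<bar> \<le> fb * \<bar>t - s\<bar>"
    using pot_diff_t[of s t y] pot_diff_t[of t s y] tpx_abs[of s t y] tpx_abs[of t s y] assms by (cases "s \<le> t") auto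
  then show ?thesis using pot_Lipschitz_x[of x t y] by linarith
qed

lemma mol_kern: "mol \<epsilon> h (x, t) = (LINT q|lborel. h q * (kern \<epsilon> (fst q - x) * kern \<epsilon> (snd q - t)))"
  by (simp add: mol_def kern2_def)

text \<open>The tangent of the flux at \<open>r = mol \<epsilon> g p\<close> is integrated against
  the kernel, which has mass \<open>1\<close>. The direction of the inequality is what turns the
  mollified potential into a supersolution.\<close>

lemma mol_Jensen:
  shows "mol \<epsilon> g p \<in> {0..R}" "mol \<epsilon> (\<lambda>q. f (g q)) p \<le> f (mol \<epsilon> g p)"
proof -
  obtain x t where p: "p = (x, t)" by (cases p)
  have nn: "0 \<le> kern \<epsilon> (fst q - x) * kern \<epsilon> (snd q - t)" for q :: "real \<times> real"
    by (intro mult_nonneg_nonneg kern_nonneg[OF eps])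
  have "0 \<le> mol \<epsilon> g p" unfolding p mol_kern using g_range nn
    by (intro Bochner_Integration.integral_nonneg mult_nonneg_nonneg[OF _ nn]) auto
  moreover have "mol \<epsilon> g p \<le> (LINT q|lborel. R * (kern \<epsilon> (fst q - x) * kern \<epsilon> (snd q - t)))"
    unfolding p mol_kern using nn g_range
    by (intro AE_nonneg_mult_integral_mono gkk_integrable integrable_mult_right kk_integrable) auto
  ultimately show m: "mol \<epsilon> g p \<in> {0..R}" using kk_integral by simp
  define r where "r = mol \<epsilon> g p"
  define c where "c = f r - b r * r"
  have i1: "integrable lborel (\<lambda>q. b r * (g q * (kern \<epsilon> (fst q - x) * kern \<epsilon> (snd q - t))))"
    "integrable lborel (\<lambda>q::real\<times>real. c * (kern \<epsilon> (fst q - x) * kern \<epsilon> (snd q - t)))"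
    by (intro integrable_mult_right gkk_integrable kk_integrable)+
  have "mol \<epsilon> (\<lambda>q. f (g q)) p \<le> (LINT q|lborel. (c + b r * g q) * (kern \<epsilon> (fst q - x) * kern \<epsilon> (snd q - t)))"
    unfolding p mol_kern
  proof (intro AE_nonneg_mult_integral_mono fkk_integrable nn)
    have "f (g q) \<le> c + b r * g q" for q
      using tangent[OF g_range[of q] m] by (simp add: r_def c_def algebra_simps)
    then show "AE q in lborel. kern \<epsilon> (fst q - x) * kern \<epsilon> (snd q - t) \<noteq> 0 \<longrightarrow> f (g q) \<le> c + b r * g q" by simp
    show "integrable lborel (\<lambda>q. (c + b r * g q) * (kern \<epsilon> (fst q - x) * kern \<epsilon> (snd q - t)))"
      using Bochner_Integration.integrable_add[OF i1(2) i1(1)] by (simp add: algebra_simps)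
  qed
  also have "(\<lambda>q. (c + b r * g q) * (kern \<epsilon> (fst q - x) * kern \<epsilon> (snd q - t)))
     = (\<lambda>q. c * (kern \<epsilon> (fst q - x) * kern \<epsilon> (snd q - t)) + b r * (g q * (kern \<epsilon> (fst q - x) * kern \<epsilon> (snd q - t))))"
    by (auto simp: algebra_simps)
  also have "(LINT q|lborel. \<dots> q) = c + b r * mol \<epsilon> g p"
    using Bochner_Integration.integral_add[OF i1(2) i1(1)] kk_integral by (simp add: p mol_kern)
  also have "\<dots> = f r" by (simp add: c_def r_def)
  finally show "mol \<epsilon> (\<lambda>q. f (g q)) p \<le> f (mol \<epsilon> g p)" by (simp add: r_def)
qed

text \<open>\<open>step_Taylor\<close> applied under the integral. For
  \<open>\<bar>r\<bar> \<le> 1\<close> the remainder vanishes unless the first coordinate lies in an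
  interval of length \<open>2 + \<epsilon>\<close> around \<open>x\<close>, which makes the constant
  independent of \<open>x\<close>, \<open>t\<close> and \<open>r\<close>.\<close>

lemma pot_Taylor_x:
  "\<exists>c\<ge>0. \<forall>x t r. \<bar>r\<bar> \<le> 1 \<longrightarrow> \<bar>pot \<epsilon> (x + r) t - pot \<epsilon> x t - r * mol \<epsilon> g (x, t)\<bar> \<le> c * r\<^sup>2"
proof -
  obtain c where c: "c \<ge> 0" "\<And>x y. \<bar>kern \<epsilon> x - kern \<epsilon> y\<bar> \<le> c * \<bar>x - y\<bar>"
    using kern_Lipschitz[OF eps] by auto
  have "\<bar>pot \<epsilon> (x + r) t - pot \<epsilon> x t - r * mol \<epsilon> g (x, t)\<bar> \<le> (R * c * (2 + \<epsilon>)) * r\<^sup>2" if r: "\<bar>r\<bar> \<le> 1" for x t r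
  proof -
    define I where "I = (indicator {x-1..x+1+\<epsilon>} :: real \<Rightarrow> real)"
    define D where "D q = (step \<epsilon> (fst q - x) - step \<epsilon> (fst q - x - r) - r * kern \<epsilon> (fst q - x)) * kern \<epsilon> (snd q - t)" for q :: "real\<times>real"
    have D_eq: "D q = (step \<epsilon> (fst q - x) - step \<epsilon> (fst q - (x + r))) * kern \<epsilon> (snd q - t) - r * (kern \<epsilon> (fst q - x) * kern \<epsilon> (snd q - t))" for q
      by (simp add: D_def algebra_simps)
    have Di: "integrable lborel D"
      unfolding D_eq[abs_def] by (intro Bochner_Integration.integrable_diff sk_integrable integrable_mult_right kk_integrable)
    have Ii: "has_bochner_integral lborel (\<lambda>q::real\<times>real. I (fst q) * kern \<epsilon> (snd q - t)) ((2 + \<epsilon>) * 1)"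
    proof (rule tensor_has_integral[OF _ kern_shift_has_integral[OF eps]])
      have "has_bochner_integral lborel (indicator {x-1..x+1+\<epsilon>} :: real \<Rightarrow> real) (measure lborel {x-1..x+1+\<epsilon>})"
        by (rule has_bochner_integral_real_indicator) (use eps in auto)
      then show "has_bochner_integral lborel I (2 + \<epsilon>)" using eps by (simp add: I_def)
    qed
    have "pot \<epsilon> (x + r) t - pot \<epsilon> x t - r * mol \<epsilon> g (x, t) = (LINT q|lborel. g q * D q)"
    proof -
      have "(LINT q|lborel. g q * D q) = (LINT q|lborel. g q * ((step \<epsilon> (fst q - x) - step \<epsilon> (fst q - (x + r))) * kern \<epsilon> (snd q - t))
          - r * (g q * (kern \<epsilon> (fst q - x) * kern \<epsilon> (snd q - t))))"
        by (intro Bochner_Integration.integral_cong) (auto simp: D_eq algebra_simps)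
      also have "\<dots> = spx \<epsilon> x (x + r) t - r * mol \<epsilon> g (x, t)"
        unfolding spx_def mol_kern
        by (subst Bochner_Integration.integral_diff[OF gsk_integrable integrable_mult_right[OF gkk_integrable]]) simp
      finally show ?thesis by (simp add: pot_diff_x)
    qed
    also have "\<bar>\<dots>\<bar> \<le> R * (LINT q|lborel. \<bar>D q\<bar>)"
      by (rule integral_bounded_mult[OF Di _ g_abs]) measurable
    also have "\<dots> \<le> R * (LINT q|lborel. c * r\<^sup>2 * (I (fst q) * kern \<epsilon> (snd q - t)))"
    proof -
      have "(LINT q|lborel. \<bar>D q\<bar>) \<le> (LINT q|lborel. c * r\<^sup>2 * (I (fst q) * kern \<epsilon> (snd q - t)))"
      proof (rule Bochner_Integration.integral_mono)
        fix q :: "real \<times> real"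
        have kn: "0 \<le> kern \<epsilon> (snd q - t)" by (rule kern_nonneg[OF eps])
        have "\<bar>step \<epsilon> (fst q - x) - step \<epsilon> (fst q - x - r) - r * kern \<epsilon> (fst q - x)\<bar> \<le> c * r\<^sup>2 * I (fst q)"
        proof (cases "fst q \<in> {x-1..x+1+\<epsilon>}")
          case True then show ?thesis using step_Taylor[OF eps c(2)] by (simp add: I_def)
        next
          case False
          then have "fst q < x - 1 \<or> fst q > x + 1 + \<epsilon>" by auto
          then show ?thesis
            using r eps step_0[OF eps, of "fst q - x"] step_0[OF eps, of "fst q - x - r"] kern_0[OF eps, of "fst q - x"]
              step_1[OF eps, of "fst q - x"] step_1[OF eps, of "fst q - x - r"] by (auto simp: I_def)
        qed
        then have "\<bar>step \<epsilon> (fst q - x) - step \<epsilon> (fst q - x - r) - r * kern \<epsilon> (fst q - x)\<bar> * kern \<epsilon> (snd q - t)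
            \<le> c * r\<^sup>2 * I (fst q) * kern \<epsilon> (snd q - t)" by (rule mult_right_mono[OF _ kn])
        then show "\<bar>D q\<bar> \<le> c * r\<^sup>2 * (I (fst q) * kern \<epsilon> (snd q - t))"
          using kn by (simp add: D_def abs_mult mult.assoc)
      next
        show "integrable lborel (\<lambda>q::real\<times>real. c * r\<^sup>2 * (I (fst q) * kern \<epsilon> (snd q - t)))"
          using Ii by (intro integrable_mult_right) (simp add: has_bochner_integral_iff)
      qed (use Di in auto)
      then show ?thesis using R_pos by (intro mult_left_mono) auto
    qed
    also have "\<dots> = (R * c * (2 + \<epsilon>)) * r\<^sup>2"
      using Ii by (simp add: has_bochner_integral_iff)
    finally show ?thesis .
  qed
  then show ?thesis using c(1) R_pos eps by (intro exI[of _ "R * c * (2 + \<epsilon>)"]) auto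
qed

text \<open>Steps backward in time only, since the maximum in the comparison argument may lie at the
  final time. The remainder is localised in time as it was in space.\<close>

lemma pot_Taylor_t:
  "\<exists>c\<ge>0. \<forall>x t h. 0 \<le> h \<longrightarrow> h \<le> 1 \<longrightarrow> h < t \<longrightarrow> \<bar>pot \<epsilon> x t - pot \<epsilon> x (t - h) + h * mol \<epsilon> (\<lambda>q. f (g q)) (x, t)\<bar> \<le> c * h\<^sup>2"
proof -
  obtain c where c: "c \<ge> 0" "\<And>x y. \<bar>kern \<epsilon> x - kern \<epsilon> y\<bar> \<le> c * \<bar>x - y\<bar>"
    using kern_Lipschitz[OF eps] by auto
  have "\<bar>pot \<epsilon> x t - pot \<epsilon> x (t - h) + h * mol \<epsilon> (\<lambda>q. f (g q)) (x, t)\<bar> \<le> (fb * c * (2 + \<epsilon>)) * h\<^sup>2" if h: "0 \<le> h" "h \<le> 1" "h < t" for x t h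
  proof -
    define I where "I = (indicator {t-1..t+1+\<epsilon>} :: real \<Rightarrow> real)"
    define D where "D q = kern \<epsilon> (fst q - x) * (step \<epsilon> (snd q - t) - step \<epsilon> (snd q - t - (-h)) - (-h) * kern \<epsilon> (snd q - t))" for q :: "real\<times>real"
    have D_eq: "D q = h * (kern \<epsilon> (fst q - x) * kern \<epsilon> (snd q - t)) - kern \<epsilon> (fst q - x) * (step \<epsilon> (snd q - (t - h)) - step \<epsilon> (snd q - t))" for q
      by (simp add: D_def algebra_simps)
    have Di: "integrable lborel D"
      unfolding D_eq[abs_def] by (intro Bochner_Integration.integrable_diff ks_integrable integrable_mult_right kk_integrable)
    have Ii: "has_bochner_integral lborel (\<lambda>q::real\<times>real. kern \<epsilon> (fst q - x) * I (snd q)) (1 * (2 + \<epsilon>))"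
    proof (rule tensor_has_integral[OF kern_shift_has_integral[OF eps]])
      have "has_bochner_integral lborel (indicator {t-1..t+1+\<epsilon>} :: real \<Rightarrow> real) (measure lborel {t-1..t+1+\<epsilon>})"
        by (rule has_bochner_integral_real_indicator) (use eps in auto)
      then show "has_bochner_integral lborel I (2 + \<epsilon>)" using eps by (simp add: I_def)
    qed
    have "pot \<epsilon> x t - pot \<epsilon> x (t - h) + h * mol \<epsilon> (\<lambda>q. f (g q)) (x, t) = (LINT q|lborel. f (g q) * D q)"
    proof -
      have "(LINT q|lborel. f (g q) * D q) = (LINT q|lborel. h * (f (g q) * (kern \<epsilon> (fst q - x) * kern \<epsilon> (snd q - t)))
          - f (g q) * (kern \<epsilon> (fst q - x) * (step \<epsilon> (snd q - (t - h)) - step \<epsilon> (snd q - t))))"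
        by (intro Bochner_Integration.integral_cong) (auto simp: D_eq algebra_simps)
      also have "\<dots> = h * mol \<epsilon> (\<lambda>q. f (g q)) (x, t) - tpx \<epsilon> x (t - h) t"
        unfolding tpx_def mol_kern
        by (subst Bochner_Integration.integral_diff[OF integrable_mult_right[OF fkk_integrable] fks_integrable]) simp
      finally show ?thesis using h pot_diff_t[of "t - h" t x] by simp
    qed
    also have "\<bar>\<dots>\<bar> \<le> fb * (LINT q|lborel. \<bar>D q\<bar>)"
      by (rule integral_bounded_mult[OF Di _ fg_abs]) measurable
    also have "\<dots> \<le> fb * (LINT q|lborel. c * h\<^sup>2 * (kern \<epsilon> (fst q - x) * I (snd q)))"
    proof -
      have "(LINT q|lborel. \<bar>D q\<bar>) \<le> (LINT q|lborel. c * h\<^sup>2 * (kern \<epsilon> (fst q - x) * I (snd q)))"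
      proof (rule Bochner_Integration.integral_mono)
        fix q :: "real \<times> real"
        have kn: "0 \<le> kern \<epsilon> (fst q - x)" by (rule kern_nonneg[OF eps])
        have "\<bar>step \<epsilon> (snd q - t) - step \<epsilon> (snd q - t - (-h)) - (-h) * kern \<epsilon> (snd q - t)\<bar> \<le> c * h\<^sup>2 * I (snd q)"
        proof (cases "snd q \<in> {t-1..t+1+\<epsilon>}")
          case True then show ?thesis using step_Taylor[OF eps c(2), of "snd q - t" "-h"] by (simp add: I_def)
        next
          case False
          then have "snd q < t - 1 \<or> snd q > t + 1 + \<epsilon>" by auto
          then show ?thesis
            using h eps step_0[OF eps, of "snd q - t"] step_0[OF eps, of "snd q - t + h"] kern_0[OF eps, of "snd q - t"]
              step_1[OF eps, of "snd q - t"] step_1[OF eps, of "snd q - t + h"] by (auto simp: I_def)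
        qed
        then have "kern \<epsilon> (fst q - x) * \<bar>step \<epsilon> (snd q - t) - step \<epsilon> (snd q - t - (-h)) - (-h) * kern \<epsilon> (snd q - t)\<bar>
            \<le> kern \<epsilon> (fst q - x) * (c * h\<^sup>2 * I (snd q))" by (rule mult_left_mono[OF _ kn])
        then show "\<bar>D q\<bar> \<le> c * h\<^sup>2 * (kern \<epsilon> (fst q - x) * I (snd q))"
          unfolding D_def abs_mult using kn by (simp add: mult_ac)
      next
        show "integrable lborel (\<lambda>q::real\<times>real. c * h\<^sup>2 * (kern \<epsilon> (fst q - x) * I (snd q)))"
          using Ii by (intro integrable_mult_right) (simp add: has_bochner_integral_iff)
      qed (use Di in auto)
      then show ?thesis using fb_nonneg by (intro mult_left_mono) auto
    qed
    also have "\<dots> = (fb * c * (2 + \<epsilon>)) * h\<^sup>2"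
      using Ii by (simp add: has_bochner_integral_iff)
    finally show ?thesis .
  qed
  then show ?thesis using c(1) fb_nonneg eps by (intro exI[of _ "fb * c * (2 + \<epsilon>)"]) auto
qed

end

section \<open>Limits of the mollified potentials\<close>

lemma pot_bound:
  assumes "\<epsilon> > 0" "t > 0"
  shows "\<bar>pot \<epsilon> x t\<bar> \<le> R * \<bar>x\<bar> + fb * t"
proof -
  have "pot \<epsilon> 0 t = - tpx \<epsilon> 0 0 t" by (simp add: pot_def spx_def)
  then have "\<bar>pot \<epsilon> 0 t\<bar> \<le> fb * t" using tpx_abs[OF assms(1), of 0 t 0] assms(2) by simp
  then show ?thesis using pot_Lipschitz_x[OF assms(1), of x t 0] by simp
qed

text \<open>Arzela-Ascoli by hand: a diagonal subsequence converges at rational points, and the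
  Lipschitz bound, uniform in \<open>\<epsilon>\<close>, carries convergence to all points of
  positive time. One sequence of widths suffices for the comparison.\<close>

lemma potential_exists:
  "\<exists>\<epsilon> U. (\<forall>k. \<epsilon> k > 0) \<and> \<epsilon> \<longlonglongrightarrow> 0 \<and> (\<forall>x t. t > 0 \<longrightarrow> (\<lambda>k::nat. pot (\<epsilon> k) x t) \<longlonglongrightarrow> U x t)"
proof -
  define S where "S = {p::real\<times>real. fst p \<in> \<rat> \<and> snd p \<in> \<rat> \<and> snd p > 0}"
  have "S \<subseteq> \<rat> \<times> \<rat>" by (auto simp: S_def)
  moreover have "countable (\<rat> \<times> \<rat> :: (real \<times> real) set)" by (intro countable_SIGMA countable_rat)
  ultimately have cS: "countable S" by (rule countable_subset)
  \<comment> \<open>The potentials grow linearly in space and time; dividing by this weight makes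
    the sequence uniformly bounded, as the diagonal argument requires.\<close>
  define w where "w p = 1 + \<bar>fst p\<bar> + \<bar>snd p\<bar>" for p :: "real \<times> real"
  have w: "w p > 0" for p by (simp add: w_def add_pos_nonneg)
  define F where "F n p = pot (1 / real (Suc n)) (fst p) (snd p) / w p" for n p
  have "norm (F n p) \<le> R + fb" if "p \<in> S" for n p
  proof -
    have "\<bar>pot (1 / real (Suc n)) (fst p) (snd p)\<bar> \<le> R * \<bar>fst p\<bar> + fb * snd p"
      using that by (intro pot_bound) (auto simp: S_def)
    also have "\<dots> \<le> R * w p + fb * w p"
      using R_pos fb_nonneg that by (intro add_mono mult_left_mono) (auto simp: w_def S_def)
    finally show ?thesis using w[of p] by (simp add: F_def field_simps)
  qed
  then obtain k where k: "strict_mono (k :: nat \<Rightarrow> nat)" "\<And>p. p \<in> S \<Longrightarrow> \<exists>l. (\<lambda>n. F (k n) p) \<longlonglongrightarrow> l"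
    using function_convergent_subsequence[OF cS] by blast
  define \<epsilon> where "\<epsilon> n = 1 / real (Suc (k n))" for n
  have \<epsilon>: "\<epsilon> n > 0" for n by (simp add: \<epsilon>_def)
  have "(\<lambda>n. 1 / real (Suc n)) \<longlonglongrightarrow> 0" by (rule LIMSEQ_Suc[OF lim_1_over_n])
  then have \<epsilon>0: "\<epsilon> \<longlonglongrightarrow> 0"
    unfolding \<epsilon>_def using LIMSEQ_subseq_LIMSEQ[OF _ k(1)] by (fastforce simp: o_def)
  have convS: "convergent (\<lambda>n. pot (\<epsilon> n) x t)" if xt: "(x, t) \<in> S" for x t
  proof -
    obtain l where "(\<lambda>n. F (k n) (x, t)) \<longlonglongrightarrow> l" using k(2)[OF xt] by blast
    then have "(\<lambda>n. F (k n) (x, t) * w (x, t)) \<longlonglongrightarrow> l * w (x, t)" by (intro tendsto_intros)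
    moreover have "F (k n) (x, t) * w (x, t) = pot (\<epsilon> n) x t" for n
      using w[of "(x, t)"] by (simp add: F_def \<epsilon>_def)
    ultimately show ?thesis unfolding convergent_def by auto
  qed
  have conv: "convergent (\<lambda>n. pot (\<epsilon> n) x t)" if t: "t > 0" for x t
  proof (rule Cauchy_convergent, rule CauchyI)
    fix e :: real assume e: "e > 0"
    define d where "d = e / (4 * (R + fb))"
    have Rf: "R + fb > 0" using R_pos fb_nonneg by simp
    have d: "d > 0" using e Rf by (simp add: d_def)
    obtain x' where x': "x' \<in> \<rat>" "x < x'" "x' < x + d" using Rats_dense_in_real[of x "x + d"] d by auto
    obtain t' where t': "t' \<in> \<rat>" "t < t'" "t' < t + d" using Rats_dense_in_real[of t "t + d"] d by auto
    have near: "\<bar>pot (\<epsilon> n) x t - pot (\<epsilon> n) x' t'\<bar> \<le> e / 4" for n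
    proof -
      have "\<bar>pot (\<epsilon> n) x t - pot (\<epsilon> n) x' t'\<bar> \<le> R * \<bar>x - x'\<bar> + fb * \<bar>t - t'\<bar>"
        using pot_Lipschitz[OF \<epsilon>[of n], of t' t x x'] t t' by simp
      also have "\<dots> \<le> R * d + fb * d"
        using x' t' R_pos fb_nonneg by (intro add_mono mult_left_mono) auto
      also have "\<dots> = (R + fb) * d" by (simp add: algebra_simps)
      also have "\<dots> = e / 4"
      proof -
        have "S * (e / (4 * S)) = e / 4" if "S > 0" for S :: real using that by simp
        from this[OF Rf] show ?thesis by (simp only: d_def)
      qed
      finally show ?thesis .
    qed
    have "Cauchy (\<lambda>n. pot (\<epsilon> n) x' t')"
      using x' t' t by (intro convergent_Cauchy convS) (auto simp: S_def)
    then obtain N where N: "\<And>m n. m \<ge> N \<Longrightarrow> n \<ge> N \<Longrightarrow> norm (pot (\<epsilon> m) x' t' - pot (\<epsilon> n) x' t') < e / 4"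
      using CauchyD[of _ "e/4"] e by (meson zero_less_divide_iff zero_less_numeral)
    have "norm (pot (\<epsilon> m) x t - pot (\<epsilon> n) x t) < e" if "m \<ge> N" "n \<ge> N" for m n
      using N[OF that] near[of m] near[of n] e unfolding real_norm_def by linarith
    then show "\<exists>M. \<forall>m\<ge>M. \<forall>n\<ge>M. norm (pot (\<epsilon> m) x t - pot (\<epsilon> n) x t) < e" by blast
  qed
  show ?thesis
    using \<epsilon> \<epsilon>0 conv
    by (intro exI[of _ \<epsilon>] exI[of _ "\<lambda>x t. lim (\<lambda>n. pot (\<epsilon> n) x t)"]) (auto simp: convergent_LIMSEQ_iff)
qed

section \<open>One-sided bound and slopes of the potential\<close>

lemma pot_DERIV:
  assumes "\<epsilon> > 0"
  shows "((\<lambda>x. pot \<epsilon> x t) has_real_derivative mol \<epsilon> g (x, t)) (at x)"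
proof -
  obtain c where c: "c \<ge> 0" "\<And>x t r. \<bar>r\<bar> \<le> 1 \<Longrightarrow> \<bar>pot \<epsilon> (x + r) t - pot \<epsilon> x t - r * mol \<epsilon> g (x, t)\<bar> \<le> c * r\<^sup>2"
    using pot_Taylor_x[OF assms] by blast
  have "((\<lambda>h. (pot \<epsilon> (x + h) t - pot \<epsilon> x t) / h - mol \<epsilon> g (x, t)) \<longlongrightarrow> 0) (at 0)"
  proof (rule Lim_null_comparison)
    show "((\<lambda>h. c * \<bar>h\<bar>) \<longlongrightarrow> 0) (at 0)"
      by (rule tendsto_eq_intros refl | simp)+
    show "\<forall>\<^sub>F h in at 0. norm ((pot \<epsilon> (x + h) t - pot \<epsilon> x t) / h - mol \<epsilon> g (x, t)) \<le> c * \<bar>h\<bar>"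
      unfolding eventually_at
    proof (intro exI[of _ 1] conjI ballI impI)
      fix h :: real assume h: "h \<noteq> 0 \<and> dist h 0 < 1"
      have "(pot \<epsilon> (x + h) t - pot \<epsilon> x t) / h - mol \<epsilon> g (x, t) = (pot \<epsilon> (x + h) t - pot \<epsilon> x t - h * mol \<epsilon> g (x, t)) / h"
        using h by (simp add: field_simps)
      also have "norm \<dots> \<le> c * h\<^sup>2 / \<bar>h\<bar>"
        using c(2)[of h x t] h by (simp add: abs_divide divide_right_mono)
      also have "\<dots> = c * \<bar>h\<bar>" using h by (simp add: power2_eq_square field_simps abs_if)
      finally show "norm ((pot \<epsilon> (x + h) t - pot \<epsilon> x t) / h - mol \<epsilon> g (x, t)) \<le> c * \<bar>h\<bar>" .
    qed simp
  qed
  then have "((\<lambda>h. (pot \<epsilon> (x + h) t - pot \<epsilon> x t) / h) \<longlongrightarrow> mol \<epsilon> g (x, t)) (at 0)"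
    by (simp add: LIM_zero_iff)
  then show ?thesis by (simp add: DERIV_def)
qed

text \<open>The one-sided condition is tested with a smoothed indicator of \<open>[x, x + h]\<close>
  in space and the kernel in time: the space derivative is a difference of two kernels, which
  produces the increment of the mollified \<open>b(\<rho>)\<close>. The kernel sees times after
  \<open>t\<close> only, so \<open>C / snd p \<le> C / t\<close> on its support.\<close>

lemma mol_b_one_sided:
  assumes eps: "\<epsilon> > 0" and "h > 0" "t > 0"
  shows "mol \<epsilon> (\<lambda>q. b (g q)) (x + h, t) \<le> mol \<epsilon> (\<lambda>q. b (g q)) (x, t) + C * h / t"
proof -
  define \<alpha> where "\<alpha> = (\<lambda>y. step \<epsilon> (y - x) - step \<epsilon> (y - (x + h)))"
  have "(LINT p|lborel. b (g p) * ((kern \<epsilon> (fst p - x) - kern \<epsilon> (fst p - (x + h))) * kern \<epsilon> (snd p - t)))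
      \<ge> - (LINT p|lborel. C / snd p * (\<alpha> (fst p) * kern \<epsilon> (snd p - t)))"
  proof (rule one_sided[where xlo = x and xhi = "x + h + \<epsilon>" and tlo = t and thi = "t + \<epsilon>"])
    show "\<alpha> y = 0" if "y \<notin> {x..x + h + \<epsilon>}" for y
      using that \<open>h > 0\<close> eps step_0[OF eps, of "y-x"] step_0[OF eps, of "y-(x+h)"] step_1[OF eps, of "y-x"] step_1[OF eps, of "y-(x+h)"]
      by (cases "y < x") (auto simp: \<alpha>_def)
    show "kern \<epsilon> (s - t) = 0" if "s \<notin> {t..t + \<epsilon>}" for s
      using that kern_0[OF eps, of "s - t"] by auto
    show "\<alpha> y \<ge> 0" for y using step_mono[OF eps, of "y - (x+h)" "y - x"] \<open>h > 0\<close> by (simp add: \<alpha>_def)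
    show "smooth \<alpha>" unfolding \<alpha>_def by (intro smooth_diff smooth_shift smooth_step)
    show "(\<alpha> has_real_derivative kern \<epsilon> (y - x) - kern \<epsilon> (y - (x + h))) (at y)" for y
      unfolding \<alpha>_def by (rule DERIV_step_diff)
  qed (auto intro!: smooth_shift smooth_kern kern_nonneg eps assms)
  moreover have "(LINT p|lborel. b (g p) * ((kern \<epsilon> (fst p - x) - kern \<epsilon> (fst p - (x + h))) * kern \<epsilon> (snd p - t)))
      = mol \<epsilon> (\<lambda>q. b (g q)) (x, t) - mol \<epsilon> (\<lambda>q. b (g q)) (x + h, t)"
    unfolding mol_kern[OF eps]
    by (subst Bochner_Integration.integral_diff[OF bkk_integrable[OF eps] bkk_integrable[OF eps], symmetric])
      (auto intro!: Bochner_Integration.integral_cong simp: algebra_simps)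
  moreover have "(LINT p|lborel. C / snd p * (\<alpha> (fst p) * kern \<epsilon> (snd p - t))) \<le> C * h / t"
  proof -
    \<comment> \<open>Where the kernel is nonzero the maximum changes nothing; elsewhere it keeps
      the factor bounded, which \<open>C / snd p\<close> is not near time \<open>0\<close>.\<close>
    have *: "C / snd p * (\<alpha> (fst p) * kern \<epsilon> (snd p - t)) = C / max t (snd p) * (\<alpha> (fst p) * kern \<epsilon> (snd p - t))" for p
      using kern_0[OF eps, of "snd p - t"] by (cases "snd p \<le> t") auto
    have nn: "0 \<le> \<alpha> (fst p) * kern \<epsilon> (snd p - t)" for p :: "real\<times>real"
      unfolding \<alpha>_def using sk_nonneg[OF eps, of x "x + h"] \<open>h > 0\<close> by simp
    have cb: "\<bar>C / max t (snd p)\<bar> \<le> C / t" for p :: "real \<times> real"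
      using C_nonneg \<open>t > 0\<close> by (auto intro!: divide_left_mono)
    have i: "integrable lborel (\<lambda>p. \<alpha> (fst p) * kern \<epsilon> (snd p - t))" 
      unfolding \<alpha>_def by (rule sk_integrable[OF eps])
    have "(LINT p|lborel. C / max t (snd p) * (\<alpha> (fst p) * kern \<epsilon> (snd p - t))) \<le> (LINT p|lborel. C / t * (\<alpha> (fst p) * kern \<epsilon> (snd p - t)))"
    proof (rule AE_nonneg_mult_integral_mono)
      show "integrable lborel (\<lambda>p. C / max t (snd p) * (\<alpha> (fst p) * kern \<epsilon> (snd p - t)))"
        by (rule integrable_bounded_mult[OF i _ cb]) measurable
      show "AE p in lborel. \<alpha> (fst p) * kern \<epsilon> (snd p - t) \<noteq> 0 \<longrightarrow> C / max t (snd p) \<le> C / t"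
        by (rule AE_I2) (blast intro: order_trans[OF abs_ge_self cb])
    qed (use i nn in auto)
    also have "\<dots> = C / t * h" unfolding \<alpha>_def using sk_integral[OF eps, of x "x + h" t] by simp
    finally show ?thesis unfolding * by simp
  qed
  ultimately show ?thesis by linarith
qed

text \<open>Mollification commutes with translation, so the mollified bound passes to almost every
  point for each fixed \<open>h\<close>. The exceptional set depends on \<open>h\<close>; the later
  statements therefore quantify over the shift outside the almost everywhere quantifier.\<close>

lemma AE_b_one_sided:
  assumes "h > 0"
  shows "AE p in lborel. snd p > 0 \<longrightarrow> b (g (p + (h, 0))) \<le> b (g p) + C * h / snd p"
proof -
  have [measurable]: "(\<lambda>p. b (g (p + (h, 0)))) \<in> borel_measurable borel"
    using measurable_compose[OF _ bg_meas, of "\<lambda>p. p + (h, 0)" borel] by simp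
  have "AE p in lborel. snd p > \<theta> \<longrightarrow> b (g (p + (h, 0))) - b (g p) \<le> C * h / snd p" if "\<theta> > 0" for \<theta>
  proof (rule AE_le_of_mol_le[where \<epsilon> = "\<lambda>k. 1 / real (Suc k)" and D' = "\<lambda>k p. C * h / snd p" and M = "2 * B + C * h / \<theta>"])
    have nn: "0 \<le> C * h / \<theta>" using C_nonneg assms that by simp
    show "\<bar>b (g (p + (h, 0))) - b (g p)\<bar> \<le> 2 * B + C * h / \<theta>" for p
      using bg_abs[of p] bg_abs[of "p + (h, 0)"] nn by linarith
    show bd: "\<bar>C * h / snd p\<bar> \<le> 2 * B + C * h / \<theta>" if "snd p > \<theta>" for p :: "real \<times> real"
    proof -
      have "C * h / snd p \<le> C * h / \<theta>" using that \<open>\<theta> > 0\<close> C_nonneg assms by (intro divide_left_mono) auto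
      moreover have "0 \<le> C * h / snd p" using that \<open>\<theta> > 0\<close> C_nonneg assms by simp
      ultimately show ?thesis using B_nonneg by simp
    qed
    then show "\<bar>C * h / snd p\<bar> \<le> 2 * B + C * h / \<theta>" if "snd p > \<theta>" for p :: "real \<times> real" using that by blast
    show "(\<lambda>k. 1 / real (Suc k)) \<longlonglongrightarrow> 0" by (rule LIMSEQ_Suc[OF lim_1_over_n])
    show "mol (1 / real (Suc k)) (\<lambda>p. b (g (p + (h, 0))) - b (g p)) p \<le> C * h / snd p" if "snd p > \<theta>" for k p
    proof -
      define \<epsilon> where "\<epsilon> = 1 / real (Suc k)"
      have eps: "\<epsilon> > 0" by (simp add: \<epsilon>_def)
      obtain x t where p: "p = (x, t)" by (cases p)
      have k2: "integrable lborel (kern2 \<epsilon>)" using kern2_has_integral[OF eps] by (simp add: has_bochner_integral_iff)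
      have i1: "integrable lborel (\<lambda>z. b (g (p + (h, 0) + z)) * kern2 \<epsilon> z)" and i2: "integrable lborel (\<lambda>z. b (g (p + z)) * kern2 \<epsilon> z)"
        by (rule integrable_bounded_mult[OF k2 _ bg_abs], measurable)+
      have "mol \<epsilon> (\<lambda>p. b (g (p + (h, 0))) - b (g p)) p = (LINT z|lborel. b (g (p + (h, 0) + z)) * kern2 \<epsilon> z - b (g (p + z)) * kern2 \<epsilon> z)"
        by (subst mol_alt) (auto intro!: Bochner_Integration.integral_cong simp: algebra_simps)
      also have "\<dots> = mol \<epsilon> (\<lambda>q. b (g q)) (p + (h, 0)) - mol \<epsilon> (\<lambda>q. b (g q)) p"
        by (subst Bochner_Integration.integral_diff[OF i1 i2]) (simp add: mol_alt)
      finally have "mol \<epsilon> (\<lambda>p. b (g (p + (h, 0))) - b (g p)) p \<le> C * h / snd p"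
        using mol_b_one_sided[OF eps assms, of t x] p that \<open>\<theta> > 0\<close> by simp
      then show ?thesis by (simp add: \<epsilon>_def)
    qed
  qed (auto intro: tendsto_const)
  then have "AE p in lborel. \<forall>n. snd p > 1 / real (Suc n) \<longrightarrow> b (g (p + (h, 0))) - b (g p) \<le> C * h / snd p"
    unfolding AE_all_countable by simp
  then show ?thesis
  proof eventually_elim
    case (elim p)
    show ?case
    proof
      assume "snd p > 0"
      then obtain n where "1 / real (Suc n) < snd p" using nat_approx_posE by blast
      then show "b (g (p + (h, 0))) \<le> b (g p) + C * h / snd p" using elim[rule_format, of n] by simp
    qed
  qed
qed

text \<open>No downward jumps: for a shift with \<open>C * h / \<theta> \<le> d\<close> the value of
  \<open>b(\<rho>)\<close> gains at most \<open>d\<close>, and \<open>b_modulus\<close> turns this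
  into a loss of at most \<open>e\<close> for \<open>\<rho>\<close>. The denominator
  \<open>C + 1\<close> covers \<open>C = 0\<close>.\<close>

lemma AE_shift_increase:
  assumes "e > 0" "\<theta> > 0"
  shows "\<exists>r0>0. \<forall>h. 0 < h \<and> h \<le> r0 \<longrightarrow> (AE p in lborel. snd p > \<theta> \<longrightarrow> g p - e \<le> g (p + (h, 0)))"
proof -
  obtain d where d: "d > 0" "\<And>r s. r \<in> {0..R} \<Longrightarrow> s \<in> {0..R} \<Longrightarrow> b s \<le> b r + d \<Longrightarrow> r - e \<le> s"
    using b_modulus[OF assms(1)] by blast
  show ?thesis
  proof (intro exI[of _ "d * \<theta> / (C + 1)"] conjI allI impI)
    show "0 < d * \<theta> / (C + 1)" using d assms C_nonneg by (intro divide_pos_pos mult_pos_pos) auto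
    fix h assume h: "0 < h \<and> h \<le> d * \<theta> / (C + 1)"
    have ch: "C * h \<le> d * \<theta>"
    proof -
      have "C * h \<le> (C + 1) * h" using h by simp
      also have "\<dots> \<le> (C + 1) * (d * \<theta> / (C + 1))" using h C_nonneg by (intro mult_left_mono) auto
      finally show ?thesis using C_nonneg by simp
    qed
    show "AE p in lborel. snd p > \<theta> \<longrightarrow> g p - e \<le> g (p + (h, 0))"
      using AE_b_one_sided[OF h[THEN conjunct1]]
    proof eventually_elim
      case (elim p)
      show ?case
      proof
        assume p: "\<theta> < snd p"
        have "C * h / snd p \<le> d"
        proof -
          have "d * \<theta> \<le> d * snd p" using p d(1) by simp
          then show ?thesis using p assms(2) ch by (simp add: divide_le_eq)
        qed
        then have "b (g (p + (h, 0))) \<le> b (g p) + d" using elim p assms by simp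
        then show "g p - e \<le> g (p + (h, 0))" using d(2) g_range by blast
      qed
    qed
  qed
qed

text \<open>For the mollified potential the mean value theorem writes a difference quotient as the
  mollified density at an intermediate point, to the right of \<open>x\<close> for the forward
  quotient and to the left for the backward one; \<open>mol_inc\<close> compares it with the value
  at \<open>x\<close>. \<open>AE_le_of_mol_le\<close> then removes the mollification.\<close>

lemma slope_sandwich:
  assumes "e > 0" "\<theta> > 0" and \<epsilon>: "\<And>k. \<epsilon> k > 0" "\<epsilon> \<longlonglongrightarrow> 0"
    and U: "\<And>x t. t > 0 \<Longrightarrow> (\<lambda>k::nat. pot (\<epsilon> k) x t) \<longlonglongrightarrow> U x t"
  shows "\<exists>r0>0. \<forall>r. 0 < r \<and> r \<le> r0 \<longrightarrow> (AE p in lborel. snd p > \<theta> \<longrightarrow>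
      g p \<le> (U (fst p + r) (snd p) - U (fst p) (snd p)) / r + e \<and>
      (U (fst p) (snd p) - U (fst p - r) (snd p)) / r - e \<le> g p)"
proof -
  obtain r0 where r0: "r0 > 0" "\<And>h. 0 < h \<Longrightarrow> h \<le> r0 \<Longrightarrow> AE p in lborel. snd p > \<theta> \<longrightarrow> g p - e \<le> g (p + (h, 0))"
    using AE_shift_increase[OF assms(1,2)] by blast
  have [measurable]: "(\<lambda>p. g (p + (h, 0))) \<in> borel_measurable borel" for h
    using measurable_compose[OF _ g_meas, of "\<lambda>p. p + (h, 0)" borel] by simp
  have mol_inc: "mol \<epsilon>' g (x, t) - e \<le> mol \<epsilon>' g (x + h, t)" if eps: "\<epsilon>' > 0" and h: "0 < h" "h \<le> r0" and t: "t > \<theta>" for \<epsilon>' x t h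
  proof -
    have k2: "integrable lborel (kern2 \<epsilon>')" "(LINT z|lborel. kern2 \<epsilon>' z) = 1"
      using kern2_has_integral[OF eps] by (auto simp: has_bochner_integral_iff)
    have i: "integrable lborel (\<lambda>z. g (p + z) * kern2 \<epsilon>' z)" for p
      by (rule integrable_bounded_mult[OF k2(1) _ g_abs]) measurable
    have "(LINT z|lborel. (g ((x, t) + z) - e) * kern2 \<epsilon>' z) \<le> (LINT z|lborel. g ((x + h, t) + z) * kern2 \<epsilon>' z)"
    proof (rule AE_nonneg_mult_integral_mono[OF _ i])
      show "integrable lborel (\<lambda>z. (g ((x, t) + z) - e) * kern2 \<epsilon>' z)"
        using Bochner_Integration.integrable_diff[OF i integrable_mult_right[OF k2(1), of e]] by (simp add: left_diff_distrib)
      show "AE z in lborel. kern2 \<epsilon>' z \<noteq> 0 \<longrightarrow> g ((x, t) + z) - e \<le> g ((x + h, t) + z)"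
        using AE_shift[OF r0(2)[OF h], of "(x, t)"]
      proof eventually_elim
        case (elim z)
        show ?case
        proof
          assume "kern2 \<epsilon>' z \<noteq> 0"
          then have "snd z > 0" using kern2_0[OF eps, of z] by fastforce
          then have "g ((x, t) + z) - e \<le> g ((x, t) + z + (h, 0))" using elim t by simp
          moreover have "(x, t) + z + (h, 0) = (x + h, t) + z" by (cases z) simp
          ultimately show "g ((x, t) + z) - e \<le> g ((x + h, t) + z)" by metis
        qed
      qed
    qed (use kern2_nonneg[OF eps] in auto)
    moreover have "(LINT z|lborel. (g ((x, t) + z) - e) * kern2 \<epsilon>' z) = mol \<epsilon>' g (x, t) - e"
      using Bochner_Integration.integral_diff[OF i[of "(x, t)"] integrable_mult_right[OF k2(1), of e]] k2(2)
      by (simp add: left_diff_distrib mol_alt)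
    ultimately show ?thesis by (simp add: mol_alt)
  qed
  have up: "mol \<epsilon>' g (x, t) \<le> (pot \<epsilon>' (x + r) t - pot \<epsilon>' x t) / r + e" 
    and low: "(pot \<epsilon>' x t - pot \<epsilon>' (x - r) t) / r - e \<le> mol \<epsilon>' g (x, t)"
    if eps: "\<epsilon>' > 0" and r: "0 < r" "r \<le> r0" and t: "t > \<theta>" for \<epsilon>' x t r
  proof -
    obtain z where z: "x < z" "z < x + r" "pot \<epsilon>' (x + r) t - pot \<epsilon>' x t = (x + r - x) * mol \<epsilon>' g (z, t)"
      using MVT2[of x "x + r" "\<lambda>x. pot \<epsilon>' x t" "\<lambda>z. mol \<epsilon>' g (z, t)"] pot_DERIV[OF eps] r by auto
    show "mol \<epsilon>' g (x, t) \<le> (pot \<epsilon>' (x + r) t - pot \<epsilon>' x t) / r + e"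
      using mol_inc[OF eps, of "z - x" t x] z r t by simp
    obtain z where z: "x - r < z" "z < x" "pot \<epsilon>' x t - pot \<epsilon>' (x - r) t = (x - (x - r)) * mol \<epsilon>' g (z, t)"
      using MVT2[of "x - r" x "\<lambda>x. pot \<epsilon>' x t" "\<lambda>z. mol \<epsilon>' g (z, t)"] pot_DERIV[OF eps] r by auto
    show "(pot \<epsilon>' x t - pot \<epsilon>' (x - r) t) / r - e \<le> mol \<epsilon>' g (x, t)"
      using mol_inc[OF eps, of "x - z" t z] z r t by simp
  qed
  have slope: "\<bar>(pot \<epsilon>' (x + r) t - pot \<epsilon>' x t) / r\<bar> \<le> R" if "\<epsilon>' > 0" "r > 0" for \<epsilon>' x t r
    using pot_Lipschitz_x[OF that(1), of "x + r" t x] that(2) by (simp add: abs_divide divide_le_eq)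
  have slope_lim: "\<bar>(U (x + r) t - U x t) / r\<bar> \<le> R" if "r > 0" "t > 0" for x t r
  proof (rule LIMSEQ_le_const2)
    show "(\<lambda>k. \<bar>(pot (\<epsilon> k) (x + r) t - pot (\<epsilon> k) x t) / r\<bar>) \<longlonglongrightarrow> \<bar>(U (x + r) t - U x t) / r\<bar>"
      using U that by (intro tendsto_intros) auto
    show "\<exists>N. \<forall>n\<ge>N. \<bar>(pot (\<epsilon> n) (x + r) t - pot (\<epsilon> n) x t) / r\<bar> \<le> R" using slope[OF \<epsilon>(1) that(1)] by blast
  qed
  show ?thesis
  proof (intro exI[of _ r0] conjI allI impI r0(1))
    fix r assume r: "0 < r \<and> r \<le> r0"
    \<comment> \<open>The limit \<open>U\<close> is controlled at positive times only, so the
      quotient is set to \<open>0\<close> up to time \<open>\<theta>\<close>; this makes it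
      measurable and bounded on the whole plane.\<close>
    define sl where "sl a V p = (if snd p > \<theta> then (V (fst p + a + r) (snd p) - V (fst p + a) (snd p)) / r else 0)"
      for a and V :: "real \<Rightarrow> real \<Rightarrow> real" and p :: "real \<times> real"
    have slm [measurable]: "sl a (pot \<epsilon>') \<in> borel_measurable borel" for a \<epsilon>'
    proof -
      have [measurable]: "(\<lambda>p. pot \<epsilon>' (fst p + a + r) (snd p)) \<in> borel_measurable borel"
        using pot_measurable[of \<epsilon>' "a + r"] by (simp add: add.assoc)
      show ?thesis unfolding sl_def by measurable
    qed
    have sll: "(\<lambda>k. sl a (pot (\<epsilon> k)) p) \<longlonglongrightarrow> sl a U p" for a p
      unfolding sl_def using U \<open>\<theta> > 0\<close> r by (cases "snd p > \<theta>") (auto intro!: tendsto_intros)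
    have slU [measurable]: "sl a U \<in> borel_measurable borel" for a
      by (rule borel_measurable_LIMSEQ_real[OF sll]) measurable
    have bnd: "\<bar>sl a (pot (\<epsilon> k)) p\<bar> \<le> R" "\<bar>sl a U p\<bar> \<le> R" for a k p
      using slope[OF \<epsilon>(1)[of k], of r "fst p + a" "snd p"] slope_lim[of r "snd p" "fst p + a"] r \<open>\<theta> > 0\<close> R_pos
      by (auto simp: sl_def)
    have bnd': "\<bar>sl a (pot (\<epsilon> k)) p + e\<bar> \<le> R + e" "\<bar>sl a U p + e\<bar> \<le> R + e" 
      "\<bar>e - sl a (pot (\<epsilon> k)) p\<bar> \<le> R + e" "\<bar>e - sl a U p\<bar> \<le> R + e" for a k p
      using bnd(1)[of a k p] bnd(2)[of a p] \<open>e > 0\<close> by linarith+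
    have "AE p in lborel. snd p > \<theta> \<longrightarrow> g p \<le> sl 0 U p + e"
    proof (rule AE_le_of_mol_le[OF g_meas, where D' = "\<lambda>k p. sl 0 (pot (\<epsilon> k)) p + e" and M = "R + e"])
      show "\<bar>g p\<bar> \<le> R + e" for p using g_abs[of p] \<open>e > 0\<close> by linarith
      show "(\<lambda>k. sl 0 (pot (\<epsilon> k)) p + e) \<longlonglongrightarrow> sl 0 U p + e" for p by (intro tendsto_intros sll)
      show "mol (\<epsilon> k) g p \<le> sl 0 (pot (\<epsilon> k)) p + e" if "snd p > \<theta>" for k p
        using up[OF \<epsilon>(1), of r "snd p" k "fst p"] r that by (simp add: sl_def)
    qed (use bnd' \<epsilon> in measurable)
    \<comment> \<open>The lower estimate goes through the same lemma, applied to
      \<open>- g\<close>.\<close>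
    moreover have "AE p in lborel. snd p > \<theta> \<longrightarrow> - g p \<le> e - sl (-r) U p"
    proof (rule AE_le_of_mol_le[where D' = "\<lambda>k p. e - sl (-r) (pot (\<epsilon> k)) p" and M = "R + e"])
      show "\<bar>- g p\<bar> \<le> R + e" for p using g_abs[of p] \<open>e > 0\<close> by simp
      show "(\<lambda>k. e - sl (-r) (pot (\<epsilon> k)) p) \<longlonglongrightarrow> e - sl (-r) U p" for p by (intro tendsto_intros sll)
      show "mol (\<epsilon> k) (\<lambda>p. - g p) p \<le> e - sl (-r) (pot (\<epsilon> k)) p" if "snd p > \<theta>" for k p
        using low[OF \<epsilon>(1), of r "snd p" k "fst p"] r that by (simp add: sl_def mol_def)
    qed (use bnd' \<epsilon> in measurable)
    ultimately show "AE p in lborel. snd p > \<theta> \<longrightarrow> g p \<le> (U (fst p + r) (snd p) - U (fst p) (snd p)) / r + e \<and>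
      (U (fst p) (snd p) - U (fst p - r) (snd p)) / r - e \<le> g p"
      by eventually_elim (auto simp: sl_def)
  qed
qed

text \<open>The signed mass of \<open>r0\<close> between \<open>0\<close> and \<open>x\<close>: the
  difference of indicators is \<open>1\<close> on \<open>(0, x]\<close>, or \<open>- 1\<close> on
  \<open>(x, 0]\<close> when \<open>x\<close> is negative.\<close>

definition pot0 :: "real \<Rightarrow> real" where
  "pot0 x = (LINT y|lborel. r0 y * (indicator {0<..} y - indicator {x<..} y))"

text \<open>The estimate has to be uniform in \<open>x\<close>, because the position of the later
  maximum is unknown. Uniformity comes from strong convergence in \<open>L^1\<close>: the weight
  \<open>ch\<close> is bounded by \<open>1\<close> for every \<open>x\<close>.\<close>

lemma pot_initial:
  assumes "e > 0"
  shows "\<exists>d>0. \<forall>\<epsilon> t x. 0 < \<epsilon> \<and> 0 < t \<and> \<epsilon> + t < d \<longrightarrow> \<bar>pot \<epsilon> x t - pot0 x\<bar> \<le> e"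
proof -
  obtain d where d: "d > 0" "AE s in lborel. 0 < s \<and> s < d \<longrightarrow>
       integrable lborel (\<lambda>x. g (x, s)) \<and> (LINT x|lborel. \<bar>g (x, s) - r0 x\<bar>) \<le> e / 2"
    using init[of "e/2"] assms by auto
  have [measurable]: "r0 \<in> borel_measurable borel" using r0_int borel_measurable_integrable by fastforce
  have r0_abs: "\<bar>r0 x\<bar> \<le> R" for x using r0_range[of x] by auto
  \<comment> \<open>Three errors: the distance to the initial datum, the two transition layers of
    width \<open>\<epsilon>\<close>, and the flux through \<open>0\<close> during
    \<open>[0, t]\<close>.\<close>
  have key: "\<bar>pot \<epsilon> x t - pot0 x\<bar> \<le> e / 2 + 2 * R * \<epsilon> + fb * t" if eps: "0 < \<epsilon>" and t: "0 < t" "\<epsilon> + t < d" for \<epsilon> t x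
  proof -
    define ch where "ch y = step \<epsilon> (y - 0) - step \<epsilon> (y - x)" for y
    have [measurable]: "ch \<in> borel_measurable borel" unfolding ch_def by measurable
    have ch1: "\<bar>ch y\<bar> \<le> 1" for y
      using step_ge_0[OF eps, of "y-0"] step_ge_0[OF eps, of "y-x"] step_le_1[OF eps, of "y-0"] step_le_1[OF eps, of "y-x"]
      unfolding ch_def by linarith
    have chi: "integrable lborel ch"
      using step_diff_has_integral'[OF eps, of 0 x] by (simp add: ch_def[abs_def] has_bochner_integral_iff)
    have r0ch: "integrable lborel (\<lambda>y. r0 y * ch y)"
      by (rule integrable_bounded_mult[OF chi _ r0_abs]) measurable
    have ki: "integrable lborel (\<lambda>s. kern \<epsilon> (s - t))" "(LINT s|lborel. kern \<epsilon> (s - t)) = 1"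
      using kern_shift_has_integral[OF eps, of t] by (auto simp: has_bochner_integral_iff)
    have tens: "has_bochner_integral lborel (\<lambda>q::real\<times>real. (r0 (fst q) * ch (fst q)) * kern \<epsilon> (snd q - t)) ((LINT y|lborel. r0 y * ch y) * 1)"
      by (rule tensor_has_integral[OF _ kern_shift_has_integral[OF eps]]) (use r0ch in \<open>simp add: has_bochner_integral_iff\<close>)
    have gi: "integrable lborel (\<lambda>q. g q * (ch (fst q) * kern \<epsilon> (snd q - t)))"
      unfolding ch_def by (rule gsk_integrable[OF eps])
    have "spx \<epsilon> 0 x t - (LINT y|lborel. r0 y * ch y) = (LINT q|lborel. (g q - r0 (fst q)) * ch (fst q) * kern \<epsilon> (snd q - t))"
    proof -
      have "(LINT q|lborel. (g q - r0 (fst q)) * ch (fst q) * kern \<epsilon> (snd q - t)) =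
         (LINT q|lborel. g q * (ch (fst q) * kern \<epsilon> (snd q - t)) - (r0 (fst q) * ch (fst q)) * kern \<epsilon> (snd q - t))"
        by (rule Bochner_Integration.integral_cong) (auto simp: algebra_simps)
      also have "\<dots> = spx \<epsilon> 0 x t - (LINT y|lborel. r0 y * ch y)"
        using Bochner_Integration.integral_diff[OF gi] tens by (simp add: has_bochner_integral_iff spx_def ch_def)
      finally show ?thesis by simp
    qed
    also have "\<bar>\<dots>\<bar> \<le> e / 2"
    proof -
      have int: "integrable (lborel \<Otimes>\<^sub>M lborel) (\<lambda>(y, s). (g (y, s) - r0 y) * ch y * kern \<epsilon> (s - t))"
      proof -
        have "integrable lborel (\<lambda>q. (g q - r0 (fst q)) * ch (fst q) * kern \<epsilon> (snd q - t))"
        proof -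
          have "integrable lborel (\<lambda>q. g q * (ch (fst q) * kern \<epsilon> (snd q - t)) - (r0 (fst q) * ch (fst q)) * kern \<epsilon> (snd q - t))"
            using Bochner_Integration.integrable_diff[OF gi] tens by (simp add: has_bochner_integral_iff)
          then show ?thesis by (simp add: algebra_simps)
        qed
        then show ?thesis unfolding lborel_prod by (simp add: case_prod_unfold)
      qed
      have "(LINT q|lborel. (g q - r0 (fst q)) * ch (fst q) * kern \<epsilon> (snd q - t)) =
          (LINT s|lborel. LINT y|lborel. (g (y, s) - r0 y) * ch y * kern \<epsilon> (s - t))"
        using lborel_pair.integral_snd[OF int] by (simp add: lborel_prod case_prod_unfold)
      also have "\<bar>\<dots>\<bar> \<le> (LINT s|lborel. \<bar>LINT y|lborel. (g (y, s) - r0 y) * ch y * kern \<epsilon> (s - t)\<bar>)"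
        by (rule integral_abs_bound)
      also have "\<dots> \<le> (LINT s|lborel. e / 2 * kern \<epsilon> (s - t))"
      proof (rule integral_mono_AE)
        show "integrable lborel (\<lambda>s. \<bar>LINT y|lborel. (g (y, s) - r0 y) * ch y * kern \<epsilon> (s - t)\<bar>)"
          by (intro integrable_abs lborel_pair.integrable_snd[OF int])
        show "AE s in lborel. \<bar>LINT y|lborel. (g (y, s) - r0 y) * ch y * kern \<epsilon> (s - t)\<bar> \<le> e / 2 * kern \<epsilon> (s - t)"
          using d(2)
        proof eventually_elim
          case (elim s)
          have kn: "0 \<le> kern \<epsilon> (s - t)" by (rule kern_nonneg[OF eps])
          show ?case
          proof (cases "kern \<epsilon> (s - t) = 0")
            case False
            then have "t < s" "s < t + \<epsilon>" using kern_0[OF eps, of "s - t"] by force+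
            then have gs: "integrable lborel (\<lambda>x. g (x, s))" "(LINT x|lborel. \<bar>g (x, s) - r0 x\<bar>) \<le> e / 2"
              using elim t by auto
            have ab: "integrable lborel (\<lambda>y. \<bar>g (y, s) - r0 y\<bar>)" using gs(1) r0_int by auto
            have "\<bar>LINT y|lborel. (g (y, s) - r0 y) * ch y\<bar> \<le> 1 * (LINT y|lborel. \<bar>g (y, s) - r0 y\<bar>)"
              using integral_bounded_mult[of lborel "\<lambda>y. g (y, s) - r0 y" ch 1] gs(1) r0_int ch1 by (simp add: mult.commute)
            also have "\<dots> \<le> e / 2" using gs by simp
            finally have "\<bar>LINT y|lborel. (g (y, s) - r0 y) * ch y\<bar> * kern \<epsilon> (s - t) \<le> e / 2 * kern \<epsilon> (s - t)"
              by (rule mult_right_mono[OF _ kn])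
            then show ?thesis using kn by (simp add: abs_mult)
          qed simp
        qed
      qed (use ki in auto)
      also have "\<dots> = e / 2" using ki by simp
      finally show ?thesis .
    qed
    finally have 1: "\<bar>spx \<epsilon> 0 x t - (LINT y|lborel. r0 y * ch y)\<bar> \<le> e / 2" .
    have "\<bar>(LINT y|lborel. r0 y * ch y) - pot0 x\<bar> \<le> 2 * R * \<epsilon>"
    proof -
      define ch0 where "ch0 y = indicator {0<..} y - (indicator {x<..} y :: real)" for y
      define J where "J y = (indicator {0..0+\<epsilon>} y + indicator {x..x+\<epsilon>} y :: real)" for y
      have [measurable]: "ch0 \<in> borel_measurable borel" "J \<in> borel_measurable borel" unfolding ch0_def J_def by measurable
      have st: "\<bar>step \<epsilon> (y - a) - indicator {a<..} y\<bar> \<le> indicator {a..a+\<epsilon>} y" for y a :: real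
        using step_0[OF eps, of "y-a"] step_1[OF eps, of "y-a"] step_ge_0[OF eps, of "y-a"] step_le_1[OF eps, of "y-a"]
        by (auto simp: indicator_def)
      have dJ: "\<bar>ch y - ch0 y\<bar> \<le> J y" for y
        using st[of y 0] st[of y x] unfolding ch_def ch0_def J_def by linarith
      have J1: "has_bochner_integral lborel J (\<epsilon> + \<epsilon>)"
      proof -
        have "has_bochner_integral lborel (indicator {a..a+\<epsilon>} :: real \<Rightarrow> real) (measure lborel {a..a+\<epsilon>})" for a
          by (rule has_bochner_integral_real_indicator) (use eps in auto)
        then have "has_bochner_integral lborel (indicator {a..a+\<epsilon>} :: real \<Rightarrow> real) \<epsilon>" for a using eps by simp
        from has_bochner_integral_add[OF this[of 0] this[of x]] show ?thesis by (simp add: J_def[abs_def])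
      qed
      have di: "integrable lborel (\<lambda>y. ch y - ch0 y)"
        by (rule Bochner_Integration.integrable_bound[of _ J]) (use J1 dJ in \<open>auto simp: has_bochner_integral_iff intro: order_trans[OF _ abs_ge_self]\<close>)
      have ch0i: "integrable lborel ch0"
        using Bochner_Integration.integrable_diff[OF chi di] by simp
      have "(LINT y|lborel. r0 y * ch y) - pot0 x = (LINT y|lborel. r0 y * (ch y - ch0 y))"
        unfolding pot0_def ch0_def[symmetric] right_diff_distrib
        by (rule Bochner_Integration.integral_diff[symmetric, OF r0ch integrable_bounded_mult[OF ch0i _ r0_abs]]) measurable
      also have "\<bar>\<dots>\<bar> \<le> R * (LINT y|lborel. \<bar>ch y - ch0 y\<bar>)"
        by (rule integral_bounded_mult[OF di _ r0_abs]) measurable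
      also have "\<dots> \<le> R * (LINT y|lborel. J y)"
        using di J1 dJ R_pos by (intro mult_left_mono Bochner_Integration.integral_mono) (auto simp: has_bochner_integral_iff)
      finally show ?thesis using J1 by (simp add: has_bochner_integral_iff)
    qed
    moreover have "\<bar>tpx \<epsilon> 0 0 t\<bar> \<le> fb * t" using tpx_abs[OF eps, of 0 t 0] t by simp
    ultimately show ?thesis using 1 unfolding pot_def by linarith
  qed
  define m where "m = e / (2 * (2 * R + fb))"
  have Rf: "2 * R + fb > 0" using R_pos fb_nonneg by simp
  have m: "m > 0" using assms Rf by (simp add: m_def)
  have "\<bar>pot \<epsilon> x t - pot0 x\<bar> \<le> e" if "0 < \<epsilon> \<and> 0 < t \<and> \<epsilon> + t < min d m" for \<epsilon> t x
  proof -
    have "2 * R * \<epsilon> + fb * t \<le> 2 * R * m + fb * m"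
      using that R_pos fb_nonneg by (intro add_mono mult_left_mono) auto
    also have "\<dots> = (2 * R + fb) * m" by (simp add: algebra_simps)
    also have "\<dots> = e / 2"
    proof -
      have "S * (e / (2 * S)) = e / 2" if "S > 0" for S :: real using that by simp
      from this[OF Rf] show ?thesis by (simp only: m_def)
    qed
    finally show ?thesis using key[of \<epsilon> t x] that by linarith
  qed
  then show ?thesis using d(1) m by (intro exI[of _ "min d m"]) auto
qed

end

subsection \<open>Uniqueness\<close>

text \<open>A smooth substitute for \<open>\<bar>x\<bar>\<close>: it grows, so a maximum exists, and
  its slope is at most \<open>1\<close>, so the penalty moves the slope of the potential by at most
  \<open>\<kappa>\<close>.\<close>

definition jap :: "real \<Rightarrow> real" where "jap x = sqrt (1 + x\<^sup>2)"

lemma jap_props: "jap x \<ge> 1" "\<bar>x\<bar> \<le> jap x" "jap x \<le> 1 + \<bar>x\<bar>"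
  "\<bar>x / jap x\<bar> \<le> 1" "jap (x + r) \<le> jap x + x / jap x * r + r\<^sup>2"
proof -
  show 1: "jap x \<ge> 1" by (simp add: jap_def)
  show 2: "\<bar>x\<bar> \<le> jap x" unfolding jap_def by (rule real_le_rsqrt) simp
  show "jap x \<le> 1 + \<bar>x\<bar>" unfolding jap_def by (rule real_le_lsqrt) (auto simp: power2_eq_square algebra_simps)
  show "\<bar>x / jap x\<bar> \<le> 1" using 1 2 by (simp add: abs_divide divide_le_eq)
  define y where "y = jap x"
  have y: "y \<ge> 1" "y\<^sup>2 = 1 + x\<^sup>2" using 1 by (auto simp: y_def jap_def)
  \<comment> \<open>\<open>y + s\<close> is the tangent of the square root at
    \<open>y\<^sup>2\<close>, evaluated at \<open>1 + (x + r)\<^sup>2\<close>; concavity puts the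
    root below it.\<close>
  define s where "s = (2 * x * r + r\<^sup>2) / (2 * y)"
  have ys: "y * s * 2 = 2 * x * r + r\<^sup>2" using y by (simp add: s_def)
  have "1 + (x + r)\<^sup>2 = y\<^sup>2 + y * s * 2" using y ys by (simp add: power2_eq_square algebra_simps)
  also have "\<dots> \<le> (y + s)\<^sup>2" by (simp add: power2_eq_square algebra_simps)
  finally have le: "1 + (x + r)\<^sup>2 \<le> (y + s)\<^sup>2" .
  have "y + s \<ge> 0"
  proof -
    have "2 * y * (y + s) = 2 * y\<^sup>2 + y * s * 2" by (simp add: power2_eq_square algebra_simps)
    also have "\<dots> = 2 + x\<^sup>2 + (x + r)\<^sup>2" using y ys by (simp add: power2_eq_square algebra_simps)
    finally have "2 * y * (y + s) \<ge> 0" by simp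
    then show ?thesis using y by (simp add: zero_le_mult_iff)
  qed
  then have "jap (x + r) \<le> y + s" unfolding jap_def using le by (rule real_le_lsqrt)
  also have "y + s = y + x / y * r + r\<^sup>2 / (2 * y)" using y by (simp add: s_def field_simps)
  also have "r\<^sup>2 / (2 * y) \<le> r\<^sup>2" using y by (simp add: divide_le_eq mult_le_cancel_left1)
  finally show "jap (x + r) \<le> jap x + x / jap x * r + r\<^sup>2" by (simp add: y_def)
qed

text \<open>The first potential is handled through its difference quotients, the second through its
  Taylor expansion, with a mollification width \<open>\<delta>\<close> that stays fixed and
  positive. Exchanging the two solutions gives the other inequality.\<close>

lemma potential_le:
  assumes "entropy_core f b R B g1 r0 C1" "entropy_core f b R B g2 r0 C2"
    and e1: "\<And>k. e1 k > 0" "e1 \<longlonglongrightarrow> 0"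
    and U1: "\<And>x t. t > 0 \<Longrightarrow> (\<lambda>k::nat. entropy_core.pot f g1 (e1 k) x t) \<longlonglongrightarrow> U1 x t"
    and e2: "\<And>k. e2 k > 0" "e2 \<longlonglongrightarrow> 0"
    and U2: "\<And>x t. t > 0 \<Longrightarrow> (\<lambda>k::nat. entropy_core.pot f g2 (e2 k) x t) \<longlonglongrightarrow> U2 x t"
    and x1t1: "t1 > 0"
  shows "U1 x1 t1 \<le> U2 x1 t1"
proof (rule ccontr)
  interpret A: entropy_core f b R B g1 r0 C1 by fact
  interpret W: entropy_core f b R B g2 r0 C2 by fact
  define F where "F = A.fb"
  have F0: "F \<ge> 0" using A.fb_nonneg by (simp add: F_def)
  have R0: "R > 0" by (rule A.R_pos)
  have B0: "B \<ge> 0" by (rule A.B_nonneg)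
  assume "\<not> U1 x1 t1 \<le> U2 x1 t1"
  define \<gamma> where "\<gamma> = U1 x1 t1 - U2 x1 t1"
  have \<gamma>: "\<gamma> > 0" using \<open>\<not> U1 x1 t1 \<le> U2 x1 t1\<close> by (simp add: \<gamma>_def)
  \<comment> \<open>The two terms of the minimum keep each of the penalties
    \<open>\<kappa> * jap x1\<close> and \<open>lam * t1\<close> at most
    \<open>\<gamma> / 8\<close>.\<close>
  define \<kappa> where "\<kappa> = min (\<gamma> / (8 * (1 + \<bar>x1\<bar>))) (\<gamma> / (8 * ((B + 1) * t1)))"
  have \<kappa>: "\<kappa> > 0" using \<gamma> x1t1 B0 by (auto simp: \<kappa>_def intro!: divide_pos_pos mult_pos_pos)
  have \<kappa>1: "\<kappa> * jap x1 \<le> \<gamma> / 8"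
  proof -
    have "\<kappa> * jap x1 \<le> \<gamma> / (8 * (1 + \<bar>x1\<bar>)) * (1 + \<bar>x1\<bar>)"
      using jap_props(1,3)[of x1] \<kappa> \<gamma> by (intro mult_mono) (auto simp: \<kappa>_def)
    also have "\<dots> = \<gamma> / 8"
    proof -
      have "\<gamma> / (8 * S) * S = \<gamma> / 8" if "S > 0" for S :: real using that by simp
      then show ?thesis by (metis abs_ge_zero add_pos_nonneg zero_less_one)
    qed
    finally show ?thesis .
  qed
  \<comment> \<open>At the maximum the first density deviates from the mollified second one by about
    \<open>\<kappa>\<close>, which costs \<open>B * \<kappa>\<close> in the flux; the additional
    \<open>\<kappa>\<close> is the margin for the contradiction.\<close>
  define lam where "lam = (B + 1) * \<kappa>"
  have lam: "lam > 0" using \<kappa> B0 by (simp add: lam_def)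
  have lam1: "lam * t1 \<le> \<gamma> / 8"
  proof -
    have P: "(B + 1) * t1 > 0" using B0 x1t1 by simp
    have "lam * t1 = \<kappa> * ((B + 1) * t1)" by (simp add: lam_def)
    also have "\<dots> \<le> \<gamma> / (8 * ((B + 1) * t1)) * ((B + 1) * t1)"
      using P by (intro mult_right_mono) (auto simp: \<kappa>_def)
    also have "\<dots> = \<gamma> / 8"
    proof -
      have "\<gamma> / (8 * S) * S = \<gamma> / 8" if "S > 0" for S :: real using that by simp
      from this[OF P] show ?thesis .
    qed
    finally show ?thesis .
  qed
  have "\<gamma> / 8 > 0" using \<gamma> by simp
  obtain d1 where d1: "d1 > 0" "\<And>\<epsilon> t x. 0 < \<epsilon> \<Longrightarrow> 0 < t \<Longrightarrow> \<epsilon> + t < d1 \<Longrightarrow> \<bar>A.pot \<epsilon> x t - A.pot0 x\<bar> \<le> \<gamma> / 8"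
    using A.pot_initial[OF \<open>\<gamma> / 8 > 0\<close>] by blast
  obtain d2 where d2: "d2 > 0" "\<And>\<epsilon> t x. 0 < \<epsilon> \<Longrightarrow> 0 < t \<Longrightarrow> \<epsilon> + t < d2 \<Longrightarrow> \<bar>W.pot \<epsilon> x t - A.pot0 x\<bar> \<le> \<gamma> / 8"
    using W.pot_initial[OF \<open>\<gamma> / 8 > 0\<close>] by blast
  \<comment> \<open>The comparison starts at a time \<open>\<theta>\<close> at which both potentials
    are still within \<open>\<gamma> / 8\<close> of the common initial potential.\<close>
  define \<theta> where "\<theta> = min (min (d1 / 2) (d2 / 2)) (t1 / 2)"
  have \<theta>: "\<theta> > 0" "\<theta> \<le> d1 / 2" "\<theta> \<le> d2 / 2" "\<theta> < t1" using d1 d2 x1t1 by (auto simp: \<theta>_def)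
  have ev1: "\<forall>\<^sub>F k in sequentially. e1 k < c" if "c > 0" for c using order_tendstoD(2)[OF e1(2) that] .
  have U1\<theta>: "\<bar>U1 x \<theta> - A.pot0 x\<bar> \<le> \<gamma> / 8" for x
  proof (rule tendsto_upperbound)
    show "(\<lambda>k. \<bar>A.pot (e1 k) x \<theta> - A.pot0 x\<bar>) \<longlonglongrightarrow> \<bar>U1 x \<theta> - A.pot0 x\<bar>"
      by (intro tendsto_intros U1 \<theta>)
    show "\<forall>\<^sub>F k in sequentially. \<bar>A.pot (e1 k) x \<theta> - A.pot0 x\<bar> \<le> \<gamma> / 8"
      using ev1[of "d1 / 2"] d1(1)
    proof (simp, elim eventually_mono)
      fix k assume "e1 k * 2 < d1"
      then show "\<bar>A.pot (e1 k) x \<theta> - A.pot0 x\<bar> * 8 \<le> \<gamma>" using d1(2)[OF e1(1) \<theta>(1), of k x] \<theta>(2) by simp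
    qed
  qed simp
  have "\<forall>\<^sub>F k in sequentially. e2 k < d2 / 2 \<and> dist (W.pot (e2 k) x1 t1) (U2 x1 t1) < \<gamma> / 8"
    using order_tendstoD(2)[OF e2(2), of "d2 / 2"] tendstoD[OF U2[OF x1t1, of x1] \<open>\<gamma> / 8 > 0\<close>] d2(1)
    by (simp add: eventually_conj_iff)
  then obtain k where k: "e2 k < d2 / 2" "dist (W.pot (e2 k) x1 t1) (U2 x1 t1) < \<gamma> / 8"
    using eventually_happens'[OF sequentially_bot] by blast
  \<comment> \<open>From here on one width is fixed, small enough for the initial estimate and for
    the value at \<open>(x1, t1)\<close>.\<close>
  define \<delta> where "\<delta> = e2 k"
  have \<delta>: "\<delta> > 0" "\<delta> < d2 / 2" "\<bar>W.pot \<delta> x1 t1 - U2 x1 t1\<bar> < \<gamma> / 8" 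
    using k e2(1) by (auto simp: \<delta>_def dist_real_def)
  define w where "w x t = W.pot \<delta> x t" for x t
  have w\<theta>: "\<bar>w x \<theta> - A.pot0 x\<bar> \<le> \<gamma> / 8" for x
    using d2(2)[OF \<delta>(1) \<theta>(1)] \<delta>(2) \<theta>(3) by (simp add: w_def)
  have Lw: "\<bar>w x t - w y s\<bar> \<le> R * \<bar>x - y\<bar> + F * \<bar>t - s\<bar>" if "t > 0" "s > 0" for x y t s
    unfolding w_def F_def using W.pot_Lipschitz[OF \<delta>(1)] that by blast
  have LU: "\<bar>U1 x t - U1 y s\<bar> \<le> R * \<bar>x - y\<bar> + F * \<bar>t - s\<bar>" if "t > 0" "s > 0" for x y t s
  proof (rule LIMSEQ_le_const2)
    show "(\<lambda>k. \<bar>A.pot (e1 k) x t - A.pot (e1 k) y s\<bar>) \<longlonglongrightarrow> \<bar>U1 x t - U1 y s\<bar>"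
      by (intro tendsto_intros U1 that)
    show "\<exists>N. \<forall>k\<ge>N. \<bar>A.pot (e1 k) x t - A.pot (e1 k) y s\<bar> \<le> R * \<bar>x - y\<bar> + F * \<bar>t - s\<bar>"
      using A.pot_Lipschitz[OF e1(1)] that unfolding F_def by blast
  qed
  define \<Psi> where "\<Psi> x t = U1 x t - w x t - \<kappa> * jap x - lam * t" for x t
  \<comment> \<open>At least \<open>5 / 8 * \<gamma>\<close> here against at most
    \<open>\<gamma> / 4\<close> at time \<open>\<theta>\<close> keeps the maximum off the initial
    line.\<close>
  have big: "\<Psi> x1 t1 \<ge> 5 / 8 * \<gamma>"
  proof -
    have "U1 x1 t1 = U2 x1 t1 + \<gamma>" by (simp add: \<gamma>_def)
    moreover have "w x1 t1 < U2 x1 t1 + \<gamma> / 8" using \<delta>(3) unfolding w_def by linarith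
    moreover have "5 / 8 * \<gamma> = \<gamma> - \<gamma> / 8 - \<gamma> / 8 - \<gamma> / 8" by simp
    ultimately show ?thesis using \<kappa>1 lam1 unfolding \<Psi>_def by linarith
  qed
  have \<kappa>j: "\<kappa> * jap x \<ge> 0" for x using \<kappa> jap_props(1)[of x] by (intro mult_nonneg_nonneg) auto
  have small: "\<Psi> x \<theta> \<le> \<gamma> / 4" for x
    using U1\<theta>[of x] w\<theta>[of x] \<kappa>j[of x] mult_pos_pos[OF lam \<theta>(1)] unfolding \<Psi>_def by linarith
  define M where "M = \<gamma> / 4 + 2 * (F * t1)"
  have diffM: "\<Psi> x t \<le> M - \<kappa> * \<bar>x\<bar>" if "\<theta> \<le> t" "t \<le> t1" for x t
  proof -
    have "F * \<bar>t - \<theta>\<bar> \<le> F * t1" using that \<theta> F0 by (intro mult_left_mono) auto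
    moreover have "\<bar>U1 x t - U1 x \<theta>\<bar> \<le> F * \<bar>t - \<theta>\<bar>" "\<bar>w x t - w x \<theta>\<bar> \<le> F * \<bar>t - \<theta>\<bar>"
      using LU[of t \<theta> x x] Lw[of t \<theta> x x] that \<theta> by auto
    moreover have "\<kappa> * \<bar>x\<bar> \<le> \<kappa> * jap x" using \<kappa> jap_props(2) by (intro mult_left_mono) auto
    moreover have "lam * t \<ge> 0" using lam that \<theta> by simp
    ultimately show ?thesis using U1\<theta>[of x] w\<theta>[of x] unfolding \<Psi>_def M_def by linarith
  qed
  \<comment> \<open>Beyond \<open>N\<close> the penalty outweighs the constant \<open>M\<close> and
    \<open>\<Psi>\<close> is nonpositive; the maximum over the rectangle is therefore one over the
    whole strip.\<close>
  define N where "N = max \<bar>x1\<bar> (M / \<kappa>)"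
  have cont: "continuous_on ({-N..N} \<times> {\<theta>..t1}) (\<lambda>p. \<Psi> (fst p) (snd p))"
  proof -
    have lipc: "continuous_on ({-N..N} \<times> {\<theta>..t1}) (\<lambda>p. V (fst p) (snd p))"
      if V: "\<And>x y t s. t > 0 \<Longrightarrow> s > 0 \<Longrightarrow> \<bar>V x t - V y s\<bar> \<le> R * \<bar>x - y\<bar> + F * \<bar>t - s\<bar>" for V :: "real \<Rightarrow> real \<Rightarrow> real"
    proof (rule lipschitz_on_continuous_on[where L = "R + F"], rule lipschitz_onI)
      fix p q assume p: "p \<in> {-N..N} \<times> {\<theta>..t1}" and q: "q \<in> {-N..N} \<times> {\<theta>..t1}"
      have "\<bar>V (fst p) (snd p) - V (fst q) (snd q)\<bar> \<le> R * \<bar>fst p - fst q\<bar> + F * \<bar>snd p - snd q\<bar>"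
        using p q \<theta> by (intro V) (auto simp: mem_Times_iff)
      also have "\<dots> \<le> R * dist p q + F * dist p q"
        using R0 F0 dist_fst_le[of p q] dist_snd_le[of p q]
        by (intro add_mono mult_left_mono) (auto simp: dist_real_def)
      finally show "dist (V (fst p) (snd p)) (V (fst q) (snd q)) \<le> (R + F) * dist p q"
        by (simp add: dist_real_def algebra_simps)
    qed (use R0 F0 in simp)
    have "continuous_on ({-N..N} \<times> {\<theta>..t1}) (\<lambda>p::real\<times>real. \<kappa> * jap (fst p) + lam * snd p)"
      unfolding jap_def by (intro continuous_intros)
    from continuous_on_diff[OF continuous_on_diff[OF lipc[of U1, OF LU] lipc[of w, OF Lw]] this]
    show ?thesis by (simp add: \<Psi>_def diff_diff_eq add.assoc)
  qed
  have "(x1, t1) \<in> {-N..N} \<times> {\<theta>..t1}" using \<theta> by (auto simp: N_def)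
  then obtain p0 where p0: "p0 \<in> {-N..N} \<times> {\<theta>..t1}"
    "\<And>p. p \<in> {-N..N} \<times> {\<theta>..t1} \<Longrightarrow> \<Psi> (fst p) (snd p) \<le> \<Psi> (fst p0) (snd p0)"
    using continuous_attains_sup[OF compact_Times[OF compact_Icc compact_Icc] _ cont] by (metis empty_iff)
  define x0 where "x0 = fst p0" define t0 where "t0 = snd p0"
  have t0: "\<theta> \<le> t0" "t0 \<le> t1" using p0(1) by (auto simp: t0_def mem_Times_iff)
  have max0: "\<Psi> x1 t1 \<le> \<Psi> x0 t0" using p0(2)[of "(x1, t1)"] \<open>(x1, t1) \<in> _\<close> by (simp add: x0_def t0_def)
  have max: "\<Psi> x t \<le> \<Psi> x0 t0" if "\<theta> \<le> t" "t \<le> t1" for x t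
  proof (cases "\<bar>x\<bar> \<le> N")
    case True
    then show ?thesis using p0(2)[of "(x, t)"] that by (simp add: x0_def t0_def abs_le_iff)
  next
    case False
    then have "M / \<kappa> \<le> \<bar>x\<bar>" by (simp add: N_def)
    then have "M \<le> \<kappa> * \<bar>x\<bar>" using \<kappa> by (simp add: divide_le_eq mult.commute)
    then have "\<Psi> x t \<le> 0" using diffM[OF that, of x] by linarith
    then show ?thesis using big max0 \<gamma> by linarith
  qed
  have "\<theta> < t0"
  proof (rule ccontr)
    assume "\<not> \<theta> < t0"
    then have "t0 = \<theta>" using t0 by simp
    then show False using small[of x0] max0 big \<gamma> by simp
  qed
  define q where "q = mol \<delta> g2 (x0, t0)"
  have q: "q \<in> {0..R}" "mol \<delta> (\<lambda>p. f (g2 p)) (x0, t0) \<le> f q"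
    using W.mol_Jensen[OF \<delta>(1), of "(x0, t0)"] by (auto simp: q_def)
  obtain cx where cx: "cx \<ge> 0" "\<And>x t r. \<bar>r\<bar> \<le> 1 \<Longrightarrow> \<bar>w (x + r) t - w x t - r * mol \<delta> g2 (x, t)\<bar> \<le> cx * r\<^sup>2"
    using W.pot_Taylor_x[OF \<delta>(1)] unfolding w_def by blast
  obtain ct where ct: "ct \<ge> 0" "\<And>x t h. 0 \<le> h \<Longrightarrow> h \<le> 1 \<Longrightarrow> h < t \<Longrightarrow> 
      \<bar>w x t - w x (t - h) + h * mol \<delta> (\<lambda>p. f (g2 p)) (x, t)\<bar> \<le> ct * h\<^sup>2"
    using W.pot_Taylor_t[OF \<delta>(1)] unfolding w_def by blast
  define j where "j = x0 / jap x0"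
  have j: "\<bar>j\<bar> \<le> 1" unfolding j_def by (rule jap_props)
  \<comment> \<open>The slope of \<open>w + \<kappa> * jap\<close> at the maximum.
    \<open>space\<close> then says that a parabola with this slope touches \<open>U1\<close> from
    above.\<close>
  define p where "p = q + \<kappa> * j"
  have space: "U1 (x0 + r) t0 - U1 x0 t0 \<le> p * r + (cx + \<kappa>) * r\<^sup>2" if r: "\<bar>r\<bar> \<le> 1" for r
  proof -
    have "U1 (x0 + r) t0 - U1 x0 t0 \<le> (w (x0 + r) t0 - w x0 t0) + \<kappa> * (jap (x0 + r) - jap x0)"
      using max[of t0 "x0 + r"] t0 unfolding \<Psi>_def by (simp add: algebra_simps)
    moreover have "w (x0 + r) t0 - w x0 t0 \<le> r * q + cx * r\<^sup>2" using cx(2)[OF r, of x0 t0] unfolding q_def by linarith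
    moreover have "\<kappa> * (jap (x0 + r) - jap x0) \<le> \<kappa> * (j * r + r\<^sup>2)"
      using jap_props(5)[of x0 r] \<kappa> unfolding j_def by (intro mult_left_mono) auto
    ultimately show ?thesis by (simp add: p_def algebra_simps)
  qed
  have B1: "B + 1 > 0" using B0 by simp
  define e where "e = \<kappa> / (4 * (B + 1))"
  have e: "e > 0" "B * e \<le> \<kappa> / 4"
  proof -
    show "e > 0" using \<kappa> B1 by (simp add: e_def)
    have "B * e \<le> (B + 1) * e" using \<open>e > 0\<close> by simp
    also have "\<dots> = \<kappa> / 4"
    proof -
      have "S * (\<kappa> / (4 * S)) = \<kappa> / 4" if "S > 0" for S :: real using that by simp
      from this[OF B1] show ?thesis by (simp only: e_def)
    qed
    finally show "B * e \<le> \<kappa> / 4" .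
  qed
  have "\<theta> / 2 > 0" using \<theta> by simp
  from A.slope_sandwich[OF e(1) this e1 U1]
  obtain rs where rs: "rs > 0" "\<And>r. 0 < r \<Longrightarrow> r \<le> rs \<Longrightarrow> AE p in lborel. snd p > \<theta> / 2 \<longrightarrow>
      g1 p \<le> (U1 (fst p + r) (snd p) - U1 (fst p) (snd p)) / r + e \<and>
      (U1 (fst p) (snd p) - U1 (fst p - r) (snd p)) / r - e \<le> g1 p"
    by blast
  \<comment> \<open>\<open>cx + \<kappa>\<close> is the curvature of the touching parabola;
    \<open>2 * (R + F)\<close> pays for moving both points of a difference quotient away from the
    maximum.\<close>
  define c' where "c' = cx + \<kappa> + 2 * (R + F)"
  have c': "c' > 0" using cx(1) \<kappa> R0 F0 by (simp add: c'_def)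
  \<comment> \<open>The last two entries make \<open>B * c' * r\<close> and \<open>ct * h\<close> at
    most \<open>\<kappa> / 4\<close> each; together with \<open>B * e \<le> \<kappa> / 4\<close>
    this leaves \<open>3 / 4 * \<kappa>\<close> against \<open>\<kappa>\<close>.\<close>
  define r where "r = min (min rs 1) (min (t0 - \<theta>) (min (\<kappa> / (4 * (B * c' + 1))) (\<kappa> / (4 * (ct + 1)))))"
  have r: "r > 0" "r \<le> rs" "r \<le> 1" "r \<le> t0 - \<theta>" 
    using rs(1) \<open>\<theta> < t0\<close> \<kappa> B0 c' ct(1) by (auto simp: r_def intro!: divide_pos_pos add_nonneg_pos)
  have r4: "(B * c' + 1) * r \<le> \<kappa> / 4" "(ct + 1) * r \<le> \<kappa> / 4"
  proof -
    have *: "S * r \<le> \<kappa> / 4" if "S > 0" "r \<le> \<kappa> / (4 * S)" for S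
      using that by (simp add: field_simps)
    show "(B * c' + 1) * r \<le> \<kappa> / 4" by (rule *) (use B0 c' in \<open>auto simp: r_def intro: add_nonneg_pos\<close>)
    show "(ct + 1) * r \<le> \<kappa> / 4" by (rule *) (use ct in \<open>auto simp: r_def\<close>)
  qed
  \<comment> \<open>Moving the base point by \<open>h = r\<^sup>2\<close> changes \<open>U1\<close>
    by a multiple of \<open>r\<^sup>2\<close>, which is still small after division by the step
    \<open>r\<close> of the quotients.\<close>
  define h where "h = r\<^sup>2"
  have h: "h > 0" "h \<le> r" "h \<le> 1" using r mult_le_one[of r r] by (auto simp: h_def power2_eq_square mult_left_le)
  have ht: "\<theta> \<le> t0 - h" "h < t0" using h r \<theta> by linarith+
  define e' where "e' = e + c' * r"
  have e'0: "e' \<ge> 0" using e c' r by (simp add: e'_def)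
  have near: "AE z in lborel. fst z \<in> {x0..x0 + h} \<and> snd z \<in> {t0 - h..t0 + h} \<longrightarrow> \<bar>g1 z - q\<bar> \<le> e' + \<kappa>"
    using rs(2)[OF r(1,2)]
  proof eventually_elim
    case (elim z)
    show ?case
    proof
      assume z: "fst z \<in> {x0..x0 + h} \<and> snd z \<in> {t0 - h..t0 + h}"
      define y where "y = fst z" define s where "s = snd z"
      have ys: "\<bar>y - x0\<bar> \<le> h" "\<bar>s - t0\<bar> \<le> h" using z by (auto simp: y_def s_def)
      have s: "s > \<theta> / 2" "s > 0" "t0 > 0" using z ht \<theta> by (auto simp: s_def)
      have sh: "\<bar>U1 (y + c) s - U1 (x0 + c) t0\<bar> \<le> (R + F) * h" for c
      proof -
        have "\<bar>U1 (y + c) s - U1 (x0 + c) t0\<bar> \<le> R * \<bar>(y + c) - (x0 + c)\<bar> + F * \<bar>s - t0\<bar>"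
          by (rule LU) (use s in auto)
        also have "\<dots> \<le> R * h + F * h" using ys R0 F0 by (intro add_mono mult_left_mono) auto
        finally show ?thesis by (simp add: algebra_simps)
      qed
      have *: "g1 z \<le> (U1 (y + r) s - U1 y s) / r + e" "(U1 y s - U1 (y - r) s) / r - e \<le> g1 z"
        using elim s by (auto simp: y_def s_def)
      have "U1 (y + r) s - U1 y s \<le> p * r + (cx + \<kappa>) * r\<^sup>2 + 2 * ((R + F) * h)"
        using sh[of r] sh[of 0] space[of r] r by (simp add: abs_le_iff)
      also have "\<dots> = (p + c' * r) * r" by (simp add: c'_def h_def power2_eq_square algebra_simps)
      finally have "(U1 (y + r) s - U1 y s) / r \<le> p + c' * r" using r by (simp add: divide_le_eq)
      then have up: "g1 z \<le> p + e'" using *(1) by (simp add: e'_def)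
      have "U1 (y - r) s - U1 y s \<le> - p * r + (cx + \<kappa>) * r\<^sup>2 + 2 * ((R + F) * h)"
        using sh[of "-r"] sh[of 0] space[of "-r"] r by (simp add: abs_le_iff)
      also have "\<dots> = - ((p - c' * r) * r)" by (simp add: c'_def h_def power2_eq_square algebra_simps)
      finally have "(p - c' * r) * r \<le> U1 y s - U1 (y - r) s" by simp
      then have "p - c' * r \<le> (U1 y s - U1 (y - r) s) / r" using r by (simp add: le_divide_eq)
      then have low: "p - e' \<le> g1 z" using *(2) by (simp add: e'_def)
      have "\<bar>p - q\<bar> \<le> \<kappa>" using j \<kappa> by (simp add: p_def abs_mult mult_left_le)
      then show "\<bar>g1 z - q\<bar> \<le> e' + \<kappa>" using up low by linarith
    qed
  qed
  define m where "m = f q - B * (e' + \<kappa>)"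
  have fnear: "AE z in lborel. fst z \<in> {x0..x0 + \<epsilon>} \<and> snd z \<in> {t0 - h..t0 + \<epsilon>} \<longrightarrow> m \<le> f (g1 z)" if "\<epsilon> \<le> h" for \<epsilon>
    using near
  proof eventually_elim
    case (elim z)
    show ?case
    proof
      assume "fst z \<in> {x0..x0 + \<epsilon>} \<and> snd z \<in> {t0 - h..t0 + \<epsilon>}"
      then have "\<bar>g1 z - q\<bar> \<le> e' + \<kappa>" using elim that by auto
      then have "B * \<bar>g1 z - q\<bar> \<le> B * (e' + \<kappa>)" by (rule mult_left_mono[OF _ B0])
      then show "m \<le> f (g1 z)" using A.f_Lipschitz[OF A.g_range q(1), of z] unfolding m_def by linarith
    qed
  qed
  \<comment> \<open>Once \<open>e1 k\<close> is below \<open>h\<close>, the densities close to the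
    maximum bound from below the flux through \<open>x0\<close> during
    \<open>[t0 - h, t0]\<close>.\<close>
  have "U1 x0 t0 - U1 x0 (t0 - h) \<le> - (m * h)"
  proof (rule tendsto_upperbound)
    show "(\<lambda>k. A.pot (e1 k) x0 t0 - A.pot (e1 k) x0 (t0 - h)) \<longlonglongrightarrow> U1 x0 t0 - U1 x0 (t0 - h)"
      using ht \<theta>(1) h(1) by (intro tendsto_intros U1) linarith+
    show "\<forall>\<^sub>F k in sequentially. A.pot (e1 k) x0 t0 - A.pot (e1 k) x0 (t0 - h) \<le> - (m * h)"
      using ev1[OF h(1)]
    proof eventually_elim
      case (elim k)
      have "A.pot (e1 k) x0 t0 - A.pot (e1 k) x0 (t0 - h) = - A.tpx (e1 k) x0 (t0 - h) t0"
        by (rule A.pot_diff_t[OF e1(1)]) (use ht h \<theta> in auto)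
      moreover have "m * (t0 - (t0 - h)) \<le> A.tpx (e1 k) x0 (t0 - h) t0"
        by (rule A.tpx_lower[OF e1(1)]) (use h fnear[of "e1 k"] elim in auto)
      ultimately show ?case by simp
    qed
  qed simp
  moreover have "U1 x0 t0 - U1 x0 (t0 - h) \<ge> w x0 t0 - w x0 (t0 - h) + lam * h"
    using max[of "t0 - h" x0] ht t0 h unfolding \<Psi>_def by (simp add: algebra_simps)
  moreover have "w x0 t0 - w x0 (t0 - h) \<ge> - (h * f q) - ct * h\<^sup>2"
  proof -
    have "h * mol \<delta> (\<lambda>p. f (g2 p)) (x0, t0) \<le> h * f q" using h by (intro mult_left_mono q) auto
    then show ?thesis using ct(2)[of h t0 x0] h ht unfolding abs_le_iff by linarith
  qed
  ultimately have "lam * h \<le> (B * (e' + \<kappa>) + ct * h) * h"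
    by (simp add: m_def power2_eq_square algebra_simps)
  then have "lam \<le> B * (e' + \<kappa>) + ct * h" using h by simp
  then have 1: "\<kappa> \<le> B * e' + ct * h" by (simp add: lam_def algebra_simps)
  have "ct * h \<le> ct * r" using ct h by (intro mult_left_mono) auto
  moreover have "ct * r \<le> (ct + 1) * r" "B * c' * r \<le> (B * c' + 1) * r" using r by auto
  moreover have "B * e' = B * e + B * c' * r" by (simp add: e'_def algebra_simps)
  ultimately have "B * e' + ct * h \<le> 3 * (\<kappa> / 4)" using r4 e(2) by linarith
  with 1 \<kappa> show False by simp
qed

text \<open>With a common potential, \<open>g1\<close> lies below the forward quotient plus
  \<open>e\<close>, and \<open>g2\<close> at the point shifted by \<open>r\<close> lies above the
  backward quotient minus \<open>e\<close>; the two quotients are the same number. So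
  \<open>g1\<close> is below a translate of \<open>g2\<close> up to \<open>2 * e\<close>, and the
  translation is sent to \<open>0\<close> after testing with continuous functions.\<close>

lemma entropy_core_le:
  assumes E1: "entropy_core f b R B g1 r0 C1" and E2: "entropy_core f b R B g2 r0 C2"
  shows "AE p in lborel. snd p > 0 \<longrightarrow> g1 p \<le> g2 p"
proof -
  interpret A: entropy_core f b R B g1 r0 C1 by fact
  interpret W: entropy_core f b R B g2 r0 C2 by fact
  obtain e1 U1 where e1: "\<And>k. e1 k > 0" "e1 \<longlonglongrightarrow> 0"
    and U1: "\<And>x t. t > 0 \<Longrightarrow> (\<lambda>k::nat. A.pot (e1 k) x t) \<longlonglongrightarrow> U1 x t"
    using A.potential_exists by blast
  obtain e2 U2 where e2: "\<And>k. e2 k > 0" "e2 \<longlonglongrightarrow> 0"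
    and U2: "\<And>x t. t > 0 \<Longrightarrow> (\<lambda>k::nat. W.pot (e2 k) x t) \<longlonglongrightarrow> U2 x t"
    using W.potential_exists by blast
  have UU: "U1 x t = U2 x t" if "t > 0" for x t
    using potential_le[OF E1 E2 e1 U1 e2 U2 that] potential_le[OF E2 E1 e2 U2 e1 U1 that] by (intro antisym)
  have step: "\<exists>r0>0. \<forall>r. 0 < r \<and> r \<le> r0 \<longrightarrow> (AE p in lborel. snd p > \<theta> \<longrightarrow> g1 p \<le> g2 ((r, 0) + p) + 2 * e)"
    if e\<theta>: "e > 0" "\<theta> > 0" for e \<theta>
  proof -
    obtain ra where ra: "ra > 0" "\<And>r. 0 < r \<Longrightarrow> r \<le> ra \<Longrightarrow> AE p in lborel. snd p > \<theta> \<longrightarrow>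
      g1 p \<le> (U1 (fst p + r) (snd p) - U1 (fst p) (snd p)) / r + e \<and>
      (U1 (fst p) (snd p) - U1 (fst p - r) (snd p)) / r - e \<le> g1 p"
      using A.slope_sandwich[OF e\<theta> e1 U1] by blast
    obtain rb where rb: "rb > 0" "\<And>r. 0 < r \<Longrightarrow> r \<le> rb \<Longrightarrow> AE p in lborel. snd p > \<theta> \<longrightarrow>
      g2 p \<le> (U2 (fst p + r) (snd p) - U2 (fst p) (snd p)) / r + e \<and>
      (U2 (fst p) (snd p) - U2 (fst p - r) (snd p)) / r - e \<le> g2 p"
      using W.slope_sandwich[OF e\<theta> e2 U2] by blast
    have "AE p in lborel. snd p > \<theta> \<longrightarrow> g1 p \<le> g2 ((r, 0) + p) + 2 * e" if r: "0 < r" "r \<le> min ra rb" for r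
    proof -
      have "r \<le> ra" "r \<le> rb" using r by auto
      from ra(2)[OF r(1) this(1)] AE_shift[OF rb(2)[OF r(1) this(2)], of "(r, 0)"]
      show ?thesis
      proof eventually_elim
        case (elim p)
        then show ?case using UU e\<theta>(2) by (auto simp: add.commute)
      qed
    qed
    then show ?thesis using ra(1) rb(1) by (intro exI[of _ "min ra rb"]) auto
  qed
  have "AE p in lborel. snd p > \<theta> \<longrightarrow> g1 p \<le> g2 p" if \<theta>: "\<theta> > 0" for \<theta>
  proof -
    define c where "c p = max 0 (min 1 (snd p - \<theta>))" for p :: "real \<times> real"
    have c01: "0 \<le> c p" "c p \<le> 1" "snd p \<le> \<theta> \<Longrightarrow> c p = 0" "snd p > \<theta> \<Longrightarrow> c p > 0" for p
      by (auto simp: c_def)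
    have cc: "continuous_on UNIV c" unfolding c_def by (intro continuous_intros)
    then have [measurable]: "c \<in> borel_measurable borel" by (rule borel_measurable_continuous_onI)
    have R0: "R > 0" by (rule A.R_pos)
    have "AE p in lborel. (g1 p - g2 p) * c p \<le> 0"
    proof (rule AE_nonpos_of_continuous_tests)
      show "\<bar>(g1 p - g2 p) * c p\<bar> \<le> R" for p
      proof -
        have "\<bar>g1 p - g2 p\<bar> \<le> R" using A.g_range[of p] W.g_range[of p] by auto
        then have "\<bar>g1 p - g2 p\<bar> * c p \<le> R * 1" using c01[of p] R0 by (intro mult_mono) auto
        then show ?thesis using c01[of p] by (simp add: abs_mult)
      qed
      fix \<psi> :: "real \<times> real \<Rightarrow> real" and \<rho>
      assume \<psi>: "continuous_on UNIV \<psi>" "\<And>p. 0 \<le> \<psi> p" "\<And>p. norm p > \<rho> \<Longrightarrow> \<psi> p = 0"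
      define k where "k p = c p * \<psi> p" for p
      have k: "continuous_on UNIV k" "\<And>p. 0 \<le> k p" "\<And>p. norm p > \<rho> \<Longrightarrow> k p = 0" "\<And>p. k p \<noteq> 0 \<Longrightarrow> snd p > \<theta>"
        using \<psi> c01 by (auto simp: k_def intro!: continuous_intros cc mult_nonneg_nonneg) (meson not_less)
      have [measurable]: "k \<in> borel_measurable borel" using k by (auto intro!: borel_measurable_continuous_onI)
      have ik: "integrable lborel k"
      proof -
        have "integrable lborel (\<lambda>p. indicator (cball 0 \<rho>) p *\<^sub>R k p)"
          by (rule borel_integrable_compact) (auto intro: continuous_on_subset[OF k(1)])
        moreover have "(\<lambda>p. indicator (cball 0 \<rho>) p *\<^sub>R k p) = k"
          using k(3) by (auto simp: indicator_def fun_eq_iff not_le)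
        ultimately show ?thesis by simp
      qed
      have i1: "integrable lborel (\<lambda>p. g1 p * k p)" "integrable lborel (\<lambda>p. g2 (z + p) * k p)" for z
        by (rule integrable_bounded_mult[OF ik _ A.g_abs] integrable_bounded_mult[OF ik _ W.g_abs], measurable)+
      define I where "I = (LINT p|lborel. k p)"
      have I: "I \<ge> 0" unfolding I_def using k(2) by (intro Bochner_Integration.integral_nonneg)
      have "(LINT p|lborel. g1 p * k p) \<le> (LINT p|lborel. g2 p * k p) + \<eta>" if \<eta>: "\<eta> > 0" for \<eta>
      proof -
        define e where "e = \<eta> / (4 * (I + 1))"
        have e: "e > 0" using \<eta> I by (simp add: e_def)
        have eI: "2 * e * I \<le> \<eta> / 2"
        proof -
          have "2 * e * I \<le> 2 * (e * (I + 1))" using e by simp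
          also have "e * (I + 1) = \<eta> / 4"
          proof -
            have "\<eta> / (4 * S) * S = \<eta> / 4" if "S > 0" for S :: real using that by simp
            then show ?thesis using I unfolding e_def by (metis add_nonneg_pos zero_less_one)
          qed
          finally show ?thesis by simp
        qed
        obtain r0 where r0: "r0 > 0" "\<And>r. 0 < r \<Longrightarrow> r \<le> r0 \<Longrightarrow> AE p in lborel. snd p > \<theta> \<longrightarrow> g1 p \<le> g2 ((r, 0) + p) + 2 * e"
          using step[OF e \<theta>] by blast
        have "\<eta> / 2 > 0" using \<eta> by simp
        obtain d where d: "d > 0" "\<And>z. norm z < d \<Longrightarrow> \<bar>(LINT p|lborel. g2 (z + p) * k p) - (LINT p|lborel. g2 p * k p)\<bar> \<le> \<eta> / 2"
          using integral_shift_continuous[OF W.g_meas W.g_abs k(1) k(3) \<open>\<eta> / 2 > 0\<close>] by blast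
        define r where "r = min r0 (d / 2)"
        have r: "0 < r" "r \<le> r0" "norm (r, 0::real) < d" using r0(1) d(1) by (auto simp: r_def norm_Pair)
        have "(LINT p|lborel. g1 p * k p) \<le> (LINT p|lborel. (g2 ((r, 0) + p) + 2 * e) * k p)"
        proof (rule AE_nonneg_mult_integral_mono[OF i1(1)])
          show "integrable lborel (\<lambda>p. (g2 ((r, 0) + p) + 2 * e) * k p)"
            using Bochner_Integration.integrable_add[OF i1(2) integrable_mult_right[OF ik, of "2 * e"]] by (simp add: distrib_right)
          show "AE p in lborel. k p \<noteq> 0 \<longrightarrow> g1 p \<le> g2 ((r, 0) + p) + 2 * e"
            using r0(2)[OF r(1,2)] by eventually_elim (use k(4) in blast)
        qed (use k in auto)
        also have "\<dots> = (LINT p|lborel. g2 ((r, 0) + p) * k p) + 2 * e * I"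
          using Bochner_Integration.integral_add[OF i1(2)[of "(r,0)"] integrable_mult_right[OF ik, of "2 * e"]]
          by (simp add: distrib_right I_def)
        finally show ?thesis using d(2)[OF r(3)] eI by linarith
      qed
      then have "(LINT p|lborel. g1 p * k p) \<le> (LINT p|lborel. g2 p * k p)" by (rule field_le_epsilon)
      moreover have "(LINT p|lborel. (g1 p - g2 p) * c p * \<psi> p) = (LINT p|lborel. g1 p * k p) - (LINT p|lborel. g2 p * k p)"
        using Bochner_Integration.integral_diff[OF i1(1) i1(2)[of 0]] by (simp add: k_def algebra_simps)
      ultimately show "(LINT p|lborel. (g1 p - g2 p) * c p * \<psi> p) \<le> 0" by simp
    qed measurable
    then show ?thesis
    proof eventually_elim
      case (elim p) then show ?case using c01(4)[of p] by (auto simp: mult_le_0_iff)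
    qed
  qed
  then have "AE p in lborel. \<forall>n. snd p > 1 / real (Suc n) \<longrightarrow> g1 p \<le> g2 p"
    unfolding AE_all_countable by simp
  then show ?thesis
  proof eventually_elim
    case (elim p)
    then show ?case using nat_approx_posE by metis
  qed
qed

lemma entropy_core_unique:
  assumes "entropy_core f b R B g1 r0 C1" and "entropy_core f b R B g2 r0 C2"
  shows "AE p in lborel. snd p > 0 \<longrightarrow> g1 p = g2 p"
  using entropy_core_le[OF assms] entropy_core_le[OF assms(2,1)] by eventually_elim auto

subsection \<open>From Lebesgue to Borel representatives\<close>

text \<open>The bridge between both kinds of representatives. \<open>h\<close> may involve values of
  \<open>v\<close> outside \<open>{0..R}\<close> on a null set and may fail to be Borel;
  completeness of the Lebesgue measure makes it measurable nevertheless.\<close>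

lemma lebesgue_AE_eq_borel:
  fixes h :: "'a::euclidean_space \<Rightarrow> real"
  assumes g: "g \<in> borel_measurable borel" and ae: "AE x in lborel. h x = g x"
  shows "h \<in> borel_measurable lebesgue" "integral\<^sup>L lebesgue h = integral\<^sup>L lborel g"
    "integrable lebesgue h \<longleftrightarrow> integrable lborel g"
proof -
  have gl: "g \<in> borel_measurable lebesgue" using g by (intro measurable_completion) simp
  have ae': "AE x in lebesgue. h x = g x" using ae by (rule AE_completion)
  show h: "h \<in> borel_measurable lebesgue"
  proof (rule measurableI)
    fix A :: "real set" assume A: "A \<in> sets borel"
    show "h -` A \<inter> space lebesgue \<in> sets lebesgue"
    proof (rule completion.in_sets_AE)
      show "g -` A \<inter> space lebesgue \<in> sets lebesgue" using gl A by (rule measurable_sets)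
      show "AE x in lebesgue. (x \<in> g -` A \<inter> space lebesgue) = (x \<in> h -` A \<inter> space lebesgue)"
        using ae' by eventually_elim simp
    qed simp
  qed simp
  have "integral\<^sup>L lebesgue h = integral\<^sup>L lebesgue g" by (rule integral_cong_AE[OF h gl ae'])
  then show "integral\<^sup>L lebesgue h = integral\<^sup>L lborel g" using g by (simp add: integral_completion)
  have "integrable lebesgue h \<longleftrightarrow> integrable lebesgue g" by (rule integrable_cong_AE[OF h gl ae'])
  then show "integrable lebesgue h \<longleftrightarrow> integrable lborel g" using g by (simp add: integrable_completion)
qed

lemma AE_lebesgue_on_iff:
  "S \<in> sets lebesgue \<Longrightarrow> (AE x in lebesgue_on S. P x) \<longleftrightarrow> (AE x in lborel. x \<in> S \<longrightarrow> P x)"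
  by (simp add: AE_restrict_space_iff AE_completion_iff)

lemma half_plane_lebesgue [simp]: "UNIV \<times> {0..} \<in> sets (lebesgue :: (real \<times> real) measure)"
  by (rule sets_completionI_sets) (auto intro!: borel_closed closed_Times)

lemma AE_snd_fst:
  fixes P :: "real \<times> real \<Rightarrow> bool"
  assumes "AE p in lborel. P p"
  shows "AE t in lborel. AE x in lborel. P (x, t)"
proof -
  have "AE p in lborel \<Otimes>\<^sub>M lborel. P p" unfolding lborel_prod by (rule assms)
  then have "AE p in distr (lborel \<Otimes>\<^sub>M lborel) (lborel \<Otimes>\<^sub>M lborel) (\<lambda>(x, y). (y, x)). P p"
    by (subst lborel_pair.distr_pair_swap[symmetric])
  then have "AE p in lborel \<Otimes>\<^sub>M lborel. P (case p of (x, y) \<Rightarrow> (y, x))"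
    by (rule AE_distrD[rotated]) simp
  from lborel_pair.AE_pair[OF this] show ?thesis by simp
qed

section \<open>Data and flux of the Cauchy problem\<close>

locale initial_flux =
  fixes \<rho>0 v :: "real \<Rightarrow> real" and K :: real
  assumes int0: "integrable lebesgue \<rho>0" and Linf0: "Linf \<rho>0"
    and nonneg0: "AE x in lebesgue. 0 \<le> \<rho>0 x"
    and supp0: "compact (ess_support \<rho>0)"
    and mass0: "(LINT x|lebesgue. \<bar>\<rho>0 x\<bar>) = 1"
    and C1v: "C1_on {0..Rbar \<rho>0} v"
    and antiv: "strict_antimono_on {0..Rbar \<rho>0} v"
    and K0: "0 \<le> K"
    and ratio: "\<And>r s. r \<in> {0..Rbar \<rho>0} \<Longrightarrow> s \<in> {0..Rbar \<rho>0} \<Longrightarrow> r \<noteq> s \<Longrightarrow>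
           0 \<le> (r * deriv_within v {0..Rbar \<rho>0} r - s * deriv_within v {0..Rbar \<rho>0} s) / (v r - v s) \<and>
           (r * deriv_within v {0..Rbar \<rho>0} r - s * deriv_within v {0..Rbar \<rho>0} s) / (v r - v s) \<le> K"
begin

definition R :: real where "R = Rbar \<rho>0"

definition v' :: "real \<Rightarrow> real" where "v' = deriv_within v {0..R}"

definition b :: "real \<Rightarrow> real" where "b = deriv_within (flux v) {0..R}"

lemma Linf_abs: "AE x in lborel. \<bar>\<rho>0 x\<bar> \<le> R" and R_nonneg: "0 \<le> R"
proof -
  have ae: "AE x in lborel. ereal \<bar>\<rho>0 x\<bar> \<le> Linf_norm \<rho>0"
    using esssup_AE[of "\<lambda>x. ereal \<bar>\<rho>0 x\<bar>" lebesgue] unfolding AE_completion_iff Linf_norm_def .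
  \<comment> \<open>A single such point shows that the norm is not \<open>- \<infinity>\<close>, so
    that \<open>real_of_ereal\<close> loses nothing.\<close>
  have "\<exists>x. ereal \<bar>\<rho>0 x\<bar> \<le> Linf_norm \<rho>0"
  proof (rule ccontr)
    assume "\<nexists>x. ereal \<bar>\<rho>0 x\<bar> \<le> Linf_norm \<rho>0"
    with ae have "AE x::real in lborel. False" by simp
    then have "emeasure lborel (UNIV :: real set) = 0" using AE_iff_null_sets[of UNIV lborel] by (auto simp: null_sets_def)
    then show False by simp
  qed
  then obtain x where "ereal \<bar>\<rho>0 x\<bar> \<le> Linf_norm \<rho>0" by blast
  moreover have "0 \<le> ereal \<bar>\<rho>0 x\<bar>" by simp
  ultimately have "0 \<le> Linf_norm \<rho>0" by (rule order_trans[rotated])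
  moreover have "Linf_norm \<rho>0 < \<infinity>" using Linf0 by (simp add: Linf_def)
  ultimately have eq: "Linf_norm \<rho>0 = ereal R" and "0 \<le> R"
    unfolding R_def Rbar_def by (cases "Linf_norm \<rho>0"; simp)+
  show "AE x in lborel. \<bar>\<rho>0 x\<bar> \<le> R" using ae unfolding eq by simp
  show "0 \<le> R" by fact
qed

lemma R_gt_0: "R > 0"
proof (rule ccontr)
  assume "\<not> R > 0"
  then have "R = 0" using R_nonneg by simp
  then have "AE x in lborel. \<bar>\<rho>0 x\<bar> = 0" using Linf_abs by simp
  then have "(LINT x|lebesgue. \<bar>\<rho>0 x\<bar>) = (LINT x|lborel. 0::real)"
    using lebesgue_AE_eq_borel(2)[of "\<lambda>_. 0" "\<lambda>x. \<bar>\<rho>0 x\<bar>"] by simp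
  then show False using mass0 by simp
qed

text \<open>A Lebesgue measurable function agrees almost everywhere with a Borel one; clamping
  brings all values of the latter into \<open>{0..R}\<close>.\<close>

lemma r0_exists: "\<exists>r0. integrable lborel r0 \<and> (\<forall>x. r0 x \<in> {0..R}) \<and> (AE x in lborel. \<rho>0 x = r0 x)"
proof -
  obtain g where g: "g \<in> borel_measurable lborel" "AE x in lborel. \<rho>0 x = g x"
    using completion_ex_borel_measurable_real[OF borel_measurable_integrable[OF int0]] by auto
  define r0 where "r0 x = max 0 (min R (g x))" for x
  have [measurable]: "r0 \<in> borel_measurable borel" using g(1) unfolding r0_def[abs_def] by simp
  have nn: "AE x in lborel. 0 \<le> \<rho>0 x" using nonneg0 by (simp add: AE_completion_iff)
  have ae: "AE x in lborel. \<rho>0 x = r0 x"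
    using g(2) nn Linf_abs by eventually_elim (auto simp: r0_def)
  have "integrable lborel r0" using lebesgue_AE_eq_borel(3)[OF _ ae] int0 by simp
  moreover have "r0 x \<in> {0..R}" for x using R_nonneg by (auto simp: r0_def)
  ultimately show ?thesis using ae by blast
qed

definition r0 :: "real \<Rightarrow> real" where
  "r0 = (SOME r0. integrable lborel r0 \<and> (\<forall>x. r0 x \<in> {0..R}) \<and> (AE x in lborel. \<rho>0 x = r0 x))"

lemma r0: "integrable lborel r0" "r0 x \<in> {0..R}" "AE x in lborel. \<rho>0 x = r0 x"
  using someI_ex[OF r0_exists] by (auto simp: r0_def)

lemma r0_measurable [measurable]: "r0 \<in> borel_measurable borel"
  using r0(1) borel_measurable_integrable by fastforce

lemma r0_mass: "(LINT x|lborel. r0 x) = 1"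
proof -
  have "AE x in lborel. \<bar>\<rho>0 x\<bar> = r0 x" using r0(3) by eventually_elim (use r0(2) in auto)
  from lebesgue_AE_eq_borel(2)[OF r0_measurable this] mass0 show ?thesis by simp
qed

lemma v_deriv: "r \<in> {0..R} \<Longrightarrow> (v has_real_derivative v' r) (at r within {0..R})"
  using C1v unfolding C1_on_def v'_def R_def
  by (simp add: has_real_derivative_iff_has_vector_derivative vector_derivative_works[symmetric])

lemma v'_cont: "continuous_on {0..R} v'"
  using C1v unfolding C1_on_def v'_def R_def by simp

lemma v_cont: "continuous_on {0..R} v"
  using v_deriv by (meson DERIV_continuous continuous_on_eq_continuous_within)

lemma v_anti: "r \<in> {0..R} \<Longrightarrow> s \<in> {0..R} \<Longrightarrow> r < s \<Longrightarrow> v s < v r"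
  using antiv unfolding R_def monotone_on_def by blast

lemma v_anti_le: "r \<in> {0..R} \<Longrightarrow> s \<in> {0..R} \<Longrightarrow> r \<le> s \<Longrightarrow> v s \<le> v r"
  using v_anti[of r s] by (cases "r = s") auto

lemma v_le_iff: "r \<in> {0..R} \<Longrightarrow> s \<in> {0..R} \<Longrightarrow> v s \<le> v r \<longleftrightarrow> r \<le> s"
  using v_anti_le[of r s] v_anti[of s r] by (meson leD leI)

lemma flux_deriv: "r \<in> {0..R} \<Longrightarrow> (flux v has_real_derivative v r + r * v' r) (at r within {0..R})"
  unfolding flux_def[abs_def] using v_deriv by (auto intro!: derivative_eq_intros)

lemma b_eq: "r \<in> {0..R} \<Longrightarrow> b r = v r + r * v' r"
  unfolding b_def using flux_deriv[of r] R_gt_0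
  by (auto simp: has_real_derivative_iff_has_vector_derivative intro!: vector_derivative_within_closed_interval)

text \<open>The two halves of the quotient hypothesis. The lower bound makes \<open>r * v' r\<close>
  nonincreasing, which drives the maximum principle and the strict decrease of \<open>f'\<close>;
  the upper bound serves to pass from increments of \<open>v\<close> to increments of
  \<open>f'\<close>.\<close>

lemma phi_diff:
  assumes "r \<in> {0..R}" "s \<in> {0..R}" "r \<le> s"
  shows "s * v' s \<le> r * v' r" "r * v' r - s * v' s \<le> K * (v r - v s)"
proof -
  have "s * v' s \<le> r * v' r \<and> r * v' r - s * v' s \<le> K * (v r - v s)"
  proof (cases "r = s")
    case False
    then have "v r - v s > 0" using v_anti assms by simp
    moreover have "0 \<le> (r * v' r - s * v' s) / (v r - v s)" "(r * v' r - s * v' s) / (v r - v s) \<le> K"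
      using ratio[of r s] assms False unfolding v'_def R_def by auto
    ultimately show ?thesis by (simp add: zero_le_divide_iff divide_le_eq)
  qed simp
  then show "s * v' s \<le> r * v' r" "r * v' r - s * v' s \<le> K * (v r - v s)" by auto
qed

lemma phi_nonpos: "r \<in> {0..R} \<Longrightarrow> r * v' r \<le> 0"
  using phi_diff(1)[of 0 r] R_nonneg by simp

text \<open>\<open>f' = v + r * v'\<close>, and the second summand grows by at most \<open>K\<close>
  times the growth of \<open>v\<close>; this is the origin of \<open>1 + K\<close>. For
  \<open>r > s\<close> both summands decrease, and the maximum with \<open>0\<close> covers the
  sign.\<close>

lemma b_diff_le:
  assumes "r \<in> {0..R}" "s \<in> {0..R}"
  shows "b r - b s \<le> (1 + K) * max 0 (v r - v s)"
proof (cases "r \<le> s")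
  case True
  then show ?thesis using phi_diff(2)[OF assms] v_anti_le[OF assms] b_eq assms K0
    by (simp add: max_def algebra_simps)
next
  case False
  then have "b r - b s \<le> 0" using phi_diff(1)[of s r] v_anti[of s r] b_eq assms by auto
  also have "0 \<le> (1 + K) * max 0 (v r - v s)" using K0 by simp
  finally show ?thesis .
qed

lemma b_cont: "continuous_on {0..R} b"
proof -
  have "continuous_on {0..R} (\<lambda>r. v r + r * v' r)" by (intro continuous_intros v_cont v'_cont)
  then show ?thesis using b_eq continuous_on_cong by (metis (no_types, lifting))
qed

definition B :: real where "B = (SUP r\<in>{0..R}. \<bar>b r\<bar>)"

lemma flux_fun: "flux_fun (flux v) b R B"
proof
  show "R > 0" by (rule R_gt_0)
  show "continuous_on {0..R} b" by (rule b_cont)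
  show anti: "b s < b r" if "r \<in> {0..R}" "s \<in> {0..R}" "r < s" for r s
    using phi_diff(1)[of r s] v_anti[of r s] b_eq that by simp
  have "bounded ((\<lambda>r. \<bar>b r\<bar>) ` {0..R})"
    by (intro compact_imp_bounded compact_continuous_image continuous_intros b_cont) auto
  then show "\<bar>b r\<bar> \<le> B" if "r \<in> {0..R}" for r
    unfolding B_def using that bounded_imp_bdd_above by (intro cSUP_upper)
  have mvt: "\<exists>z\<in>{x<..<y}. flux v y - flux v x = b z * (y - x)" if "x \<in> {0..R}" "y \<in> {0..R}" "x < y" for x y
  proof (rule mvt_simple[OF that(3)])
    fix z assume z: "x \<le> z" "z \<le> y"
    have "(flux v has_real_derivative b z) (at z within {0..R})"
      using flux_deriv[of z] b_eq[of z] z that by simp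
    then have "(flux v has_real_derivative b z) (at z within {x..y})"
      by (rule DERIV_subset) (use that in auto)
    then show "(flux v has_derivative (*) (b z)) (at z within {x..y})" by (simp add: has_field_derivative_def)
  qed
  show "flux v r \<le> flux v s + b s * (r - s)" if rs: "r \<in> {0..R}" "s \<in> {0..R}" for r s
  proof (cases r s rule: linorder_cases)
    case less
    then obtain z where z: "z \<in> {r<..<s}" "flux v s - flux v r = b z * (s - r)" using mvt[of r s] rs by blast
    have "b s \<le> b z" using anti[of z s] z rs by auto
    then have "b s * (s - r) \<le> b z * (s - r)" using less by (intro mult_right_mono) auto
    then show ?thesis using z by (simp add: algebra_simps)
  next
    case greater
    then obtain z where z: "z \<in> {s<..<r}" "flux v r - flux v s = b z * (r - s)" using mvt[of s r] rs by blast
    have "b z \<le> b s" using anti[of s z] z rs by auto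
    then have "b z * (r - s) \<le> b s * (r - s)" using greater by (intro mult_right_mono) auto
    then show ?thesis using z by (simp add: algebra_simps)
  qed simp
qed

text \<open>The representative is Borel, clamped to \<open>{0..R}\<close>, and agrees with
  \<open>\<sigma>\<close> almost everywhere at nonnegative times. Test functions and their
  derivatives vanish at times \<open>t \<le> 0\<close>, so integrals over the half plane are
  integrals over the plane.\<close>

lemma entropy_solution_core:
  assumes "extended_entropy_solution v \<rho>0 \<sigma>"
  shows "\<exists>g C. entropy_core (flux v) b R B g r0 C \<and> (AE p in lborel. snd p \<ge> 0 \<longrightarrow> \<sigma> (fst p) (snd p) = g p)"
proof -
  interpret F: flux_fun "flux v" b R B by (rule flux_fun)
  have LT: "Linf_time_L1_Linf \<sigma>" and rng: "AE (x, t) in lebesgue_on (UNIV \<times> {0..}). \<sigma> x t \<in> {0..R}"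
    and wk: "weak_solution (flux v) \<sigma>" and ini: "attains_initial_datum \<rho>0 \<sigma>"
    and os: "one_sided_estimate b \<sigma>"
    using assms unfolding extended_entropy_solution_def R_def b_def by auto
  have "(\<lambda>(x, t). \<sigma> x t) \<in> borel_measurable (lebesgue_on (UNIV \<times> {0..}))"
    using LT by (simp add: Linf_time_L1_Linf_def)
  then have "(\<lambda>p. if p \<in> UNIV \<times> {0..} then (\<lambda>(x, t). \<sigma> x t) p else 0) \<in> borel_measurable lebesgue"
    by (rule borel_measurable_if_I) simp
  then obtain g1 where g1: "g1 \<in> borel_measurable lborel" 
      "AE p in lborel. (if p \<in> UNIV \<times> {0..} then (\<lambda>(x, t). \<sigma> x t) p else 0) = g1 p"
    using completion_ex_borel_measurable_real by blast
  define g where "g p = max 0 (min R (g1 p))" for p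
  have g_meas [measurable]: "g \<in> borel_measurable borel" using g1(1) unfolding g_def[abs_def] by simp
  have g_range: "g p \<in> {0..R}" for p using R_nonneg by (auto simp: g_def)
  have rng': "AE p in lborel. p \<in> UNIV \<times> {0..} \<longrightarrow> (case p of (x, t) \<Rightarrow> \<sigma> x t \<in> {0..R})"
    using rng by (simp add: AE_lebesgue_on_iff)
  have ae: "AE p in lborel. snd p \<ge> 0 \<longrightarrow> \<sigma> (fst p) (snd p) = g p"
    using g1(2) rng' by eventually_elim (auto simp: g_def case_prod_unfold mem_Times_iff)
  obtain C where C: "C \<ge> 1" and os': "\<And>\<phi>. test_function \<phi> \<Longrightarrow> (\<And>p. 0 \<le> \<phi> p) \<Longrightarrow>
        (LINT (x, t):UNIV \<times> {0<..}|lebesgue. b (\<sigma> x t) * dx \<phi> x t)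
          \<ge> - (LINT (x, t):UNIV \<times> {0<..}|lebesgue. C / t * \<phi> (x, t))"
    using os unfolding one_sided_estimate_def by blast
  have [measurable]: "(\<lambda>p. flux v (g p)) \<in> borel_measurable borel" "(\<lambda>p. b (g p)) \<in> borel_measurable borel"
    by (rule F.comp_measurable[OF F.f_cont g_meas g_range] F.comp_measurable[OF b_cont g_meas g_range])+
  have "entropy_core (flux v) b R B g r0 C"
  proof
    show "g \<in> borel_measurable borel" by (rule g_meas)
    show "g p \<in> {0..R}" for p by (rule g_range)
    show "C \<ge> 0" using C by simp
    show "integrable lborel r0" "r0 x \<in> {0..R}" for x by (rule r0)+
  next
    fix \<alpha> \<beta> \<alpha>' \<beta>' :: "real \<Rightarrow> real" and xlo xhi tlo thi :: real
    assume sm: "smooth \<alpha>" "smooth \<beta>" and D: "\<And>x. (\<alpha> has_real_derivative \<alpha>' x) (at x)" "\<And>t. (\<beta> has_real_derivative \<beta>' t) (at t)"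
      and supp: "\<And>x. x \<notin> {xlo..xhi} \<Longrightarrow> \<alpha> x = 0" "\<And>t. t \<notin> {tlo..thi} \<Longrightarrow> \<beta> t = 0" and tlo: "tlo > 0"
    have tf: "test_function (\<lambda>p. \<alpha> (fst p) * \<beta> (snd p))" by (rule test_function_tensor[OF sm supp tlo])
    have [measurable]: "\<alpha> \<in> borel_measurable borel" "\<alpha>' \<in> borel_measurable borel" "\<beta> \<in> borel_measurable borel" "\<beta>' \<in> borel_measurable borel"
      using smooth_imp_continuous sm smooth_DERIV D by (auto intro!: borel_measurable_continuous_onI)
    have b0: "\<beta> t = 0" "\<beta>' t = 0" if "t \<le> 0" for t
    proof -
      show "\<beta> t = 0" using supp(2) that tlo by auto
      have "((\<lambda>_. 0::real) has_real_derivative 0) (at t)" by simp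
      then have "(\<beta> has_real_derivative 0) (at t)"
        by (rule has_field_derivative_transform_within_open[where S="{..<tlo}"]) (use that tlo supp(2) in auto)
      then show "\<beta>' t = 0" using D(2) DERIV_unique by blast
    qed
    have "(LINT p|lborel. g p * (\<alpha> (fst p) * \<beta>' (snd p)) + flux v (g p) * (\<alpha>' (fst p) * \<beta> (snd p))) =
       (LINT (x, t):UNIV \<times> {0<..}|lebesgue. \<sigma> x t * dt (\<lambda>p. \<alpha> (fst p) * \<beta> (snd p)) x t + flux v (\<sigma> x t) * dx (\<lambda>p. \<alpha> (fst p) * \<beta> (snd p)) x t)"
      unfolding set_lebesgue_integral_def dt_tensor[where h=\<beta>, OF D(2)] dx_tensor[where g=\<alpha>, OF D(1)]
    proof (rule lebesgue_AE_eq_borel(2)[symmetric])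
      show "AE p in lborel. indicator (UNIV \<times> {0<..}) p *\<^sub>R (case p of (x, t) \<Rightarrow> \<sigma> x t * (\<alpha> x * \<beta>' t) + flux v (\<sigma> x t) * (\<alpha>' x * \<beta> t)) =
          g p * (\<alpha> (fst p) * \<beta>' (snd p)) + flux v (g p) * (\<alpha>' (fst p) * \<beta> (snd p))"
        using ae by eventually_elim (auto simp: indicator_def case_prod_unfold mem_Times_iff b0 not_less)
    qed measurable
    also have "\<dots> = 0" using wk tf unfolding weak_solution_def by blast
    finally show "(LINT p|lborel. g p * (\<alpha> (fst p) * \<beta>' (snd p)) + flux v (g p) * (\<alpha>' (fst p) * \<beta> (snd p))) = 0" .
  next
    fix \<alpha> \<beta> \<alpha>' :: "real \<Rightarrow> real" and xlo xhi tlo thi :: real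
    assume sm: "smooth \<alpha>" "smooth \<beta>" and D: "\<And>x. (\<alpha> has_real_derivative \<alpha>' x) (at x)"
      and nn: "\<And>x. \<alpha> x \<ge> 0" "\<And>t. \<beta> t \<ge> 0"
      and supp: "\<And>x. x \<notin> {xlo..xhi} \<Longrightarrow> \<alpha> x = 0" "\<And>t. t \<notin> {tlo..thi} \<Longrightarrow> \<beta> t = 0" and tlo: "tlo > 0"
    have tf: "test_function (\<lambda>p. \<alpha> (fst p) * \<beta> (snd p))" by (rule test_function_tensor[OF sm supp tlo])
    have [measurable]: "\<alpha> \<in> borel_measurable borel" "\<alpha>' \<in> borel_measurable borel" "\<beta> \<in> borel_measurable borel"
      using smooth_imp_continuous sm smooth_DERIV D by (auto intro!: borel_measurable_continuous_onI)
    have b0: "\<beta> t = 0" if "t \<le> 0" for t using supp(2) that tlo by auto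
    have "(LINT p|lborel. b (g p) * (\<alpha>' (fst p) * \<beta> (snd p))) =
       (LINT (x, t):UNIV \<times> {0<..}|lebesgue. b (\<sigma> x t) * dx (\<lambda>p. \<alpha> (fst p) * \<beta> (snd p)) x t)"
      unfolding set_lebesgue_integral_def dx_tensor[where g=\<alpha>, OF D(1)]
    proof (rule lebesgue_AE_eq_borel(2)[symmetric])
      show "AE p in lborel. indicator (UNIV \<times> {0<..}) p *\<^sub>R (case p of (x, t) \<Rightarrow> b (\<sigma> x t) * (\<alpha>' x * \<beta> t)) =
          b (g p) * (\<alpha>' (fst p) * \<beta> (snd p))"
        using ae by eventually_elim (auto simp: indicator_def case_prod_unfold mem_Times_iff b0 not_less)
    qed measurable
    moreover have "(LINT p|lborel. C / snd p * (\<alpha> (fst p) * \<beta> (snd p))) =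
       (LINT (x, t):UNIV \<times> {0<..}|lebesgue. C / t * (\<lambda>p. \<alpha> (fst p) * \<beta> (snd p)) (x, t))"
      unfolding set_lebesgue_integral_def
    proof (rule lebesgue_AE_eq_borel(2)[symmetric])
      show "AE p in lborel. indicator (UNIV \<times> {0<..}) p *\<^sub>R (case p of (x, t) \<Rightarrow> C / t * (\<lambda>p. \<alpha> (fst p) * \<beta> (snd p)) (x, t)) =
          C / snd p * (\<alpha> (fst p) * \<beta> (snd p))"
        by (rule AE_I2) (auto simp: indicator_def case_prod_unfold mem_Times_iff b0 not_less)
    qed measurable
    ultimately show "(LINT p|lborel. b (g p) * (\<alpha>' (fst p) * \<beta> (snd p))) \<ge> - (LINT p|lborel. C / snd p * (\<alpha> (fst p) * \<beta> (snd p)))"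
      using os'[OF tf] nn by simp
  next
    fix e :: real assume e: "e > 0"
    obtain s where s: "AE t in lebesgue_on {0..}. AE x in lebesgue. s x t = \<sigma> x t"
      "\<And>t. t > 0 \<Longrightarrow> integrable lebesgue (\<lambda>x. s x t)"
      "((\<lambda>t. LINT x|lebesgue. \<bar>s x t - \<rho>0 x\<bar>) \<longlongrightarrow> 0) (at_right 0)"
      using ini unfolding attains_initial_datum_def by blast
    have "\<forall>\<^sub>F t in at_right 0. (LINT x|lebesgue. \<bar>s x t - \<rho>0 x\<bar>) < e" by (rule order_tendstoD(2)[OF s(3) e])
    then obtain d where d: "d > 0" "\<And>t. 0 < t \<Longrightarrow> t < d \<Longrightarrow> (LINT x|lebesgue. \<bar>s x t - \<rho>0 x\<bar>) < e"
      unfolding eventually_at_right_field by blast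
    have s1: "AE t in lborel. t \<in> {0..} \<longrightarrow> (AE x in lborel. s x t = \<sigma> x t)"
      using s(1) by (simp add: AE_lebesgue_on_iff AE_completion_iff)
    \<comment> \<open>Fubini transfers the joint almost everywhere identity to almost every time
      slice, where it meets the representative \<open>s\<close> in time.\<close>
    have "AE t in lborel. 0 < t \<and> t < d \<longrightarrow> integrable lborel (\<lambda>x. g (x, t)) \<and> (LINT x|lborel. \<bar>g (x, t) - r0 x\<bar>) \<le> e"
      using s1 AE_snd_fst[OF ae]
    proof eventually_elim
      case (elim t)
      show ?case
      proof
        assume t: "0 < t \<and> t < d"
        have 1: "AE x in lborel. s x t = \<sigma> x t" and 2: "AE x in lborel. \<sigma> x t = g (x, t)" using elim t by auto
        have eq: "AE x in lborel. s x t = g (x, t)" using 1 2 by eventually_elim simp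
        have eq2: "AE x in lborel. \<bar>s x t - \<rho>0 x\<bar> = \<bar>g (x, t) - r0 x\<bar>" using eq r0(3) by eventually_elim simp
        have "integrable lborel (\<lambda>x. g (x, t))" using lebesgue_AE_eq_borel(3)[OF _ eq] s(2) t by simp
        moreover have "(LINT x|lborel. \<bar>g (x, t) - r0 x\<bar>) < e"
          using lebesgue_AE_eq_borel(2)[OF _ eq2] d(2)[of t] t by simp
        ultimately show "integrable lborel (\<lambda>x. g (x, t)) \<and> (LINT x|lborel. \<bar>g (x, t) - r0 x\<bar>) \<le> e" by simp
      qed
    qed
    then show "\<exists>d>0. AE s in lborel. 0 < s \<and> s < d \<longrightarrow>
       integrable lborel (\<lambda>x. g (x, s)) \<and> (LINT x|lborel. \<bar>g (x, s) - r0 x\<bar>) \<le> e" using d(1) by blast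
  qed
  then show ?thesis using ae by blast
qed

lemma AE_snd_neq_0: "AE p::real\<times>real in lborel. snd p \<noteq> 0"
proof -
  have "{p::real\<times>real. snd p = 0} = UNIV \<times> {0}" by auto
  moreover have "emeasure (lborel \<Otimes>\<^sub>M lborel) ((UNIV::real set) \<times> {0::real}) = emeasure lborel (UNIV::real set) * emeasure lborel {0::real}"
    by (rule lborel.emeasure_pair_measure_Times) auto
  ultimately have "{p::real\<times>real. snd p = 0} \<in> null_sets lborel"
    by (auto simp: null_sets_def lborel_prod intro!: borel_closed closed_Times)
  then show ?thesis using AE_not_in by fastforce
qed

lemma entropy_solution_unique:
  assumes "extended_entropy_solution v \<rho>0 \<sigma>" "extended_entropy_solution v \<rho>0 \<rho>"
  shows "AE (x, t) in lebesgue_on (UNIV \<times> {0..}). \<sigma> x t = \<rho> x t"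
proof -
  obtain g1 C1 where 1: "entropy_core (flux v) b R B g1 r0 C1" "AE p in lborel. snd p \<ge> 0 \<longrightarrow> \<sigma> (fst p) (snd p) = g1 p"
    using entropy_solution_core[OF assms(1)] by blast
  obtain g2 C2 where 2: "entropy_core (flux v) b R B g2 r0 C2" "AE p in lborel. snd p \<ge> 0 \<longrightarrow> \<rho> (fst p) (snd p) = g2 p"
    using entropy_solution_core[OF assms(2)] by blast
  have "AE p in lborel. p \<in> UNIV \<times> {0..} \<longrightarrow> \<sigma> (fst p) (snd p) = \<rho> (fst p) (snd p)"
    using 1(2) 2(2) entropy_core_unique[OF 1(1) 2(1)] AE_snd_neq_0
    by eventually_elim (auto simp: mem_Times_iff)
  then show ?thesis by (simp add: AE_lebesgue_on_iff case_prod_unfold)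
qed

end

subsection \<open>The initial particle positions\<close>

context initial_flux
begin

definition V :: real where "V = max \<bar>v 0\<bar> \<bar>v R\<bar>"

lemma v_bound: "r \<in> {0..R} \<Longrightarrow> \<bar>v r\<bar> \<le> V"
  using v_anti_le[of 0 r] v_anti_le[of r R] R_nonneg by (auto simp: V_def)

lemma V_nonneg: "0 \<le> V" by (simp add: V_def)

text \<open>The complement of the support is an arbitrary union of open sets on which the datum
  vanishes almost everywhere; by Lindelof a countable union suffices.\<close>

lemma AE_outside_support: "AE y in lborel. y \<notin> ess_support \<rho>0 \<longrightarrow> r0 y = 0"
proof -
  define \<U> where "\<U> = {U. open U \<and> (AE x in lebesgue. x \<in> U \<longrightarrow> \<rho>0 x = 0)}"
  obtain \<V> where \<V>: "\<V> \<subseteq> \<U>" "countable \<V>" "\<Union>\<V> = \<Union>\<U>"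
    using Lindelof[of \<U>] by (auto simp: \<U>_def)
  have "AE x in lborel. \<forall>U\<in>\<V>. x \<in> U \<longrightarrow> \<rho>0 x = 0"
    using \<V> by (subst AE_ball_countable) (auto simp: \<U>_def AE_completion_iff)
  with r0(3) show ?thesis
  proof eventually_elim
    case (elim y)
    show ?case
    proof
      assume "y \<notin> ess_support \<rho>0"
      then have "y \<in> \<Union>\<V>" unfolding ess_support_def \<V>(3) \<U>_def by auto
      then show "r0 y = 0" using elim by auto
    qed
  qed
qed

lemma ess_support_nonempty: "ess_support \<rho>0 \<noteq> {}"
proof
  assume "ess_support \<rho>0 = {}"
  then have "AE y in lborel. r0 y = 0" using AE_outside_support by simp
  then have "(LINT y|lborel. r0 y) = 0" by (simp add: integral_eq_zero_AE)
  then show False using r0_mass by simp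
qed

definition xl :: real where "xl = x_min \<rho>0"
definition xr :: real where "xr = x_max \<rho>0"

lemma support_bounds: "ess_support \<rho>0 \<subseteq> {xl..xr}" "xl \<le> xr"
proof -
  have "compact (convex hull (ess_support \<rho>0))" by (rule compact_convex_hull[OF supp0])
  then have "bounded (convex hull (ess_support \<rho>0))" by (rule compact_imp_bounded)
  then have bd: "bdd_below (convex hull (ess_support \<rho>0))" "bdd_above (convex hull (ess_support \<rho>0))"
    by (rule bounded_imp_bdd_below, rule bounded_imp_bdd_above)
  have "y \<in> {xl..xr}" if "y \<in> ess_support \<rho>0" for y
    using hull_inc[OF that, of convex] bd
    by (auto simp: xl_def xr_def x_min_def x_max_def intro: cInf_lower cSup_upper)
  note * = this
  show "ess_support \<rho>0 \<subseteq> {xl..xr}" using * by blast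
  obtain y where "y \<in> ess_support \<rho>0" using ess_support_nonempty by blast
  from *[OF this] show "xl \<le> xr" by simp
qed

lemma AE_r0_outside: "AE y in lborel. y \<notin> {xl..xr} \<longrightarrow> r0 y = 0"
  using AE_outside_support by eventually_elim (use support_bounds in auto)

definition m0 :: "real \<Rightarrow> real" where "m0 y = (LINT z|lborel. r0 z * indicator {..y} z)"

lemma r0_mult_indicator: "A \<in> sets borel \<Longrightarrow> integrable lborel (\<lambda>z. r0 z * indicator A z)"
  using integrable_mult_indicator[OF _ r0(1), of A] by (simp add: mult.commute)

lemma m0_diff: "a \<le> y \<Longrightarrow> m0 y - m0 a = (LINT z|lborel. r0 z * indicator {a<..y} z)"
proof -
  assume "a \<le> y"
  have "m0 y - m0 a = (LINT z|lborel. r0 z * indicator {..y} z - r0 z * indicator {..a} z)"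
    unfolding m0_def by (rule Bochner_Integration.integral_diff[symmetric]) (auto intro!: r0_mult_indicator)
  also have "\<dots> = (LINT z|lborel. r0 z * indicator {a<..y} z)"
    using \<open>a \<le> y\<close> by (intro Bochner_Integration.integral_cong) (auto simp: indicator_def)
  finally show ?thesis .
qed

lemma m0_Lipschitz:
  assumes "a \<le> y" shows "0 \<le> m0 y - m0 a" "m0 y - m0 a \<le> R * (y - a)"
proof -
  show "0 \<le> m0 y - m0 a" unfolding m0_diff[OF assms]
    using r0(2) by (intro Bochner_Integration.integral_nonneg) auto
  have "integrable lborel (indicator {a<..y} :: real \<Rightarrow> real)"
    by (rule integrable_real_indicator) (use assms in auto)
  then have "m0 y - m0 a \<le> (LINT z|lborel. R * indicator {a<..y} z)" unfolding m0_diff[OF assms]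
    using r0(2) by (intro Bochner_Integration.integral_mono r0_mult_indicator integrable_mult_right)
      (auto intro!: mult_right_mono)
  then show "m0 y - m0 a \<le> R * (y - a)" using assms by simp
qed

lemma m0_mono: "a \<le> y \<Longrightarrow> m0 a \<le> m0 y" using m0_Lipschitz(1) by fastforce

lemma m0_left: "y \<le> xl \<Longrightarrow> m0 y = 0"
proof -
  assume y: "y \<le> xl"
  have "AE z in lborel. z \<noteq> xl" by (rule AE_lborel_singleton)
  then have "AE z in lborel. r0 z * indicator {..y} z = 0"
    using AE_r0_outside by eventually_elim (use y in \<open>auto simp: indicator_def\<close>)
  then show ?thesis unfolding m0_def by (simp add: integral_eq_zero_AE)
qed

lemma m0_right: "xr \<le> y \<Longrightarrow> m0 y = 1"
proof -
  assume y: "xr \<le> y"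
  have "m0 y = (LINT z|lborel. r0 z)"
    unfolding m0_def
  proof (rule integral_cong_AE)
    show "AE z in lborel. r0 z * indicator {..y} z = r0 z"
      using AE_r0_outside by eventually_elim (use y in \<open>auto simp: indicator_def\<close>)
  qed measurable
  then show ?thesis by (simp add: r0_mass)
qed

text \<open>Valid also for \<open>x < a\<close>, where the interval integral changes sign. Hence the
  set in the recursion for the initial positions is a full sublevel set of \<open>m0\<close>,
  including everything left of the previous particle.\<close>

lemma interval_integral_m0: "(LINT y=ereal a..ereal x|lebesgue. \<rho>0 y) = m0 x - m0 a"
proof -
  have *: "(LINT y=ereal a..ereal x|lebesgue. \<rho>0 y) = m0 x - m0 a" if "a \<le> x" for a x
  proof -
    have "(LINT y=ereal a..ereal x|lebesgue. \<rho>0 y) = (LINT y|lebesgue. indicator {a<..<x} y *\<^sub>R \<rho>0 y)"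
      using that by (simp add: interval_lebesgue_integral_def set_lebesgue_integral_def)
    also have "\<dots> = (LINT y|lborel. indicator {a<..<x} y * r0 y)"
      by (rule lebesgue_AE_eq_borel(2)) (use r0(3) in \<open>auto elim!: eventually_mono\<close>)
    also have "\<dots> = (LINT y|lborel. r0 y * indicator {a<..x} y)"
    proof (rule integral_cong_AE)
      show "AE y in lborel. indicator {a<..<x} y * r0 y = r0 y * indicator {a<..x} y"
        using AE_lborel_singleton[of x] by eventually_elim (auto simp: indicator_def)
    qed measurable
    finally show ?thesis by (simp add: m0_diff[OF that])
  qed
  show ?thesis
  proof (cases "a \<le> x")
    case False
    then have "(LINT y=ereal a..ereal x|lebesgue. \<rho>0 y) = - (LINT y=ereal x..ereal a|lebesgue. \<rho>0 y)"
      by (simp add: interval_lebesgue_integral_def)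
    then show ?thesis using *[of x a] False by simp
  qed (rule *)
qed

text \<open>\<open>m0\<close> is nondecreasing and Lipschitz, so the supremum of a sublevel set
  attains the level; \<open>c \<le> 1\<close> bounds the set by \<open>xr\<close>, and
  \<open>0 < c\<close> makes it nonempty.\<close>

lemma m0_Sup:
  assumes "0 < c" "c \<le> 1"
  shows "m0 (Sup {x. m0 x < c}) = c"
proof -
  define S where "S = {x. m0 x < c}"
  have "xl \<in> S" using m0_left[of xl] assms by (simp add: S_def)
  then have ne: "S \<noteq> {}" by blast
  have ub: "x \<le> xr" if "x \<in> S" for x using m0_right[of x] that assms by (auto simp: S_def intro: ccontr)
  then have bdd: "bdd_above S" by (auto simp: bdd_above_def)
  have "m0 (Sup S) \<le> c"
  proof (rule field_le_epsilon)
    fix e :: real assume e: "e > 0"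
    obtain y where y: "y \<in> S" "Sup S - e / R < y"
      using less_cSup_iff[OF ne bdd, of "Sup S - e / R"] e R_gt_0 by auto
    have "y \<le> Sup S" using y bdd by (intro cSup_upper)
    then have "m0 (Sup S) - m0 y \<le> R * (Sup S - y)" by (rule m0_Lipschitz)
    also have "\<dots> \<le> R * (e / R)" using y R_gt_0 by (intro mult_left_mono) auto
    finally show "m0 (Sup S) \<le> c + e" using y R_gt_0 by (simp add: S_def)
  qed
  moreover have "c \<le> m0 (Sup S)"
  proof (rule ccontr)
    assume "\<not> c \<le> m0 (Sup S)"
    define h where "h = (c - m0 (Sup S)) / (2 * R)"
    have h: "h > 0" using \<open>\<not> c \<le> m0 (Sup S)\<close> R_gt_0 by (simp add: h_def)
    have "m0 (Sup S + h) - m0 (Sup S) \<le> R * h" using m0_Lipschitz(2)[of "Sup S" "Sup S + h"] h by simp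
    also have "\<dots> = (c - m0 (Sup S)) / 2" using R_gt_0 by (simp add: h_def)
    finally have "m0 (Sup S + h) < c" using \<open>\<not> c \<le> m0 (Sup S)\<close> by (simp add: field_simps)
    then have "Sup S + h \<le> Sup S" using bdd by (intro cSup_upper) (auto simp: S_def)
    then show False using h by simp
  qed
  ultimately show ?thesis by (simp add: S_def)
qed

lemma m0_initial_position:
  assumes "1 \<le> n" "i \<le> n"
  shows "m0 (initial_position \<rho>0 n i) = real i / real n"
  using assms(2)
proof (induction i)
  case 0
  then show ?case using m0_left[of xl] by (simp add: xl_def)
next
  case (Suc i)
  show ?case
  proof (cases "Suc i = n")
    case True
    then have "initial_position \<rho>0 n (Suc i) = xr"
      unfolding initial_position.simps xr_def by (rule if_P)
    then show ?thesis using m0_right[of xr] assms True by simp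
  next
    case False
    have IH: "m0 (initial_position \<rho>0 n i) = real i / real n" using Suc by simp
    have "{x. (LINT y=ereal (initial_position \<rho>0 n i)..ereal x|lebesgue. \<rho>0 y) < 1 / real n} = {x. m0 x < real (Suc i) / real n}"
      using IH by (auto simp: interval_integral_m0 add_divide_distrib)
    then have "m0 (initial_position \<rho>0 n (Suc i)) = m0 (Sup {x. m0 x < real (Suc i) / real n})"
      using False by simp
    also have "\<dots> = real (Suc i) / real n" using Suc.prems assms by (intro m0_Sup) auto
    finally show ?thesis .
  qed
qed

end

subsection \<open>Estimates for the particle scheme\<close>

locale ftl_scheme = initial_flux +
  fixes n :: nat and x :: "nat \<Rightarrow> real \<Rightarrow> real"
  assumes n_pos: "1 \<le> n" and sol: "ftl_solution v \<rho>0 n x"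
begin

text \<open>From index \<open>n\<close> on the density is \<open>0\<close>, so the leader obeys the
  same law of motion \<open>v (rr i t)\<close> as the other particles and the formulas below need no
  separate case for it.\<close>

definition rr :: "nat \<Rightarrow> real \<Rightarrow> real" where "rr i t = (if i < n then discrete_density n x i t else 0)"

lemma x_less: "0 \<le> t \<Longrightarrow> i < n \<Longrightarrow> x i t < x (Suc i) t"
  and x_initial: "i \<le> n \<Longrightarrow> x i 0 = initial_position \<rho>0 n i"
  using sol unfolding ftl_solution_def by auto

lemma rr_range: "0 \<le> t \<Longrightarrow> rr i t \<in> {0..R}"
  using sol R_nonneg unfolding ftl_solution_def rr_def R_def by auto

lemma x_deriv: "0 \<le> t \<Longrightarrow> i \<le> n \<Longrightarrow> (x i has_real_derivative v (rr i t)) (at t within {0..})"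
  using sol unfolding ftl_solution_def rr_def by (cases "i = n") auto

lemma rr_eq: "i < n \<Longrightarrow> rr i t = (1 / real n) / (x (Suc i) t - x i t)"
  by (simp add: rr_def discrete_density_def)

lemma rr_len: "0 \<le> t \<Longrightarrow> i < n \<Longrightarrow> rr i t * (x (Suc i) t - x i t) = 1 / real n"
  using x_less[of t i] by (simp add: rr_eq)

lemma rr_n [simp]: "rr n t = 0" by (simp add: rr_def)

lemma x_mono: "0 \<le> t \<Longrightarrow> i \<le> j \<Longrightarrow> j \<le> n \<Longrightarrow> x i t \<le> x j t"
proof (induction j)
  case (Suc j)
  then show ?case using x_less[of t j] by (cases "i = Suc j") auto
qed simp

lemma rr_deriv:
  assumes "0 \<le> t" "i \<le> n"
  shows "(rr i has_real_derivative - (real n * (rr i t)\<^sup>2 * (v (rr (Suc i) t) - v (rr i t)))) (at t within {0..})"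
proof (cases "i < n")
  case True
  have eq: "rr i = (\<lambda>t. (1 / real n) / (x (Suc i) t - x i t))" using True by (simp add: rr_eq fun_eq_iff)
  have "((\<lambda>t. (1 / real n) / (x (Suc i) t - x i t)) has_real_derivative
      - (1 / real n * (v (rr (Suc i) t) - v (rr i t))) / (x (Suc i) t - x i t)\<^sup>2) (at t within {0..})"
    using True assms x_less[of t i]
    by (auto intro!: derivative_eq_intros x_deriv simp: power2_eq_square)
  moreover have "- (1 / real n * (v (rr (Suc i) t) - v (rr i t))) / (x (Suc i) t - x i t)\<^sup>2
     = - (real n * (rr i t)\<^sup>2 * (v (rr (Suc i) t) - v (rr i t)))"
  proof -
    have "- (1 / N * w) / l\<^sup>2 = - (N * ((1 / N) / l)\<^sup>2 * w)" if "N \<noteq> 0" "l \<noteq> 0" for N w l :: real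
      using that by (simp add: power2_eq_square field_simps)
    then show ?thesis unfolding rr_eq[OF True] using n_pos x_less[OF assms(1) True] by simp
  qed
  ultimately show ?thesis unfolding eq by metis
next
  case False
  then have "i = n" using assms by simp
  moreover have "rr n = (\<lambda>_. 0)" by (simp add: fun_eq_iff)
  ultimately show ?thesis by simp
qed

definition z :: "nat \<Rightarrow> real \<Rightarrow> real" where
  "z i t = (v (rr (Suc i) t) - v (rr i t)) / (x (Suc i) t - x i t)"

definition ph :: "nat \<Rightarrow> real \<Rightarrow> real" where "ph i t = rr i t * v' (rr i t)"

lemma w_deriv:
  assumes "0 \<le> t" "i \<le> n"
  shows "((\<lambda>t. v (rr i t)) has_real_derivative - (ph i t * z i t)) (at t within {0..})"
proof -
  have "(v has_real_derivative v' (rr i t)) (at (rr i t) within {0..R})"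
    using rr_range[OF assms(1)] by (rule v_deriv)
  then have "(v has_real_derivative v' (rr i t)) (at (rr i t) within rr i ` {0..})"
    by (rule DERIV_subset) (use rr_range in auto)
  from DERIV_image_chain[OF this rr_deriv[OF assms]]
  have "((\<lambda>t. v (rr i t)) has_real_derivative v' (rr i t) * - (real n * (rr i t)\<^sup>2 * (v (rr (Suc i) t) - v (rr i t)))) (at t within {0..})"
    by (simp add: o_def)
  moreover have "v' (rr i t) * - (real n * (rr i t)\<^sup>2 * (v (rr (Suc i) t) - v (rr i t))) = - (ph i t * z i t)"
  proof (cases "i < n")
    case True
    then have "z i t = real n * rr i t * (v (rr (Suc i) t) - v (rr i t))"
    proof -
      have "w / l = c * w" if "c * l = 1" for w l c :: real using that by (metis divide_eq_eq mult.commute mult.left_commute mult_1 mult_zero_right zero_neq_one)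
      moreover have "real n * rr i t * (x (Suc i) t - x i t) = 1"
        using rr_len[OF assms(1) True] n_pos by (simp add: mult.assoc)
      ultimately show ?thesis unfolding z_def by blast
    qed
    then show ?thesis by (simp add: ph_def power2_eq_square)
  next
    \<comment> \<open>The leader has density \<open>0\<close>, so both sides vanish whatever the
      value of \<open>z n\<close>.\<close>
    case False
    then have "i = n" using assms by simp
    then show ?thesis by (simp add: ph_def)
  qed
  ultimately show ?thesis by metis
qed

text \<open>The gap grows at the rate \<open>z i t\<close> times its length. Differentiating the
  denominator therefore yields the Riccati term \<open>- (z i t)\<^sup>2\<close>, the source of the
  bound \<open>1 / t\<close>; the rest compares neighbouring quotients.\<close>

lemma z_deriv:
  assumes "0 \<le> t" "i < n"
  shows "(z i has_real_derivative (ph i t * z i t - ph (Suc i) t * z (Suc i) t) / (x (Suc i) t - x i t) - (z i t)\<^sup>2) (at t within {0..})"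
proof -
  have ln: "x (Suc i) t - x i t \<noteq> 0" using x_less[OF assms] by simp
  have "((\<lambda>t. (v (rr (Suc i) t) - v (rr i t)) / (x (Suc i) t - x i t)) has_real_derivative
     (((- (ph (Suc i) t * z (Suc i) t)) - (- (ph i t * z i t))) * (x (Suc i) t - x i t) -
      (v (rr (Suc i) t) - v (rr i t)) * (v (rr (Suc i) t) - v (rr i t))) / ((x (Suc i) t - x i t) * (x (Suc i) t - x i t))) (at t within {0..})"
    by (intro DERIV_divide DERIV_diff w_deriv x_deriv ln) (use assms in auto)
  moreover have "(((- (ph (Suc i) t * z (Suc i) t)) - (- (ph i t * z i t))) * (x (Suc i) t - x i t) -
      (v (rr (Suc i) t) - v (rr i t)) * (v (rr (Suc i) t) - v (rr i t))) / ((x (Suc i) t - x i t) * (x (Suc i) t - x i t))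
     = (ph i t * z i t - ph (Suc i) t * z (Suc i) t) / (x (Suc i) t - x i t) - ((v (rr (Suc i) t) - v (rr i t)) / (x (Suc i) t - x i t))\<^sup>2"
  proof -
    have "(((- a2) - (- a1)) * l - w * w) / (l * l) = (a1 - a2) / l - (w / l)\<^sup>2" if "l \<noteq> 0" for a1 a2 w l :: real
      using that by (simp add: power2_eq_square field_simps)
    from this[OF ln] show ?thesis .
  qed
  ultimately show ?thesis unfolding z_def[abs_def] by metis
qed

text \<open>At a point where \<open>t z\<^sub>i(t)\<close> is maximal and exceeds \<open>1\<close>, the monotonicity of \<open>r v'(r)\<close>
  gives \<open>z\<^sub>i' \<le> - z\<^sub>i\<^sup>2\<close>, so \<open>t z\<^sub>i(t)\<close> would be strictly decreasing there.\<close>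

lemma Oleinik_z:
  assumes "0 \<le> T" "k < n"
  shows "T * z k T \<le> 1"
proof (rule ccontr)
  assume neg: "\<not> T * z k T \<le> 1"
  have cont: "continuous_on {0..T} (\<lambda>t. t * z i t)" if "i < n" for i
  proof (intro continuous_intros)
    have "continuous_on {0..} (z i)"
      using z_deriv[OF _ that] by (meson DERIV_continuous atLeast_iff continuous_on_eq_continuous_within)
    then show "continuous_on {0..T} (z i)" by (rule continuous_on_subset) auto
  qed
  have "\<forall>i\<in>{..<n}. \<exists>s\<in>{0..T}. \<forall>t\<in>{0..T}. t * z i t \<le> s * z i s"
    using continuous_attains_sup[OF compact_Icc _ cont] assms by auto
  then obtain s where s: "\<And>i. i < n \<Longrightarrow> s i \<in> {0..T}" "\<And>i t. i < n \<Longrightarrow> t \<in> {0..T} \<Longrightarrow> t * z i t \<le> s i * z i (s i)"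
    by (metis lessThan_iff)
  obtain i where i: "i < n" "\<And>j. j < n \<Longrightarrow> s j * z j (s j) \<le> s i * z i (s i)"
  proof -
    have "Max ((\<lambda>j. s j * z j (s j)) ` {..<n}) \<in> (\<lambda>j. s j * z j (s j)) ` {..<n}"
      using n_pos by (intro Max_in) (auto simp: lessThan_empty_iff)
    then obtain i where i: "i < n" "Max ((\<lambda>j. s j * z j (s j)) ` {..<n}) = s i * z i (s i)" by auto
    have "s j * z j (s j) \<le> Max ((\<lambda>j. s j * z j (s j)) ` {..<n})" if "j < n" for j
      using that by (intro Max_ge) auto
    then show ?thesis using that[of i] i by simp
  qed
  define t where "t = s i"
  have t: "t \<in> {0..T}" using s(1)[OF i(1)] by (simp add: t_def)
  have mx: "r * z j r \<le> t * z i t" if "j < n" "r \<in> {0..T}" for j r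
    using s(2)[OF that] i(2)[OF that(1)] by (simp add: t_def)
  have gt1: "t * z i t > 1" using mx[of k T] neg assms by simp
  have tpos: "t > 0" using gt1 t by (cases "t = 0") auto
  have zpos: "z i t > 0" using gt1 tpos zero_less_mult_pos[of t "z i t"] by linarith
  have ln: "x (Suc i) t - x i t > 0" using x_less[of t i] i t by simp
  have r: "rr i t \<in> {0..R}" "rr (Suc i) t \<in> {0..R}" using rr_range t by auto
  have "v (rr i t) < v (rr (Suc i) t)" using zpos ln by (simp add: z_def zero_less_divide_iff)
  then have "rr (Suc i) t \<le> rr i t" using v_le_iff[OF r] by linarith
  then have ph_le: "ph i t \<le> ph (Suc i) t" using phi_diff(1)[OF r(2,1)] by (simp add: ph_def)
  have ph_np: "ph (Suc i) t \<le> 0" using phi_nonpos[OF r(2)] by (simp add: ph_def)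
  \<comment> \<open>\<open>- ph\<close> is nonnegative and \<open>z (Suc i) t \<le> z i t\<close> by
    maximality at the same time; for the last gap the neighbour is the leader, where
    \<open>ph\<close> is \<open>0\<close>.\<close>
  have "- ph (Suc i) t * z (Suc i) t \<le> - ph (Suc i) t * z i t"
  proof (cases "Suc i < n")
    case True
    then have "t * z (Suc i) t \<le> t * z i t" using mx[of "Suc i" t] t by simp
    then have "z (Suc i) t \<le> z i t" using tpos by simp
    then show ?thesis using ph_np by (intro mult_left_mono) auto
  next
    case False
    then have "Suc i = n" using i by simp
    then have "ph (Suc i) t = 0" by (simp add: ph_def)
    then show ?thesis by simp
  qed
  then have "ph i t * z i t - ph (Suc i) t * z (Suc i) t \<le> (ph i t - ph (Suc i) t) * z i t" by (simp add: algebra_simps)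
  also have "\<dots> \<le> 0" using ph_le zpos by (simp add: mult_le_0_iff)
  finally have num: "(ph i t * z i t - ph (Suc i) t * z (Suc i) t) / (x (Suc i) t - x i t) \<le> 0"
    using ln by (simp add: divide_le_0_iff)
  define z' where "z' = (ph i t * z i t - ph (Suc i) t * z (Suc i) t) / (x (Suc i) t - x i t) - (z i t)\<^sup>2"
  have D: "((\<lambda>t. t * z i t) has_real_derivative 1 * z i t + z' * t) (at t within {0..})"
    unfolding z'_def by (intro DERIV_mult z_deriv) (use t i in auto)
  have "z' \<le> - (z i t)\<^sup>2" using num by (simp add: z'_def)
  then have "z' * t \<le> - (z i t)\<^sup>2 * t" using tpos by (intro mult_right_mono) auto
  then have "1 * z i t + z' * t \<le> z i t * (1 - t * z i t)" by (simp add: power2_eq_square algebra_simps)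
  also have "\<dots> < 0" using zpos gt1 by (simp add: mult_less_0_iff)
  \<comment> \<open>Looking backward in time works even when the maximum sits at
    \<open>t = T\<close>.\<close>
  finally obtain d where d: "d > 0" "\<And>h. 0 < h \<Longrightarrow> t - h \<in> {0..} \<Longrightarrow> h < d \<Longrightarrow> t * z i t < (t - h) * z i (t - h)"
    using has_real_derivative_neg_dec_left[OF D] by auto
  define h where "h = min (d / 2) t"
  have "0 < h" "t - h \<in> {0..T}" "h < d" using d(1) tpos t by (auto simp: h_def)
  then show False using d(2)[of h] mx[OF i(1), of "t - h"] by auto
qed

lemma Oleinik_step:
  assumes "0 < t" "i < n"
  shows "v (rr (Suc i) t) - v (rr i t) \<le> (x (Suc i) t - x i t) / t"
proof -
  have ln: "x (Suc i) t - x i t > 0" using x_less[of t i] assms by simp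
  have "z i t \<le> 1 / t" using Oleinik_z[of t i] assms by (simp add: field_simps)
  then have "z i t * (x (Suc i) t - x i t) \<le> 1 / t * (x (Suc i) t - x i t)" using ln by (intro mult_right_mono) auto
  then show ?thesis using ln by (simp add: z_def)
qed

lemma Oleinik_sum:
  assumes "0 < t" "i \<le> j" "j \<le> n"
  shows "v (rr j t) - v (rr i t) \<le> (x j t - x i t) / t"
  using assms(2,3)
proof (induction j)
  case (Suc j)
  show ?case
  proof (cases "i = Suc j")
    case False
    then have "v (rr j t) - v (rr i t) \<le> (x j t - x i t) / t" using Suc by simp
    moreover have "v (rr (Suc j) t) - v (rr j t) \<le> (x (Suc j) t - x j t) / t"
      using Oleinik_step[OF assms(1), of j] Suc.prems by simp
    ultimately show ?thesis by (simp add: diff_divide_distrib)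
  qed simp
qed simp

section \<open>The piecewise constant density\<close>

definition D :: "real \<Rightarrow> real \<Rightarrow> real" where "D y t = ftl_density n x y t"

lemma D_sum: "D y t = (\<Sum>i<n. rr i t * indicator {x i t..<x (Suc i) t} y)"
  unfolding D_def ftl_density_def by (intro sum.cong) (auto simp: rr_def)

lemma cell_unique:
  assumes "0 \<le> t" "i < n" "j < n" "y \<in> {x i t..<x (Suc i) t}" "y \<in> {x j t..<x (Suc j) t}"
  shows "i = j"
proof (rule ccontr)
  assume "i \<noteq> j"
  then have "Suc i \<le> j \<or> Suc j \<le> i" by linarith
  then show False
  proof
    assume "Suc i \<le> j"
    then have "x (Suc i) t \<le> x j t" using assms(3) by (intro x_mono assms(1)) auto
    then show False using assms(4,5) by simp
  next
    assume "Suc j \<le> i"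
    then have "x (Suc j) t \<le> x i t" using assms(2) by (intro x_mono assms(1)) auto
    then show False using assms(4,5) by simp
  qed
qed

lemma comp_D_cell:
  assumes "0 \<le> t" "i < n" "y \<in> {x i t..<x (Suc i) t}" 
  shows "(\<Sum>j<n. G j * indicator {x j t..<x (Suc j) t} y) = (G i :: real)"
proof -
  have "(\<Sum>j<n. G j * indicator {x j t..<x (Suc j) t} y) = (\<Sum>j<n. if j = i then G i else 0)"
  proof (intro sum.cong refl)
    fix j assume "j \<in> {..<n}"
    show "G j * indicator {x j t..<x (Suc j) t} y = (if j = i then G i else 0)"
    proof (cases "j = i")
      case True
      then show ?thesis using assms(3) by simp
    next
      case False
      then have "y \<notin> {x j t..<x (Suc j) t}"
        using cell_unique[OF assms(1,2) _ assms(3), of j] \<open>j \<in> {..<n}\<close> by blast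
      then show ?thesis using False by (simp add: indicator_def)
    qed
  qed
  then show ?thesis using assms(2) by simp
qed

lemma D_cell: "0 \<le> t \<Longrightarrow> i < n \<Longrightarrow> y \<in> {x i t..<x (Suc i) t} \<Longrightarrow> D y t = rr i t"
  unfolding D_sum by (rule comp_D_cell)

lemma outside_cell:
  assumes "0 \<le> t" "y < x 0 t \<or> x n t \<le> y" "j < n"
  shows "y \<notin> {x j t..<x (Suc j) t}"
  using x_mono[OF assms(1), of 0 j] x_mono[OF assms(1), of "Suc j" n] assms by auto

lemma D_outside: "0 \<le> t \<Longrightarrow> y < x 0 t \<or> x n t \<le> y \<Longrightarrow> D y t = 0"
  unfolding D_sum using outside_cell by (intro sum.neutral) (auto simp: indicator_def)

lemma cell_exists:
  assumes "x 0 t \<le> y" "y < x n t"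
  shows "\<exists>i<n. y \<in> {x i t..<x (Suc i) t}"
proof -
  define i where "i = (LEAST i. y < x (Suc i) t)"
  obtain m where m: "n = Suc m" using n_pos by (cases n) auto
  have ex: "y < x (Suc m) t" using assms(2) m by simp
  have i1: "y < x (Suc i) t" unfolding i_def using ex by (rule LeastI)
  have "i \<le> m" unfolding i_def using ex by (rule Least_le)
  moreover have "x i t \<le> y"
  proof (cases i)
    case (Suc k)
    then have "\<not> y < x (Suc k) t" using not_less_Least[of k "\<lambda>i. y < x (Suc i) t"] by (simp add: i_def)
    then show ?thesis using Suc by simp
  qed (use assms in simp)
  ultimately show ?thesis using i1 m by (intro exI[of _ i]) auto
qed

lemma D_range: "0 \<le> t \<Longrightarrow> D y t \<in> {0..R}"
proof (cases "y < x 0 t \<or> x n t \<le> y")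
  case True
  assume "0 \<le> t"
  then show ?thesis using D_outside True R_nonneg by simp
next
  case False
  assume t: "0 \<le> t"
  obtain i where "i < n" "y \<in> {x i t..<x (Suc i) t}" using cell_exists[of t y] False by auto
  then have "D y t = rr i t" using D_cell t by blast
  then show ?thesis using rr_range[OF t] by simp
qed

lemma comp_D:
  assumes "0 \<le> t" "G 0 = (0::real)"
  shows "G (D y t) = (\<Sum>i<n. G (rr i t) * indicator {x i t..<x (Suc i) t} y)"
proof (cases "y < x 0 t \<or> x n t \<le> y")
  case True
  then have "(\<Sum>i<n. G (rr i t) * indicator {x i t..<x (Suc i) t} y) = 0"
    using outside_cell[OF assms(1) True] by (intro sum.neutral) (auto simp: indicator_def)
  then show ?thesis using D_outside[OF assms(1) True] assms(2) by simp
next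
  case False
  then obtain i where i: "i < n" "y \<in> {x i t..<x (Suc i) t}" using cell_exists[of t y] by auto
  then show ?thesis using D_cell[OF assms(1) i] comp_D_cell[OF assms(1) i, of "\<lambda>i. G (rr i t)"] by simp
qed

text \<open>Across a gap of length at most \<open>1 / sqrt n\<close> the quotient bound \<open>1/t\<close> controls the jump of \<open>v\<close>;
  a longer gap has density at most \<open>1 / sqrt n\<close>, where \<open>v\<close> is close to its maximum \<open>v(0)\<close>.\<close>

definition err :: "real \<Rightarrow> real" where
  "err t = 1 / (t * sqrt (real n)) + (v 0 - v (min R (1 / sqrt (real n))))"

lemma err_step:
  assumes "0 < t" "i < n"
  shows "v (rr (Suc i) t) - v (rr i t) \<le> err t"
proof (cases "x (Suc i) t - x i t \<le> 1 / sqrt (real n)")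
  case True
  have "v (rr (Suc i) t) - v (rr i t) \<le> (x (Suc i) t - x i t) / t" by (rule Oleinik_step[OF assms])
  also have "\<dots> \<le> (1 / sqrt (real n)) / t" using True assms by (intro divide_right_mono) auto
  also have "\<dots> \<le> err t" using v_anti_le[of 0 "min R (1 / sqrt (real n))"] R_gt_0 by (simp add: err_def mult.commute)
  finally show ?thesis .
next
  case False
  have sq: "sqrt (real n) > 0" using n_pos by simp
  have "rr i t = (1 / real n) / (x (Suc i) t - x i t)" using assms by (simp add: rr_eq)
  also have "\<dots> \<le> (1 / real n) / (1 / sqrt (real n))"
    using False n_pos sq x_less[of t i] assms by (intro divide_left_mono mult_pos_pos) auto
  also have "\<dots> = 1 / sqrt (real n)" using n_pos by (simp add: real_div_sqrt field_simps)
  finally have "rr i t \<le> min R (1 / sqrt (real n))" using rr_range[of t i] assms by auto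
  then have "v (min R (1 / sqrt (real n))) \<le> v (rr i t)"
    using rr_range[of t i] assms R_gt_0 by (intro v_anti_le) auto
  moreover have "v (rr (Suc i) t) \<le> v 0" using rr_range[of t "Suc i"] assms R_gt_0 by (intro v_anti_le) auto
  ultimately show ?thesis using assms sq by (simp add: err_def add_increasing)
qed

lemma err_nonneg: "0 < t \<Longrightarrow> 0 \<le> err t"
  using v_anti_le[of 0 "min R (1 / sqrt (real n))"] R_gt_0 by (simp add: err_def)

text \<open>The sum of jumps cannot start at the left end \<open>x i t\<close> of the gap containing
  \<open>y\<close>, which may lie far left of \<open>y\<close>. It starts at the next particle, to
  the right of \<open>y\<close>, and the one remaining jump is covered by
  \<open>err_step\<close>.\<close>

lemma D_one_sided:
  assumes "0 < t" "y \<le> y'"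
  shows "v (D y' t) - v (D y t) \<le> (y' - y) / t + err t"
proof (cases "y < x 0 t \<or> x n t \<le> y")
  case True
  then have "D y t = 0" using D_outside assms by simp
  moreover have "v (D y' t) \<le> v 0" using D_range[of t y'] assms R_gt_0 by (intro v_anti_le) auto
  moreover have "0 \<le> (y' - y) / t" using assms by simp
  ultimately show ?thesis using err_nonneg[OF assms(1)] by simp
next
  case False
  then obtain i where i: "i < n" "y \<in> {x i t..<x (Suc i) t}" using cell_exists[of t y] by auto
  have Dy: "D y t = rr i t" using D_cell i assms by simp
  have "\<exists>j\<le>n. D y' t = rr j t \<and> x j t \<le> y' \<and> i \<le> j"
  proof (cases "x n t \<le> y'")
    case True
    then show ?thesis using D_outside[of t y'] assms i by (intro exI[of _ n]) auto
  next
    case False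
    then obtain j where j: "j < n" "y' \<in> {x j t..<x (Suc j) t}" using cell_exists[of t y'] \<open>\<not> (y < x 0 t \<or> x n t \<le> y)\<close> assms by auto
    have "i \<le> j"
    proof (rule ccontr)
      assume "\<not> i \<le> j"
      then have "x (Suc j) t \<le> x i t" using x_mono[of t "Suc j" i] i assms by simp
      then show False using i j assms by auto
    qed
    then show ?thesis using j D_cell[of t j y'] assms by (intro exI[of _ j]) auto
  qed
  then obtain j where j: "j \<le> n" "D y' t = rr j t" "x j t \<le> y'" "i \<le> j" by blast
  show ?thesis
  proof (cases "i = j")
    case True
    then show ?thesis using Dy j assms err_nonneg[OF assms(1)] by simp
  next
    case False
    then have "v (rr j t) - v (rr (Suc i) t) \<le> (x j t - x (Suc i) t) / t" using j by (intro Oleinik_sum assms) auto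
    also have "\<dots> \<le> (y' - y) / t" using j i assms by (intro divide_right_mono) auto
    finally show ?thesis using err_step[OF assms(1) i(1)] Dy j by simp
  qed
qed

section \<open>Integrals and energy of the density\<close>

lemma D_measurable_x [measurable]: "(\<lambda>y. D y t) \<in> borel_measurable borel"
  unfolding D_sum by measurable

lemma cell_integral:
  assumes "0 \<le> t" "i < n"
  shows "has_bochner_integral lborel (indicator {x i t..<x (Suc i) t} :: real \<Rightarrow> real) (x (Suc i) t - x i t)"
proof -
  have "has_bochner_integral lborel (indicator {x i t..<x (Suc i) t} :: real \<Rightarrow> real) (measure lborel {x i t..<x (Suc i) t})"
    by (rule has_bochner_integral_real_indicator) (use x_less[OF assms] in auto)
  then show ?thesis using x_less[OF assms] by simp
qed

lemma comp_D_integral: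
  assumes "0 \<le> t" "G 0 = (0::real)"
  shows "has_bochner_integral lborel (\<lambda>y. G (D y t)) (\<Sum>i<n. G (rr i t) * (x (Suc i) t - x i t))"
  unfolding comp_D[where G=G, OF assms]
  by (intro has_bochner_integral_sum has_bochner_integral_mult_right cell_integral assms) auto

lemma D_integrable: "0 \<le> t \<Longrightarrow> integrable lborel (\<lambda>y. D y t)"
  using comp_D_integral[of t "\<lambda>r. r"] by (simp add: has_bochner_integral_iff)

lemma D_mass: "0 \<le> t \<Longrightarrow> (LINT y|lborel. D y t) = 1"
  using comp_D_integral[of t "\<lambda>r. r"] rr_len[of t] n_pos by (simp add: has_bochner_integral_iff)

lemma D_square: "0 \<le> t \<Longrightarrow> (LINT y|lborel. (D y t)\<^sup>2) = (\<Sum>i<n. rr i t) / real n"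
  using comp_D_integral[of t "\<lambda>r. r\<^sup>2"] rr_len[of t]
  by (simp add: has_bochner_integral_iff power2_eq_square sum_divide_distrib mult.assoc)

text \<open>By \<open>D_square\<close> the sum is \<open>n\<close> times the integral of the squared
  density, so this is the decay of an energy. The function \<open>Q\<close> below is the integral of
  \<open>y\<^sup>2\<close> with respect to \<open>v\<close> from \<open>0\<close> to
  \<open>r\<close>, written by parts.\<close>

lemma rr_sum_antimono:
  assumes "0 \<le> T"
  shows "(\<Sum>i<n. rr i T) \<le> (\<Sum>i<n. rr i 0)"
proof -
  \<comment> \<open>\<open>Q\<close> turns the derivative of the sum into a telescoping sum, as \<open>Q s - Q r \<le> r\<^sup>2 (v(s) - v(r))\<close>.\<close>
  define Q where "Q r = r\<^sup>2 * v r - integral {0..r} (\<lambda>s. 2 * s * v s)" for r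
  have cont: "continuous_on {0..R} (\<lambda>s. 2 * s * v s)" by (intro continuous_intros v_cont)
  have int: "(\<lambda>s. 2 * s * v s) integrable_on {a..c}" if "0 \<le> a" "c \<le> R" for a c
    by (rule integrable_continuous_real, rule continuous_on_subset[OF cont]) (use that in auto)
  have sq: "((\<lambda>s. 2 * s * c) has_integral (e\<^sup>2 - a\<^sup>2) * c) {a..e}" if "a \<le> e" for a e c :: real
  proof -
    have "((\<lambda>s. 2 * s * c) has_integral (e\<^sup>2 * c - a\<^sup>2 * c)) {a..e}"
      by (rule fundamental_theorem_of_calculus[OF that])
        (auto simp: has_real_derivative_iff_has_vector_derivative[symmetric] intro!: derivative_eq_intros)
    then show ?thesis by (simp add: left_diff_distrib)
  qed
  have Q: "Q s - Q r \<le> r\<^sup>2 * (v s - v r)" if rs: "r \<in> {0..R}" "s \<in> {0..R}" for r s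
  proof (cases "r \<le> s")
    case True
    have "integral {0..r} (\<lambda>s. 2 * s * v s) + integral {r..s} (\<lambda>s. 2 * s * v s) = integral {0..s} (\<lambda>s. 2 * s * v s)"
      by (rule Henstock_Kurzweil_Integration.integral_combine) (use rs True int in auto)
    moreover have "(s\<^sup>2 - r\<^sup>2) * v s \<le> integral {r..s} (\<lambda>s. 2 * s * v s)"
    proof (rule has_integral_le[OF sq[OF True] integrable_integral[OF int]])
      fix y assume "y \<in> {r..s}"
      then show "2 * y * v s \<le> 2 * y * v y" using v_anti_le[of y s] rs by (intro mult_left_mono) auto
    qed (use rs in auto)
    ultimately show ?thesis by (simp add: Q_def algebra_simps)
  next
    case False
    have "integral {0..s} (\<lambda>s. 2 * s * v s) + integral {s..r} (\<lambda>s. 2 * s * v s) = integral {0..r} (\<lambda>s. 2 * s * v s)"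
      by (rule Henstock_Kurzweil_Integration.integral_combine) (use rs False int in auto)
    moreover have "integral {s..r} (\<lambda>s. 2 * s * v s) \<le> (r\<^sup>2 - s\<^sup>2) * v s"
    proof (rule has_integral_le[OF integrable_integral[OF int] sq])
      fix y assume "y \<in> {s..r}"
      then show "2 * y * v y \<le> 2 * y * v s" using v_anti_le[of s y] rs by (intro mult_left_mono) auto
    qed (use rs False in auto)
    ultimately show ?thesis by (simp add: Q_def algebra_simps)
  qed
  have Q0: "Q 0 = 0" by (simp add: Q_def)
  have Qnp: "Q r \<le> 0" if "r \<in> {0..R}" for r using Q[of 0 r] that R_nonneg Q0 by simp
  have sum_nn: "0 \<le> (\<Sum>i<n. (rr i t)\<^sup>2 * (v (rr (Suc i) t) - v (rr i t)))" if "0 \<le> t" for t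
  proof -
    have "0 \<le> Q (rr n t) - Q (rr 0 t)" using Qnp rr_range[OF that, of 0] Q0 by simp
    also have "\<dots> = (\<Sum>i<n. Q (rr (Suc i) t) - Q (rr i t))" by (rule sum_lessThan_telescope[symmetric])
    also have "\<dots> \<le> (\<Sum>i<n. (rr i t)\<^sup>2 * (v (rr (Suc i) t) - v (rr i t)))"
      by (intro sum_mono Q rr_range that)
    finally show ?thesis .
  qed
  show ?thesis
  proof (cases "T = 0")
    case False
    then have T: "0 < T" using assms by simp
    have "\<exists>t\<in>{0<..<T}. (\<Sum>i<n. rr i T) - (\<Sum>i<n. rr i 0) = (- real n * (\<Sum>i<n. (rr i t)\<^sup>2 * (v (rr (Suc i) t) - v (rr i t)))) * (T - 0)"
    proof (rule mvt_simple[OF T])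
      fix t assume t: "0 \<le> t" "t \<le> T"
      have "((\<lambda>t. \<Sum>i<n. rr i t) has_real_derivative (\<Sum>i<n. - (real n * (rr i t)\<^sup>2 * (v (rr (Suc i) t) - v (rr i t))))) (at t within {0..T})"
        by (intro DERIV_sum DERIV_subset[OF rr_deriv]) (use t in auto)
      moreover have "(\<Sum>i<n. - (real n * (rr i t)\<^sup>2 * (v (rr (Suc i) t) - v (rr i t)))) = - real n * (\<Sum>i<n. (rr i t)\<^sup>2 * (v (rr (Suc i) t) - v (rr i t)))"
        by (simp add: sum_distrib_left sum_negf mult.assoc)
      ultimately show "((\<lambda>t. \<Sum>i<n. rr i t) has_derivative (*) (- real n * (\<Sum>i<n. (rr i t)\<^sup>2 * (v (rr (Suc i) t) - v (rr i t))))) (at t within {0..T})"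
        by (simp add: has_field_derivative_def)
    qed
    then obtain t where t: "0 < t" "(\<Sum>i<n. rr i T) - (\<Sum>i<n. rr i 0) = (- real n * (\<Sum>i<n. (rr i t)\<^sup>2 * (v (rr (Suc i) t) - v (rr i t)))) * T"
      by auto
    have "0 \<le> real n * (\<Sum>i<n. (rr i t)\<^sup>2 * (v (rr (Suc i) t) - v (rr i t))) * T"
      using sum_nn[of t] t(1) T by (intro mult_nonneg_nonneg) auto
    then show ?thesis using t(2) by simp
  qed simp
qed

lemma r0_sq_integrable: "integrable lborel (\<lambda>y. (r0 y)\<^sup>2)"
proof -
  have "\<bar>r0 y\<bar> \<le> R" for y using r0(2)[of y] by auto
  from integrable_bounded_mult[OF r0(1) _ this] show ?thesis by (simp add: power2_eq_square)
qed

text \<open>At time \<open>0\<close> each \<open>rr i\<close> is the mean of \<open>r0\<close> over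
  its cell, because the cell has mass \<open>1 / n\<close>, and the mean of the square dominates the
  square of the mean. Later times follow from \<open>rr_sum_antimono\<close>.\<close>

lemma D_square_le:
  assumes "0 \<le> t"
  shows "(LINT y|lborel. (D y t)\<^sup>2) \<le> (LINT y|lborel. (r0 y)\<^sup>2)"
proof -
  have sq_ind: "integrable lborel (\<lambda>y. (r0 y)\<^sup>2 * indicator A y)" if "A \<in> sets borel" for A
    using integrable_mult_indicator[OF _ r0_sq_integrable, of A] that by (simp add: mult.commute)
  have cell: "rr i 0 / real n \<le> (LINT y|lborel. (r0 y)\<^sup>2 * indicator {x i 0..<x (Suc i) 0} y)" if i: "i < n" for i
  proof -
    define A where "A = {x i 0..<x (Suc i) 0}"
    have A: "A \<in> sets borel" by (simp add: A_def)
    have mass: "(LINT y|lborel. r0 y * indicator A y) = 1 / real n"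
    proof -
      have "(LINT y|lborel. r0 y * indicator A y) = (LINT y|lborel. r0 y * indicator {x i 0<..x (Suc i) 0} y)"
      proof (rule integral_cong_AE)
        show "AE y in lborel. r0 y * indicator A y = r0 y * indicator {x i 0<..x (Suc i) 0} y"
          using AE_lborel_singleton[of "x i 0"] AE_lborel_singleton[of "x (Suc i) 0"]
          by eventually_elim (auto simp: A_def indicator_def)
      qed (use A in measurable)
      also have "\<dots> = m0 (x (Suc i) 0) - m0 (x i 0)" using x_less[of 0 i] i by (subst m0_diff) auto
      also have "\<dots> = 1 / real n"
        using m0_initial_position[OF n_pos, of i] m0_initial_position[OF n_pos, of "Suc i"] i x_initial[of i] x_initial[of "Suc i"]
        by (simp add: add_divide_distrib)
      finally show ?thesis .
    qed
    have hA: "has_bochner_integral lborel (indicator A :: real \<Rightarrow> real) (x (Suc i) 0 - x i 0)"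
      unfolding A_def by (rule cell_integral) (use i in auto)
    have "0 \<le> (LINT y|lborel. ((r0 y - rr i 0)\<^sup>2) * indicator A y)"
      by (intro Bochner_Integration.integral_nonneg) auto
    also have "\<dots> = (LINT y|lborel. ((r0 y)\<^sup>2 * indicator A y - (2 * rr i 0) * (r0 y * indicator A y)) + (rr i 0)\<^sup>2 * indicator A y)"
      by (intro Bochner_Integration.integral_cong) (auto simp: power2_eq_square algebra_simps)
    also have "\<dots> = (LINT y|lborel. (r0 y)\<^sup>2 * indicator A y) - (2 * rr i 0) * (1 / real n) + (rr i 0)\<^sup>2 * (x (Suc i) 0 - x i 0)"
      using hA mass A sq_ind[OF A] r0_mult_indicator[OF A]
      by (simp add: has_bochner_integral_iff)
    also have "(rr i 0)\<^sup>2 * (x (Suc i) 0 - x i 0) = rr i 0 * (1 / real n)"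
      using rr_len[of 0 i] i by (simp add: power2_eq_square mult.assoc)
    finally show ?thesis by (simp add: A_def)
  qed
  have "(LINT y|lborel. (D y t)\<^sup>2) = (\<Sum>i<n. rr i t) / real n" by (rule D_square[OF assms])
  also have "\<dots> \<le> (\<Sum>i<n. rr i 0) / real n" using rr_sum_antimono[OF assms] by (intro divide_right_mono) auto
  also have "\<dots> = (\<Sum>i<n. rr i 0 / real n)" by (simp add: sum_divide_distrib)
  also have "\<dots> \<le> (\<Sum>i<n. (LINT y|lborel. (r0 y)\<^sup>2 * indicator {x i 0..<x (Suc i) 0} y))"
    by (intro sum_mono cell) auto
  also have "\<dots> = (LINT y|lborel. (\<Sum>i<n. (r0 y)\<^sup>2 * indicator {x i 0..<x (Suc i) 0} y))"
    by (intro Bochner_Integration.integral_sum[symmetric] sq_ind) auto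
  also have "\<dots> \<le> (LINT y|lborel. (r0 y)\<^sup>2)"
  proof (rule Bochner_Integration.integral_mono)
    show "integrable lborel (\<lambda>y. \<Sum>i<n. (r0 y)\<^sup>2 * indicator {x i 0..<x (Suc i) 0} y)"
      by (intro Bochner_Integration.integrable_sum sq_ind) auto
    fix y
    show "(\<Sum>i<n. (r0 y)\<^sup>2 * indicator {x i 0..<x (Suc i) 0} y) \<le> (r0 y)\<^sup>2"
    proof (cases "y < x 0 0 \<or> x n 0 \<le> y")
      case True
      have "(\<Sum>i<n. (r0 y)\<^sup>2 * indicator {x i 0..<x (Suc i) 0} y) = 0"
        using outside_cell[OF _ True] by (intro sum.neutral) (auto simp: indicator_def)
      then show ?thesis by (simp only: zero_le_power2)
    next
      case False
      then obtain i where i: "i < n" "y \<in> {x i 0..<x (Suc i) 0}" using cell_exists[of 0 y] by auto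
      have "(\<Sum>i<n. (r0 y)\<^sup>2 * indicator {x i 0..<x (Suc i) 0} y) = (r0 y)\<^sup>2"
        by (rule comp_D_cell[where G="\<lambda>_. (r0 y)\<^sup>2", OF order_refl i])
      then show ?thesis by (rule eq_refl)
    qed
  qed (rule r0_sq_integrable)
  finally show ?thesis .
qed

section \<open>Motion of the particles and cumulative mass\<close>

lemma x_speed:
  assumes "0 \<le> s" "0 \<le> t" "i \<le> n"
  shows "\<bar>x i t - x i s\<bar> \<le> V * \<bar>t - s\<bar>"
  using field_differentiable_bound[of "{0..}" "x i" "\<lambda>t. v (rr i t)" V t s] x_deriv[OF _ assms(3)] v_bound[OF rr_range] assms
  by auto

lemma x_bounds:
  assumes "0 \<le> t" "i \<le> n"
  shows "xl - V * t \<le> x i t" "x i t \<le> xr + V * t"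
proof -
  have "x 0 0 = xl" "x n 0 = xr"
    using x_initial[of 0] x_initial[of n] n_pos by (auto simp: xl_def xr_def gr0_conv_Suc dest!: Suc_le_D)
  then show "xl - V * t \<le> x i t" "x i t \<le> xr + V * t"
    using x_speed[of 0 t 0] x_speed[of 0 t n] x_mono[OF assms(1), of 0 i] x_mono[OF assms(1), of i n] assms
    by (auto simp: abs_le_iff)
qed

lemma D_support: "0 \<le> t \<Longrightarrow> y \<notin> {xl - V * t..xr + V * t} \<Longrightarrow> D y t = 0"
  using x_bounds[of t 0] x_bounds[of t n] by (intro D_outside) auto

lemma D_ind_integrable: "0 \<le> t \<Longrightarrow> A \<in> sets borel \<Longrightarrow> integrable lborel (\<lambda>z. D z t * indicator A z)"
  using integrable_mult_indicator[OF _ D_integrable, of A t] by (simp add: mult.commute)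

definition P :: "real \<Rightarrow> real \<Rightarrow> real" where "P y t = (LINT z|lborel. D z t * indicator {..y} z)"

lemma P_diff:
  assumes "0 \<le> t" "a \<le> y"
  shows "P y t - P a t = (LINT z|lborel. D z t * indicator {a<..y} z)"
proof -
  have "P y t - P a t = (LINT z|lborel. D z t * indicator {..y} z - D z t * indicator {..a} z)"
    unfolding P_def by (rule Bochner_Integration.integral_diff[symmetric]) (auto intro!: D_ind_integrable assms)
  also have "\<dots> = (LINT z|lborel. D z t * indicator {a<..y} z)"
    using assms by (intro Bochner_Integration.integral_cong) (auto simp: indicator_def)
  finally show ?thesis .
qed

lemma P_Lipschitz:
  assumes "0 \<le> t" "a \<le> y"
  shows "P a t \<le> P y t" "P y t - P a t \<le> R * (y - a)"
proof -
  have "0 \<le> P y t - P a t" unfolding P_diff[OF assms]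
    using D_range[OF assms(1)] by (intro Bochner_Integration.integral_nonneg) auto
  then show "P a t \<le> P y t" by simp
  have "integrable lborel (indicator {a<..y} :: real \<Rightarrow> real)"
    by (rule integrable_real_indicator) (use assms in auto)
  then have "P y t - P a t \<le> (LINT z|lborel. R * indicator {a<..y} z)" unfolding P_diff[OF assms]
    using D_range[OF assms(1)] assms by (intro Bochner_Integration.integral_mono D_ind_integrable integrable_mult_right)
      (auto intro!: mult_right_mono)
  then show "P y t - P a t \<le> R * (y - a)" using assms by simp
qed

lemma P_nonneg: "0 \<le> t \<Longrightarrow> 0 \<le> P y t"
  unfolding P_def using D_range by (intro Bochner_Integration.integral_nonneg) auto

lemma P_le_1: assumes "0 \<le> t" shows "P y t \<le> 1"
proof -
  have "P y t \<le> (LINT z|lborel. D z t)" unfolding P_def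
    using D_range[OF assms] assms
    by (intro Bochner_Integration.integral_mono D_ind_integrable D_integrable) (auto simp: indicator_def)
  then show ?thesis using D_mass[OF assms] by simp
qed

lemma P_particle:
  assumes "0 \<le> t" "j \<le> n"
  shows "P (x j t) t = real j / real n"
  using assms(2)
proof (induction j)
  case 0
  have "AE z in lborel. D z t * indicator {..x 0 t} z = 0"
    using AE_lborel_singleton[of "x 0 t"] by eventually_elim (auto simp: indicator_def D_outside[OF assms(1)])
  then show ?case unfolding P_def by (simp add: integral_eq_zero_AE)
next
  case (Suc j)
  then have j: "j < n" by simp
  have "P (x (Suc j) t) t - P (x j t) t = (LINT z|lborel. D z t * indicator {x j t<..x (Suc j) t} z)"
    using x_less[OF assms(1) j] by (intro P_diff assms) auto
  also have "\<dots> = (LINT z|lborel. rr j t * indicator {x j t..<x (Suc j) t} z)"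
  proof (rule integral_cong_AE)
    show "AE z in lborel. D z t * indicator {x j t<..x (Suc j) t} z = rr j t * indicator {x j t..<x (Suc j) t} z"
      using AE_lborel_singleton[of "x j t"] AE_lborel_singleton[of "x (Suc j) t"]
      by eventually_elim (auto simp: indicator_def D_cell[OF assms(1) j])
  qed measurable
  also have "\<dots> = rr j t * (x (Suc j) t - x j t)"
    using cell_integral[OF assms(1) j] by (simp add: has_bochner_integral_iff)
  also have "\<dots> = 1 / real n" by (rule rr_len[OF assms(1) j])
  finally show ?case using Suc j by (simp add: add_divide_distrib)
qed

lemma P_locate:
  assumes "0 \<le> t" "x 0 t \<le> y"
  shows "\<exists>j\<le>n. x j t \<le> y \<and> real j / real n \<le> P y t \<and> P y t \<le> (real j + 1) / real n \<and> (j < n \<longrightarrow> y < x (Suc j) t)"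
proof (cases "x n t \<le> y")
  case True
  have "1 \<le> P y t" using P_Lipschitz(1)[OF assms(1) True] P_particle[OF assms(1), of n] n_pos by simp
  moreover have "P y t \<le> (real n + 1) / real n"
  proof -
    have "1 \<le> (real n + 1) / real n" using n_pos by (simp add: le_divide_eq)
    then show ?thesis using P_le_1[OF assms(1), of y] by linarith
  qed
  ultimately show ?thesis using True n_pos by (intro exI[of _ n]) auto
next
  case False
  then obtain j where j: "j < n" "y \<in> {x j t..<x (Suc j) t}" using cell_exists[of t y] assms by auto
  have "P y t \<le> P (x (Suc j) t) t" using j by (intro P_Lipschitz assms) auto
  also have "\<dots> = (real j + 1) / real n" using P_particle[OF assms(1), of "Suc j"] j by (simp add: add.commute)
  finally have "P y t \<le> (real j + 1) / real n" .
  moreover have "real j / real n \<le> P y t"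
    using P_Lipschitz(1)[of t "x j t" y] P_particle[OF assms(1), of j] j assms by simp
  ultimately show ?thesis using j by (intro exI[of _ j]) auto
qed

text \<open>\<open>P\<close> is known at particles, and in between up to one cell of mass
  \<open>1 / n\<close>. A particle left of \<open>y\<close> at time \<open>t\<close> was left of
  \<open>y + V * \<bar>t - s\<bar>\<close> at time \<open>s\<close>, and the bound \<open>R\<close>
  on the density converts this distance into mass.\<close>

lemma P_time:
  assumes "0 \<le> s" "0 \<le> t"
  shows "P y t \<le> P y s + 1 / real n + R * V * \<bar>t - s\<bar>"
proof (cases "x 0 t \<le> y")
  case False
  then have "P y t \<le> 0" using P_Lipschitz(1)[OF assms(2), of y "x 0 t"] P_particle[OF assms(2), of 0] by simp
  moreover have "0 \<le> P y s + 1 / real n + R * V * \<bar>t - s\<bar>"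
    using P_nonneg[OF assms(1), of y] R_nonneg V_nonneg by (intro add_nonneg_nonneg mult_nonneg_nonneg) auto
  ultimately show ?thesis by linarith
next
  case True
  then obtain j where j: "j \<le> n" "x j t \<le> y" "P y t \<le> (real j + 1) / real n"
    using P_locate[OF assms(2) True] by blast
  define a where "a = x j s - V * \<bar>t - s\<bar>"
  have "a \<le> y" using x_speed[OF assms j(1)] j(2) by (simp add: a_def abs_le_iff)
  then have "P a s \<le> P y s" by (rule P_Lipschitz(1)[OF assms(1)])
  moreover have "P (x j s) s - P a s \<le> R * (x j s - a)"
    using V_nonneg by (intro P_Lipschitz assms) (simp add: a_def)
  ultimately show ?thesis using j(3) P_particle[OF assms(1) j(1)] by (simp add: a_def add_divide_distrib)
qed

text \<open>Both functions are nondecreasing and take the value \<open>j / n\<close> at the initial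
  position of particle \<open>j\<close>, so they differ by at most the mass of one cell.\<close>

lemma P_initial: "\<bar>P y 0 - m0 y\<bar> \<le> 1 / real n"
proof -
  have x0: "x 0 0 = xl" using x_initial[of 0] by (simp add: xl_def)
  have mx: "m0 (x j 0) = real j / real n" if "j \<le> n" for j
    using m0_initial_position[OF n_pos that] x_initial[OF that] by simp
  show ?thesis
  proof (cases "x 0 0 \<le> y")
    case False
    then have "P y 0 \<le> 0" using P_Lipschitz(1)[of 0 y "x 0 0"] P_particle[of 0 0] by simp
    moreover have "m0 y = 0" using False x0 by (intro m0_left) simp
    ultimately show ?thesis using P_nonneg[of 0 y] by simp
  next
    case True
    then obtain j where j: "j \<le> n" "x j 0 \<le> y" "real j / real n \<le> P y 0" "P y 0 \<le> (real j + 1) / real n" "j < n \<longrightarrow> y < x (Suc j) 0"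
      using P_locate[of 0 y] by auto
    have "real j / real n \<le> m0 y" using m0_mono[OF j(2)] mx[OF j(1)] by simp
    moreover have "m0 y \<le> (real j + 1) / real n"
    proof (cases "j < n")
      case True
      then show ?thesis using m0_mono[of y "x (Suc j) 0"] mx[of "Suc j"] j(5) by (simp add: add.commute)
    next
      case False
      then have "j = n" using j by simp
      have "m0 y \<le> m0 (max y xr)" by (rule m0_mono) simp
      also have "\<dots> = 1" by (rule m0_right) simp
      also have "1 \<le> (real j + 1) / real n" using n_pos \<open>j = n\<close> by (simp add: le_divide_eq)
      finally show ?thesis .
    qed
    ultimately show ?thesis using j(3,4) by (simp add: add_divide_distrib abs_le_iff)
  qed
qed

text \<open>A discontinuous density has no mean value theorem; but it cannot lie strictly on one
  side of its mean throughout an interval.\<close>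

lemma mean_attained:
  assumes t: "0 \<le> t" and yz: "y < y'" and m: "m = (P y' t - P y t) / (y' - y)"
  shows "\<exists>u\<in>{y<..y'}. D u t \<le> m" "\<exists>u\<in>{y<..y'}. m \<le> D u t"
proof -
  have ind: "integrable lborel (indicator {y<..y'} :: real \<Rightarrow> real)"
    by (rule integrable_real_indicator) (use yz in auto)
  have int: "integrable lborel (\<lambda>u. D u t * indicator {y<..y'} u - m * indicator {y<..y'} u)"
    by (intro Bochner_Integration.integrable_diff D_ind_integrable integrable_mult_right ind t) auto
  have zero: "(LINT u|lborel. D u t * indicator {y<..y'} u - m * indicator {y<..y'} u) = 0"
  proof -
    have "(LINT u|lborel. D u t * indicator {y<..y'} u - m * indicator {y<..y'} u) = (P y' t - P y t) - m * (y' - y)"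
      using P_diff[OF t, of y y'] yz ind
      by (subst Bochner_Integration.integral_diff) (auto intro!: D_ind_integrable t)
    then show ?thesis using m yz by simp
  qed
  have not_ae: "\<not> (AE u in lborel. u \<notin> {y<..y'})"
  proof
    assume "AE u in lborel. u \<notin> {y<..y'}"
    then have "{y<..y'} \<in> null_sets lborel" by (subst AE_iff_null_sets) auto
    then show False using yz by (auto simp: null_sets_def)
  qed
  show "\<exists>u\<in>{y<..y'}. D u t \<le> m"
  proof (rule ccontr)
    assume "\<not> (\<exists>u\<in>{y<..y'}. D u t \<le> m)"
    then have lt: "m < D u t" if "u \<in> {y<..y'}" for u using that by force
    have nn: "0 \<le> D u t * indicator {y<..y'} u - m * indicator {y<..y'} u" for u
      using lt[of u] by (cases "u \<in> {y<..y'}") auto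
    have "AE u in lborel. D u t * indicator {y<..y'} u - m * indicator {y<..y'} u = 0"
      using integral_nonneg_eq_0_iff_AE[OF int AE_I2[OF nn]] zero by simp
    then have "AE u in lborel. u \<notin> {y<..y'}" by eventually_elim (use lt in \<open>auto simp: indicator_def split: if_splits\<close>)
    then show False using not_ae by simp
  qed
  show "\<exists>u\<in>{y<..y'}. m \<le> D u t"
  proof (rule ccontr)
    assume "\<not> (\<exists>u\<in>{y<..y'}. m \<le> D u t)"
    then have lt: "D u t < m" if "u \<in> {y<..y'}" for u using that by force
    define h where "h u = - (D u t * indicator {y<..y'} u - m * indicator {y<..y'} u)" for u
    have nn: "0 \<le> h u" for u
      using lt[of u] by (cases "u \<in> {y<..y'}") (auto simp: h_def)
    have int': "integrable lborel h" unfolding h_def by (rule Bochner_Integration.integrable_minus[OF int])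
    have "(LINT u|lborel. h u) = 0" unfolding h_def Bochner_Integration.integral_minus zero by simp
    then have "AE u in lborel. h u = 0"
      using integral_nonneg_eq_0_iff_AE[OF int' AE_I2[OF nn]] by simp
    then have "AE u in lborel. u \<notin> {y<..y'}"
    proof eventually_elim
      case (elim u) then show ?case using lt[of u] by (auto simp: h_def)
    qed
    then show False using not_ae by simp
  qed
qed

lemma mean_range:
  assumes "0 \<le> t" "y < y'"
  shows "(P y' t - P y t) / (y' - y) \<in> {0..R}"
  using P_Lipschitz[OF assms(1), of y y'] assms by (auto simp: divide_le_eq)

text \<open>Links point values of the density to slopes of \<open>P\<close>, the quantities whose
  convergence is known. Each inequality applies \<open>D_one_sided\<close> between an endpoint and a
  point at which the density lies on the suitable side of its mean.\<close>

lemma mean_one_sided: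
  assumes "0 < t" "y < y'" and m: "m = (P y' t - P y t) / (y' - y)"
  shows "v m \<le> v (D y t) + (y' - y) / t + err t" "v (D y' t) \<le> v m + (y' - y) / t + err t"
proof -
  have t: "0 \<le> t" using assms by simp
  have mr: "m \<in> {0..R}" using mean_range[OF t assms(2)] m by simp
  obtain u where u: "u \<in> {y<..y'}" "D u t \<le> m" using mean_attained(1)[OF t assms(2) m] by blast
  have "v m \<le> v (D u t)" using D_range[OF t] mr u by (intro v_anti_le) auto
  also have "\<dots> \<le> v (D y t) + (u - y) / t + err t" using D_one_sided[OF assms(1), of y u] u by simp
  also have "(u - y) / t \<le> (y' - y) / t" using u assms by (intro divide_right_mono) auto
  finally show "v m \<le> v (D y t) + (y' - y) / t + err t" by simp
  obtain u where u: "u \<in> {y<..y'}" "m \<le> D u t" using mean_attained(2)[OF t assms(2) m] by blast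
  have "v (D y' t) \<le> v (D u t) + (y' - u) / t + err t" using D_one_sided[OF assms(1), of u y'] u by simp
  also have "v (D u t) \<le> v m" using D_range[OF t] mr u by (intro v_anti_le) auto
  also have "(y' - u) / t \<le> (y' - y) / t" using u assms by (intro divide_right_mono) auto
  finally show "v (D y' t) \<le> v m + (y' - y) / t + err t" by simp
qed

text \<open>Each cell has mass \<open>1 / n\<close>, so evaluating \<open>h\<close> and
  \<open>k\<close> at its left particle instead of averaging over the cell costs a Lipschitz
  constant times the cell length, divided by \<open>n\<close>; the lengths telescope. The particle
  sum has the form of a time derivative along trajectories.\<close>

lemma weak_error:
  assumes t: "0 \<le> t"
    and h: "continuous_on UNIV h" "\<And>y u. \<bar>h y - h u\<bar> \<le> \<Lambda> * \<bar>y - u\<bar>"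
    and k: "continuous_on UNIV k" "\<And>y u. \<bar>k y - k u\<bar> \<le> \<Lambda> * \<bar>y - u\<bar>"
  shows "\<bar>(LINT y|lborel. D y t * h y + flux v (D y t) * k y) - (\<Sum>i<n. h (x i t) + v (rr i t) * k (x i t)) / real n\<bar>
     \<le> \<Lambda> * (1 + V) * (x n t - x 0 t) / real n"
proof -
  have \<Lambda>0: "0 \<le> \<Lambda>" using h(2)[of 0 1] by auto
  define G where "G i y = h y + v (rr i t) * k y" for i y
  define A where "A i = {x i t..<x (Suc i) t}" for i
  have contG: "continuous_on S (G i)" for i S
    unfolding G_def by (rule continuous_on_subset[of UNIV]) (auto intro!: continuous_intros h k)
  have [measurable]: "G i \<in> borel_measurable borel" for i by (rule borel_measurable_continuous_onI[OF contG])
  have LG: "\<bar>G i y - G i u\<bar> \<le> \<Lambda> * (1 + V) * \<bar>y - u\<bar>" for i y u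
  proof -
    have "\<bar>v (rr i t) * (k y - k u)\<bar> \<le> V * (\<Lambda> * \<bar>y - u\<bar>)"
      unfolding abs_mult using v_bound[OF rr_range[OF t]] k(2) V_nonneg by (intro mult_mono) auto
    moreover have "G i y - G i u = (h y - h u) + v (rr i t) * (k y - k u)" by (simp add: G_def algebra_simps)
    ultimately show ?thesis using h(2)[of y u] by (simp add: algebra_simps)
  qed
  have intA: "integrable lborel (\<lambda>y. indicator (A i) y * G i y)" for i
  proof -
    have "integrable lborel (\<lambda>y. indicator {x i t..x (Suc i) t} y *\<^sub>R G i y)"
      by (rule borel_integrable_compact[OF compact_Icc contG])
    then have "integrable lborel (\<lambda>y. indicator (A i) y *\<^sub>R (indicator {x i t..x (Suc i) t} y *\<^sub>R G i y))"
      by (rule integrable_mult_indicator[rotated]) (simp add: A_def)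
    moreover have "(\<lambda>y. indicator (A i) y *\<^sub>R (indicator {x i t..x (Suc i) t} y *\<^sub>R G i y)) = (\<lambda>y. indicator (A i) y * G i y)"
      by (auto simp: A_def indicator_def fun_eq_iff)
    ultimately show ?thesis by simp
  qed
  have "D y t * h y + flux v (D y t) * k y = (\<Sum>i<n. rr i t * (indicator (A i) y * G i y))" for y
  proof -
    have "D y t * h y + flux v (D y t) * k y = (\<Sum>i<n. rr i t * indicator (A i) y) * h y + (\<Sum>i<n. flux v (rr i t) * indicator (A i) y) * k y"
      using comp_D[OF t, of "flux v" y] by (simp add: D_sum A_def flux_def)
    also have "\<dots> = (\<Sum>i<n. rr i t * (indicator (A i) y * G i y))"
      unfolding sum_distrib_right sum.distrib[symmetric]
      by (intro sum.cong) (auto simp: flux_def G_def algebra_simps)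
    finally show ?thesis .
  qed
  then have "(LINT y|lborel. D y t * h y + flux v (D y t) * k y) = (\<Sum>i<n. rr i t * (LINT y|lborel. indicator (A i) y * G i y))"
    using intA by simp
  then have "\<bar>(LINT y|lborel. D y t * h y + flux v (D y t) * k y) - (\<Sum>i<n. G i (x i t)) / real n\<bar>
      = \<bar>\<Sum>i<n. rr i t * (LINT y|lborel. indicator (A i) y * G i y) - G i (x i t) / real n\<bar>"
    by (simp add: sum_subtractf sum_divide_distrib)
  also have "\<dots> \<le> (\<Sum>i<n. \<bar>rr i t * (LINT y|lborel. indicator (A i) y * G i y) - G i (x i t) / real n\<bar>)"
    by (rule sum_abs)
  also have "\<dots> \<le> (\<Sum>i<n. \<Lambda> * (1 + V) * (x (Suc i) t - x i t) / real n)"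
  proof (rule sum_mono)
    fix i assume "i \<in> {..<n}"
    then have i: "i < n" by simp
    define l where "l = x (Suc i) t - x i t"
    have l: "l > 0" using x_less[OF t i] by (simp add: l_def)
    have cA: "integrable lborel (indicator (A i) :: real \<Rightarrow> real)" "(LINT y|lborel. indicator (A i) y) = l"
      using cell_integral[OF t i] by (auto simp: has_bochner_integral_iff A_def l_def)
    have rl: "rr i t * l = 1 / real n" using rr_len[OF t i] by (simp add: l_def)
    have rn: "0 \<le> rr i t" using rr_range[OF t] by simp
    have "rr i t * (LINT y|lborel. indicator (A i) y * G i y) - G i (x i t) / real n
       = rr i t * ((LINT y|lborel. indicator (A i) y * G i y) - G i (x i t) * l)"
      using rl by (simp add: right_diff_distrib) (metis mult.commute mult.left_commute mult_1 times_divide_eq_right)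
    also have "(LINT y|lborel. indicator (A i) y * G i y) - G i (x i t) * l = (LINT y|lborel. indicator (A i) y * G i y - G i (x i t) * indicator (A i) y)"
      using Bochner_Integration.integral_diff[OF intA[of i] integrable_mult_right[OF cA(1), of "G i (x i t)"]] cA(2) by simp
    also have "\<bar>rr i t * \<dots>\<bar> \<le> rr i t * (LINT y|lborel. (\<Lambda> * (1 + V) * l) * indicator (A i) y)"
    proof -
      have "\<bar>LINT y|lborel. indicator (A i) y * G i y - G i (x i t) * indicator (A i) y\<bar>
          \<le> (LINT y|lborel. \<bar>indicator (A i) y * G i y - G i (x i t) * indicator (A i) y\<bar>)" by (rule integral_abs_bound)
      also have "\<dots> \<le> (LINT y|lborel. (\<Lambda> * (1 + V) * l) * indicator (A i) y)"
      proof (rule Bochner_Integration.integral_mono)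
        show "integrable lborel (\<lambda>y. \<bar>indicator (A i) y * G i y - G i (x i t) * indicator (A i) y\<bar>)"
          by (intro integrable_abs Bochner_Integration.integrable_diff intA integrable_mult_right cA)
        show "integrable lborel (\<lambda>y. \<Lambda> * (1 + V) * l * indicator (A i) y)" by (intro integrable_mult_right cA)
        fix y
        show "\<bar>indicator (A i) y * G i y - G i (x i t) * indicator (A i) y\<bar> \<le> \<Lambda> * (1 + V) * l * indicator (A i) y"
        proof (cases "y \<in> A i")
          case True
          have "\<bar>G i y - G i (x i t)\<bar> \<le> \<Lambda> * (1 + V) * \<bar>y - x i t\<bar>" by (rule LG)
          also have "\<dots> \<le> \<Lambda> * (1 + V) * l"
            using True \<Lambda>0 V_nonneg by (intro mult_left_mono) (auto simp: A_def l_def)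
          finally show ?thesis using True by simp
        qed simp
      qed
      finally show ?thesis using rn by (simp add: abs_mult mult_left_mono)
    qed
    also have "\<dots> = \<Lambda> * (1 + V) * l * (rr i t * l)" using cA(2) by simp
    also have "\<dots> = \<Lambda> * (1 + V) * (x (Suc i) t - x i t) / real n" unfolding rl by (simp add: l_def)
    finally show "\<bar>rr i t * (LINT y|lborel. indicator (A i) y * G i y) - G i (x i t) / real n\<bar>
      \<le> \<Lambda> * (1 + V) * (x (Suc i) t - x i t) / real n" .
  qed
  also have "\<dots> = \<Lambda> * (1 + V) * (x n t - x 0 t) / real n"
  proof -
    have "(\<Sum>i<n. x (Suc i) t - x i t) = x n t - x 0 t" by (rule sum_lessThan_telescope)
    then show ?thesis by (simp add: sum_distrib_left[symmetric] sum_divide_distrib[symmetric])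
  qed
  finally show ?thesis by (simp add: G_def)
qed

section \<open>Joint measurability in space and time\<close>

lemma x_cont: "i \<le> n \<Longrightarrow> continuous_on UNIV (\<lambda>t. x i (max 0 t))"
proof -
  assume i: "i \<le> n"
  have "continuous_on {0..} (x i)"
    using x_deriv[OF _ i] by (meson DERIV_continuous atLeast_iff continuous_on_eq_continuous_within)
  then show ?thesis by (rule continuous_on_compose2) (auto intro!: continuous_intros)
qed

lemma D_joint_measurable: "(\<lambda>p. if 0 \<le> snd p then D (fst p) (snd p) else 0) \<in> borel_measurable (borel :: (real \<times> real) measure)"
proof -
  define X where "X i t = x i (max 0 t)" for i t
  have X [measurable]: "X i \<in> borel_measurable borel" if "i \<le> n" for i
    unfolding X_def by (rule borel_measurable_continuous_onI[OF x_cont[OF that]])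
  have "(\<lambda>p. if 0 \<le> snd p then D (fst p) (snd p) else 0)
      = (\<lambda>p. if 0 \<le> snd p then (\<Sum>i<n. (1 / real n) / (X (Suc i) (snd p) - X i (snd p)) *
          (if X i (snd p) \<le> fst p \<and> fst p < X (Suc i) (snd p) then 1 else 0)) else 0)"
    by (auto simp: fun_eq_iff D_sum rr_eq X_def indicator_def intro!: sum.cong)
  also have "\<dots> \<in> borel_measurable borel"
  proof (intro measurable_If borel_measurable_sum)
    fix i assume "i \<in> {..<n}"
    then have [measurable]: "X i \<in> borel_measurable borel" "X (Suc i) \<in> borel_measurable borel" by (auto intro!: X)
    show "(\<lambda>p. (1 / real n) / (X (Suc i) (snd p) - X i (snd p)) *
          (if X i (snd p) \<le> fst p \<and> fst p < X (Suc i) (snd p) then 1 else 0)) \<in> borel_measurable (borel :: (real \<times> real) measure)"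
      by measurable
  qed auto
  finally show ?thesis .
qed

end

subsection \<open>Compactness\<close>

locale ftl_family = initial_flux +
  fixes X :: "nat \<Rightarrow> nat \<Rightarrow> real \<Rightarrow> real"
  assumes ftl: "\<And>n. 1 \<le> n \<Longrightarrow> ftl_solution v \<rho>0 n (X n)"
begin

lemma scheme: "1 \<le> n \<Longrightarrow> ftl_scheme \<rho>0 v K n (X n)"
  by unfold_locales (auto intro: ftl)

abbreviation "Dn n \<equiv> ftl_scheme.D n (X n)"
abbreviation "Pn n \<equiv> ftl_scheme.P n (X n)"
abbreviation "errn n \<equiv> ftl_scheme.err \<rho>0 v n"

lemma Pn_Lipschitz: "1 \<le> n \<Longrightarrow> 0 \<le> t \<Longrightarrow> \<bar>Pn n y t - Pn n a t\<bar> \<le> R * \<bar>y - a\<bar>"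
  using ftl_scheme.P_Lipschitz[OF scheme, of n t a y] ftl_scheme.P_Lipschitz[OF scheme, of n t y a]
  by (cases "a \<le> y") auto

lemma Pn_time: 
  assumes "1 \<le> n" "0 \<le> s" "0 \<le> t" shows "\<bar>Pn n y t - Pn n y s\<bar> \<le> 1 / real n + R * V * \<bar>t - s\<bar>"
  using ftl_scheme.P_time[OF scheme[OF assms(1)] assms(2,3), of y] ftl_scheme.P_time[OF scheme[OF assms(1)] assms(3,2), of y]
  by (simp add: abs_le_iff abs_minus_commute)

text \<open>Arzela-Ascoli once more. Equicontinuity in time holds only up to \<open>1 / n\<close>,
  which is harmless because this defect tends to \<open>0\<close> along the subsequence. The shift
  by \<open>Suc\<close> keeps all indices positive.\<close>

lemma subsequence_exists:
  "\<exists>N U. strict_mono N \<and> (\<forall>k. 1 \<le> N k) \<and> (\<forall>y t. 0 \<le> t \<longrightarrow> (\<lambda>k. Pn (N k) y t) \<longlonglongrightarrow> U y t)"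
proof -
  define S where "S = {p::real\<times>real. fst p \<in> \<rat> \<and> snd p \<in> \<rat> \<and> snd p \<ge> 0}"
  have "S \<subseteq> \<rat> \<times> \<rat>" by (auto simp: S_def)
  moreover have "countable (\<rat> \<times> \<rat> :: (real \<times> real) set)" by (intro countable_SIGMA countable_rat)
  ultimately have cS: "countable S" by (rule countable_subset)
  have "norm (Pn (Suc n) (fst p) (snd p)) \<le> 1" if "p \<in> S" for n p
    using ftl_scheme.P_nonneg[OF scheme[of "Suc n"], of "snd p" "fst p"] ftl_scheme.P_le_1[OF scheme[of "Suc n"], of "snd p" "fst p"] that
    by (auto simp: S_def)
  from function_convergent_subsequence[where f="\<lambda>n p. Pn (Suc n) (fst p) (snd p)", OF cS this]
  obtain k where k: "strict_mono (k :: nat \<Rightarrow> nat)" "\<And>p. p \<in> S \<Longrightarrow> \<exists>l. (\<lambda>n. Pn (Suc (k n)) (fst p) (snd p)) \<longlonglongrightarrow> l"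
    by blast
  define N where "N n = Suc (k n)" for n
  have N: "strict_mono N" "1 \<le> N n" for n using k(1) by (auto simp: N_def strict_mono_def)
  have invN: "(\<lambda>n. 1 / real (N n)) \<longlonglongrightarrow> 0"
    using LIMSEQ_subseq_LIMSEQ[OF lim_1_over_n N(1)] by (simp add: o_def)
  have conv: "convergent (\<lambda>n. Pn (N n) y t)" if t: "t \<ge> 0" for y t
  proof (rule Cauchy_convergent, rule CauchyI)
    fix e :: real assume e: "e > 0"
    define d where "d = e / (8 * (R + R * V + 1))"
    have RV: "R + R * V + 1 > 0" using R_nonneg V_nonneg by (intro add_nonneg_pos add_nonneg_nonneg mult_nonneg_nonneg) auto
    have d: "d > 0" using e RV by (simp add: d_def)
    obtain y' where y': "y' \<in> \<rat>" "y < y'" "y' < y + d" using Rats_dense_in_real[of y "y + d"] d by auto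
    obtain t' where t': "t' \<in> \<rat>" "t < t'" "t' < t + d" using Rats_dense_in_real[of t "t + d"] d by auto
    have near: "\<bar>Pn (N n) y t - Pn (N n) y' t'\<bar> \<le> e / 8 + 1 / real (N n)" for n
    proof -
      have "\<bar>Pn (N n) y t - Pn (N n) y' t\<bar> \<le> R * d"
        using Pn_Lipschitz[OF N(2)[of n] t, of y y'] y' R_nonneg mult_left_mono[of "\<bar>y - y'\<bar>" d R] by auto
      moreover have "\<bar>Pn (N n) y' t - Pn (N n) y' t'\<bar> \<le> 1 / real (N n) + R * V * d"
        using Pn_time[OF N(2)[of n], of t' t y'] t t' R_nonneg V_nonneg mult_left_mono[of "\<bar>t - t'\<bar>" d "R * V"] by auto
      moreover have "R * d + R * V * d \<le> e / 8"
      proof -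
        have "R * d + R * V * d \<le> (R + R * V + 1) * d" using d by (simp add: algebra_simps)
        also have "\<dots> = e / 8"
        proof -
          have "S * (e / (8 * S)) = e / 8" if "S > 0" for S :: real using that by simp
          from this[OF RV] show ?thesis by (simp only: d_def)
        qed
        finally show ?thesis .
      qed
      ultimately show ?thesis by linarith
    qed
    obtain l where "(\<lambda>n. Pn (N n) y' t') \<longlonglongrightarrow> l" using k(2)[of "(y', t')"] y' t' t by (auto simp: S_def N_def)
    then have "Cauchy (\<lambda>n. Pn (N n) y' t')" by (rule LIMSEQ_imp_Cauchy)
    moreover have e8: "e / 8 > 0" using e by simp
    ultimately obtain M1 where M1: "\<And>m n. m \<ge> M1 \<Longrightarrow> n \<ge> M1 \<Longrightarrow> norm (Pn (N m) y' t' - Pn (N n) y' t') < e / 8"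
      using CauchyD by blast
    obtain M2 where M2: "\<And>n. n \<ge> M2 \<Longrightarrow> norm (1 / real (N n) - 0) < e / 8" using LIMSEQ_D[OF invN e8] by blast
    have "norm (Pn (N m) y t - Pn (N n) y t) < e" if "m \<ge> max M1 M2" "n \<ge> max M1 M2" for m n
      using M1[of m n] M2[of m] M2[of n] near[of m] near[of n] that e unfolding real_norm_def by linarith
    then show "\<exists>M. \<forall>m\<ge>M. \<forall>n\<ge>M. norm (Pn (N m) y t - Pn (N n) y t) < e" by blast
  qed
  show ?thesis
    using N conv
    by (intro exI[of _ N] exI[of _ "\<lambda>y t. lim (\<lambda>n. Pn (N n) y t)"]) (auto simp: convergent_LIMSEQ_iff)
qed

text \<open>A continuous injection of a compact interval has a continuous inverse, and the limit of
  \<open>v (d k)\<close> remains in the closed image.\<close>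

lemma v_convergent_imp:
  assumes d: "\<And>k. d k \<in> {0..R}" and "convergent (\<lambda>k::nat. v (d k))"
  shows "convergent d"
proof -
  define w where "w = the_inv_into {0..R} v"
  have inj: "inj_on v {0..R}"
    using v_anti by (intro inj_onI) (metis less_irrefl linorder_neqE)
  have wv: "\<And>r. r \<in> {0..R} \<Longrightarrow> w (v r) = r" unfolding w_def using the_inv_into_f_f[OF inj] by blast
  have wc: "continuous_on (v ` {0..R}) w"
    by (rule continuous_on_inv[OF v_cont]) (auto simp: wv)
  obtain L where L: "(\<lambda>k. v (d k)) \<longlonglongrightarrow> L" using assms(2) unfolding convergent_def by blast
  have "closed (v ` {0..R})" by (intro compact_imp_closed compact_continuous_image v_cont) auto
  then have "L \<in> v ` {0..R}" using closed_sequentially[of _ "\<lambda>k. v (d k)" L] L d by blast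
  then have "(\<lambda>k. w (v (d k))) \<longlonglongrightarrow> w L"
    by (intro continuous_on_tendsto_compose[OF wc L]) (use d in auto)
  then show ?thesis unfolding convergent_def using wv[OF d] by auto
qed

lemma countable_imp_AE: "countable S \<Longrightarrow> AE y in lborel. y \<notin> (S :: real set)"
  by (rule AE_not_in) (rule countable_imp_null_set_lborel)

end

locale ftl_limit = ftl_family +
  fixes N :: "nat \<Rightarrow> nat" and U :: "real \<Rightarrow> real \<Rightarrow> real"
  assumes N_strict: "strict_mono N" and N_pos: "\<And>k. 1 \<le> N k"
    and U: "\<And>y t. 0 \<le> t \<Longrightarrow> (\<lambda>k. ftl_scheme.P (N k) (X (N k)) y t) \<longlonglongrightarrow> U y t"
begin

lemma inverse_N: "(\<lambda>n. 1 / real (N n)) \<longlonglongrightarrow> 0"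
  using LIMSEQ_subseq_LIMSEQ[OF lim_1_over_n N_strict] by (simp add: o_def)

lemma err_tendsto: 
  assumes "0 < t" shows "(\<lambda>k. errn (N k) t) \<longlonglongrightarrow> 0"
proof -
  have "(\<lambda>k. sqrt (1 / real (N k))) \<longlonglongrightarrow> sqrt 0" by (intro tendsto_intros inverse_N)
  then have s: "(\<lambda>k. 1 / sqrt (real (N k))) \<longlonglongrightarrow> 0" by (simp add: real_sqrt_divide)
  have "(\<lambda>k. (1 / t) * (1 / sqrt (real (N k)))) \<longlonglongrightarrow> (1 / t) * 0" by (intro tendsto_intros s)
  moreover have "(\<lambda>k. v (min R (1 / sqrt (real (N k))))) \<longlonglongrightarrow> v (min R 0)"
    by (rule continuous_on_tendsto_compose[OF v_cont tendsto_min[OF tendsto_const s]]) (use R_nonneg in auto)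
  ultimately have "(\<lambda>k. (1 / t) * (1 / sqrt (real (N k))) + (v 0 - v (min R (1 / sqrt (real (N k)))))) \<longlonglongrightarrow> (1 / t) * 0 + (v 0 - v (min R 0))"
    by (intro tendsto_add tendsto_diff tendsto_const)
  then show ?thesis using ftl_scheme.err_def[OF scheme[OF N_pos]] R_nonneg by simp
qed

lemma Dn_range: "0 \<le> t \<Longrightarrow> Dn (N k) y t \<in> {0..R}"
  by (rule ftl_scheme.D_range[OF scheme[OF N_pos]])

section \<open>Pointwise limit of the densities\<close>

definition slope :: "real \<Rightarrow> real \<Rightarrow> real \<Rightarrow> real" where "slope t a y = (U y t - U a t) / (y - a)"

lemma slope_limit:
  assumes "0 < t" "a < y"
  shows "(\<lambda>k. v ((Pn (N k) y t - Pn (N k) a t) / (y - a))) \<longlonglongrightarrow> v (slope t a y)" "slope t a y \<in> {0..R}"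
proof -
  have lim: "(\<lambda>k. (Pn (N k) y t - Pn (N k) a t) / (y - a)) \<longlonglongrightarrow> slope t a y"
    unfolding slope_def using assms by (intro tendsto_intros U) auto
  have r: "(Pn (N k) y t - Pn (N k) a t) / (y - a) \<in> {0..R}" for k
    by (rule ftl_scheme.mean_range[OF scheme[OF N_pos]]) (use assms in auto)
  show s: "slope t a y \<in> {0..R}" using closed_sequentially[OF _ _ lim, of "{0..R}"] r by auto
  show "(\<lambda>k. v ((Pn (N k) y t - Pn (N k) a t) / (y - a))) \<longlonglongrightarrow> v (slope t a y)"
    by (rule continuous_on_tendsto_compose[OF v_cont lim s]) (use r in auto)
qed

text \<open>Backward quotients of the limit \<open>U\<close> bound \<open>v(\<rho>\<^sup>n)\<close>
  from above and, in \<open>v_lower\<close>, forward quotients bound it from below. The terms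
  \<open>(y - a) / t\<close> come from the one-sided bound, while the error of the scheme tends to
  \<open>0\<close>.\<close>

lemma v_upper:
  assumes "0 < t" "a < y" "c > v (slope t a y) + (y - a) / t"
  shows "\<forall>\<^sub>F k in sequentially. v (Dn (N k) y t) < c"
proof -
  have "(\<lambda>k. v ((Pn (N k) y t - Pn (N k) a t) / (y - a)) + (y - a) / t + errn (N k) t) \<longlonglongrightarrow> v (slope t a y) + (y - a) / t + 0"
    by (intro tendsto_intros slope_limit err_tendsto assms)
  then have "\<forall>\<^sub>F k in sequentially. v ((Pn (N k) y t - Pn (N k) a t) / (y - a)) + (y - a) / t + errn (N k) t < c"
    using assms(3) by (intro order_tendstoD(2)) auto
  then show ?thesis
  proof eventually_elim
    case (elim k)
    then show ?case using ftl_scheme.mean_one_sided(2)[OF scheme[OF N_pos] assms(1,2) refl, of k] by simp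
  qed
qed

lemma v_lower:
  assumes "0 < t" "y < a" "c < v (slope t y a) - (a - y) / t"
  shows "\<forall>\<^sub>F k in sequentially. c < v (Dn (N k) y t)"
proof -
  have "(\<lambda>k. v ((Pn (N k) a t - Pn (N k) y t) / (a - y)) - (a - y) / t - errn (N k) t) \<longlonglongrightarrow> v (slope t y a) - (a - y) / t - 0"
    by (intro tendsto_intros slope_limit err_tendsto assms)
  then have "\<forall>\<^sub>F k in sequentially. c < v ((Pn (N k) a t - Pn (N k) y t) / (a - y)) - (a - y) / t - errn (N k) t"
    using assms(3) by (intro order_tendstoD(1)) auto
  then show ?thesis
  proof eventually_elim
    case (elim k)
    then show ?case using ftl_scheme.mean_one_sided(1)[OF scheme[OF N_pos] assms(1,2) refl, of k] by simp
  qed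
qed

text \<open>\<open>up y\<close> is the best upper bound that backward quotients give for the limit
  of \<open>v\<close> at \<open>y\<close>. A quotient over \<open>[y, a]\<close> is backward for
  \<open>a\<close> and forward for \<open>y\<close>, so \<open>up a\<close>, lowered by
  \<open>2 * (a - y) / t\<close>, is a lower bound at \<open>y\<close>. Hence
  \<open>2 * y / t - up y\<close> is nondecreasing, and both bounds meet at its continuity
  points.\<close>

lemma AE_convergent:
  assumes t: "0 < t"
  shows "AE y in lborel. convergent (\<lambda>k. Dn (N k) y t)"
proof -
  define up where "up y = (INF a\<in>{..<y}. v (slope t a y) + (y - a) / t)" for y
  have lb: "v R \<le> v (slope t a y) + (y - a) / t" if "a < y" for a y
    using slope_limit(2)[OF t that] v_anti_le[of "slope t a y" R] R_nonneg t that by (auto intro: add_increasing2)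
  have bdd: "bdd_below ((\<lambda>a. v (slope t a y) + (y - a) / t) ` {..<y})" for y
    by (rule bdd_belowI2[where m="v R"]) (use lb in auto)
  have ne: "{..<y} \<noteq> {}" for y :: real using lt_ex[of y] by auto
  have up_le: "up y \<le> v (slope t a y) + (y - a) / t" if "a < y" for a y
    unfolding up_def using bdd that by (intro cINF_lower) auto
  have upper: "\<forall>\<^sub>F k in sequentially. v (Dn (N k) y t) < c" if upc: "up y < c" for y c
  proof -
    obtain a where "a < y" "v (slope t a y) + (y - a) / t < c"
      using upc cINF_less_iff[OF ne bdd, of y c] unfolding up_def by auto
    then show ?thesis by (intro v_upper[OF t]) auto
  qed
  have lower: "\<forall>\<^sub>F k in sequentially. c < v (Dn (N k) y t)" if "y < a" "c < up a - 2 * (a - y) / t" for y a c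
  proof (rule v_lower[OF t that(1)])
    \<comment> \<open>One \<open>(a - y) / t\<close> comes from the definition of
      \<open>up a\<close>, the other from \<open>v_lower\<close>; hence the factor
      \<open>2\<close>.\<close>
    have "2 * (a - y) / t = (a - y) / t + (a - y) / t" by simp
    then show "c < v (slope t y a) - (a - y) / t" using up_le[OF that(1)] that(2) by linarith
  qed
  define M where "M y = 2 * y / t - up y" for y
  have "mono M"
  proof (rule monoI)
    fix y a :: real assume "y \<le> a"
    show "M y \<le> M a"
    proof (cases "y = a")
      case False
      then have ya: "y < a" using \<open>y \<le> a\<close> by simp
      have "up a - 2 * (a - y) / t \<le> up y"
      proof (rule ccontr)
        assume "\<not> up a - 2 * (a - y) / t \<le> up y"
        \<comment> \<open>\<open>v (Dn (N k) y t)\<close> would eventually lie on both sides of such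
          a level \<open>c\<close>.\<close>
        then obtain c where c: "up y < c" "c < up a - 2 * (a - y) / t" using dense not_le by blast
        have "\<forall>\<^sub>F k in sequentially. False"
          using upper[OF c(1)] lower[OF ya c(2)] by eventually_elim simp
        then show False by simp
      qed
      then show ?thesis by (simp add: M_def diff_divide_distrib right_diff_distrib)
    qed simp
  qed
  then have "countable {a. \<not> isCont M a}" by (rule mono_ctble_discont)
  from countable_imp_AE[OF this] show ?thesis
  proof eventually_elim
    case (elim y)
    then have cM: "isCont M y" by simp
    have "(\<lambda>k. v (Dn (N k) y t)) \<longlonglongrightarrow> up y"
    proof (rule order_tendstoI)
      fix c assume "up y < c" then show "\<forall>\<^sub>F k in sequentially. v (Dn (N k) y t) < c" by (rule upper)
    next
      fix c assume c: "c < up y"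
      \<comment> \<open>By continuity of \<open>M\<close> the lower bounds from points
        \<open>a\<close> right of \<open>y\<close> approach \<open>up y\<close> itself.\<close>
      have "isCont (\<lambda>a. 2 * y / t - M a) y" by (intro continuous_intros cM)
      then have "((\<lambda>a. 2 * y / t - M a) \<longlongrightarrow> up y) (at y)" by (simp add: isCont_def M_def)
      then have "((\<lambda>a. 2 * y / t - M a) \<longlongrightarrow> up y) (at_right y)" by (rule tendsto_within_subset) simp
      then have "\<forall>\<^sub>F a in at_right y. c < 2 * y / t - M a" using c by (rule order_tendstoD)
      then have "\<forall>\<^sub>F a in at_right y. c < 2 * y / t - M a \<and> y < a"
        by (intro eventually_conj eventually_at_right_less)
      then obtain a where "c < 2 * y / t - M a" "y < a"
        using eventually_happens'[OF trivial_limit_at_right_real] by blast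
      then show "\<forall>\<^sub>F k in sequentially. c < v (Dn (N k) y t)"
        by (intro lower[of y a]) (auto simp: M_def diff_divide_distrib right_diff_distrib)
    qed
    then have "convergent (\<lambda>k. v (Dn (N k) y t))" by (rule convergentI)
    then show ?case by (rule v_convergent_imp[rotated]) (use Dn_range t in auto)
  qed
qed

text \<open>\<open>lim\<close> is unspecified where the sequence diverges; the clamp puts these
  values into \<open>{0..R}\<close> too, so that \<open>v\<close> and \<open>b\<close> are evaluated
  only where they are known. Convergence is established for positive times, and \<open>0\<close> is
  a default value for the others.\<close>

definition rho :: "real \<Rightarrow> real \<Rightarrow> real" where
  "rho y t = (if 0 < t then max 0 (min R (lim (\<lambda>k. Dn (N k) y t))) else 0)"

lemma rho_range: "rho y t \<in> {0..R}"
  using R_nonneg by (auto simp: rho_def)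

lemma rho_limit:
  assumes "0 < t" "convergent (\<lambda>k. Dn (N k) y t)"
  shows "(\<lambda>k. Dn (N k) y t) \<longlonglongrightarrow> rho y t"
proof -
  have lim: "(\<lambda>k. Dn (N k) y t) \<longlonglongrightarrow> lim (\<lambda>k. Dn (N k) y t)" using assms(2) by (simp add: convergent_LIMSEQ_iff)
  have "lim (\<lambda>k. Dn (N k) y t) \<in> {0..R}"
    using closed_sequentially[OF _ _ lim, of "{0..R}"] Dn_range assms(1) by auto
  then have "rho y t = lim (\<lambda>k. Dn (N k) y t)" using assms(1) by (simp add: rho_def)
  then show ?thesis using lim by simp
qed

lemma AE_limit: "0 < t \<Longrightarrow> AE y in lborel. (\<lambda>k. Dn (N k) y t) \<longlonglongrightarrow> rho y t"
proof -
  assume t: "0 < t"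
  show ?thesis using AE_convergent[OF t] by eventually_elim (rule rho_limit[OF t])
qed

lemma Dn_measurable: "0 \<le> t \<Longrightarrow> (\<lambda>y. Dn (N k) y t) \<in> borel_measurable borel"
  by (rule ftl_scheme.D_measurable_x[OF scheme[OF N_pos]])

lemma Dn_joint_measurable: "(\<lambda>p. if 0 \<le> snd p then Dn (N k) (fst p) (snd p) else 0) \<in> borel_measurable (borel :: (real \<times> real) measure)"
  by (rule ftl_scheme.D_joint_measurable[OF scheme[OF N_pos]])

lemma rho_joint_measurable [measurable]: "(\<lambda>p. rho (fst p) (snd p)) \<in> borel_measurable (borel :: (real \<times> real) measure)"
proof -
  have [measurable]: "(\<lambda>p. lim (\<lambda>k. if 0 \<le> snd p then Dn (N k) (fst p) (snd p) else 0)) \<in> borel_measurable (borel :: (real \<times> real) measure)"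
    by (rule borel_measurable_lim_metric) (rule Dn_joint_measurable)
  have "(\<lambda>p. rho (fst p) (snd p)) = (\<lambda>p::real\<times>real. if 0 < snd p then
      max 0 (min R (lim (\<lambda>k. if 0 \<le> snd p then Dn (N k) (fst p) (snd p) else 0))) else 0)"
    by (auto simp: rho_def fun_eq_iff)
  also have "\<dots> \<in> borel_measurable borel" by measurable
  finally show ?thesis .
qed

lemma rho_measurable [measurable]: "(\<lambda>y. rho y t) \<in> borel_measurable borel"
  using measurable_compose[OF _ rho_joint_measurable, of "\<lambda>y. (y, t)" borel] by simp

lemma rho_outside:
  assumes "y \<notin> {xl - V * t..xr + V * t}" shows "rho y t = 0"
proof (cases "0 < t")
  case True
  then have "Dn (N k) y t = 0" for k
    using ftl_scheme.D_support[OF scheme[OF N_pos], of t y k] assms by simp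
  then show ?thesis using R_nonneg by (simp add: rho_def)
qed (simp add: rho_def)

lemma rho_one_sided:
  assumes "0 < t" "y \<le> y'" "convergent (\<lambda>k. Dn (N k) y t)" "convergent (\<lambda>k. Dn (N k) y' t)"
  shows "v (rho y' t) - v (rho y t) \<le> (y' - y) / t"
proof (rule LIMSEQ_le)
  have "(\<lambda>k. v (Dn (N k) z t)) \<longlonglongrightarrow> v (rho z t)" if "convergent (\<lambda>k. Dn (N k) z t)" for z
    by (rule continuous_on_tendsto_compose[OF v_cont rho_limit[OF assms(1) that] rho_range])
      (use Dn_range assms(1) in auto)
  then show "(\<lambda>k. v (Dn (N k) y' t) - v (Dn (N k) y t)) \<longlonglongrightarrow> v (rho y' t) - v (rho y t)"
    using assms(3,4) by (intro tendsto_diff) blast+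
  show "(\<lambda>k. (y' - y) / t + errn (N k) t) \<longlonglongrightarrow> (y' - y) / t"
    using tendsto_add[OF tendsto_const err_tendsto[OF assms(1)]] by fastforce
  show "\<exists>M. \<forall>k\<ge>M. v (Dn (N k) y' t) - v (Dn (N k) y t) \<le> (y' - y) / t + errn (N k) t"
    using ftl_scheme.D_one_sided[OF scheme[OF N_pos] assms(1,2)] by blast
qed

lemma limit_integral:
  fixes G h :: "real \<Rightarrow> real"
  assumes "0 < t" "continuous_on {0..R} G" "integrable lborel h"
  shows "(\<lambda>k. LINT y|lborel. G (Dn (N k) y t) * h y) \<longlonglongrightarrow> (LINT y|lborel. G (rho y t) * h y)"
proof -
  interpret F: flux_fun "flux v" b R B by (rule flux_fun)
  have "bounded (G ` {0..R})" by (intro compact_imp_bounded compact_continuous_image assms) auto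
  then obtain M where M: "\<And>r. r \<in> {0..R} \<Longrightarrow> \<bar>G r\<bar> \<le> M" unfolding bounded_iff by (metis image_eqI real_norm_def)
  have t: "0 \<le> t" using assms by simp
  have [measurable]: "(\<lambda>y. G (Dn (N k) y t)) \<in> borel_measurable borel" "(\<lambda>y. G (rho y t)) \<in> borel_measurable borel" for k
    by (rule F.comp_measurable[OF assms(2) Dn_measurable[OF t] Dn_range[OF t]] F.comp_measurable[OF assms(2) rho_measurable rho_range])+
  have [measurable]: "h \<in> borel_measurable borel" using assms(3) borel_measurable_integrable by fastforce
  show ?thesis
  proof (rule integral_dominated_convergence[where w="\<lambda>y. M * \<bar>h y\<bar>"])
    show "AE y in lborel. (\<lambda>k. G (Dn (N k) y t) * h y) \<longlonglongrightarrow> G (rho y t) * h y"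
      using AE_limit[OF assms(1)]
    proof eventually_elim
      case (elim y)
      have "(\<lambda>k. G (Dn (N k) y t)) \<longlonglongrightarrow> G (rho y t)"
        by (rule continuous_on_tendsto_compose[OF assms(2) elim rho_range]) (use Dn_range t in auto)
      then show ?case by (intro tendsto_intros)
    qed
    show "AE y in lborel. norm (G (Dn (N k) y t) * h y) \<le> M * \<bar>h y\<bar>" for k
      using M[OF Dn_range[OF t]] by (intro AE_I2) (auto simp: abs_mult intro: mult_right_mono)
    show "integrable lborel (\<lambda>y. M * \<bar>h y\<bar>)" using assms(3) by auto
  qed measurable
qed

end

subsection \<open>Test functions\<close>

lemma DERIV_slice:
  fixes \<psi> :: "real \<times> real \<Rightarrow> real"
  assumes "\<psi> differentiable (at (x, t))"
  shows "((\<lambda>y. \<psi> (y, t)) has_real_derivative frechet_derivative \<psi> (at (x, t)) (1, 0)) (at x)"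
    and "((\<lambda>s. \<psi> (x, s)) has_real_derivative frechet_derivative \<psi> (at (x, t)) (0, 1)) (at t)"
proof -
  define L where "L = frechet_derivative \<psi> (at (x, t))"
  have D: "(\<psi> has_derivative L) (at (x, t))" using assms by (simp add: L_def frechet_derivative_works)
  then have lin: "linear L" by (rule has_derivative_linear)
  have L1: "(\<lambda>h. L (h, 0)) = (*) (L (1, 0))"
  proof
    fix h
    have "L (h *\<^sub>R (1, 0)) = h *\<^sub>R L (1, 0)" by (rule linear_cmul[OF lin])
    then show "L (h, 0) = L (1, 0) * h" by (simp add: mult.commute)
  qed
  have L2: "(\<lambda>h. L (0, h)) = (*) (L (0, 1))"
  proof
    fix h
    have "L (h *\<^sub>R (0, 1)) = h *\<^sub>R L (0, 1)" by (rule linear_cmul[OF lin])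
    then show "L (0, h) = L (0, 1) * h" by (simp add: mult.commute)
  qed
  have "((\<lambda>y. \<psi> (y, t)) has_derivative (\<lambda>h. L (h, 0))) (at x)"
    by (rule has_derivative_compose[OF has_derivative_Pair[OF has_derivative_ident has_derivative_const] D])
  then show "((\<lambda>y. \<psi> (y, t)) has_real_derivative frechet_derivative \<psi> (at (x, t)) (1, 0)) (at x)"
    unfolding has_field_derivative_def L_def[symmetric] L1 .
  have "((\<lambda>s. \<psi> (x, s)) has_derivative (\<lambda>h. L (0, h))) (at t)"
    by (rule has_derivative_compose[OF has_derivative_Pair[OF has_derivative_const has_derivative_ident] D])
  then show "((\<lambda>s. \<psi> (x, s)) has_real_derivative frechet_derivative \<psi> (at (x, t)) (0, 1)) (at t)"
    unfolding has_field_derivative_def L_def[symmetric] L2 .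
qed

lemma frechet_derivative_eq_0:
  fixes \<psi> :: "real \<times> real \<Rightarrow> real"
  assumes "closed S" "\<And>q. q \<notin> S \<Longrightarrow> \<psi> q = 0" "p \<notin> S"
  shows "frechet_derivative \<psi> (at p) u = 0"
proof -
  have "((\<lambda>_. 0::real) has_derivative (\<lambda>_. 0)) (at p)" by simp
  then have "(\<psi> has_derivative (\<lambda>_. 0)) (at p)"
    by (rule has_derivative_transform_within_open[where s="-S"]) (use assms in auto)
  then show ?thesis using frechet_derivative_at by metis
qed

lemma Ck_1_bounds:
  fixes \<psi> :: "real \<times> real \<Rightarrow> real"
  assumes \<psi>: "Ck 1 \<psi>" and S: "compact S" "\<And>q. q \<notin> S \<Longrightarrow> \<psi> q = 0"
  shows "continuous_on UNIV \<psi>" "\<exists>\<Lambda>\<ge>0. (\<forall>x y t. \<bar>\<psi> (x, t) - \<psi> (y, t)\<bar> \<le> \<Lambda> * \<bar>x - y\<bar>) \<and> (\<forall>p. \<bar>\<psi> p\<bar> \<le> \<Lambda>)"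
proof -
  define \<psi>x where "\<psi>x p = frechet_derivative \<psi> (at p) (1, 0)" for p
  have diff: "\<psi> differentiable (at p)" for p using \<psi> by (cases p) simp
  have cx: "continuous_on UNIV \<psi>x" using \<psi> by (simp add: \<psi>x_def[abs_def])
  show c: "continuous_on UNIV \<psi>"
    using diff differentiable_imp_continuous_within continuous_at_imp_continuous_on by blast
  have z: "\<psi>x p = 0" if "p \<notin> S" for p
    unfolding \<psi>x_def by (rule frechet_derivative_eq_0[OF compact_imp_closed[OF S(1)] _ that]) (rule S(2))
  have bd: "\<exists>M. \<forall>p\<in>S. \<bar>k p\<bar> \<le> M" if "continuous_on UNIV k" for k :: "real \<times> real \<Rightarrow> real"
  proof -
    have "bounded (k ` S)" by (intro compact_imp_bounded compact_continuous_image S continuous_on_subset[OF that]) simp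
    then show ?thesis unfolding bounded_iff by (metis image_eqI real_norm_def)
  qed
  obtain M1 where M1: "\<And>p. p \<in> S \<Longrightarrow> \<bar>\<psi>x p\<bar> \<le> M1" using bd[OF cx] by blast
  obtain M2 where M2: "\<And>p. p \<in> S \<Longrightarrow> \<bar>\<psi> p\<bar> \<le> M2" using bd[OF c] by blast
  define \<Lambda> where "\<Lambda> = max 0 (max M1 M2)"
  have b1: "\<bar>\<psi>x p\<bar> \<le> \<Lambda>" for p using z[of p] M1[of p] by (cases "p \<in> S") (auto simp: \<Lambda>_def)
  have b2: "\<bar>\<psi> p\<bar> \<le> \<Lambda>" for p using S(2)[of p] M2[of p] by (cases "p \<in> S") (auto simp: \<Lambda>_def)
  have "\<bar>\<psi> (x, t) - \<psi> (y, t)\<bar> \<le> \<Lambda> * \<bar>x - y\<bar>" for x y t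
  proof -
    have "norm (\<psi> (x, t) - \<psi> (y, t)) \<le> \<Lambda> * norm (x - y)"
    proof (rule field_differentiable_bound[of UNIV])
      show "((\<lambda>y. \<psi> (y, t)) has_field_derivative \<psi>x (z, t)) (at z within UNIV)" for z
        unfolding \<psi>x_def using DERIV_slice(1)[OF diff] by simp
    qed (use b1 in auto)
    then show ?thesis by simp
  qed
  then show "\<exists>\<Lambda>\<ge>0. (\<forall>x y t. \<bar>\<psi> (x, t) - \<psi> (y, t)\<bar> \<le> \<Lambda> * \<bar>x - y\<bar>) \<and> (\<forall>p. \<bar>\<psi> p\<bar> \<le> \<Lambda>)"
    using b2 by (intro exI[of _ \<Lambda>]) (auto simp: \<Lambda>_def)
qed

text \<open>\<open>a\<close> and \<open>c\<close> are the time and the space derivative. The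
  Lipschitz bounds in space feed the quadrature error of the particle sums; \<open>\<tau>\<close>
  keeps the support away from time \<open>0\<close>.\<close>

lemma test_function_facts:
  fixes \<phi> :: "real \<times> real \<Rightarrow> real"
  assumes "test_function \<phi>"
  obtains a c \<Lambda> A \<tau> T where "0 < \<tau>" "\<tau> \<le> T" "0 \<le> \<Lambda>" "0 \<le> A"
    "continuous_on UNIV \<phi>" "continuous_on UNIV a" "continuous_on UNIV c"
    "\<And>p. p \<notin> {-A..A} \<times> {\<tau>..T} \<Longrightarrow> \<phi> p = 0 \<and> a p = 0 \<and> c p = 0"
    "\<And>x t. dt \<phi> x t = a (x, t)" "\<And>x t. dx \<phi> x t = c (x, t)"
    "\<And>p. (\<phi> has_derivative (\<lambda>u. fst u * c p + snd u * a p)) (at p)"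
    "\<And>x y t. \<bar>\<phi> (x, t) - \<phi> (y, t)\<bar> \<le> \<Lambda> * \<bar>x - y\<bar>"
    "\<And>x y t. \<bar>a (x, t) - a (y, t)\<bar> \<le> \<Lambda> * \<bar>x - y\<bar>"
    "\<And>x y t. \<bar>c (x, t) - c (y, t)\<bar> \<le> \<Lambda> * \<bar>x - y\<bar>"
    "\<And>p. \<bar>\<phi> p\<bar> \<le> \<Lambda>" "\<And>p. \<bar>a p\<bar> \<le> \<Lambda>" "\<And>p. \<bar>c p\<bar> \<le> \<Lambda>"
proof -
  define S where "S = closure {p. \<phi> p \<noteq> 0}"
  have C: "Ck k \<phi>" for k using assms unfolding test_function_def by (rule conjunct1[THEN spec])
  have cs: "compact_support_in (UNIV \<times> {0<..}) \<phi>" using assms unfolding test_function_def by (rule conjunct2)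
  have S: "compact S" "S \<subseteq> UNIV \<times> {0<..}"
    using cs[unfolded compact_support_in_def, folded S_def] by (rule conjunct1, rule conjunct2)
  note C2 = C[of "Suc (Suc 0)"] and C1 = C[of 1]
  have "{p. \<phi> p \<noteq> 0} \<subseteq> S" unfolding S_def by (rule closure_subset)
  then have zS: "\<phi> p = 0" if "p \<notin> S" for p using that by (metis (mono_tags, lifting) mem_Collect_eq subsetD)
  have diff: "\<phi> differentiable (at p)" for p using C2 unfolding Ck.simps by blast
  define a where "a p = frechet_derivative \<phi> (at p) (0, 1)" for p
  define c where "c p = frechet_derivative \<phi> (at p) (1, 0)" for p
  have "Ck 1 (\<lambda>p. frechet_derivative \<phi> (at p) u)" for u using C2 unfolding One_nat_def Ck.simps(2)[of "Suc 0"] by blast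
  then have Ca: "Ck 1 a" and Cc: "Ck 1 c" unfolding a_def[abs_def] c_def[abs_def] by blast+
  have za: "a p = 0" and zc: "c p = 0" if "p \<notin> S" for p :: "real \<times> real"
    unfolding a_def c_def by (rule frechet_derivative_eq_0[OF compact_imp_closed[OF S(1)] _ that], erule zS)+
  have D: "(\<phi> has_derivative (\<lambda>u. fst u * c p + snd u * a p)) (at p)" for p
  proof -
    define L where "L = frechet_derivative \<phi> (at p)"
    have DL: "(\<phi> has_derivative L) (at p)" using diff by (simp add: L_def frechet_derivative_works)
    then have lin: "linear L" by (rule has_derivative_linear)
    have Lu: "L u = fst u * L (1, 0) + snd u * L (0, 1)" for u
    proof -
      have "L u = L (fst u *\<^sub>R (1, 0) + snd u *\<^sub>R (0, 1))" by simp
      then show ?thesis by (simp only: linear_add[OF lin] linear_cmul[OF lin] real_scaleR_def)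
    qed
    have "L = (\<lambda>u. fst u * c p + snd u * a p)"
    proof
      fix u show "L u = fst u * c p + snd u * a p"
        unfolding a_def c_def L_def[symmetric] by (rule Lu)
    qed
    then show ?thesis using DL by simp
  qed
  obtain \<tau> where \<tau>: "\<tau> > 0" "\<And>p. p \<in> S \<Longrightarrow> \<tau> \<le> snd p"
  proof (cases "S = {}")
    case False
    obtain p0 where "p0 \<in> S" "\<And>p. p \<in> S \<Longrightarrow> snd p0 \<le> snd p"
      using continuous_attains_inf[OF S(1) False continuous_on_snd[OF continuous_on_id]] by auto
    then show ?thesis using that[of "snd p0"] S(2) by auto
  qed (use that[of 1] in auto)
  obtain M where M: "\<And>p. p \<in> S \<Longrightarrow> norm p \<le> M" using compact_imp_bounded[OF S(1)] unfolding bounded_iff by blast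
  define A where "A = max 0 M" define T where "T = max \<tau> M"
  have inS: "p \<in> {-A..A} \<times> {\<tau>..T}" if "p \<in> S" for p
  proof -
    have "\<bar>fst p\<bar> \<le> M" "\<bar>snd p\<bar> \<le> M" using M[OF that] norm_fst_le[of "fst p" "snd p"] norm_snd_le[of "snd p" "fst p"] by auto
    then show ?thesis using \<tau>(2)[OF that] by (auto simp: A_def T_def mem_Times_iff)
  qed
  obtain L1 where L1: "L1 \<ge> 0" "\<forall>x y t. \<bar>\<phi> (x, t) - \<phi> (y, t)\<bar> \<le> L1 * \<bar>x - y\<bar>" "\<forall>p. \<bar>\<phi> p\<bar> \<le> L1"
    using Ck_1_bounds(2)[OF C1 S(1) zS] by blast
  obtain L2 where L2: "L2 \<ge> 0" "\<forall>x y t. \<bar>a (x, t) - a (y, t)\<bar> \<le> L2 * \<bar>x - y\<bar>" "\<forall>p. \<bar>a p\<bar> \<le> L2"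
    using Ck_1_bounds(2)[OF Ca S(1) za] by blast
  obtain L3 where L3: "L3 \<ge> 0" "\<forall>x y t. \<bar>c (x, t) - c (y, t)\<bar> \<le> L3 * \<bar>x - y\<bar>" "\<forall>p. \<bar>c p\<bar> \<le> L3"
    using Ck_1_bounds(2)[OF Cc S(1) zc] by blast
  define \<Lambda> where "\<Lambda> = L1 + L2 + L3"
  have up: "L1 * \<bar>d\<bar> \<le> \<Lambda> * \<bar>d\<bar>" "L2 * \<bar>d\<bar> \<le> \<Lambda> * \<bar>d\<bar>" "L3 * \<bar>d\<bar> \<le> \<Lambda> * \<bar>d\<bar>" for d
    using L1(1) L2(1) L3(1) by (auto simp: \<Lambda>_def intro!: mult_right_mono)
  show ?thesis
  proof (rule that[of \<tau> T \<Lambda> A a c])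
    show "0 < \<tau>" "\<tau> \<le> T" "0 \<le> \<Lambda>" "0 \<le> A" using \<tau> L1 L2 L3 by (auto simp: T_def A_def \<Lambda>_def)
    show "continuous_on UNIV \<phi>" "continuous_on UNIV a" "continuous_on UNIV c"
      using Ck_1_bounds(1)[OF C1 S(1) zS] Ck_1_bounds(1)[OF Ca S(1) za] Ck_1_bounds(1)[OF Cc S(1) zc] by auto
    show "\<phi> p = 0 \<and> a p = 0 \<and> c p = 0" if "p \<notin> {-A..A} \<times> {\<tau>..T}" for p
      using zS za zc inS that by blast
    show "dt \<phi> x t = a (x, t)" "dx \<phi> x t = c (x, t)" for x t
      unfolding dt_def dx_def a_def c_def using DERIV_slice[OF diff] by (auto intro: DERIV_imp_deriv)
    show "(\<phi> has_derivative (\<lambda>u. fst u * c p + snd u * a p)) (at p)" for p by (rule D)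
    show "\<bar>\<phi> (x, t) - \<phi> (y, t)\<bar> \<le> \<Lambda> * \<bar>x - y\<bar>" "\<bar>a (x, t) - a (y, t)\<bar> \<le> \<Lambda> * \<bar>x - y\<bar>" "\<bar>c (x, t) - c (y, t)\<bar> \<le> \<Lambda> * \<bar>x - y\<bar>" for x y t
      using L1(2) L2(2) L3(2) up order_trans by blast+
    show "\<bar>\<phi> p\<bar> \<le> \<Lambda>" "\<bar>a p\<bar> \<le> \<Lambda>" "\<bar>c p\<bar> \<le> \<Lambda>" for p
      using L1(1) L2(1) L3(1) L1(3)[rule_format, of p] L2(3)[rule_format, of p] L3(3)[rule_format, of p] by (auto simp: \<Lambda>_def)
  qed
qed

lemma integral_iterated:
  fixes f :: "real \<times> real \<Rightarrow> real"
  assumes "integrable lborel f"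
  shows "(LINT p|lborel. f p) = (LINT t|lborel. LINT y|lborel. f (y, t))" "integrable lborel (\<lambda>t. LINT y|lborel. f (y, t))"
proof -
  have "integrable (lborel \<Otimes>\<^sub>M lborel) (\<lambda>(y, t). f (y, t))" using assms by (simp add: lborel_prod)
  from lborel_pair.integral_snd[OF this] lborel_pair.integrable_snd[OF this]
  show "(LINT p|lborel. f p) = (LINT t|lborel. LINT y|lborel. f (y, t))" "integrable lborel (\<lambda>t. LINT y|lborel. f (y, t))"
    by (simp_all add: lborel_prod)
qed

lemma compact_support_integrable:
  fixes k :: "'a::euclidean_space \<Rightarrow> real"
  assumes "continuous_on UNIV k" "compact S" "\<And>p. p \<notin> S \<Longrightarrow> k p = 0"
  shows "integrable lborel k"
proof -
  have "integrable lborel (\<lambda>p. indicator S p *\<^sub>R k p)"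
    by (rule borel_integrable_compact[OF assms(2)]) (rule continuous_on_subset[OF assms(1)], simp)
  moreover have "(\<lambda>p. indicator S p *\<^sub>R k p) = k" using assms(3) by (auto simp: indicator_def fun_eq_iff)
  ultimately show ?thesis by simp
qed

text \<open>Pairing with a continuous function is small when the primitive \<open>u\<close> of
  \<open>q\<close> is small. On each of the \<open>J\<close> intervals \<open>g\<close> is replaced
  by its value at the left end: the oscillation \<open>e\<close> acts on the integral of
  \<open>\<bar>q\<bar>\<close>, and the constant part sees only an increment of \<open>u\<close>, at
  most \<open>2 * \<eta>\<close>.\<close>

lemma step_pairing:
  fixes q g u :: "real \<Rightarrow> real"
  assumes q: "integrable lborel q" and g: "continuous_on UNIV g" "\<And>y. \<bar>g y\<bar> \<le> G"
    and u: "\<And>c d. c \<le> d \<Longrightarrow> (LINT y|lborel. q y * indicator {c<..d} y) = u d - u c" "\<And>y. \<bar>u y\<bar> \<le> \<eta>"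
    and unif: "\<And>y z. y \<in> {a..b} \<Longrightarrow> z \<in> {a..b} \<Longrightarrow> \<bar>y - z\<bar> \<le> h \<Longrightarrow> \<bar>g y - g z\<bar> \<le> e"
    and "0 \<le> h" "a + real J * h \<le> b"
  shows "\<bar>LINT y|lborel. q y * g y * indicator {a<..a + real J * h} y\<bar>
     \<le> e * (LINT y|lborel. \<bar>q y\<bar> * indicator {a<..a + real J * h} y) + real J * (G * (2 * \<eta>))"
  using assms(8)
proof (induction J)
  case (Suc J)
  define c where "c = a + real J * h" define d where "d = a + real (Suc J) * h"
  have cd: "c \<le> d" "d - c = h" "a \<le> c" "d \<le> b" using Suc.prems \<open>0 \<le> h\<close> by (auto simp: c_def d_def algebra_simps)
  have [measurable]: "q \<in> borel_measurable borel" "g \<in> borel_measurable borel"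
    using borel_measurable_integrable[OF q] borel_measurable_continuous_onI[OF g(1)] by simp_all
  have qA: "integrable lborel (\<lambda>y. q y * indicator A y)" if "A \<in> sets borel" for A
    using integrable_mult_indicator[OF _ q, of A] that by (simp add: mult.commute)
  have aqA: "integrable lborel (\<lambda>y. \<bar>q y\<bar> * indicator A y)" if "A \<in> sets borel" for A
    using integrable_mult_indicator[OF _ integrable_abs[OF q], of A] that by (simp add: mult.commute)
  have qgA: "integrable lborel (\<lambda>y. q y * g y * indicator A y)" if "A \<in> sets borel" for A
    using integrable_bounded_mult[OF qA[OF that], of g G] g(2) by (simp add: mult_ac)
  have split: "indicator {a<..d} y = indicator {a<..c} y + (indicator {c<..d} y :: real)" for y
    using cd by (auto simp: indicator_def)
  have "(LINT y|lborel. q y * g y * indicator {c<..d} y) = (LINT y|lborel. (g y - g c) * (q y * indicator {c<..d} y)) + g c * (u d - u c)"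
  proof -
    have "(LINT y|lborel. q y * g y * indicator {c<..d} y) = (LINT y|lborel. (g y - g c) * (q y * indicator {c<..d} y) + g c * (q y * indicator {c<..d} y))"
      by (rule Bochner_Integration.integral_cong) (auto simp: algebra_simps)
    also have "\<dots> = (LINT y|lborel. (g y - g c) * (q y * indicator {c<..d} y)) + g c * (u d - u c)"
    proof -
      have "\<bar>g y - g c\<bar> \<le> 2 * G" for y using g(2)[of y] g(2)[of c] by linarith
      then have "integrable lborel (\<lambda>y. (g y - g c) * (q y * indicator {c<..d} y))"
        by (intro integrable_bounded_mult[OF qA]) auto
      then show ?thesis using qA[of "{c<..d}"] u(1)[OF cd(1)] by simp
    qed
    finally show ?thesis .
  qed
  moreover have "\<bar>LINT y|lborel. (g y - g c) * (q y * indicator {c<..d} y)\<bar> \<le> e * (LINT y|lborel. \<bar>q y\<bar> * indicator {c<..d} y)"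
  proof -
    have "\<bar>LINT y|lborel. (g y - g c) * (q y * indicator {c<..d} y)\<bar> \<le> (LINT y|lborel. \<bar>(g y - g c) * (q y * indicator {c<..d} y)\<bar>)"
      by (rule integral_abs_bound)
    also have "\<dots> \<le> (LINT y|lborel. e * (\<bar>q y\<bar> * indicator {c<..d} y))"
    proof (rule Bochner_Integration.integral_mono)
      have "\<bar>g y - g c\<bar> \<le> 2 * G" for y using g(2)[of y] g(2)[of c] by linarith
      then show "integrable lborel (\<lambda>y. \<bar>(g y - g c) * (q y * indicator {c<..d} y)\<bar>)"
        by (intro integrable_abs integrable_bounded_mult[OF qA]) auto
      show "integrable lborel (\<lambda>y. e * (\<bar>q y\<bar> * indicator {c<..d} y))" by (intro integrable_mult_right aqA) simp
      fix y
      show "\<bar>(g y - g c) * (q y * indicator {c<..d} y)\<bar> \<le> e * (\<bar>q y\<bar> * indicator {c<..d} y)"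
      proof (cases "y \<in> {c<..d}")
        case True
        then have "\<bar>g y - g c\<bar> \<le> e" using cd by (intro unif) auto
        then show ?thesis using True by (simp add: abs_mult mult_right_mono)
      qed simp
    qed
    finally show ?thesis by simp
  qed
  moreover have "\<bar>g c * (u d - u c)\<bar> \<le> G * (2 * \<eta>)"
  proof -
    have "\<bar>u d - u c\<bar> \<le> 2 * \<eta>" using u(2)[of d] u(2)[of c] by linarith
    moreover have "0 \<le> G" using g(2)[of 0] by linarith
    ultimately show ?thesis unfolding abs_mult using g(2)[of c] by (intro mult_mono) auto
  qed
  moreover have "\<bar>LINT y|lborel. q y * g y * indicator {a<..c} y\<bar> \<le> e * (LINT y|lborel. \<bar>q y\<bar> * indicator {a<..c} y) + real J * (G * (2 * \<eta>))"
    unfolding c_def using Suc cd(1,4) by (intro Suc.IH) (auto simp: c_def)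
  moreover have "(LINT y|lborel. q y * g y * indicator {a<..d} y) = (LINT y|lborel. q y * g y * indicator {a<..c} y) + (LINT y|lborel. q y * g y * indicator {c<..d} y)"
    unfolding split distrib_left by (intro Bochner_Integration.integral_add qgA) auto
  moreover have "(LINT y|lborel. \<bar>q y\<bar> * indicator {a<..d} y) = (LINT y|lborel. \<bar>q y\<bar> * indicator {a<..c} y) + (LINT y|lborel. \<bar>q y\<bar> * indicator {c<..d} y)"
    unfolding split distrib_left by (intro Bochner_Integration.integral_add aqA) auto
  moreover have "real (Suc J) * (G * (2 * \<eta>)) = real J * (G * (2 * \<eta>)) + G * (2 * \<eta>)" by (simp add: algebra_simps)
  ultimately show ?case unfolding d_def[symmetric] by (simp add: distrib_left)
qed simp

subsection \<open>The limit is an extended entropy solution\<close>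

context ftl_limit
begin

section \<open>Strong attainment of the initial datum\<close>

lemma U_diff:
  assumes "0 < t" "a \<le> y"
  shows "U y t - U a t = (LINT z|lborel. rho z t * indicator {a<..y} z)"
proof (rule LIMSEQ_unique)
  have t: "0 \<le> t" using assms by simp
  show "(\<lambda>k. Pn (N k) y t - Pn (N k) a t) \<longlonglongrightarrow> U y t - U a t" by (intro tendsto_diff U t)
  have "integrable lborel (indicator {a<..y} :: real \<Rightarrow> real)"
    by (rule integrable_real_indicator) (use assms in auto)
  from limit_integral[OF assms(1) continuous_on_id this]
  show "(\<lambda>k. Pn (N k) y t - Pn (N k) a t) \<longlonglongrightarrow> (LINT z|lborel. rho z t * indicator {a<..y} z)"
    using ftl_scheme.P_diff[OF scheme[OF N_pos] t assms(2)] by simp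
qed

lemma U_initial: "U y 0 = m0 y"
proof (rule LIMSEQ_unique)
  show "(\<lambda>k. Pn (N k) y 0) \<longlonglongrightarrow> U y 0" by (rule U) simp
  have "(\<lambda>k. Pn (N k) y 0 - m0 y) \<longlonglongrightarrow> 0"
    by (rule Lim_null_comparison[OF _ inverse_N]) (use ftl_scheme.P_initial[OF scheme[OF N_pos]] in auto)
  then show "(\<lambda>k. Pn (N k) y 0) \<longlonglongrightarrow> m0 y" by (simp add: LIM_zero_iff)
qed

text \<open>The defect \<open>1 / n\<close> of the time estimate disappears in the limit. The
  primitive of \<open>rho\<close> minus \<open>r0\<close> is thus of order \<open>t\<close>,
  uniformly in \<open>y\<close>: weak attainment of the datum with a rate.\<close>

lemma U_time:
  assumes "0 \<le> t" shows "\<bar>U y t - m0 y\<bar> \<le> R * V * t"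
proof (rule LIMSEQ_le)
  show "(\<lambda>k. \<bar>Pn (N k) y t - Pn (N k) y 0\<bar>) \<longlonglongrightarrow> \<bar>U y t - m0 y\<bar>"
    unfolding U_initial[symmetric] by (intro tendsto_rabs tendsto_diff U assms order_refl)
  show "(\<lambda>k. 1 / real (N k) + R * V * t) \<longlonglongrightarrow> R * V * t"
    using tendsto_add[OF inverse_N tendsto_const] by fastforce
  show "\<exists>M. \<forall>k\<ge>M. \<bar>Pn (N k) y t - Pn (N k) y 0\<bar> \<le> 1 / real (N k) + R * V * t"
    using Pn_time[OF N_pos order_refl assms] assms by auto
qed

lemma rho_abs: "\<bar>rho y t\<bar> \<le> R" using rho_range[of y t] by auto

lemma Icc_integrable: "integrable lborel (indicator {a..d} :: real \<Rightarrow> real)"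
  by (cases "a \<le> d") (auto intro!: integrable_real_indicator)

lemma rho_integrable: "integrable lborel (\<lambda>y. rho y t)"
proof -
  have "integrable lborel (\<lambda>y. rho y t * indicator {xl - V * t..xr + V * t} y)"
    by (rule integrable_bounded_mult[OF Icc_integrable _ rho_abs]) measurable
  moreover have "(\<lambda>y. rho y t * indicator {xl - V * t..xr + V * t} y) = (\<lambda>y. rho y t)"
    using rho_outside by (fastforce simp: fun_eq_iff indicator_def)
  ultimately show ?thesis by simp
qed

lemma rho_comp_integral:
  assumes "0 < t" "continuous_on {0..R} G" "G 0 = (0::real)"
  shows "(\<lambda>k. LINT y|lborel. G (Dn (N k) y t)) \<longlonglongrightarrow> (LINT y|lborel. G (rho y t))"
proof -
  have "(\<lambda>k. LINT y|lborel. G (Dn (N k) y t) * indicator {xl - V * t..xr + V * t} y) \<longlonglongrightarrow> (LINT y|lborel. G (rho y t) * indicator {xl - V * t..xr + V * t} y)"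
    by (rule limit_integral[OF assms(1,2) Icc_integrable])
  moreover have "G (rho y t) * indicator {xl - V * t..xr + V * t} y = G (rho y t)" for y
    using rho_outside[of y t] assms(3) by (cases "y \<in> {xl - V * t..xr + V * t}") simp_all
  moreover have "G (Dn (N k) y t) * indicator {xl - V * t..xr + V * t} y = G (Dn (N k) y t)" for y k
    using ftl_scheme.D_support[OF scheme[OF N_pos], of t y k] assms
    by (cases "y \<in> {xl - V * t..xr + V * t}") simp_all
  ultimately show ?thesis by simp
qed

lemma rho_mass: 
  assumes "0 < t" shows "(LINT y|lborel. rho y t) = 1"
proof (rule LIMSEQ_unique)
  show "(\<lambda>k. LINT y|lborel. Dn (N k) y t) \<longlonglongrightarrow> (LINT y|lborel. rho y t)"
    by (rule rho_comp_integral[OF assms continuous_on_id]) simp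
  show "(\<lambda>k. LINT y|lborel. Dn (N k) y t) \<longlonglongrightarrow> 1"
    using ftl_scheme.D_mass[OF scheme[OF N_pos], of t] assms by simp
qed

lemma rho_square_le:
  assumes "0 < t" shows "(LINT y|lborel. (rho y t)\<^sup>2) \<le> (LINT y|lborel. (r0 y)\<^sup>2)"
proof (rule LIMSEQ_le_const2)
  show "(\<lambda>k. LINT y|lborel. (Dn (N k) y t)\<^sup>2) \<longlonglongrightarrow> (LINT y|lborel. (rho y t)\<^sup>2)"
    by (rule rho_comp_integral[OF assms]) (auto intro!: continuous_intros)
  show "\<exists>M. \<forall>k\<ge>M. (LINT y|lborel. (Dn (N k) y t)\<^sup>2) \<le> (LINT y|lborel. (r0 y)\<^sup>2)"
    using ftl_scheme.D_square_le[OF scheme[OF N_pos], of t] assms by auto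
qed

lemma r0_continuous_approx:
  assumes "e > 0"
  shows "\<exists>g. continuous_on UNIV g \<and> (\<forall>y. \<bar>g y\<bar> \<le> R) \<and> (LINT y|lborel. \<bar>r0 y - g y\<bar> * indicator {a..d} y) < e"
proof -
  have "r0 \<in> borel_measurable lebesgue" by (intro measurable_completion) simp
  then have "r0 measurable_on UNIV" by (rule lebesgue_measurable_imp_measurable_on) simp
  then obtain M g where M: "negligible M" and g: "\<And>n. continuous_on UNIV (g n)"
    "\<And>x. x \<notin> M \<Longrightarrow> (\<lambda>n. g n x) \<longlonglongrightarrow> r0 x"
    unfolding measurable_on_def by auto
  have aeM: "AE x in lborel. x \<notin> M"
    using M unfolding negligible_iff_null_sets using AE_not_in AE_completion_iff by blast
  define h where "h n y = max 0 (min R (g n y))" for n y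
  have hc: "continuous_on UNIV (h n)" for n unfolding h_def by (intro continuous_intros g)
  then have [measurable]: "h n \<in> borel_measurable borel" for n by (rule borel_measurable_continuous_onI)
  have hR: "\<bar>h n y\<bar> \<le> R" for n y using R_nonneg by (auto simp: h_def)
  have "(\<lambda>n. LINT y|lborel. \<bar>r0 y - h n y\<bar> * indicator {a..d} y) \<longlonglongrightarrow> (LINT y::real|lborel. (0::real))"
  proof (rule integral_dominated_convergence[where w="\<lambda>y. 2 * R * indicator {a..d} y"])
    show "AE y in lborel. (\<lambda>n. \<bar>r0 y - h n y\<bar> * indicator {a..d} y) \<longlonglongrightarrow> 0"
      using aeM
    proof eventually_elim
      case (elim y)
      have "(\<lambda>n. \<bar>r0 y - max 0 (min R (g n y))\<bar> * indicator {a..d} y) \<longlonglongrightarrow> \<bar>r0 y - max 0 (min R (r0 y))\<bar> * indicator {a..d} y"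
        by (intro tendsto_intros g(2) elim)
      moreover have "max 0 (min R (r0 y)) = r0 y" using r0(2)[of y] by auto
      ultimately show ?case by (simp add: h_def)
    qed
    have "\<bar>r0 y - h n y\<bar> \<le> 2 * R" for n y using hR[of n y] r0(2)[of y] by auto
    then show "AE y in lborel. norm (\<bar>r0 y - h n y\<bar> * indicator {a..d} y) \<le> 2 * R * indicator {a..d} y" for n
      by (intro AE_I2) (auto simp: indicator_def)
    show "integrable lborel (\<lambda>y. 2 * R * indicator {a..d} y)" by (intro integrable_mult_right Icc_integrable)
  qed measurable
  then have "\<forall>\<^sub>F n in sequentially. (LINT y|lborel. \<bar>r0 y - h n y\<bar> * indicator {a..d} y) < e"
    using assms by (intro order_tendstoD(2)) auto
  then obtain n where "(LINT y|lborel. \<bar>r0 y - h n y\<bar> * indicator {a..d} y) < e"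
    using eventually_happens'[OF sequentially_bot] by blast
  then show ?thesis using hc hR by blast
qed

lemma q_integrable: "integrable lborel (\<lambda>y. rho y t - r0 y)"
  by (intro Bochner_Integration.integrable_diff rho_integrable r0(1))

lemma q_abs: "\<bar>rho y t - r0 y\<bar> \<le> R"
  using rho_range[of y t] r0(2)[of y] by auto

lemma AE_q_outside:
  assumes "0 < t" "t \<le> 1"
  shows "AE y in lborel. y \<notin> {xl - V..xr + V} \<longrightarrow> rho y t = 0 \<and> r0 y = 0"
  using AE_r0_outside
proof eventually_elim
  case (elim y)
  have "V * t \<le> V" using assms V_nonneg by (simp add: mult_left_le)
  then show ?case using elim rho_outside[of y t] V_nonneg by auto
qed

text \<open>The weak rate of \<open>U_time\<close> is paired with the datum itself. As
  \<open>r0\<close> enters here only as a bounded measurable function, it is first replaced by a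
  continuous one, to which \<open>step_pairing\<close> applies.\<close>

lemma initial_pairing:
  assumes "e > 0"
  shows "\<exists>d>0. \<forall>t. 0 < t \<and> t < d \<longrightarrow> \<bar>LINT y|lborel. (rho y t - r0 y) * r0 y\<bar> \<le> e"
proof -
  define lo where "lo = xl - V - 1" define hi where "hi = xr + V + 1"
  have lohi: "lo < hi" using support_bounds(2) V_nonneg by (simp add: lo_def hi_def)
  \<comment> \<open>Budget: \<open>e / 4\<close> for replacing \<open>r0\<close> by a continuous
    \<open>g\<close>, \<open>e / 4\<close> for the oscillation of \<open>g\<close> on the
    subintervals, as the integral of \<open>\<bar>q\<bar>\<close> is at most \<open>2\<close>, and
    \<open>e / 4\<close> for the primitive.\<close>
  have e': "e / (4 * (R + 1)) > 0" using assms R_nonneg by (simp add: add_nonneg_pos)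
  obtain g where g: "continuous_on UNIV g" "\<And>y. \<bar>g y\<bar> \<le> R" "(LINT y|lborel. \<bar>r0 y - g y\<bar> * indicator {lo..hi} y) < e / (4 * (R + 1))"
    using r0_continuous_approx[OF e', of lo hi] by blast
  have [measurable]: "g \<in> borel_measurable borel" by (rule borel_measurable_continuous_onI[OF g(1)])
  have "uniformly_continuous_on {lo..hi} g"
    by (rule compact_uniformly_continuous[OF continuous_on_subset[OF g(1)]]) auto
  moreover have "e / 8 > 0" using assms by simp
  ultimately obtain h0 where h0: "h0 > 0" "\<And>y z. y \<in> {lo..hi} \<Longrightarrow> z \<in> {lo..hi} \<Longrightarrow> dist z y < h0 \<Longrightarrow> dist (g z) (g y) < e / 8"
    unfolding uniformly_continuous_on_def by metis
  obtain J where J: "(hi - lo) / h0 < real J" using reals_Archimedean2 by blast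
  have J0: "real J > 0" using J lohi h0 by (metis divide_pos_pos diff_gt_0_iff_gt less_trans)
  define h where "h = (hi - lo) / real J"
  have h: "0 \<le> h" "h < h0" "lo + real J * h = hi"
    using J J0 lohi h0 by (auto simp: h_def field_simps)
  have unif: "\<bar>g y - g z\<bar> \<le> e / 8" if "y \<in> {lo..hi}" "z \<in> {lo..hi}" "\<bar>y - z\<bar> \<le> h" for y z
    using h0(2)[OF that(2,1)] that(3) h(2) by (simp add: dist_real_def)
  \<comment> \<open>For \<open>t < e / (4 * Q)\<close> the primitive contributes at most
    \<open>e / 4\<close> over all \<open>J\<close> intervals; the summand \<open>1\<close> keeps
    \<open>Q\<close> positive.\<close>
  define Q where "Q = real J * (R * (2 * (R * V))) + 1"
  have Q: "Q > 0" using R_nonneg V_nonneg by (auto simp: Q_def intro!: add_nonneg_pos mult_nonneg_nonneg)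
  define d where "d = min 1 (e / (4 * Q))"
  have d: "d > 0" using assms Q by (simp add: d_def)
  have "\<bar>LINT y|lborel. (rho y t - r0 y) * r0 y\<bar> \<le> e" if t: "0 < t" "t < d" for t
  proof -
    define q where "q y = rho y t - r0 y" for y
    have [measurable]: "q \<in> borel_measurable borel" unfolding q_def by measurable
    have qi: "integrable lborel q" unfolding q_def by (rule q_integrable)
    have qR: "\<bar>q y\<bar> \<le> R" for y unfolding q_def by (rule q_abs)
    have t1: "t \<le> 1" using t by (simp add: d_def)
    define I where "I = (indicator {lo<..hi} :: real \<Rightarrow> real)"
    have [measurable]: "I \<in> borel_measurable borel" by (simp add: I_def)
    have Ii: "integrable lborel I" unfolding I_def by (rule integrable_real_indicator) (use lohi in auto)
    have "(LINT y|lborel. q y * indicator {c1<..c2} y) = (U c2 t - m0 c2) - (U c1 t - m0 c1)" if "c1 \<le> c2" for c1 c2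
    proof -
      have A: "integrable lborel (\<lambda>y. rho y t * indicator {c1<..c2} y)"
        using integrable_mult_indicator[OF _ rho_integrable, of "{c1<..c2}" t] by (simp add: mult.commute)
      have "(LINT y|lborel. q y * indicator {c1<..c2} y) = (LINT y|lborel. rho y t * indicator {c1<..c2} y - r0 y * indicator {c1<..c2} y)"
        by (simp add: q_def left_diff_distrib)
      also have "\<dots> = (U c2 t - U c1 t) - (m0 c2 - m0 c1)"
        unfolding U_diff[OF t(1) that] m0_diff[OF that]
        by (rule Bochner_Integration.integral_diff[OF A r0_mult_indicator]) simp
      finally show ?thesis by simp
    qed
    from step_pairing[where u="\<lambda>y. U y t - m0 y" and \<eta>="R * V * t" and G=R and e="e/8" and h=h and J=J and a=lo and b=hi, OF qi g(1,2) this _ unif h(1)]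
    have "\<bar>LINT y|lborel. q y * g y * I y\<bar> \<le> e / 8 * (LINT y|lborel. \<bar>q y\<bar> * I y) + real J * (R * (2 * (R * V * t)))"
      using U_time[of t] t h(3) by (simp add: I_def)
    also have "(LINT y|lborel. \<bar>q y\<bar> * I y) \<le> 2"
    proof -
      have "(LINT y|lborel. \<bar>q y\<bar> * I y) \<le> (LINT y|lborel. rho y t + r0 y)"
      proof (rule Bochner_Integration.integral_mono)
        show "integrable lborel (\<lambda>y. \<bar>q y\<bar> * I y)"
          using integrable_mult_indicator[OF _ integrable_abs[OF qi], of "{lo<..hi}"] by (simp add: I_def mult.commute)
        show "integrable lborel (\<lambda>y. rho y t + r0 y)" by (intro Bochner_Integration.integrable_add rho_integrable r0(1))
        show "\<bar>q y\<bar> * I y \<le> rho y t + r0 y" for y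
          using rho_range[of y t] r0(2)[of y] by (auto simp: q_def I_def indicator_def)
      qed
      also have "\<dots> = 2" using rho_mass[OF t(1)] r0_mass rho_integrable r0(1) by simp
      finally show ?thesis .
    qed
    also have "real J * (R * (2 * (R * V * t))) \<le> e / 4"
    proof -
      have "real J * (R * (2 * (R * V * t))) \<le> Q * t" using t by (simp add: Q_def algebra_simps)
      also have "\<dots> \<le> Q * (e / (4 * Q))" using t Q by (intro mult_left_mono) (auto simp: d_def)
      also have "\<dots> = e / 4" using Q by simp
      finally show ?thesis .
    qed
    finally have 1: "\<bar>LINT y|lborel. q y * g y * I y\<bar> \<le> e / 2" using assms by simp
    have gI: "integrable lborel (\<lambda>y. (r0 y - g y) * I y)"
    proof (rule integrable_bounded_mult[OF Ii])
      show "\<bar>r0 y - g y\<bar> \<le> 2 * R" for y using r0(2)[of y] g(2)[of y] by auto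
    qed measurable
    have "\<bar>LINT y|lborel. q y * ((r0 y - g y) * I y)\<bar> \<le> R * (LINT y|lborel. \<bar>(r0 y - g y) * I y\<bar>)"
      by (rule integral_bounded_mult[OF gI _ qR]) measurable
    also have "(LINT y|lborel. \<bar>(r0 y - g y) * I y\<bar>) \<le> (LINT y|lborel. \<bar>r0 y - g y\<bar> * indicator {lo..hi} y)"
    proof (rule Bochner_Integration.integral_mono)
      show "integrable lborel (\<lambda>y. \<bar>r0 y - g y\<bar> * indicator {lo..hi} y)"
      proof (rule integrable_bounded_mult[OF Icc_integrable])
        show "\<bar>\<bar>r0 y - g y\<bar>\<bar> \<le> 2 * R" for y using r0(2)[of y] g(2)[of y] by auto
      qed measurable
    qed (use gI in \<open>auto simp: I_def indicator_def\<close>)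
    also have "R * (LINT y|lborel. \<bar>r0 y - g y\<bar> * indicator {lo..hi} y) \<le> (R + 1) * (e / (4 * (R + 1)))"
      using g(3) R_nonneg e' by (intro mult_mono) auto
    also have "\<dots> = e / 4"
    proof -
      have "S * (e / (4 * S)) = e / 4" if "S > 0" for S :: real using that by simp
      then show ?thesis using R_nonneg by (metis add_nonneg_pos zero_less_one)
    qed
    finally have 2: "\<bar>LINT y|lborel. q y * ((r0 y - g y) * I y)\<bar> \<le> e / 4" using R_nonneg by (simp add: mult_left_mono)
    have qgI: "integrable lborel (\<lambda>y. q y * g y * I y)"
    proof -
      have "\<bar>q y * g y\<bar> \<le> R * R" for y unfolding abs_mult using qR g(2) R_nonneg by (intro mult_mono) auto
      then show ?thesis by (intro integrable_bounded_mult[OF Ii, where M="R * R"]) auto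
    qed
    have "(LINT y|lborel. q y * r0 y) = (LINT y|lborel. q y * g y * I y + q y * ((r0 y - g y) * I y))"
    proof (rule integral_cong_AE)
      show "AE y in lborel. q y * r0 y = q y * g y * I y + q y * ((r0 y - g y) * I y)"
        using AE_q_outside[OF t(1) t1]
      proof eventually_elim
        case (elim y)
        show ?case
        proof (cases "y \<in> {lo<..hi}")
          case True
          then show ?thesis by (simp add: I_def algebra_simps)
        next
          case False
          then have "q y = 0" using elim by (auto simp: q_def lo_def hi_def)
          then show ?thesis by simp
        qed
      qed
    qed measurable
    also have "\<dots> = (LINT y|lborel. q y * g y * I y) + (LINT y|lborel. q y * ((r0 y - g y) * I y))"
      by (rule Bochner_Integration.integral_add[OF qgI integrable_bounded_mult[OF gI _ qR]]) measurable
    finally have "\<bar>LINT y|lborel. q y * r0 y\<bar> \<le> e" using 1 2 assms by linarith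
    then show ?thesis by (simp add: q_def)
  qed
  then show ?thesis using d by blast
qed

text \<open>For \<open>q = rho - r0\<close>, expanding the square gives
  \<open>\<integral> q\<^sup>2 \<le> - 2 * \<integral> q * r0\<close>, because the energy of
  \<open>rho\<close> is at most that of \<open>r0\<close>; the right-hand side tends to
  \<open>0\<close> by \<open>initial_pairing\<close>. On the bounded support,
  \<open>\<bar>q\<bar> \<le> \<delta> + q\<^sup>2 / \<delta>\<close> passes from \<open>L^2\<close>
  to \<open>L^1\<close>.\<close>

lemma initial_limit: "((\<lambda>t. LINT y|lborel. \<bar>rho y t - r0 y\<bar>) \<longlongrightarrow> 0) (at_right 0)"
proof (rule tendstoI)
  fix e :: real assume e: "e > 0"
  define lo where "lo = xl - V" define hi where "hi = xr + V"
  define l where "l = hi - lo + 1"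
  have lohi: "lo \<le> hi" "l > 0" using support_bounds(2) V_nonneg by (simp_all add: lo_def hi_def l_def)
  \<comment> \<open>Then \<open>\<delta> * l = e / 2\<close>, and the tolerance
    \<open>e * \<delta> / 8\<close> of the pairing leaves \<open>e / 4\<close> after doubling and
    division by \<open>\<delta>\<close>.\<close>
  define \<delta> where "\<delta> = e / (2 * l)"
  have \<delta>: "\<delta> > 0" using e lohi by (simp add: \<delta>_def)
  have "e * \<delta> / 8 > 0" using e \<delta> by simp
  then obtain d where d: "d > 0" "\<And>t. 0 < t \<Longrightarrow> t < d \<Longrightarrow> \<bar>LINT y|lborel. (rho y t - r0 y) * r0 y\<bar> \<le> e * \<delta> / 8"
    using initial_pairing by blast
  have "(LINT y|lborel. \<bar>rho y t - r0 y\<bar>) < e" if t: "0 < t" "t < min d 1" for t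
  proof -
    define q where "q y = rho y t - r0 y" for y
    have qi: "integrable lborel q" unfolding q_def by (rule q_integrable)
    have [measurable]: "q \<in> borel_measurable borel" unfolding q_def by measurable
    have qR: "\<bar>q y\<bar> \<le> R" for y unfolding q_def by (rule q_abs)
    have rr2: "integrable lborel (\<lambda>y. rho y t * rho y t)" "integrable lborel (\<lambda>y. r0 y * r0 y)" "integrable lborel (\<lambda>y. rho y t * r0 y)"
    proof -
      have r0R: "\<bar>r0 y\<bar> \<le> R" for y using r0(2)[of y] by auto
      show "integrable lborel (\<lambda>y. rho y t * rho y t)" by (rule integrable_bounded_mult[OF rho_integrable _ rho_abs]) measurable
      show "integrable lborel (\<lambda>y. r0 y * r0 y)" by (rule integrable_bounded_mult[OF r0(1) _ r0R]) measurable
      show "integrable lborel (\<lambda>y. rho y t * r0 y)" by (rule integrable_bounded_mult[OF r0(1) _ rho_abs]) measurable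
    qed
    have q2: "integrable lborel (\<lambda>y. q y * q y)" by (rule integrable_bounded_mult[OF qi _ qR]) measurable
    have "(LINT y|lborel. q y * q y) = (LINT y|lborel. (rho y t * rho y t - 2 * (rho y t * r0 y)) + r0 y * r0 y)"
      by (rule Bochner_Integration.integral_cong) (auto simp: q_def algebra_simps)
    also have "\<dots> = (LINT y|lborel. rho y t * rho y t) - 2 * (LINT y|lborel. rho y t * r0 y) + (LINT y|lborel. r0 y * r0 y)"
      using rr2 by simp
    also have "(LINT y|lborel. rho y t * rho y t) \<le> (LINT y|lborel. r0 y * r0 y)"
      using rho_square_le[OF t(1)] by (simp add: power2_eq_square)
    finally have "(LINT y|lborel. q y * q y) \<le> - 2 * ((LINT y|lborel. rho y t * r0 y) - (LINT y|lborel. r0 y * r0 y))" by simp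
    also have "(LINT y|lborel. rho y t * r0 y) - (LINT y|lborel. r0 y * r0 y) = (LINT y|lborel. q y * r0 y)"
      using Bochner_Integration.integral_diff[OF rr2(3,2)] by (simp add: q_def left_diff_distrib)
    finally have S: "(LINT y|lborel. q y * q y) \<le> e * \<delta> / 4" using d(2)[of t] t by (simp add: q_def[abs_def] abs_le_iff)
    have i2: "integrable lborel (\<lambda>y. \<delta> * indicator {lo..hi} y + (1 / \<delta>) * (q y * q y))"
      by (intro Bochner_Integration.integrable_add integrable_mult_right Icc_integrable q2)
    have "(LINT y|lborel. \<bar>q y\<bar>) \<le> (LINT y|lborel. \<delta> * indicator {lo..hi} y + (1 / \<delta>) * (q y * q y))"
    proof (rule integral_mono_AE[OF _ i2])
      show "AE y in lborel. \<bar>q y\<bar> \<le> \<delta> * indicator {lo..hi} y + (1 / \<delta>) * (q y * q y)"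
        using AE_q_outside[of t] t(1) t(2)
      proof (simp, elim eventually_mono)
        fix y assume A: "(xl - V \<le> y \<longrightarrow> \<not> y \<le> xr + V) \<longrightarrow> rho y t = 0 \<and> r0 y = 0"
        show "\<bar>q y\<bar> \<le> \<delta> * indicator {lo..hi} y + q y * q y / \<delta>"
        proof (cases "y \<in> {lo..hi}")
          case True
          have "0 \<le> (\<bar>q y\<bar> - \<delta>)\<^sup>2 + \<bar>q y\<bar> * \<delta> * 0" by simp
          then have "2 * (\<bar>q y\<bar> * \<delta>) \<le> q y * q y + \<delta> * \<delta>" by (simp add: power2_eq_square algebra_simps abs_mult_self_eq)
          moreover have "0 \<le> \<bar>q y\<bar> * \<delta>" using \<delta> by simp
          ultimately have "\<bar>q y\<bar> * \<delta> \<le> q y * q y + \<delta> * \<delta>" by linarith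
          then have "\<bar>q y\<bar> \<le> (q y * q y + \<delta> * \<delta>) / \<delta>" using \<delta> by (simp add: le_divide_eq)
          also have "\<dots> = \<delta> + q y * q y / \<delta>" using \<delta> by (simp add: add_divide_distrib)
          finally show ?thesis using True by simp
        next
          case False
          then have "q y = 0" using A by (auto simp: q_def lo_def hi_def)
          then show ?thesis using False by simp
        qed
      qed
    qed (use qi in auto)
    also have "\<dots> = \<delta> * (hi - lo) + (1 / \<delta>) * (LINT y|lborel. q y * q y)"
      using lohi q2 Icc_integrable[of lo hi] by simp
    also have "\<dots> \<le> \<delta> * l + (1 / \<delta>) * (e * \<delta> / 4)"
      using \<delta> S by (intro add_mono mult_left_mono) (auto simp: l_def)
    also have "\<dots> = e / 2 + e / 4" using \<delta> lohi by (simp add: \<delta>_def)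
    also have "\<dots> < e" using e by simp
    finally show ?thesis by (simp add: q_def)
  qed
  then have "\<forall>t>0. t < min d 1 \<longrightarrow> dist (LINT y|lborel. \<bar>rho y t - r0 y\<bar>) 0 < e"
    by (auto simp: dist_real_def abs_of_nonneg)
  moreover have "min d 1 > 0" using d by simp
  ultimately show "\<forall>\<^sub>F t in at_right 0. dist (LINT y|lborel. \<bar>rho y t - r0 y\<bar>) 0 < e"
    unfolding eventually_at_right_field by blast
qed

section \<open>Passing to the limit in the two distributional conditions\<close>

lemma flux_cont: "continuous_on {0..R} (flux v)"
  unfolding flux_def[abs_def] by (intro continuous_intros v_cont)

lemma comp_rho_joint_measurable:
  "continuous_on {0..R} G \<Longrightarrow> (\<lambda>p. G (rho (fst p) (snd p))) \<in> borel_measurable (borel :: (real \<times> real) measure)"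
  using flux_fun.comp_measurable[OF flux_fun _ rho_joint_measurable rho_range] .

lemma comp_rho_integrable:
  fixes k :: "real \<times> real \<Rightarrow> real"
  assumes "continuous_on {0..R} G" "integrable lborel k"
  shows "integrable lborel (\<lambda>p. G (rho (fst p) (snd p)) * k p)"
proof -
  have "bounded (G ` {0..R})" by (intro compact_imp_bounded compact_continuous_image assms) auto
  then obtain M where M: "\<And>r. r \<in> {0..R} \<Longrightarrow> \<bar>G r\<bar> \<le> M" unfolding bounded_iff by (metis image_eqI real_norm_def)
  show ?thesis
    by (rule integrable_bounded_mult[OF assms(2) _ M[OF rho_range]])
      (simp add: comp_rho_joint_measurable[OF assms(1)])
qed

lemma comp_rho_integrable_slice:
  assumes "continuous_on {0..R} G" "integrable lborel k"
  shows "integrable lborel (\<lambda>y. G (rho y t) * k y :: real)"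
proof -
  have "bounded (G ` {0..R})" by (intro compact_imp_bounded compact_continuous_image assms) auto
  then obtain M where M: "\<And>r. r \<in> {0..R} \<Longrightarrow> \<bar>G r\<bar> \<le> M" unfolding bounded_iff by (metis image_eqI real_norm_def)
  have "(\<lambda>y. G (rho y t)) \<in> borel_measurable borel"
    by (rule flux_fun.comp_measurable[OF flux_fun assms(1) rho_measurable rho_range])
  then show ?thesis by (intro integrable_bounded_mult[OF assms(2) _ M[OF rho_range]]) simp
qed

end

context ftl_scheme
begin

text \<open>The integrand is the time derivative of the particle average of \<open>\<phi>\<close>
  along the trajectories, each particle moving with velocity \<open>v (rr i t)\<close>;
  \<open>\<phi>\<close> vanishes at both ends of the time interval.\<close>

lemma particle_integral:
  fixes \<phi> a c :: "real \<times> real \<Rightarrow> real"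
  assumes T: "0 \<le> T" and z: "\<And>y. \<phi> (y, 0) = 0" "\<And>y. \<phi> (y, T) = 0"
    and ac: "continuous_on UNIV a" "continuous_on UNIV c"
    and d: "\<And>p. (\<phi> has_derivative (\<lambda>u. fst u * c p + snd u * a p)) (at p)"
  defines "g \<equiv> \<lambda>t. (\<Sum>i<n. a (x i t, t) + v (rr i t) * c (x i t, t)) / real n"
  shows "has_bochner_integral lborel (\<lambda>t. indicator {0..T} t * g t) 0"
proof -
  define F where "F t = (\<Sum>i<n. \<phi> (x i t, t)) / real n" for t
  have xc: "continuous_on {0..T} (x i)" if "i \<le> n" for i
    by (rule continuous_on_subset[of "{0..}"]) (use DERIV_continuous_on[OF x_deriv[OF _ that]] in auto)
  have wc: "continuous_on {0..T} (\<lambda>t. v (rr i t))" if "i \<le> n" for i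
    by (rule continuous_on_subset[of "{0..}"]) (use DERIV_continuous_on[OF w_deriv[OF _ that]] in auto)
  have pc: "continuous_on {0..T} (\<lambda>t. k (x i t, t))" if "i \<le> n" "continuous_on UNIV k" for i and k :: "real \<times> real \<Rightarrow> real"
    by (rule continuous_on_compose2[OF that(2)]) (auto intro!: continuous_intros xc that)
  have gc: "continuous_on {0..T} g" unfolding g_def
    using n_pos by (intro continuous_intros pc wc ac) auto
  have "(F has_vector_derivative g t) (at t within {0..T})" if t: "0 \<le> t" for t
  proof -
    have "((\<lambda>t. \<phi> (x i t, t)) has_real_derivative a (x i t, t) + v (rr i t) * c (x i t, t)) (at t within {0..T})" if "i < n" for i
    proof -
      have "(x i has_real_derivative v (rr i t)) (at t within {0..T})"
        by (rule DERIV_subset[OF x_deriv]) (use t that in auto)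
      then have "(x i has_derivative (*) (v (rr i t))) (at t within {0..T})" by (simp add: has_field_derivative_def)
      then have "((\<lambda>t. (x i t, t)) has_derivative (\<lambda>s. (v (rr i t) * s, s))) (at t within {0..T})"
        by (rule has_derivative_Pair) (rule has_derivative_ident)
      from has_derivative_compose[OF this d[of "(x i t, t)"]]
      have "((\<lambda>t. \<phi> (x i t, t)) has_derivative (\<lambda>s. v (rr i t) * s * c (x i t, t) + s * a (x i t, t))) (at t within {0..T})"
        by simp
      moreover have "(\<lambda>s. v (rr i t) * s * c (x i t, t) + s * a (x i t, t)) = (*) (a (x i t, t) + v (rr i t) * c (x i t, t))"
        by (auto simp: fun_eq_iff algebra_simps)
      ultimately show ?thesis by (simp add: has_field_derivative_def)
    qed
    then have "(F has_real_derivative g t) (at t within {0..T})"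
      unfolding F_def[abs_def] g_def using n_pos by (intro DERIV_cdivide DERIV_sum) auto
    then show ?thesis by (simp add: has_real_derivative_iff_has_vector_derivative)
  qed
  then have "has_bochner_integral lborel (\<lambda>t. indicator {0..T} t *\<^sub>R g t) (F T - F 0)"
    by (intro has_bochner_integral_FTC_Icc T gc) auto
  then show ?thesis using z by (simp add: F_def)
qed

end

context ftl_limit
begin

text \<open>At each fixed positive time the particle sums \<open>g k t\<close> converge to the slice
  integral \<open>J t\<close>, since the quadrature error of \<open>weak_error\<close> vanishes.
  Integration in time by dominated convergence gives the claim, because the particle side is exactly
  \<open>0\<close> for every \<open>k\<close>.\<close>

lemma limit_weak:
  assumes T: "0 < \<tau>" "\<tau> \<le> T" "0 \<le> \<Lambda>"
    and cont: "continuous_on UNIV a" "continuous_on UNIV c"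
    and supp: "\<And>p. p \<notin> {-A..A} \<times> {\<tau>..T} \<Longrightarrow> \<phi> p = 0 \<and> a p = 0 \<and> c p = 0"
    and d: "\<And>p. (\<phi> has_derivative (\<lambda>u. fst u * c p + snd u * a p)) (at p)"
    and Lip: "\<And>x y t. \<bar>a (x, t) - a (y, t)\<bar> \<le> \<Lambda> * \<bar>x - y\<bar>" "\<And>x y t. \<bar>c (x, t) - c (y, t)\<bar> \<le> \<Lambda> * \<bar>x - y\<bar>"
    and bnd: "\<And>p. \<bar>a p\<bar> \<le> \<Lambda>" "\<And>p. \<bar>c p\<bar> \<le> \<Lambda>"
  shows "(LINT p|lborel. rho (fst p) (snd p) * a p + flux v (rho (fst p) (snd p)) * c p) = 0"
proof -
  \<comment> \<open>One unit beyond the support, so that \<open>\<phi>\<close> vanishes at the final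
    time.\<close>
  define S where "S = T + 1"
  have S: "0 \<le> S" "T < S" using T by (auto simp: S_def)
  define g where "g k t = (\<Sum>i<N k. a (X (N k) i t, t) + v (ftl_scheme.rr (N k) (X (N k)) i t) * c (X (N k) i t, t)) / real (N k)" for k t
  define J where "J t = (LINT y|lborel. rho y t * a (y, t) + flux v (rho y t) * c (y, t))" for t
  have int: "integrable lborel a" "integrable lborel c"
    by (rule compact_support_integrable[of _ "{-A..A} \<times> {\<tau>..T}"], use cont supp in \<open>auto intro!: compact_Times\<close>)+
  have slice: "continuous_on UNIV (\<lambda>y. k (y, t))" if "continuous_on UNIV k" for k :: "real \<times> real \<Rightarrow> real" and t
    by (rule continuous_on_compose2[OF that]) (auto intro!: continuous_intros)
  have ints: "integrable lborel (\<lambda>y. a (y, t))" "integrable lborel (\<lambda>y. c (y, t))" for t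
    by (rule compact_support_integrable[of _ "{-A..A}"], use slice cont supp in auto)+
  have Jint: "integrable lborel (\<lambda>p. rho (fst p) (snd p) * a p + flux v (rho (fst p) (snd p)) * c p)"
    using comp_rho_integrable[OF continuous_on_id int(1)] comp_rho_integrable[OF flux_cont int(2)]
    by (intro Bochner_Integration.integrable_add) auto
  have hb: "has_bochner_integral lborel (\<lambda>t. indicator {0..S} t * g k t) 0" for k
    unfolding g_def using supp T S
    by (intro ftl_scheme.particle_integral[OF scheme[OF N_pos] S(1) _ _ cont d]) auto
  have gb: "\<bar>g k t\<bar> \<le> \<Lambda> * (1 + V)" if t: "0 \<le> t" for k t
  proof -
    have "\<bar>\<Sum>i<N k. a (X (N k) i t, t) + v (ftl_scheme.rr (N k) (X (N k)) i t) * c (X (N k) i t, t)\<bar>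
       \<le> (\<Sum>i<N k. \<Lambda> + V * \<Lambda>)"
    proof (rule order_trans[OF sum_abs], rule sum_mono)
      fix i
      have "\<bar>v (ftl_scheme.rr (N k) (X (N k)) i t) * c (X (N k) i t, t)\<bar> \<le> V * \<Lambda>"
        unfolding abs_mult using ftl_scheme.rr_range[OF scheme[OF N_pos] t] v_bound bnd T V_nonneg by (intro mult_mono) auto
      then show "\<bar>a (X (N k) i t, t) + v (ftl_scheme.rr (N k) (X (N k)) i t) * c (X (N k) i t, t)\<bar> \<le> \<Lambda> + V * \<Lambda>"
        using bnd(1)[of "(X (N k) i t, t)"] by linarith
    qed
    then show ?thesis unfolding g_def abs_divide using N_pos[of k] by (simp add: divide_le_eq algebra_simps)
  qed
  have lim: "(\<lambda>k. g k t) \<longlonglongrightarrow> J t" if t: "0 < t" for t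
  proof -
    have t0: "0 \<le> t" using t by simp
    define I where "I k = (LINT y|lborel. Dn (N k) y t * a (y, t) + flux v (Dn (N k) y t) * c (y, t))" for k
    \<comment> \<open>The particles occupy an interval of length at most
      \<open>xr - xl + 2 * V * t\<close>.\<close>
    define E where "E = \<Lambda> * (1 + V) * (xr - xl + 2 * V * t)"
    have IJ: "I \<longlonglongrightarrow> J t"
    proof -
      have "(\<lambda>k. (LINT y|lborel. Dn (N k) y t * a (y, t)) + (LINT y|lborel. flux v (Dn (N k) y t) * c (y, t)))
        \<longlonglongrightarrow> (LINT y|lborel. rho y t * a (y, t)) + (LINT y|lborel. flux v (rho y t) * c (y, t))"
        by (intro tendsto_add limit_integral[OF t continuous_on_id] limit_integral[OF t flux_cont] ints)
      moreover have "I = (\<lambda>k. (LINT y|lborel. Dn (N k) y t * a (y, t)) + (LINT y|lborel. flux v (Dn (N k) y t) * c (y, t)))"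
      proof (rule ext)
        fix k
        interpret F: flux_fun "flux v" b R B by (rule flux_fun)
        have 1: "integrable lborel (\<lambda>y. Dn (N k) y t * a (y, t))"
          by (rule integrable_bounded_mult[OF ints(1), where M=R])
            (use Dn_measurable[OF t0] Dn_range[OF t0] in \<open>auto simp: abs_of_nonneg\<close>)
        have "bounded (flux v ` {0..R})" by (intro compact_imp_bounded compact_continuous_image flux_cont) auto
        then obtain M where M: "\<And>r. r \<in> {0..R} \<Longrightarrow> \<bar>flux v r\<bar> \<le> M" unfolding bounded_iff by (metis image_eqI real_norm_def)
        have 2: "integrable lborel (\<lambda>y. flux v (Dn (N k) y t) * c (y, t))"
          by (rule integrable_bounded_mult[OF ints(2) _ M[OF Dn_range[OF t0]]])
            (simp add: F.comp_measurable[OF flux_cont Dn_measurable[OF t0] Dn_range[OF t0]])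
        show "I k = (LINT y|lborel. Dn (N k) y t * a (y, t)) + (LINT y|lborel. flux v (Dn (N k) y t) * c (y, t))"
          unfolding I_def by (rule Bochner_Integration.integral_add[OF 1 2])
      qed
      moreover have "J t = (LINT y|lborel. rho y t * a (y, t)) + (LINT y|lborel. flux v (rho y t) * c (y, t))"
        unfolding J_def
        by (rule Bochner_Integration.integral_add[OF comp_rho_integrable_slice[OF continuous_on_id ints(1)] comp_rho_integrable_slice[OF flux_cont ints(2)]])
      ultimately show ?thesis by simp
    qed
    have "(\<lambda>k. I k - g k t) \<longlonglongrightarrow> 0"
    proof (rule Lim_null_comparison)
      show "(\<lambda>k. E * (1 / real (N k))) \<longlonglongrightarrow> 0" using tendsto_mult[OF tendsto_const inverse_N, of E] by simp
      have "\<bar>I k - g k t\<bar> \<le> E * (1 / real (N k))" for k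
      proof -
        have "\<bar>I k - g k t\<bar> \<le> \<Lambda> * (1 + V) * (X (N k) (N k) t - X (N k) 0 t) / real (N k)"
          unfolding I_def g_def
          by (rule ftl_scheme.weak_error[OF scheme[OF N_pos] t0 slice[OF cont(1)] Lip(1) slice[OF cont(2)] Lip(2)])
        also have "\<dots> \<le> E / real (N k)"
          unfolding E_def using ftl_scheme.x_bounds[OF scheme[OF N_pos[of k]] t0, of 0] ftl_scheme.x_bounds[OF scheme[OF N_pos[of k]] t0, of "N k"] T V_nonneg
          by (intro divide_right_mono mult_left_mono) auto
        finally show ?thesis by simp
      qed
      then show "\<forall>\<^sub>F k in sequentially. norm (I k - g k t) \<le> E * (1 / real (N k))" by simp
    qed
    from tendsto_diff[OF IJ this] show ?thesis by simp
  qed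
  have "(\<lambda>k. LINT t|lborel. indicator {0..S} t * g k t) \<longlonglongrightarrow> (LINT t|lborel. indicator {0..S} t * J t)"
  proof (rule integral_dominated_convergence[where w="\<lambda>t. \<Lambda> * (1 + V) * indicator {0..S} t"])
    show "(\<lambda>t. indicator {0..S} t * J t) \<in> borel_measurable lborel"
      using borel_measurable_integrable[OF integral_iterated(2)[OF Jint]] by (simp add: J_def)
    show "(\<lambda>t. indicator {0..S} t * g k t) \<in> borel_measurable lborel" for k
      using hb has_bochner_integral_iff borel_measurable_integrable by blast
    show "integrable lborel (\<lambda>t. \<Lambda> * (1 + V) * indicator {0..S} t)" by (intro integrable_mult_right Icc_integrable)
    show "AE t in lborel. norm (indicator {0..S} t * g k t) \<le> \<Lambda> * (1 + V) * indicator {0..S} t" for k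
      using gb by (intro AE_I2) (auto simp: indicator_def)
    show "AE t in lborel. (\<lambda>k. indicator {0..S} t * g k t) \<longlonglongrightarrow> indicator {0..S} t * J t"
      using AE_lborel_singleton[of 0]
    proof eventually_elim
      case (elim t)
      then show ?case using lim[of t] by (cases "t \<in> {0..S}") auto
    qed
  qed
  then have "(LINT t|lborel. indicator {0..S} t * J t) = 0"
    using LIMSEQ_unique[OF _ tendsto_const[of 0]] has_bochner_integral_integral_eq[OF hb] by simp
  moreover have "indicator {0..S} t * J t = J t" for t
  proof (cases "t \<in> {0..S}")
    case False
    then have "a (y, t) = 0 \<and> c (y, t) = 0" for y using supp[of "(y, t)"] T S by auto
    then show ?thesis by (simp add: J_def)
  qed simp
  ultimately have "(LINT t|lborel. J t) = 0" by (simp only:)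
  then show ?thesis unfolding integral_iterated(1)[OF Jint] by (simp add: J_def)
qed

text \<open>Integration by parts on difference quotients, as \<open>rho\<close> has no derivative:
  the shift by \<open>h j\<close> is moved from \<open>\<psi>\<close> onto \<open>b(\<rho>)\<close>,
  which for almost every \<open>y\<close> increases by at most \<open>(1 + K) * h j / t\<close> over
  the distance \<open>h j\<close>.\<close>

lemma limit_one_sided_slice:
  assumes t: "0 < t" and \<psi>: "\<And>y. 0 \<le> \<psi> y" "\<And>y. (\<psi> has_real_derivative \<psi>' y) (at y)" "continuous_on UNIV \<psi>'"
    and supp: "\<And>y. y \<notin> {-A..A} \<Longrightarrow> \<psi> y = 0" "\<And>y. y \<notin> {-A..A} \<Longrightarrow> \<psi>' y = 0"
    and Lip: "\<And>x y. \<bar>\<psi> x - \<psi> y\<bar> \<le> \<Lambda> * \<bar>x - y\<bar>" and \<Lambda>: "0 \<le> \<Lambda>"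
  shows "(LINT y|lborel. b (rho y t) * \<psi>' y) \<ge> - ((1 + K) / t * (LINT y|lborel. \<psi> y))"
proof (rule LIMSEQ_le_const)
  interpret F: flux_fun "flux v" b R B by (rule flux_fun)
  have bB: "\<bar>b (rho y t)\<bar> \<le> B" for y using F.b_bound[OF rho_range] .
  have B0: "0 \<le> B" using bB[of 0] by linarith
  have bm: "(\<lambda>y. b (rho y t)) \<in> borel_measurable borel"
    by (rule F.comp_measurable[OF b_cont rho_measurable rho_range])
  note [measurable] = bm
  have c\<psi>: "continuous_on UNIV \<psi>" using \<psi>(2) by (auto intro: DERIV_continuous_on)
  have [measurable]: "\<psi> \<in> borel_measurable borel" "\<psi>' \<in> borel_measurable borel"
    using c\<psi> \<psi>(3) by (auto intro: borel_measurable_continuous_onI)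
  have int\<psi>: "integrable lborel \<psi>"
    by (rule compact_support_integrable[of _ "{-A..A}"]) (use c\<psi> supp in auto)
  define h where "h j = 1 / (real j + 1)" for j
  have h: "0 < h j" "h j \<le> 1" for j by (auto simp: h_def)
  have h0: "h \<longlonglongrightarrow> 0" unfolding h_def using LIMSEQ_inverse_real_of_nat by (simp add: inverse_eq_divide add.commute)
  show "(\<lambda>j. LINT y|lborel. b (rho y t) * ((\<psi> (y + h j) - \<psi> y) / h j)) \<longlonglongrightarrow> (LINT y|lborel. b (rho y t) * \<psi>' y)"
  proof (rule integral_dominated_convergence[where w="\<lambda>y. B * \<Lambda> * indicator {-A-1..A+1} y"])
    show "integrable lborel (\<lambda>y. B * \<Lambda> * indicator {-A-1..A+1} y)" by (intro integrable_mult_right Icc_integrable)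
    show "AE y in lborel. (\<lambda>j. b (rho y t) * ((\<psi> (y + h j) - \<psi> y) / h j)) \<longlonglongrightarrow> b (rho y t) * \<psi>' y"
    proof (intro AE_I2 tendsto_mult tendsto_const)
      fix y
      have "((\<lambda>h. (\<psi> (y + h) - \<psi> y) / h) \<longlongrightarrow> \<psi>' y) (at 0)" using \<psi>(2)[of y] by (simp add: DERIV_def)
      moreover have "filterlim h (at 0) sequentially"
        using h0 h(1) by (auto simp: filterlim_at intro!: always_eventually less_imp_neq[symmetric])
      ultimately show "(\<lambda>j. (\<psi> (y + h j) - \<psi> y) / h j) \<longlonglongrightarrow> \<psi>' y" by (rule filterlim_compose)
    qed
    show "AE y in lborel. norm (b (rho y t) * ((\<psi> (y + h j) - \<psi> y) / h j)) \<le> B * \<Lambda> * indicator {-A-1..A+1} y" for j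
    proof (intro AE_I2)
      fix y
      show "norm (b (rho y t) * ((\<psi> (y + h j) - \<psi> y) / h j)) \<le> B * \<Lambda> * indicator {-A-1..A+1} y"
      proof (cases "y \<in> {-A-1..A+1}")
        case True
        have "\<bar>(\<psi> (y + h j) - \<psi> y) / h j\<bar> \<le> \<Lambda>"
          using Lip[of "y + h j" y] h[of j] by (simp add: divide_le_eq)
        then have "\<bar>b (rho y t)\<bar> * \<bar>(\<psi> (y + h j) - \<psi> y) / h j\<bar> \<le> B * \<Lambda>" using bB B0 by (intro mult_mono) auto
        then show ?thesis using True by (simp add: abs_mult)
      next
        case False
        then have "\<psi> (y + h j) = 0" "\<psi> y = 0" using supp(1) h[of j] by auto
        then show ?thesis using False by simp
      qed
    qed
  qed measurable
  have "- ((1 + K) / t * (LINT y|lborel. \<psi> y)) \<le> (LINT y|lborel. b (rho y t) * ((\<psi> (y + h j) - \<psi> y) / h j))" for j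
  proof -
    have bp: "integrable lborel (\<lambda>y. b (rho (- h j + y) t) * \<psi> y)"
      using bB by (intro integrable_bounded_mult[OF int\<psi>]) measurable
    have bp': "integrable lborel (\<lambda>y. b (rho y t) * \<psi> y)"
      using bB by (intro integrable_bounded_mult[OF int\<psi>]) measurable
    have s\<psi>: "integrable lborel (\<lambda>y. \<psi> (y + h j))"
      by (rule compact_support_integrable[of _ "{-A-1..A+1}"])
        (use supp(1) h[of j] c\<psi> in \<open>auto intro!: continuous_on_compose2[OF c\<psi>] continuous_intros\<close>)
    have bs: "integrable lborel (\<lambda>y. b (rho y t) * \<psi> (y + h j))"
      using bB by (intro integrable_bounded_mult[OF s\<psi>]) measurable
    have shift: "(LINT y|lborel. b (rho y t) * \<psi> (y + h j)) = (LINT y|lborel. b (rho (- h j + y) t) * \<psi> y)"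
      using integral_shift[of "\<lambda>y. b (rho y t) * \<psi> (y + h j)" "- h j"] by simp
    have "(LINT y|lborel. b (rho y t) * ((\<psi> (y + h j) - \<psi> y) / h j))
        = (LINT y|lborel. (1 / h j) * (b (rho y t) * \<psi> (y + h j) - b (rho y t) * \<psi> y))"
      by (intro Bochner_Integration.integral_cong) (auto simp: diff_divide_distrib right_diff_distrib)
    also have "\<dots> = (1 / h j) * ((LINT y|lborel. b (rho y t) * \<psi> (y + h j)) - (LINT y|lborel. b (rho y t) * \<psi> y))"
      using bs bp' by simp
    also have "\<dots> = (LINT y|lborel. (1 / h j) * (b (rho (- h j + y) t) * \<psi> y - b (rho y t) * \<psi> y))"
      unfolding shift using bp bp' by simp
    finally have eq: "(LINT y|lborel. b (rho y t) * ((\<psi> (y + h j) - \<psi> y) / h j))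
        = (LINT y|lborel. (1 / h j) * (b (rho (- h j + y) t) * \<psi> y - b (rho y t) * \<psi> y))" .
    have "(LINT y|lborel. - ((1 + K) / t) * \<psi> y) \<le> (LINT y|lborel. (1 / h j) * (b (rho (- h j + y) t) * \<psi> y - b (rho y t) * \<psi> y))"
    proof (rule integral_mono_AE)
      show "integrable lborel (\<lambda>y. - ((1 + K) / t) * \<psi> y)" by (intro integrable_mult_right int\<psi>)
      show "integrable lborel (\<lambda>y. (1 / h j) * (b (rho (- h j + y) t) * \<psi> y - b (rho y t) * \<psi> y))"
        by (intro integrable_mult_right Bochner_Integration.integrable_diff bp bp')
      show "AE y in lborel. - ((1 + K) / t) * \<psi> y \<le> (1 / h j) * (b (rho (- h j + y) t) * \<psi> y - b (rho y t) * \<psi> y)"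
        using AE_convergent[OF t] AE_shift[OF AE_convergent[OF t], of "- h j"]
      proof eventually_elim
        case (elim y)
        have "v (rho y t) - v (rho (- h j + y) t) \<le> h j / t"
          using rho_one_sided[OF t _ elim(2,1)] h[of j] by simp
        then have "max 0 (v (rho y t) - v (rho (- h j + y) t)) \<le> h j / t" using t h[of j] by simp
        then have "(1 + K) * max 0 (v (rho y t) - v (rho (- h j + y) t)) \<le> (1 + K) * (h j / t)"
          using K0 by (intro mult_left_mono) auto
        then have "b (rho y t) - b (rho (- h j + y) t) \<le> (1 + K) * (h j / t)"
          using b_diff_le[OF rho_range[of y t] rho_range[of "- h j + y" t]] by linarith
        then have "(1 / h j) * (b (rho y t) - b (rho (- h j + y) t)) \<le> (1 / h j) * ((1 + K) * (h j / t))"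
          using h[of j] by (intro mult_left_mono) auto
        also have "\<dots> = (1 + K) / t" using h(1)[of j] by simp
        finally have "(1 / h j) * (b (rho y t) - b (rho (- h j + y) t)) * \<psi> y \<le> (1 + K) / t * \<psi> y"
          by (rule mult_right_mono[OF _ \<psi>(1)])
        then show ?case by (simp add: algebra_simps)
      qed
    qed
    then show ?thesis unfolding eq using int\<psi> by simp
  qed
  then show "\<exists>M. \<forall>j\<ge>M. - ((1 + K) / t * (LINT y|lborel. \<psi> y)) \<le> (LINT y|lborel. b (rho y t) * ((\<psi> (y + h j) - \<psi> y) / h j))" by blast
qed

section \<open>Verification of the solution concept\<close>

lemma rho_Linf_time_L1_Linf: "Linf_time_L1_Linf rho"
  unfolding Linf_time_L1_Linf_def
proof (intro conjI exI[of _ "max 1 R"] AE_I2)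
  have "(\<lambda>p. rho (fst p) (snd p)) \<in> borel_measurable (lebesgue :: (real \<times> real) measure)"
    by (intro measurable_completion) simp
  then show "(\<lambda>(x, t). rho x t) \<in> borel_measurable (lebesgue_on (UNIV \<times> {0..}))"
    by (simp add: case_prod_unfold measurable_restrict_space1)
  fix t
  show "integrable lebesgue (\<lambda>x. rho x t)" using rho_integrable by (simp add: integrable_completion)
  have "(LINT x|lebesgue. \<bar>rho x t\<bar>) = (LINT x|lborel. rho x t)"
    using rho_range by (simp add: integral_completion abs_of_nonneg)
  also have "\<dots> \<le> 1" by (cases "0 < t") (simp_all add: rho_mass, simp add: rho_def)
  finally show "(LINT x|lebesgue. \<bar>rho x t\<bar>) \<le> max 1 R" by simp
  show "\<bar>rho x t\<bar> \<le> max 1 R" for x using rho_abs[of x t] by simp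
qed

lemma rho_weak_solution: "weak_solution (flux v) rho"
  unfolding weak_solution_def
proof (intro allI impI)
  fix \<phi> :: "real \<times> real \<Rightarrow> real" assume tf: "test_function \<phi>"
  obtain a c \<Lambda> A \<tau> T where F: "0 < \<tau>" "\<tau> \<le> T" "0 \<le> \<Lambda>" "0 \<le> A"
    "continuous_on UNIV \<phi>" "continuous_on UNIV a" "continuous_on UNIV c"
    "\<And>p. p \<notin> {-A..A} \<times> {\<tau>..T} \<Longrightarrow> \<phi> p = 0 \<and> a p = 0 \<and> c p = 0"
    "\<And>x t. dt \<phi> x t = a (x, t)" "\<And>x t. dx \<phi> x t = c (x, t)"
    "\<And>p. (\<phi> has_derivative (\<lambda>u. fst u * c p + snd u * a p)) (at p)"
    "\<And>x y t. \<bar>\<phi> (x, t) - \<phi> (y, t)\<bar> \<le> \<Lambda> * \<bar>x - y\<bar>"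
    "\<And>x y t. \<bar>a (x, t) - a (y, t)\<bar> \<le> \<Lambda> * \<bar>x - y\<bar>"
    "\<And>x y t. \<bar>c (x, t) - c (y, t)\<bar> \<le> \<Lambda> * \<bar>x - y\<bar>"
    "\<And>p. \<bar>\<phi> p\<bar> \<le> \<Lambda>" "\<And>p. \<bar>a p\<bar> \<le> \<Lambda>" "\<And>p. \<bar>c p\<bar> \<le> \<Lambda>"
    by (rule test_function_facts[OF tf]) (rule that; assumption)
  note [measurable] = comp_rho_joint_measurable[OF flux_cont] borel_measurable_continuous_onI[OF F(6)] borel_measurable_continuous_onI[OF F(7)]
  have "(LINT (x, t):UNIV \<times> {0<..}|lebesgue. rho x t * dt \<phi> x t + flux v (rho x t) * dx \<phi> x t)
     = (LINT p|lborel. rho (fst p) (snd p) * a p + flux v (rho (fst p) (snd p)) * c p)"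
    unfolding set_lebesgue_integral_def F(9,10)
  proof (rule lebesgue_AE_eq_borel(2))
    have "a (x, t) = 0 \<and> c (x, t) = 0" if "t \<le> 0" for x t using F(8)[of "(x, t)"] F(1) that by auto
    then show "AE p in lborel. indicator (UNIV \<times> {0<..}) p *\<^sub>R (case p of (x, t) \<Rightarrow> rho x t * a (x, t) + flux v (rho x t) * c (x, t))
        = rho (fst p) (snd p) * a p + flux v (rho (fst p) (snd p)) * c p"
      by (intro AE_I2) (auto simp: indicator_def case_prod_unfold mem_Times_iff not_less)
  qed measurable
  also have "\<dots> = 0" by (rule limit_weak[OF F(1-3,6-8,11,13,14,16,17)])
  finally show "(LINT (x, t):UNIV \<times> {0<..}|lebesgue. rho x t * dt \<phi> x t + flux v (rho x t) * dx \<phi> x t) = 0" .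
qed

lemma rho_attains_initial_datum: "attains_initial_datum \<rho>0 rho"
  unfolding attains_initial_datum_def
proof (intro exI[of _ rho] conjI allI impI AE_I2 refl)
  show "integrable lebesgue (\<lambda>x. rho x t)" for t using rho_integrable by (simp add: integrable_completion)
  have "(LINT x|lebesgue. \<bar>rho x t - \<rho>0 x\<bar>) = (LINT x|lborel. \<bar>rho x t - r0 x\<bar>)" for t
  proof (rule lebesgue_AE_eq_borel(2))
    show "AE x in lborel. \<bar>rho x t - \<rho>0 x\<bar> = \<bar>rho x t - r0 x\<bar>" using r0(3) by eventually_elim simp
  qed measurable
  then show "((\<lambda>t. LINT x|lebesgue. \<bar>rho x t - \<rho>0 x\<bar>) \<longlongrightarrow> 0) (at_right 0)" using initial_limit by simp
qed

lemma rho_one_sided_estimate: "one_sided_estimate b rho"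
  unfolding one_sided_estimate_def
proof (intro exI[of _ "1 + K"] conjI allI impI)
  show "1 \<le> 1 + K" using K0 by simp
  fix \<phi> :: "real \<times> real \<Rightarrow> real" assume tf: "test_function \<phi> \<and> (\<forall>p. 0 \<le> \<phi> p)"
  obtain a c \<Lambda> A \<tau> T where F: "0 < \<tau>" "\<tau> \<le> T" "0 \<le> \<Lambda>" "0 \<le> A"
    "continuous_on UNIV \<phi>" "continuous_on UNIV a" "continuous_on UNIV c"
    "\<And>p. p \<notin> {-A..A} \<times> {\<tau>..T} \<Longrightarrow> \<phi> p = 0 \<and> a p = 0 \<and> c p = 0"
    "\<And>x t. dt \<phi> x t = a (x, t)" "\<And>x t. dx \<phi> x t = c (x, t)"
    "\<And>p. (\<phi> has_derivative (\<lambda>u. fst u * c p + snd u * a p)) (at p)"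
    "\<And>x y t. \<bar>\<phi> (x, t) - \<phi> (y, t)\<bar> \<le> \<Lambda> * \<bar>x - y\<bar>"
    "\<And>x y t. \<bar>a (x, t) - a (y, t)\<bar> \<le> \<Lambda> * \<bar>x - y\<bar>"
    "\<And>x y t. \<bar>c (x, t) - c (y, t)\<bar> \<le> \<Lambda> * \<bar>x - y\<bar>"
    "\<And>p. \<bar>\<phi> p\<bar> \<le> \<Lambda>" "\<And>p. \<bar>a p\<bar> \<le> \<Lambda>" "\<And>p. \<bar>c p\<bar> \<le> \<Lambda>"
    by (rule test_function_facts[OF conjunct1[OF tf]]) (rule that; assumption)
  \<comment> \<open>The support of \<open>\<phi>\<close> starts at \<open>\<tau>\<close>; the
    maximum leaves the integrand unchanged there and makes it continuous on the plane.\<close>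
  define k where "k p = (1 + K) / max \<tau> (snd p) * \<phi> p" for p
  have kc: "continuous_on UNIV k" unfolding k_def using F(1) by (intro continuous_intros F) auto
  have compact: "compact ({-A..A} \<times> {\<tau>..T})" by (intro compact_Times) auto
  have ki: "integrable lborel k" by (rule compact_support_integrable[OF kc compact]) (use F(8) in \<open>simp add: k_def\<close>)
  have ci: "integrable lborel c" by (rule compact_support_integrable[OF F(7) compact]) (use F(8) in simp)
  have bi: "integrable lborel (\<lambda>p. b (rho (fst p) (snd p)) * c p)" by (rule comp_rho_integrable[OF b_cont ci])
  note [measurable] = comp_rho_joint_measurable[OF b_cont] borel_measurable_continuous_onI[OF kc] borel_measurable_continuous_onI[OF F(7)]
  have z: "\<phi> (x, t) = 0" "c (x, t) = 0" if "t < \<tau>" for x t using F(8)[of "(x, t)"] that by auto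
  have z0: "\<phi> (x, t) = 0" "c (x, t) = 0" if "t \<le> 0" for x t using z that F(1) by auto
  have 1: "(LINT (x, t):UNIV \<times> {0<..}|lebesgue. b (rho x t) * dx \<phi> x t) = (LINT p|lborel. b (rho (fst p) (snd p)) * c p)"
    unfolding set_lebesgue_integral_def F(10)
  proof (rule lebesgue_AE_eq_borel(2))
    show "AE p in lborel. indicator (UNIV \<times> {0<..}) p *\<^sub>R (case p of (x, t) \<Rightarrow> b (rho x t) * c (x, t)) = b (rho (fst p) (snd p)) * c p"
      using z0 by (intro AE_I2) (auto simp: indicator_def case_prod_unfold mem_Times_iff not_less)
  qed measurable
  have 2: "(LINT (x, t):UNIV \<times> {0<..}|lebesgue. (1 + K) / t * \<phi> (x, t)) = (LINT p|lborel. k p)"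
    unfolding set_lebesgue_integral_def
  proof (rule lebesgue_AE_eq_borel(2))
    show "AE p in lborel. indicator (UNIV \<times> {0<..}) p *\<^sub>R (case p of (x, t) \<Rightarrow> (1 + K) / t * \<phi> (x, t)) = k p"
    proof (intro AE_I2)
      fix p :: "real \<times> real"
      show "indicator (UNIV \<times> {0<..}) p *\<^sub>R (case p of (x, t) \<Rightarrow> (1 + K) / t * \<phi> (x, t)) = k p"
        using z[of "snd p" "fst p"] F(1) by (cases "snd p < \<tau>") (auto simp: k_def case_prod_unfold mem_Times_iff max_def)
    qed
  qed measurable
  have "(LINT y|lborel. b (rho y t) * c (y, t)) \<ge> - (LINT y|lborel. k (y, t))" for t
  proof (cases "t < \<tau>")
    case True
    then show ?thesis using z by (simp add: k_def)
  next
    case False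
    then have t: "0 < t" using F(1) by simp
    have "- ((1 + K) / t * (LINT y|lborel. \<phi> (y, t))) \<le> (LINT y|lborel. b (rho y t) * c (y, t))"
    proof (rule limit_one_sided_slice[where A=A, OF t _ _ _ _ _ F(12) F(3)])
      show "((\<lambda>y. \<phi> (y, t)) has_real_derivative c (y, t)) (at y)" for y
        using has_derivative_compose[OF has_derivative_Pair[OF has_derivative_ident has_derivative_const] F(11)[of "(y, t)"]]
        by (simp add: has_field_derivative_def mult_commute_abs)
      show "continuous_on UNIV (\<lambda>y. c (y, t))"
        by (rule continuous_on_compose2[OF F(7)]) (auto intro!: continuous_intros)
    qed (use tf F(8) in auto)
    moreover have "(LINT y|lborel. k (y, t)) = (1 + K) / t * (LINT y|lborel. \<phi> (y, t))"
      using False by (simp add: k_def max_def)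
    ultimately show ?thesis by simp
  qed
  then have "(LINT t|lborel. - (LINT y|lborel. k (y, t))) \<le> (LINT t|lborel. LINT y|lborel. b (rho y t) * c (y, t))"
    using integral_iterated(2)[OF bi] integral_iterated(2)[OF ki] by (intro Bochner_Integration.integral_mono) auto
  then show "(LINT (x, t):UNIV \<times> {0<..}|lebesgue. b (rho x t) * dx \<phi> x t)
      \<ge> - (LINT (x, t):UNIV \<times> {0<..}|lebesgue. (1 + K) / t * \<phi> (x, t))"
    unfolding 1 2 integral_iterated(1)[OF bi] integral_iterated(1)[OF ki] by simp
qed

lemma rho_extended_entropy_solution: "extended_entropy_solution v \<rho>0 rho"
  unfolding extended_entropy_solution_def R_def[symmetric] b_def[symmetric]
  using rho_Linf_time_L1_Linf rho_weak_solution rho_attains_initial_datum rho_one_sided_estimate rho_range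
  by (auto intro!: AE_I2)

section \<open>Convergence of the densities\<close>

lemma Dn_eq: "Dn (N k) = ftl_density (N k) (X (N k))"
  by (intro ext ftl_scheme.D_def[OF scheme[OF N_pos]])

text \<open>Convergence is known slice by slice, for every positive time and almost every
  \<open>y\<close>. To obtain one joint null set by Fubini, the set of convergence must be
  measurable, which is why it is expressed with countable quantifiers.\<close>

lemma AE_joint_limit:
  "AE p in lborel. 0 \<le> snd p \<longrightarrow> (\<lambda>k. Dn (N k) (fst p) (snd p)) \<longlonglongrightarrow> rho (fst p) (snd p)"
proof -
  define F where "F k p = (if 0 \<le> snd p then Dn (N k) (fst p) (snd p) else 0)" for k p
  have [measurable]: "F k \<in> borel_measurable (borel :: (real \<times> real) measure)" for k
    unfolding F_def[abs_def] by (rule Dn_joint_measurable)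
  define P where "P p \<longleftrightarrow> 0 < snd p \<longrightarrow> (\<forall>j. \<exists>m. \<forall>k\<ge>m. \<bar>F k p - rho (fst p) (snd p)\<bar> < 1 / real (Suc j))" for p
  have P_iff: "P p \<longleftrightarrow> (0 < snd p \<longrightarrow> (\<lambda>k. F k p) \<longlonglongrightarrow> rho (fst p) (snd p))" for p
  proof -
    have "(\<forall>j. \<exists>m. \<forall>k\<ge>m. \<bar>F k p - rho (fst p) (snd p)\<bar> < 1 / real (Suc j)) \<longleftrightarrow> (\<lambda>k. F k p) \<longlonglongrightarrow> rho (fst p) (snd p)"
    proof
      assume L: "\<forall>j. \<exists>m. \<forall>k\<ge>m. \<bar>F k p - rho (fst p) (snd p)\<bar> < 1 / real (Suc j)"
      show "(\<lambda>k. F k p) \<longlonglongrightarrow> rho (fst p) (snd p)"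
      proof (rule LIMSEQ_I)
        fix e :: real assume "0 < e"
        then obtain j where j: "1 / real (Suc j) < e" by (rule nat_approx_posE)
        obtain m where m: "\<And>k. k \<ge> m \<Longrightarrow> \<bar>F k p - rho (fst p) (snd p)\<bar> < 1 / real (Suc j)" using L by blast
        show "\<exists>m. \<forall>k\<ge>m. norm (F k p - rho (fst p) (snd p)) < e"
          by (intro exI[of _ m] allI impI) (use m j in \<open>auto intro: less_trans\<close>)
      qed
    next
      assume L: "(\<lambda>k. F k p) \<longlonglongrightarrow> rho (fst p) (snd p)"
      show "\<forall>j. \<exists>m. \<forall>k\<ge>m. \<bar>F k p - rho (fst p) (snd p)\<bar> < 1 / real (Suc j)"
      proof
        fix j
        have "0 < 1 / real (Suc j)" by simp
        from LIMSEQ_D[OF L this] show "\<exists>m. \<forall>k\<ge>m. \<bar>F k p - rho (fst p) (snd p)\<bar> < 1 / real (Suc j)" by simp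
      qed
    qed
    then show ?thesis by (simp add: P_def)
  qed
  have Pm: "{p \<in> space (lborel \<Otimes>\<^sub>M lborel). P p} \<in> sets (lborel \<Otimes>\<^sub>M lborel)"
  proof -
    have "Measurable.pred (borel :: (real \<times> real) measure) P" unfolding P_def[abs_def] by measurable
    then show ?thesis unfolding lborel_prod pred_def by simp
  qed
  have "AE t in lborel. AE y in lborel. P (y, t)"
  proof (rule AE_I2)
    fix t :: real
    show "AE y in lborel. P (y, t)"
    proof (cases "0 < t")
      case True
      show ?thesis using AE_limit[OF True] by eventually_elim (use True in \<open>simp add: P_iff F_def\<close>)
    next
      case False
      then show ?thesis by (simp add: P_def)
    qed
  qed
  then have "AE y in lborel. AE t in lborel. P (y, t)"
    using lborel_pair.AE_commute[of "\<lambda>y t. P (y, t)"] Pm by simp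
  then have "AE p in lborel. P p" using lborel_pair.AE_pair_measure[OF Pm] unfolding lborel_prod by simp
  then show ?thesis using AE_snd_neq_0
    by eventually_elim (auto simp: P_iff F_def)
qed

lemma AE_ftl_density_limit:
  "AE (x, t) in lebesgue_on (UNIV \<times> {0..}). (\<lambda>k. ftl_density (N k) (X (N k)) x t) \<longlonglongrightarrow> rho x t"
  using AE_joint_limit by (simp add: AE_lebesgue_on_iff case_prod_unfold mem_Times_iff Dn_eq)

lemma L1loc_limit: "L1loc_converges (UNIV \<times> {0..}) (\<lambda>k. ftl_density (N k) (X (N k))) rho"
  unfolding L1loc_converges_def Dn_eq[symmetric]
proof (intro allI impI)
  fix S :: "(real \<times> real) set" assume S: "compact S \<and> S \<subseteq> UNIV \<times> {0..}"
  have [measurable]: "S \<in> sets borel" using S by (auto intro: borel_closed compact_imp_closed)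
  have iS: "integrable lborel (indicator S :: real \<times> real \<Rightarrow> real)"
    by (rule integrable_real_indicator) (use emeasure_compact_finite S in auto)
  \<comment> \<open>Setting the density to \<open>0\<close> at negative times makes it jointly
    measurable; on \<open>S\<close>, which lies at nonnegative times, nothing changes.\<close>
  define F where "F k p = (if 0 \<le> snd p then Dn (N k) (fst p) (snd p) else 0)" for k p
  have [measurable]: "F k \<in> borel_measurable (borel :: (real \<times> real) measure)" for k
    unfolding F_def[abs_def] by (rule Dn_joint_measurable)
  have FR: "F k p \<in> {0..R}" for k p using Dn_range R_nonneg by (simp add: F_def)
  have FS: "F k p = Dn (N k) (fst p) (snd p)" if "p \<in> S" for k p using S that by (auto simp: F_def)
  have "set_integrable lebesgue S (\<lambda>(x, t). rho x t)"
    unfolding set_integrable_def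
  proof (subst lebesgue_AE_eq_borel(3)[where g="\<lambda>p. rho (fst p) (snd p) * indicator S p"])
    show "integrable lborel (\<lambda>p. rho (fst p) (snd p) * indicator S p)"
      by (rule integrable_bounded_mult[OF iS _ rho_abs]) measurable
  qed (auto simp: case_prod_unfold)
  moreover have "set_integrable lebesgue S (\<lambda>(x, t). Dn (N k) x t)" for k
    unfolding set_integrable_def
  proof (subst lebesgue_AE_eq_borel(3)[where g="\<lambda>p. F k p * indicator S p"])
    have "\<bar>F k p\<bar> \<le> R" for p using FR[of k p] by auto
    then show "integrable lborel (\<lambda>p. F k p * indicator S p)"
      by (intro integrable_bounded_mult[OF iS]) measurable
  qed (use FS in \<open>auto simp: case_prod_unfold indicator_def\<close>)
  moreover have "(\<lambda>k. LINT (x, t):S|lebesgue. \<bar>Dn (N k) x t - rho x t\<bar>) \<longlonglongrightarrow> 0"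
  proof -
    have "(LINT (x, t):S|lebesgue. \<bar>Dn (N k) x t - rho x t\<bar>) = (LINT p|lborel. \<bar>F k p - rho (fst p) (snd p)\<bar> * indicator S p)" for k
      unfolding set_lebesgue_integral_def
    proof (rule lebesgue_AE_eq_borel(2))
      show "AE p in lborel. indicator S p *\<^sub>R (case p of (x, t) \<Rightarrow> \<bar>Dn (N k) x t - rho x t\<bar>) = \<bar>F k p - rho (fst p) (snd p)\<bar> * indicator S p"
        using FS by (intro AE_I2) (auto simp: case_prod_unfold indicator_def)
    qed measurable
    moreover have "(\<lambda>k. LINT p|lborel. \<bar>F k p - rho (fst p) (snd p)\<bar> * indicator S p) \<longlonglongrightarrow> (LINT p::real \<times> real|lborel. (0::real))"
    proof (rule integral_dominated_convergence[where w="\<lambda>p. R * indicator S p"])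
      show "integrable lborel (\<lambda>p. R * indicator S p)" by (intro integrable_mult_right iS)
      show "AE p in lborel. (\<lambda>k. \<bar>F k p - rho (fst p) (snd p)\<bar> * indicator S p) \<longlonglongrightarrow> 0"
        using AE_joint_limit
      proof eventually_elim
        case (elim p)
        show ?case
        proof (cases "p \<in> S")
          case True
          then have "(\<lambda>k. F k p) \<longlonglongrightarrow> rho (fst p) (snd p)" using elim S FS by (auto simp: mem_Times_iff)
          then have "(\<lambda>k. \<bar>F k p - rho (fst p) (snd p)\<bar>) \<longlonglongrightarrow> 0" by (intro tendsto_rabs_zero LIM_zero)
          then show ?thesis using True by simp
        qed simp
      qed
      have "\<bar>F k p - rho (fst p) (snd p)\<bar> \<le> R" for k p using FR[of k p] rho_range[of "fst p" "snd p"] by auto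
      then show "AE p in lborel. norm (\<bar>F k p - rho (fst p) (snd p)\<bar> * indicator S p) \<le> R * indicator S p" for k
        by (intro AE_I2) (auto simp: indicator_def)
    qed measurable
    ultimately show ?thesis by simp
  qed
  ultimately show "set_integrable lebesgue S (\<lambda>(x, t). rho x t) \<and> (\<forall>k. set_integrable lebesgue S (\<lambda>(x, t). Dn (N k) x t)) \<and>
     (\<lambda>k. LINT (x, t):S|lebesgue. \<bar>Dn (N k) x t - rho x t\<bar>) \<longlonglongrightarrow> 0" by blast
qed

end

theorem theorem2p2:
  fixes \<rho>0 v \<phi> :: "real \<Rightarrow> real" and K :: real and X :: "nat \<Rightarrow> nat \<Rightarrow> real \<Rightarrow> real"
  assumes "BV \<rho>0" and "integrable lebesgue \<rho>0" and "Linf \<rho>0"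
    and "AE x in lebesgue. 0 \<le> \<rho>0 x"
    and "compact (ess_support \<rho>0)"
    and "(LINT x|lebesgue. \<bar>\<rho>0 x\<bar>) = 1"
    and "C1_on {0..Rbar \<rho>0} v"
    and "strict_antimono_on {0..Rbar \<rho>0} v"
    and "\<And>r. \<phi> r = r * deriv_within v {0..Rbar \<rho>0} r"
    and "0 \<le> K"
    and "\<And>r s. r \<in> {0..Rbar \<rho>0} \<Longrightarrow> s \<in> {0..Rbar \<rho>0} \<Longrightarrow> r \<noteq> s \<Longrightarrow>
           0 \<le> (\<phi> r - \<phi> s) / (v r - v s) \<and> (\<phi> r - \<phi> s) / (v r - v s) \<le> K"
    and "\<And>n. 1 \<le> n \<Longrightarrow> ftl_solution v \<rho>0 n (X n)"
  shows "\<exists>\<rho>. extended_entropy_solution v \<rho>0 \<rho> \<and>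
           (\<forall>\<sigma>. extended_entropy_solution v \<rho>0 \<sigma> \<longrightarrow>
              (AE (x, t) in lebesgue_on (UNIV \<times> {0..}). \<sigma> x t = \<rho> x t)) \<and>
           (\<exists>N :: nat \<Rightarrow> nat. strict_mono N \<and> (\<forall>k. 1 \<le> N k) \<and>
              (AE (x, t) in lebesgue_on (UNIV \<times> {0..}).
                 (\<lambda>k. ftl_density (N k) (X (N k)) x t) \<longlonglongrightarrow> \<rho> x t) \<and>
              L1loc_converges (UNIV \<times> {0..}) (\<lambda>k. ftl_density (N k) (X (N k))) \<rho>)"
proof -
  interpret A: ftl_family \<rho>0 v K X
    by unfold_locales (use assms(2-8,10-12) in \<open>simp_all add: assms(9)\<close>)
  obtain N U where NU: "strict_mono N" "\<forall>k. 1 \<le> N k" "\<forall>y t. 0 \<le> t \<longrightarrow> (\<lambda>k. A.Pn (N k) y t) \<longlonglongrightarrow> U y t"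
    using A.subsequence_exists by blast
  interpret L: ftl_limit \<rho>0 v K X N U
    by unfold_locales (use NU in auto)
  show ?thesis
    using L.rho_extended_entropy_solution A.entropy_solution_unique NU(1,2) L.AE_ftl_density_limit L.L1loc_limit by blast
qed

end
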